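(* Let $M$ be a Riemannian manifold, $f:M\to M$ a $C^1$ map and $\Lambda\subset M$ an isolated repeller such that $f|_\Lambda$ is topologically mixing. Let $\Phi=\{\phi_n\}$ and $\Psi=\{\psi_n\}$ be almost additive sequences of continuous potentials (for $f|_\Lambda$) satisfying the bounded distortion condition, and assume that $\Psi$ is not cohomologous to a constant. Let $\mu_\Phi$ be the unique equilibrium state of $f|_\Lambda$ with respect to $\Phi$, let $\mathcal{E}_{f,\Phi,\Psi}$ be the free energy function, and let $I_{f,\Phi,\Psi}: J_{\Phi,\Psi}\to\mathbb{R}$ be the Legendre transform (see context). Then: (i) $I_{f,\Phi,\Psi}(\mathcal{E}'_{f,\Phi,\Psi}(t)) = t\,\mathcal{E}'_{f,\Phi,\Psi}(t)-\mathcal{E}_{f,\Phi,\Psi}(t)$ for every $t\in\mathbb{R}$; (ii) $I_{f,\Phi,\Psi}$ is a non-negative convex function, and for any $a<b$ in $J_{\Phi,\Psi}$ such that the interval $(a,b)$ does not contain $\mathcal{F}_*(\Psi,\mu_\Phi)$, $$\inf_{s\in(a,b)} I_{f,\Phi,\Psi}(s)=\min\{I_{f,\Phi,\Psi}(a),I_{f,\Phi,\Psi}(b)\};$$ (iii) for every $s\in J_{\Phi,\Psi}$, $$I_{f,\Phi,\Psi}(s)=\inf_{\eta\in\mathcal{M}_1(f)}\{P_{\mathrm{top}}(f,\Phi)-h_\eta(f)-\mathcal{F}_*(\Phi,\eta):\ \mathcal{F}_*(\Psi,\eta)=s\};$$ (iv) $I_{f,\Phi,\Psi}(s)=0$ if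 and only if $s=\mathcal{F}_*(\Psi,\mu_\Phi)$; moreover $s\mapsto I_{f,\Phi,\Psi}(s)$ is strictly convex in an open neighborhood of $\mathcal{F}_*(\Psi,\mu_\Phi)$.
   Context: Isolated repeller: $\Lambda\subset M$ is compact, $f(\Lambda)=\Lambda$, there are $C>0$, $\lambda>1$ with $\|Df^n(x)v\|\ge C\lambda^n\|v\|$ for all $x\in\Lambda$, $v\in T_xM$, $n\ge1$, and $\Lambda=\bigcap_{n\ge0}f^{-n}(U)$ for some open neighborhood $U$ of $\Lambda$. Throughout, $f$ also denotes $f|_\Lambda$, $\mathcal{M}_1(f)$ is the set of $f|_\Lambda$-invariant Borel probability measures on $\Lambda$ (weak* topology), $h_\eta(f)$ is the metric entropy, and $S_n g=\sum_{j=0}^{n-1}g\circ f^j$. A sequence $\Phi=\{\phi_n\}_{n\ge1}\subset C(\Lambda,\mathbb{R})$ is almost additive if there is $C>0$ with $\phi_m+\phi_n\circ f^m-C\le\phi_{m+n}\le\phi_m+\phi_n\circ f^m+C$ for all $m,n\ge1$. Sums and scalar multiples are taken termwise: $\Phi+t\Psi=\{\phi_n+t\psi_n\}$. The dynamical ball is $B(x,n,\delta)=\{y: d(f^j(y),f^j(x))\le\delta,\ 0\le j\le n\}$, and $\gamma_n(\Phi,\delta)=\sup\{|\phi_n(y)-\phi_n(z)|: y,z\in B(x,n,\delta),\ x\in \Lambda\}$. $\Phi$ satisfies the bounded distortion condition if there are $A,\delta>0$ with $\sup_n\gamma_n(\Phi,\delta)\le A$. For an almost additive $\Phi$ and $\eta\in\mathcal{M}_1(f)$,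 $\mathcal{F}_*(\Phi,\eta)=\lim_{n\to\infty}\frac1n\int\phi_n\,d\eta$. Topological pressure: $P_{\mathrm{top}}(f,\Phi)=\sup\{h_\eta(f)+\mathcal{F}_*(\Phi,\eta):\eta\in\mathcal{M}_1(f)\}$ (for a continuous function $\varphi$, $P_{\mathrm{top}}(f,\varphi)$ is the usual pressure, i.e. that of $\{S_n\varphi\}$). An equilibrium state for $\Phi$ is an $\eta$ attaining this supremum; for almost additive $\Phi$ with bounded distortion it is known to be unique and is denoted $\mu_\Phi$. Fix $\alpha\in(0,1)$. An admissible family for $\Psi$ is a family $\{g_\varepsilon\}_{\varepsilon\in(0,1)}$ of $\alpha$-Hölder continuous functions on $\Lambda$ with $\limsup_{n\to\infty}\frac1n\|\psi_n-S_ng_\varepsilon\|_\infty<\varepsilon$ for every $\varepsilon$. A function $g$ is cohomologous to a constant if $g=u\circ f-u+c$ for some continuous $u$ and constant $c$. $\Psi$ is cohomologous to a constant if it has an admissible family $\{g_\varepsilon\}$ with $g_\varepsilon$ cohomologous to a constant for every small $\varepsilon$. If $\Psi$ is not cohomologous to a constant, only admissible families $\{g_\varepsilon\}$ for $\Psi$ with $g_\varepsilon$ not cohomologous to a constant for all small $\varepsilon$ are considered. Free energy: $\mathcal{E}_{f,\Phi,\Psi}(t)=P_{\mathrm{top}}(f,\Phi+t\Psi)-P_{\mathrm{top}}(f,\Phi)$, $t\in\mathbb{R}$; it is known to be $C^1$ with $\mathcal{E}'_{f,\Phi,\Psi}(t)=\mathcal{F}_*(\Psi,\mu_{\Phi+t\Psi})$.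 For functions $\varphi,g$, $\mathcal{E}_{f,\varphi,g}(t)=P_{\mathrm{top}}(f,\varphi+tg)-P_{\mathrm{top}}(f,\varphi)$ and $I_{f,\varphi,g}(s)=\sup_{t\in\mathbb{R}}(st-\mathcal{E}_{f,\varphi,g}(t))$. Legendre transform: let $J_{\Phi,\Psi}=\big(\inf_{t\in\mathbb{R}}\mathcal{F}_*(\Psi,\mu_{\Phi+t\Psi}),\ \sup_{t\in\mathbb{R}}\mathcal{F}_*(\Psi,\mu_{\Phi+t\Psi})\big)$. For $s\in J_{\Phi,\Psi}$, $I_{f,\Phi,\Psi}(s)=\lim_{\varepsilon\to0}I_{f,\varphi_\varepsilon,g_\varepsilon}(s)$, where $\{\varphi_\varepsilon\}$, $\{g_\varepsilon\}$ are admissible families for $\Phi$, $\Psi$; the limit exists and does not depend on the chosen families. *)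

theory Defs
  imports "HOL-Probability.Probability"
begin

section \<open>Riemannian manifolds\<close>

text \<open>
  The manifold is the whole type \<open>'m\<close> (Hausdorff, second countable), modelled on the Euclidean
  space \<open>'e\<close>.  A chart is a pair of its domain and its coordinate map; only the values of
  the map on the domain are relevant.  A tangent vector at \<open>x\<close> is represented by its coordinates
  \<open>v :: 'e\<close> in a chart around \<open>x\<close>, and changes of charts act by their derivatives.
\<close>

type_synonym ('m, 'e) chart = "'m set \<times> ('m \<Rightarrow> 'e)"

type_synonym ('m, 'e) metric_field = "('m, 'e) chart \<Rightarrow> 'm \<Rightarrow> 'e \<Rightarrow> 'e \<Rightarrow> real"

abbreviation chart_dom :: "('m, 'e) chart \<Rightarrow> 'm set"
  where "chart_dom c \<equiv> fst c"

abbreviation chart_map :: "('m, 'e) chart \<Rightarrow> 'm \<Rightarrow> 'e"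
  where "chart_map c \<equiv> snd c"

definition chart_inv :: "('m, 'e) chart \<Rightarrow> 'e \<Rightarrow> 'm"
  where "chart_inv c = inv_into (chart_dom c) (chart_map c)"

text \<open>
  Class \<open>C\<^sup>k\<close> on an open set \<open>S\<close> (only used for open \<open>S\<close>): on a finite-dimensional space it
  suffices to require this of all directional derivatives of a differentiable function.
\<close>

primrec Ck_on :: "nat \<Rightarrow> ('a::euclidean_space \<Rightarrow> 'b::real_normed_vector) \<Rightarrow> 'a set \<Rightarrow> bool" where
  "Ck_on 0 F S \<longleftrightarrow> continuous_on S F"
| "Ck_on (Suc k) F S \<longleftrightarrow>
     F differentiable_on S \<and> (\<forall>v. Ck_on k (\<lambda>p. frechet_derivative F (at p) v) S)"

definition smooth_on :: "('a::euclidean_space \<Rightarrow> 'b::real_normed_vector) \<Rightarrow> 'a set \<Rightarrow> bool"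
  where "smooth_on F S \<longleftrightarrow> (\<forall>k. Ck_on k F S)"

definition local_rep ::
  "('m, 'e) chart \<Rightarrow> ('m, 'e) chart \<Rightarrow> ('m \<Rightarrow> 'm) \<Rightarrow> 'e \<Rightarrow> 'e"
  where "local_rep c c' F = chart_map c' \<circ> F \<circ> chart_inv c"

definition smooth_atlas ::
  "('m::{t2_space, second_countable_topology}, 'e::euclidean_space) chart set \<Rightarrow> bool"
  where "smooth_atlas \<A> \<longleftrightarrow>
     (\<Union>c\<in>\<A>. chart_dom c) = UNIV \<and>
     (\<forall>c\<in>\<A>. open (chart_dom c) \<and> open (chart_map c ` chart_dom c) \<and>
        homeomorphism (chart_dom c) (chart_map c ` chart_dom c) (chart_map c) (chart_inv c)) \<and>
     (\<forall>c\<in>\<A>. \<forall>c'\<in>\<A>.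
        smooth_on (local_rep c c' id) (chart_map c ` (chart_dom c \<inter> chart_dom c')))"

definition tangent_map ::
  "('m, 'e::euclidean_space) chart \<Rightarrow> ('m, 'e) chart \<Rightarrow> ('m \<Rightarrow> 'm) \<Rightarrow> 'm \<Rightarrow> 'e \<Rightarrow> 'e"
  where "tangent_map c c' F x = frechet_derivative (local_rep c c' F) (at (chart_map c x))"

definition riemannian_manifold ::
  "('m::{t2_space, second_countable_topology}, 'e::euclidean_space) chart set \<Rightarrow>
   ('m, 'e) metric_field \<Rightarrow> bool"
  where "riemannian_manifold \<A> G \<longleftrightarrow>
     smooth_atlas \<A> \<and>
     (\<forall>c\<in>\<A>. \<forall>x\<in>chart_dom c.
        bilinear (G c x) \<and> (\<forall>u v. G c x u v = G c x v u) \<and> (\<forall>v. v \<noteq> 0 \<longrightarrow> G c x v v > 0)) \<and>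
     (\<forall>c\<in>\<A>. \<forall>u v. smooth_on (\<lambda>p. G c (chart_inv c p) u v) (chart_map c ` chart_dom c)) \<and>
     (\<forall>c\<in>\<A>. \<forall>c'\<in>\<A>. \<forall>x\<in>chart_dom c \<inter> chart_dom c'. \<forall>u v.
        G c x u v = G c' x (tangent_map c c' id x u) (tangent_map c c' id x v))"

definition tangent_norm :: "('m, 'e) metric_field \<Rightarrow> ('m, 'e) chart \<Rightarrow> 'm \<Rightarrow> 'e \<Rightarrow> real"
  where "tangent_norm G c x v = sqrt (G c x v v)"

definition C1_map ::
  "('m::{t2_space, second_countable_topology}, 'e::euclidean_space) chart set \<Rightarrow>
   ('m \<Rightarrow> 'm) \<Rightarrow> bool"
  where "C1_map \<A> f \<longleftrightarrow> continuous_on UNIV f \<and>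
     (\<forall>c\<in>\<A>. \<forall>c'\<in>\<A>.
        Ck_on 1 (local_rep c c' f) (chart_map c ` (chart_dom c \<inter> f -` chart_dom c')))"

definition piecewise_C1_curve ::
  "('m::{t2_space, second_countable_topology}, 'e::euclidean_space) chart set \<Rightarrow>
   (real \<Rightarrow> 'm) \<Rightarrow> bool"
  where "piecewise_C1_curve \<A> \<gamma> \<longleftrightarrow> continuous_on {0..1} \<gamma> \<and>
     (\<forall>c\<in>\<A>. \<forall>a b. 0 \<le> a \<and> a < b \<and> b \<le> 1 \<and> \<gamma> ` {a..b} \<subseteq> chart_dom c \<longrightarrow>
        (chart_map c \<circ> \<gamma>) piecewise_C1_differentiable_on {a..b})"

text \<open>The speed does not depend on the chart chosen around \<open>\<gamma> t\<close>.\<close>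

definition curve_speed ::
  "('m, 'e::euclidean_space) chart set \<Rightarrow> ('m, 'e) metric_field \<Rightarrow> (real \<Rightarrow> 'm) \<Rightarrow> real \<Rightarrow> real"
  where "curve_speed \<A> G \<gamma> t =
     (let c = (SOME c. c \<in> \<A> \<and> \<gamma> t \<in> chart_dom c)
      in tangent_norm G c (\<gamma> t) (vector_derivative (chart_map c \<circ> \<gamma>) (at t)))"

text \<open>
  The manifold need not be connected; points in different components are at distance \<open>\<infinity>\<close>.
\<close>

definition riemannian_dist ::
  "('m::{t2_space, second_countable_topology}, 'e::euclidean_space) chart set \<Rightarrow>
   ('m, 'e) metric_field \<Rightarrow> 'm \<Rightarrow> 'm \<Rightarrow> ennreal"
  where "riemannian_dist \<A> G x y =
     (INF \<gamma> \<in> {\<gamma>. piecewise_C1_curve \<A> \<gamma> \<and> \<gamma> 0 = x \<and> \<gamma> 1 = y}.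
        \<integral>\<^sup>+t\<in>{0..1}. ennreal (curve_speed \<A> G \<gamma> t) \<partial>lborel)"


section \<open>Repellers\<close>

definition isolated_repeller ::
  "('m::{t2_space, second_countable_topology}, 'e::euclidean_space) chart set \<Rightarrow>
   ('m, 'e) metric_field \<Rightarrow> ('m \<Rightarrow> 'm) \<Rightarrow> 'm set \<Rightarrow> bool"
  where "isolated_repeller \<A> G f \<Lambda> \<longleftrightarrow>
     \<Lambda> \<noteq> {} \<and> compact \<Lambda> \<and> f ` \<Lambda> = \<Lambda> \<and>
     (\<exists>C>0. \<exists>L>1. \<forall>x\<in>\<Lambda>. \<forall>n\<ge>1. \<forall>c\<in>\<A>. \<forall>c'\<in>\<A>.
        x \<in> chart_dom c \<and> (f ^^ n) x \<in> chart_dom c' \<longrightarrow>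
        (\<forall>v. tangent_norm G c' ((f ^^ n) x) (tangent_map c c' (f ^^ n) x v)
               \<ge> C * L ^ n * tangent_norm G c x v)) \<and>
     (\<exists>U. open U \<and> \<Lambda> \<subseteq> U \<and> \<Lambda> = (\<Inter>n. (f ^^ n) -` U))"

definition topologically_mixing_on :: "'m::topological_space set \<Rightarrow> ('m \<Rightarrow> 'm) \<Rightarrow> bool"
  where "topologically_mixing_on \<Lambda> f \<longleftrightarrow>
     (\<forall>U V. open U \<and> open V \<and> U \<inter> \<Lambda> \<noteq> {} \<and> V \<inter> \<Lambda> \<noteq> {} \<longrightarrow>
        (\<exists>N. \<forall>n\<ge>N. (f ^^ n) ` (U \<inter> \<Lambda>) \<inter> (V \<inter> \<Lambda>) \<noteq> {}))"


section \<open>Sequences of potentials\<close>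

text \<open>
  A sequence \<open>\<Phi> :: nat \<Rightarrow> 'm \<Rightarrow> real\<close> is indexed from \<open>1\<close>; the entry \<open>\<Phi> 0\<close> and the values outside
  \<open>\<Lambda>\<close> are irrelevant.  Below, \<open>d\<close> is the (extended) distance on the manifold.
\<close>

definition birkhoff_sum :: "('m \<Rightarrow> 'm) \<Rightarrow> ('m \<Rightarrow> real) \<Rightarrow> nat \<Rightarrow> 'm \<Rightarrow> real"
  where "birkhoff_sum f g n x = (\<Sum>j<n. g ((f ^^ j) x))"

definition seq_add_scaled ::
  "(nat \<Rightarrow> 'm \<Rightarrow> real) \<Rightarrow> real \<Rightarrow> (nat \<Rightarrow> 'm \<Rightarrow> real) \<Rightarrow> nat \<Rightarrow> 'm \<Rightarrow> real"
  where "seq_add_scaled \<Phi> t \<Psi> n x = \<Phi> n x + t * \<Psi> n x"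

definition continuous_potentials :: "'m::topological_space set \<Rightarrow> (nat \<Rightarrow> 'm \<Rightarrow> real) \<Rightarrow> bool"
  where "continuous_potentials \<Lambda> \<Phi> \<longleftrightarrow> (\<forall>n\<ge>1. continuous_on \<Lambda> (\<Phi> n))"

definition almost_additive :: "'m set \<Rightarrow> ('m \<Rightarrow> 'm) \<Rightarrow> (nat \<Rightarrow> 'm \<Rightarrow> real) \<Rightarrow> bool"
  where "almost_additive \<Lambda> f \<Phi> \<longleftrightarrow>
     (\<exists>C>0. \<forall>m\<ge>1. \<forall>n\<ge>1. \<forall>x\<in>\<Lambda>.
        \<Phi> m x + \<Phi> n ((f ^^ m) x) - C \<le> \<Phi> (m + n) x \<and>
        \<Phi> (m + n) x \<le> \<Phi> m x + \<Phi> n ((f ^^ m) x) + C)"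

definition dyn_ball ::
  "('m \<Rightarrow> 'm \<Rightarrow> ennreal) \<Rightarrow> 'm set \<Rightarrow> ('m \<Rightarrow> 'm) \<Rightarrow> 'm \<Rightarrow> nat \<Rightarrow> real \<Rightarrow> 'm set"
  where "dyn_ball d \<Lambda> f x n \<delta> = {y\<in>\<Lambda>. \<forall>j\<le>n. d ((f ^^ j) y) ((f ^^ j) x) \<le> ennreal \<delta>}"

definition distortion ::
  "('m \<Rightarrow> 'm \<Rightarrow> ennreal) \<Rightarrow> 'm set \<Rightarrow> ('m \<Rightarrow> 'm) \<Rightarrow> (nat \<Rightarrow> 'm \<Rightarrow> real) \<Rightarrow> nat \<Rightarrow> real \<Rightarrow> ereal"
  where "distortion d \<Lambda> f \<Phi> n \<delta> =
     Sup {ereal \<bar>\<Phi> n y - \<Phi> n z\<bar> |x y z.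
            x \<in> \<Lambda> \<and> y \<in> dyn_ball d \<Lambda> f x n \<delta> \<and> z \<in> dyn_ball d \<Lambda> f x n \<delta>}"

definition bounded_distortion ::
  "('m \<Rightarrow> 'm \<Rightarrow> ennreal) \<Rightarrow> 'm set \<Rightarrow> ('m \<Rightarrow> 'm) \<Rightarrow> (nat \<Rightarrow> 'm \<Rightarrow> real) \<Rightarrow> bool"
  where "bounded_distortion d \<Lambda> f \<Phi> \<longleftrightarrow>
     (\<exists>A>0. \<exists>\<delta>>0. (SUP n\<in>{1..}. distortion d \<Lambda> f \<Phi> n \<delta>) \<le> ereal A)"


section \<open>Invariant measures, entropy and pressure\<close>

definition invariant_measures :: "'m::topological_space set \<Rightarrow> ('m \<Rightarrow> 'm) \<Rightarrow> 'm measure set"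
  where "invariant_measures \<Lambda> f =
     {\<eta>. prob_space \<eta> \<and> sets \<eta> = sets (restrict_space borel \<Lambda>) \<and>
          f \<in> \<eta> \<rightarrow>\<^sub>M \<eta> \<and> distr \<eta> \<eta> f = \<eta>}"

definition partition_entropy :: "'m measure \<Rightarrow> 'm set set \<Rightarrow> real"
  where "partition_entropy \<eta> P = - (\<Sum>A\<in>P. measure \<eta> A * ln (measure \<eta> A))"

definition partition_join :: "'m set set \<Rightarrow> 'm set set \<Rightarrow> 'm set set"
  where "partition_join P Q = {A \<inter> B |A B. A \<in> P \<and> B \<in> Q \<and> A \<inter> B \<noteq> {}}"

text \<open>\<open>dyn_partition \<eta> f P n\<close> is the join of the preimages of \<open>P\<close> under \<open>f ^^ j\<close>, \<open>0 \<le> j < n\<close>.\<close>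

primrec dyn_partition :: "'m measure \<Rightarrow> ('m \<Rightarrow> 'm) \<Rightarrow> 'm set set \<Rightarrow> nat \<Rightarrow> 'm set set" where
  "dyn_partition \<eta> f P 0 = {space \<eta>}"
| "dyn_partition \<eta> f P (Suc n) =
     partition_join (dyn_partition \<eta> f P n) ((\<lambda>A. (f ^^ n) -` A \<inter> space \<eta>) ` P)"

definition metric_entropy :: "('m \<Rightarrow> 'm) \<Rightarrow> 'm measure \<Rightarrow> ereal"
  where "metric_entropy f \<eta> =
     (SUP P \<in> {P. finite P \<and> partition_on (space \<eta>) P \<and> P \<subseteq> sets \<eta>}.
        ereal (lim (\<lambda>n. partition_entropy \<eta> (dyn_partition \<eta> f P n) / real n)))"

definition mean_potential :: "(nat \<Rightarrow> 'm \<Rightarrow> real) \<Rightarrow> 'm measure \<Rightarrow> real"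
  where "mean_potential \<Phi> \<eta> = lim (\<lambda>n. (1 / real n) * (\<integral>x. \<Phi> n x \<partial>\<eta>))"

definition top_pressure ::
  "'m::topological_space set \<Rightarrow> ('m \<Rightarrow> 'm) \<Rightarrow> (nat \<Rightarrow> 'm \<Rightarrow> real) \<Rightarrow> ereal"
  where "top_pressure \<Lambda> f \<Phi> =
     (SUP \<eta> \<in> invariant_measures \<Lambda> f. metric_entropy f \<eta> + ereal (mean_potential \<Phi> \<eta>))"

definition is_equilibrium_state ::
  "'m::topological_space set \<Rightarrow> ('m \<Rightarrow> 'm) \<Rightarrow> (nat \<Rightarrow> 'm \<Rightarrow> real) \<Rightarrow> 'm measure \<Rightarrow> bool"
  where "is_equilibrium_state \<Lambda> f \<Phi> \<eta> \<longleftrightarrow>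
     \<eta> \<in> invariant_measures \<Lambda> f \<and>
     metric_entropy f \<eta> + ereal (mean_potential \<Phi> \<eta>) = top_pressure \<Lambda> f \<Phi>"

definition equilibrium_state ::
  "'m::topological_space set \<Rightarrow> ('m \<Rightarrow> 'm) \<Rightarrow> (nat \<Rightarrow> 'm \<Rightarrow> real) \<Rightarrow> 'm measure"
  where "equilibrium_state \<Lambda> f \<Phi> = (THE \<eta>. is_equilibrium_state \<Lambda> f \<Phi> \<eta>)"


section \<open>Admissible families and cohomology\<close>

definition holder_on ::
  "('m \<Rightarrow> 'm \<Rightarrow> ennreal) \<Rightarrow> real \<Rightarrow> 'm set \<Rightarrow> ('m \<Rightarrow> real) \<Rightarrow> bool"
  where "holder_on d \<alpha> \<Lambda> g \<longleftrightarrow>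
     (\<exists>C\<ge>0. \<forall>x\<in>\<Lambda>. \<forall>y\<in>\<Lambda>. d x y < \<infinity> \<longrightarrow> \<bar>g x - g y\<bar> \<le> C * enn2real (d x y) powr \<alpha>)"

definition admissible_family ::
  "('m \<Rightarrow> 'm \<Rightarrow> ennreal) \<Rightarrow> real \<Rightarrow> 'm set \<Rightarrow> ('m \<Rightarrow> 'm) \<Rightarrow>
   (nat \<Rightarrow> 'm \<Rightarrow> real) \<Rightarrow> (real \<Rightarrow> 'm \<Rightarrow> real) \<Rightarrow> bool"
  where "admissible_family d \<alpha> \<Lambda> f \<Psi> g \<longleftrightarrow>
     (\<forall>\<epsilon>\<in>{0<..<1}. holder_on d \<alpha> \<Lambda> (g \<epsilon>) \<and>
        limsup (\<lambda>n. ereal (1 / real n) *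
                    (SUP x\<in>\<Lambda>. ereal \<bar>\<Psi> n x - birkhoff_sum f (g \<epsilon>) n x\<bar>)) < ereal \<epsilon>)"

definition cohomologous_to_const :: "'m::topological_space set \<Rightarrow> ('m \<Rightarrow> 'm) \<Rightarrow> ('m \<Rightarrow> real) \<Rightarrow> bool"
  where "cohomologous_to_const \<Lambda> f g \<longleftrightarrow>
     (\<exists>u c. continuous_on \<Lambda> u \<and> (\<forall>x\<in>\<Lambda>. g x = u (f x) - u x + c))"

definition seq_cohomologous_to_const ::
  "('m::topological_space \<Rightarrow> 'm \<Rightarrow> ennreal) \<Rightarrow> real \<Rightarrow> 'm set \<Rightarrow> ('m \<Rightarrow> 'm) \<Rightarrow>
   (nat \<Rightarrow> 'm \<Rightarrow> real) \<Rightarrow> bool"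
  where "seq_cohomologous_to_const d \<alpha> \<Lambda> f \<Psi> \<longleftrightarrow>
     (\<exists>g. admissible_family d \<alpha> \<Lambda> f \<Psi> g \<and>
          (\<forall>\<^sub>F \<epsilon> in at_right 0. cohomologous_to_const \<Lambda> f (g \<epsilon>)))"

text \<open>
  The admissible families that are taken into account: for a sequence that is not cohomologous
  to a constant, the members for small \<open>\<epsilon>\<close> must not be cohomologous to a constant either.
\<close>

definition considered_family ::
  "('m::topological_space \<Rightarrow> 'm \<Rightarrow> ennreal) \<Rightarrow> real \<Rightarrow> 'm set \<Rightarrow> ('m \<Rightarrow> 'm) \<Rightarrow>
   (nat \<Rightarrow> 'm \<Rightarrow> real) \<Rightarrow> (real \<Rightarrow> 'm \<Rightarrow> real) \<Rightarrow> bool"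
  where "considered_family d \<alpha> \<Lambda> f \<Psi> g \<longleftrightarrow>
     admissible_family d \<alpha> \<Lambda> f \<Psi> g \<and>
     (\<not> seq_cohomologous_to_const d \<alpha> \<Lambda> f \<Psi> \<longrightarrow>
        (\<forall>\<^sub>F \<epsilon> in at_right 0. \<not> cohomologous_to_const \<Lambda> f (g \<epsilon>)))"


section \<open>Free energy and Legendre transform\<close>

definition free_energy ::
  "'m::topological_space set \<Rightarrow> ('m \<Rightarrow> 'm) \<Rightarrow> (nat \<Rightarrow> 'm \<Rightarrow> real) \<Rightarrow> (nat \<Rightarrow> 'm \<Rightarrow> real) \<Rightarrow> real \<Rightarrow> real"
  where "free_energy \<Lambda> f \<Phi> \<Psi> t =
     real_of_ereal (top_pressure \<Lambda> f (seq_add_scaled \<Phi> t \<Psi>) - top_pressure \<Lambda> f \<Phi>)"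

text \<open>For functions \<open>\<phi>\<close>, \<open>g\<close>; the supremum may be infinite for some \<open>s\<close>.\<close>

definition legendre_fun ::
  "'m::topological_space set \<Rightarrow> ('m \<Rightarrow> 'm) \<Rightarrow> ('m \<Rightarrow> real) \<Rightarrow> ('m \<Rightarrow> real) \<Rightarrow> real \<Rightarrow> ereal"
  where "legendre_fun \<Lambda> f \<phi> g s =
     (SUP t. ereal (s * t -
        real_of_ereal (top_pressure \<Lambda> f (birkhoff_sum f (\<lambda>x. \<phi> x + t * g x))
                       - top_pressure \<Lambda> f (birkhoff_sum f \<phi>))))"

definition rate_domain ::
  "'m::topological_space set \<Rightarrow> ('m \<Rightarrow> 'm) \<Rightarrow> (nat \<Rightarrow> 'm \<Rightarrow> real) \<Rightarrow> (nat \<Rightarrow> 'm \<Rightarrow> real) \<Rightarrow> real set"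
  where "rate_domain \<Lambda> f \<Phi> \<Psi> =
     (let F = (\<lambda>t. ereal (mean_potential \<Psi> (equilibrium_state \<Lambda> f (seq_add_scaled \<Phi> t \<Psi>))))
      in {s. (INF t. F t) < ereal s \<and> ereal s < (SUP t. F t)})"

text \<open>Meaningful for \<open>s \<in> rate_domain \<Lambda> f \<Phi> \<Psi>\<close>: the common limit along all families.\<close>

definition legendre ::
  "('m::topological_space \<Rightarrow> 'm \<Rightarrow> ennreal) \<Rightarrow> real \<Rightarrow> 'm set \<Rightarrow> ('m \<Rightarrow> 'm) \<Rightarrow>
   (nat \<Rightarrow> 'm \<Rightarrow> real) \<Rightarrow> (nat \<Rightarrow> 'm \<Rightarrow> real) \<Rightarrow> real \<Rightarrow> real"
  where "legendre d \<alpha> \<Lambda> f \<Phi> \<Psi> s =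
     (THE L. \<forall>\<phi> g. considered_family d \<alpha> \<Lambda> f \<Phi> \<phi> \<and> considered_family d \<alpha> \<Lambda> f \<Psi> g \<longrightarrow>
        ((\<lambda>\<epsilon>. legendre_fun \<Lambda> f (\<phi> \<epsilon>) (g \<epsilon>) s) \<longlongrightarrow> ereal L) (at_right 0))"

definition strictly_convex_on :: "real set \<Rightarrow> (real \<Rightarrow> real) \<Rightarrow> bool"
  where "strictly_convex_on S F \<longleftrightarrow> convex S \<and>
     (\<forall>x\<in>S. \<forall>y\<in>S. \<forall>u>0. \<forall>v>0. x \<noteq> y \<and> u + v = 1 \<longrightarrow> F (u * x + v * y) < u * F x + v * F y)"

end

theory Submission
  imports Defs
begin

text \<open>
  Local bump functions built from charts give a real-valued metric \<open>D\<close> on \<open>\<Lambda>\<close>, locally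
  bi-Lipschitz to every chart, for which some iterate of \<open>f\<close> doubles small distances.  Since
  derivatives are invertible and \<open>\<Lambda>\<close> is isolated, \<open>f\<close> is uniformly open on \<open>\<Lambda>\<close>, so that pseudo-orbits
  are shadowed; with mixing this yields expansiveness and specification, the only dynamical input.

  For a sequence \<open>\<Theta>\<close> with bounded distortion, weights \<open>exp \<Theta>\<^sub>n\<close> on preimages give atomic measures,
  and any limit of their averages is an invariant Gibbs measure.  The Gibbs bounds identify it as an
  equilibrium state, force every other equilibrium state to be absolutely continuous with respect
  to it, and make it ergodic; hence it is unique.  Since the Gibbs constants are locally uniform in
  \<open>t\<close>, the state \<open>\<mu>\<^sub>t\<close> of \<open>\<Phi> + t \<Psi>\<close> depends continuously on \<open>t\<close>, and \<open>\<sigma> t = mean_potential \<Psi> \<mu>\<^sub>t\<close> is a continuous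
  selection of subgradients of the free energy, so it is the derivative.  If \<open>\<sigma>\<close> took a value twice,
  the two Gibbs measures would coincide and \<open>\<Psi>\<^sub>n - n c\<close> would be bounded, making \<open>\<Psi>\<close> cohomologous to
  a constant; so the free energy is strictly convex, and everything else is Legendre duality.
\<close>

text \<open>Hence the explicit constants in \<open>C\<close> and \<open>Q\<close>, which depend
  neither on the order of the Bowen ball nor on the measure and can therefore be carried through
  weak limits in t. Radii are multiples of \<rho>: each weak limit moves a lower bound to a larger
  ball and an upper bound to a smaller one, while all triangle inequalities must end within the
  expansivity scale 64 \<rho>. The Legendre transform is a limit over Hoelder approximations whose
  pressure error grows like (2 + |t|) \<epsilon>, so convergence is not uniform in t. It is saved by
  s being interior to the range of the derivative: then s t - E t decays linearly at infinity and
  beats the error. The Riemannian distance may be infinite, and the speed of a curve is defined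
  through an arbitrary chart at each time. Hence the distance enters only through local comparison
  with charts, with integrals estimated as lower integrals and no measurability argument.\<close>

lemma fekete:
 fixes u :: "nat => real"
 assumes sub: "!!m n. m >= 1 ==> n >= 1 ==> u (m + n) <= u m + u n"
  and bdd: "!!n. n >= 1 ==> B * real n <= u n"
 obtains l where "(%n. u n / real n) \<longlonglongrightarrow> l" "!!n. n >= 1 ==> l <= u n / real n" "B <= l"
proof -
 define S where "S = (%n. u n / real n) ` {1..}"
 define l where "l = Inf S"
 have ge: "B <= u n / real n" if "n >= 1" for n
  using bdd[OF that] that by (simp add: field_simps)
 have bb: "bdd_below S" unfolding S_def by (rule bdd_belowI2[of _ B]) (use ge in auto)
 have l_le: "l <= u n / real n" if "n >= 1" for n
  unfolding l_def by (rule cInf_lower[OF _ bb]) (use that in \<open>auto simp: S_def\<close>)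
 have Bl: "B <= l" unfolding l_def by (rule cInf_greatest) (use ge in \<open>auto simp: S_def\<close>)
 have mult: "u (k * m) <= real k * u m" if "m >= 1" "k >= 1" for k m
  using that(2)
 proof (induction k rule: dec_induct)
  case base thus ?case by simp
 next
  case (step k)
  have "u (Suc k * m) = u (k * m + m)" by (simp add: add.commute)
  also have "\<dots> <= u (k * m) + u m" by (rule sub) (use step that in auto)
  also have "\<dots> <= real (Suc k) * u m" using step by (simp add: algebra_simps)
  finally show ?case .
 qed
 have "(%n. u n / real n) \<longlonglongrightarrow> l"
 proof (rule LIMSEQ_I)
  fix e :: real assume e: "e > 0"
  have "EX x:S. x < l + e / 2"
   using cInf_lessD[of S "l + e/2"] e unfolding l_def by (auto simp: S_def)
  then obtain m where m: "m >= 1" "u m / real m < l + e / 2" by (auto simp: S_def)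
  \<comment> \<open>The sum pays for the remainder \<open>n mod m\<close>, the last term for
    replacing \<open>k * m\<close> by \<open>n\<close> in the main part.\<close>
  define C where "C = (\<Sum>r\<le>m. \<bar>u r\<bar>) + \<bar>u m\<bar>"
  have C0: "C >= 0" unfolding C_def by (simp add: sum_nonneg)
  define N where "N = nat \<lceil>2 * (C + 1) / e\<rceil> + m + 1"
  have "norm (u n / real n - l) < e" if n: "n >= N" for n
  proof -
   have nm: "n >= m" "n >= 1" using n m by (auto simp: N_def)
   define k r where "k = n div m" and "r = n mod m"
   have nk: "n = k * m + r" "r < m" "k >= 1"
    using m nm by (auto simp: k_def r_def Suc_le_eq div_greater_zero_iff)
   have ur: "u r <= (\<Sum>r\<le>m. \<bar>u r\<bar>)"
   proof -
    have "\<bar>u r\<bar> <= (\<Sum>r\<le>m. \<bar>u r\<bar>)"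
     by (rule member_le_sum) (use nk in auto)
    thus ?thesis by linarith
   qed
   have S0: "0 <= (\<Sum>r\<le>m. \<bar>u r\<bar>)" by (simp add: sum_nonneg)
   \<comment> \<open>Subadditivity is given for positive indices only, so a vanishing remainder is a
     separate case.\<close>
   have "u n <= u (k * m) + (\<Sum>r\<le>m. \<bar>u r\<bar>)"
   proof (cases "r = 0")
    case True thus ?thesis using nk S0 by simp
   next
    case False
    have "u n <= u (k*m) + u r" unfolding nk(1) by (rule sub) (use nk m False in auto)
    thus ?thesis using ur by simp
   qed
   also have "\<dots> <= real k * u m + (\<Sum>r\<le>m. \<bar>u r\<bar>)" using mult[OF m(1) nk(3)] by simp
   also have "real k * u m = (real n - real r) * (u m / real m)"
    using nk m by (simp add: field_simps)
   also have "\<dots> <= real n * (u m / real m) + \<bar>u m\<bar>"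
   proof -
    have "- (real r * (u m / real m)) <= real r / real m * \<bar>u m\<bar>"
    proof -
     have "- u m * (real r / real m) <= \<bar>u m\<bar> * (real r / real m)"
      by (intro mult_right_mono) auto
     thus ?thesis by (simp add: field_simps)
    qed
    also have "\<dots> <= 1 * \<bar>u m\<bar>" by (intro mult_right_mono) (use nk m in \<open>auto simp: field_simps\<close>)
    finally show ?thesis unfolding left_diff_distrib by linarith
   qed
   finally have "u n <= real n * (u m / real m) + C" unfolding C_def by simp
   hence "u n / real n <= u m / real m + C / real n"
    using nm by (simp add: field_simps)
   moreover have "C / real n < e / 2"
   proof -
    have "2 * (C + 1) / e < real n" using n unfolding N_def by linarith
    hence "2 * (C + 1) < real n * e" using e by (simp add: field_simps)
    hence "2 * C < real n * e" by simp
    thus ?thesis using nm by (simp add: field_simps)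
   qed
   moreover have "l <= u n / real n" using l_le nm by simp
   ultimately show ?thesis using m(2) by (simp del: divide_const_simps)
  qed
  thus "EX no. ALL n>=no. norm (u n / real n - l) < e" by blast
 qed
 thus ?thesis using that l_le Bl by blast
qed

section \<open>Entropy of finitely valued functions\<close>

definition ent :: "real => real" where "ent p = - p * ln p"

lemma ent_0 [simp]: "ent 0 = 0" and ent_1 [simp]: "ent 1 = 0"
 by (simp_all add: ent_def)

lemma ent_nonneg: "0 <= p ==> p <= 1 ==> 0 <= ent p"
 by (cases "p = 0") (auto simp: ent_def mult_nonneg_nonpos)

text \<open>Nonnegativity of the conditional mutual information of a and b given c. With marginals
  q, r, z, each term p ln (p z / (q r)) is at least p - q r / z by ln t <= t - 1, and these lower
  bounds add up to zero.\<close>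

lemma strong_subadditivity_sums:
 fixes p :: "'a => 'b => 'c => real"
 assumes fin: "finite A" "finite B" "finite C" and nn: "!!a b c. 0 <= p a b c"
 shows "(\<Sum>a\<in>A. \<Sum>b\<in>B. \<Sum>c\<in>C. ent (p a b c)) + (\<Sum>c\<in>C. ent (\<Sum>a\<in>A. \<Sum>b\<in>B. p a b c))
  <= (\<Sum>a\<in>A. \<Sum>c\<in>C. ent (\<Sum>b\<in>B. p a b c)) + (\<Sum>b\<in>B. \<Sum>c\<in>C. ent (\<Sum>a\<in>A. p a b c))"
proof -
 define q where "q a c = (\<Sum>b\<in>B. p a b c)" for a c
 define r where "r b c = (\<Sum>a\<in>A. p a b c)" for b c
 define z where "z c = (\<Sum>a\<in>A. \<Sum>b\<in>B. p a b c)" for c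
 have zq: "z c = (\<Sum>a\<in>A. q a c)" for c by (simp add: z_def q_def)
 have zr: "z c = (\<Sum>b\<in>B. r b c)" for c unfolding z_def r_def by (rule sum.swap)
 have q0: "0 <= q a c" and r0: "0 <= r b c" and z0: "0 <= z c" for a b c
  by (auto simp: q_def r_def z_def intro!: sum_nonneg nn)
 have pq: "p a b c <= q a c" if "b : B" for a b c
  unfolding q_def by (rule member_le_sum) (use that fin nn in auto)
 have pr: "p a b c <= r b c" if "a : A" for a b c
  unfolding r_def by (rule member_le_sum[where f="%a. p a b c"]) (use that fin nn in auto)
 have qz: "q a c <= z c" if "a : A" for a c
  unfolding zq by (rule member_le_sum[where f="%a. q a c"]) (use that fin q0 in auto)
 have trm: "p a b c - q a c * r b c / z c
   <= p a b c * ln (p a b c) + p a b c * ln (z c) - p a b c * ln (q a c) - p a b c * ln (r b c)"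
  if "a : A" "b : B" for a b c
 proof (cases "p a b c = 0")
  case True thus ?thesis using q0 r0 z0 by simp
 next
  case False
  hence p: "p a b c > 0" using nn[of a b c] by simp
  hence q: "q a c > 0" and r: "r b c > 0" using pq pr that by (meson less_le_trans)+
  hence z: "z c > 0" using qz that by (meson less_le_trans)
  let ?t = "q a c * r b c / (z c * p a b c)"
  have t: "?t > 0" using p q r z by simp
  have "ln ?t <= ?t - 1" using t by (rule ln_le_minus_one)
  moreover have "ln ?t = ln (q a c) + ln (r b c) - ln (z c) - ln (p a b c)"
   using p q r z by (simp add: ln_div ln_mult)
  ultimately have "1 - ?t <= ln (p a b c) + ln (z c) - ln (q a c) - ln (r b c)" by linarith
  from mult_left_mono[OF this, of "p a b c"] 
  have "p a b c * (1 - ?t) <= p a b c * (ln (p a b c) + ln (z c) - ln (q a c) - ln (r b c))"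
   using p by simp
  moreover have "p a b c * (1 - ?t) = p a b c - q a c * r b c / z c"
   using p z by (simp add: field_simps)
  ultimately show ?thesis by (simp add: algebra_simps)
 qed
 have rot: "(\<Sum>c\<in>C. \<Sum>a\<in>A. \<Sum>b\<in>B. F a b c) = (\<Sum>a\<in>A. \<Sum>b\<in>B. \<Sum>c\<in>C. F a b c)" for F :: "'a => 'b => 'c => real"
  by (subst sum.swap) (intro sum.cong refl sum.swap)
 \<comment> \<open>Values c with z c = 0 contribute nothing, since division by zero yields
   zero.\<close>
 have "0 = (\<Sum>c\<in>C. z c - z c * z c / z c)" by simp
 also have "\<dots> = (\<Sum>c\<in>C. z c - (\<Sum>a\<in>A. q a c) * (\<Sum>b\<in>B. r b c) / z c)"
  by (simp only: zq[symmetric] zr[symmetric])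
 also have "\<dots> = (\<Sum>c\<in>C. \<Sum>a\<in>A. \<Sum>b\<in>B. p a b c - q a c * r b c / z c)"
  by (intro sum.cong) (simp_all add: z_def sum_subtractf sum_product sum_divide_distrib)
 also have "\<dots> = (\<Sum>a\<in>A. \<Sum>b\<in>B. \<Sum>c\<in>C. p a b c - q a c * r b c / z c)"
  by (rule rot)
 also have "\<dots> <= (\<Sum>a\<in>A. \<Sum>b\<in>B. \<Sum>c\<in>C.
   p a b c * ln (p a b c) + p a b c * ln (z c) - p a b c * ln (q a c) - p a b c * ln (r b c))"
  by (intro sum_mono trm)
 also have "\<dots> = (\<Sum>a\<in>A. \<Sum>b\<in>B. \<Sum>c\<in>C. p a b c * ln (p a b c))
   + (\<Sum>a\<in>A. \<Sum>b\<in>B. \<Sum>c\<in>C. p a b c * ln (z c))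
   - (\<Sum>a\<in>A. \<Sum>b\<in>B. \<Sum>c\<in>C. p a b c * ln (q a c))
   - (\<Sum>a\<in>A. \<Sum>b\<in>B. \<Sum>c\<in>C. p a b c * ln (r b c))"
  by (simp add: sum.distrib sum_subtractf)
 also have "(\<Sum>a\<in>A. \<Sum>b\<in>B. \<Sum>c\<in>C. p a b c * ln (z c)) = (\<Sum>c\<in>C. z c * ln (z c))"
  unfolding rot[symmetric] by (simp add: z_def sum_distrib_right)
 also have "(\<Sum>a\<in>A. \<Sum>b\<in>B. \<Sum>c\<in>C. p a b c * ln (q a c)) = (\<Sum>a\<in>A. \<Sum>c\<in>C. q a c * ln (q a c))"
  unfolding q_def sum_distrib_right by (intro sum.cong refl sum.swap)
 also have "(\<Sum>a\<in>A. \<Sum>b\<in>B. \<Sum>c\<in>C. p a b c * ln (r b c)) = (\<Sum>b\<in>B. \<Sum>c\<in>C. r b c * ln (r b c))"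
  unfolding r_def sum_distrib_right by (subst sum.swap) (intro sum.cong refl sum.swap)
 finally show ?thesis
  by (simp add: ent_def q_def r_def z_def sum_negf)
qed

text \<open>With q the fourth root of t, ln u <= u - 1 at u = 1 / q gives the bound 4 q^3 - 4 q^4,
  and q^2 (2 q - 1)^2 >= 0 turns it into q^2. The same argument with the square root of t in place
  of q would only give twice the desired bound for small t.\<close>

lemma ent_le_sqrt:
 assumes "0 <= t" "t <= 1"
 shows "ent t <= sqrt t"
proof (cases "t = 0")
 case False
 hence t: "t > 0" using assms by simp
 let ?s = "sqrt t"
 have s: "?s > 0" "?s * ?s = t" "?s <= 1" using t assms by auto
 have "ln (1 / ?s) <= 1 / ?s - 1" by (rule ln_le_minus_one) (use s in simp)
 hence "- ln ?s <= 1 / ?s - 1" using s by (simp add: ln_div)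
 hence a: "- ln t <= 2 * (1 / ?s) - 2" using t by (simp add: ln_sqrt)
 let ?q = "sqrt ?s"
 have q: "?q > 0" "?q * ?q = ?s" using s by auto
 have "ln (1 / ?q) <= 1 / ?q - 1" by (rule ln_le_minus_one) (use q in simp)
 hence "- ln ?q <= 1 / ?q - 1" using q by (simp add: ln_div)
 hence a: "- ln t <= 4 * (1 / ?q) - 4" using t s by (simp add: ln_sqrt)
 have "1 / ?q = ?q / ?s" using q by (metis divide_divide_eq_left div_self less_irrefl)
 have t4: "t = ?q ^ 4"
 proof -
  have "?q ^ 4 = (?q * ?q) * (?q * ?q)" by (simp only: power4_eq_xxxx mult.assoc)
  also have "\<dots> = t" by (simp only: q s)
  finally show ?thesis by simp
 qed
 have "t * (- ln t) <= t * (4 * (1 / ?q) - 4)" using a t by (intro mult_left_mono) auto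
 also have "\<dots> = ?q ^ 4 * (4 * (1 / ?q) - 4)" by (simp only: t4[symmetric])
 also have "\<dots> = 4 * ?q^3 - 4 * ?q ^ 4"
  using q by (simp add: field_simps power_numeral_reduce)
 also have "\<dots> <= ?q ^ 2"
 proof -
  have "0 <= ?q^2 * (2 * ?q - 1)^2" by simp
  also have "\<dots> = ?q^2 - (4 * ?q^3 - 4 * ?q ^ 4)"
   by (simp add: power2_eq_square power_numeral_reduce algebra_simps)
  finally show ?thesis by simp
 qed
 also have "\<dots> = ?s" using q by (simp add: power2_eq_square)
 finally show ?thesis unfolding ent_def by (simp only: mult_minus_left mult_minus_right)
qed simp

text \<open>A cell of mass w that lies in one piece i up to mass r gains little entropy by being
  subdivided. Each other piece costs at most sqrt (w r), which is replaced by
  \<open>s * w + r / s\<close>: this is linear in w and r, so that the bound can be summed over all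
  cells with one choice of s.\<close>

lemma ent_split_close:
 assumes "finite A" "!!a. a : A ==> 0 <= p a" "i : A" "(\<Sum>a\<in>A. p a) = w" "(\<Sum>a\<in>A - {i}. p a) <= r"
  and s: "s > 0" "w <= 1"
 shows "(\<Sum>a\<in>A. ent (p a)) <= ent w + r + real (card A) * (s * w + r / s)"
proof (cases "w = 0")
 case True
 hence "ALL a:A. p a = 0" using assms by (simp add: sum_nonneg_eq_0_iff)
 moreover have "0 <= r" using assms(5) sum_nonneg[of "A - {i}" p] assms(2) by fastforce
 ultimately show ?thesis using True s by simp
next
 case False
 have wnn: "0 <= w" using assms sum_nonneg by metis
 hence w: "w > 0" using False by simp
 have pw: "p a <= w" if "a : A" for a
  using member_le_sum[of a A p] assms that by auto
 have r0: "0 <= r" using assms(5) sum_nonneg[of "A - {i}" p] assms(2) by fastforce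
 have split: "ent (p a) = - p a * ln w + w * ent (p a / w)" if "a : A" for a
 proof (cases "p a = 0")
  case False
  hence "p a > 0" using assms that by (simp add: order_less_le)
  thus ?thesis using w by (simp add: ent_def ln_div field_simps)
 qed simp
 have "(\<Sum>a\<in>A. ent (p a)) = (\<Sum>a\<in>A. - p a * ln w) + (\<Sum>a\<in>A. w * ent (p a / w))"
  unfolding sum.distrib[symmetric] by (intro sum.cong refl split)
 also have "(\<Sum>a\<in>A. - p a * ln w) = ent w"
  using assms(4) by (simp add: ent_def sum_negf flip: sum_distrib_right)
 also have "(\<Sum>a\<in>A. w * ent (p a / w)) = w * ent (p i / w) + (\<Sum>a\<in>A-{i}. w * ent (p a / w))"
  using assms by (simp add: sum.remove)
 also have "w * ent (p i / w) <= r"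
 proof (cases "p i = 0")
  case True thus ?thesis using r0 by simp
 next
  case False
  hence pi: "p i > 0" using assms by (simp add: order_less_le)
  have "ln (w / p i) <= w / p i - 1" by (rule ln_le_minus_one) (use w pi in simp)
  hence "p i * ln (w / p i) <= p i * (w / p i - 1)" using pi by (intro mult_left_mono) auto
  also have "\<dots> = w - p i" using pi by (simp add: field_simps)
  also have "\<dots> = (\<Sum>a\<in>A-{i}. p a)" using assms by (simp add: sum.remove flip: assms(4))
  also have "\<dots> <= r" by fact
  finally have "p i * ln (w / p i) <= r" .
  moreover have "w * ent (p i / w) = p i * ln (w / p i)"
   using w pi by (simp add: ent_def ln_div right_diff_distrib)
  ultimately show ?thesis by simp
 qed
 also have "(\<Sum>a\<in>A-{i}. w * ent (p a / w)) <= (\<Sum>a\<in>A-{i}. s * w + r / s)"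
 proof (rule sum_mono)
  fix a assume a: "a : A - {i}"
  have pr: "p a <= r"
   using member_le_sum[of a "A-{i}" p] assms a by fastforce
  have "w * ent (p a / w) <= w * sqrt (p a / w)"
   using w a assms pw by (intro mult_left_mono ent_le_sqrt) (auto simp: field_simps)
  also have "\<dots> = sqrt (w * w) * sqrt (p a / w)" using w by simp
  also have "\<dots> = sqrt (w * w * (p a / w))" by (rule real_sqrt_mult[symmetric])
  also have "\<dots> = sqrt (w * p a)" using w by simp
  also have "\<dots> <= s * w + p a / s"
  proof (rule real_le_lsqrt)
   show "0 <= s * w + p a / s" using s w assms a by auto
   have "(s * w + p a / s)^2 = (s * w - p a / s)^2 + 4 * (w * p a)"
    using s by (simp add: power2_eq_square field_simps)
   thus "w * p a <= (s * w + p a / s)^2" using w assms a by (simp add: add_increasing)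
  qed
  also have "\<dots> <= s * w + r / s" using s pr by (simp add: divide_right_mono)
  finally show "w * ent (p a / w) <= s * w + r / s" .
 qed
 also have "(\<Sum>a\<in>A-{i}. s * w + r / s) <= real (card A) * (s * w + r / s)"
  using assms w r0 by (simp add: mult_right_mono)
 finally show ?thesis by simp
qed

text \<open>Shannon entropy of the partition into fibres of X. Encoding partitions by functions
  makes joins into pairs and iterated joins into lists, and equality of partitions becomes equality
  of kernels.\<close>

definition fent :: "'a measure => ('a => 'b) => real"
 where "fent M X = (\<Sum>a\<in>X ` space M. ent (measure M (X -` {a} \<inter> space M)))"

lemma fent_superset:
 assumes "finite S" "X ` space M \<subseteq> S"
 shows "fent M X = (\<Sum>a\<in>S. ent (measure M (X -` {a} \<inter> space M)))"
 unfolding fent_def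
proof (rule sum.mono_neutral_left[OF assms])
 show "ALL i:S - X ` space M. ent (measure M (X -` {i} \<inter> space M)) = 0"
 proof
  fix i assume "i : S - X ` space M"
  hence "X -` {i} \<inter> space M = {}" by auto
  thus "ent (measure M (X -` {i} \<inter> space M)) = 0" by simp
 qed
qed

lemma fent_relabel:
 assumes "!!x y. x : space M ==> y : space M ==> X x = X y \<longleftrightarrow> Y x = Y y"
 shows "fent M X = fent M Y"
proof -
 define h where "h a = Y (SOME x. x : space M & X x = a)" for a
 have h: "h (X x) = Y x" if "x : space M" for x
 proof -
  have "(SOME y. y : space M & X y = X x) : space M & X (SOME y. y : space M & X y = X x) = X x"
   by (rule someI[of _ x]) (use that in simp)
  thus ?thesis unfolding h_def using assms that by blast
 qed
 have "bij_betw h (X ` space M) (Y ` space M)"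
  by (rule bij_betwI'[where f=h]) (use h assms in auto)
 moreover have "X -` {a} \<inter> space M = Y -` {h a} \<inter> space M" if "a : X ` space M" for a
  using that h assms by auto
 ultimately show ?thesis unfolding fent_def
  using sum.reindex_bij_betw[of h "X ` space M" "Y ` space M" "%b. ent (measure M (Y -` {b} \<inter> space M))"]
  by simp
qed

context prob_space begin

lemma measure_fiber_sum:
 assumes "simple_function M Y" "finite S" "Y ` space M \<subseteq> S" "A : events"
 shows "prob A = (\<Sum>b\<in>S. prob (A \<inter> (Y -` {b} \<inter> space M)))"
proof -
 have "A = (\<Union>b\<in>S. A \<inter> (Y -` {b} \<inter> space M))"
  using assms sets.sets_into_space[OF assms(4)] by auto
 hence "prob A = prob (\<Union>b\<in>S. A \<inter> (Y -` {b} \<inter> space M))" by simp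
 also have "\<dots> = (\<Sum>b\<in>S. prob (A \<inter> (Y -` {b} \<inter> space M)))"
 proof (rule finite_measure_finite_Union)
  show "(%b. A \<inter> (Y -` {b} \<inter> space M)) ` S \<subseteq> events"
   using assms simple_functionD(2)[OF assms(1)] by auto
 qed (use assms in \<open>auto simp: disjoint_family_on_def\<close>)
 finally show ?thesis .
qed

lemma fent_nonneg: "0 <= fent M X"
 unfolding fent_def by (intro sum_nonneg ent_nonneg) auto

lemma strong_subadditivity:
 assumes X: "simple_function M X" and Y: "simple_function M Y" and Z: "simple_function M Z"
 shows "fent M (%x. (X x, Y x, Z x)) + fent M Z <= fent M (%x. (X x, Z x)) + fent M (%x. (Y x, Z x))"
proof -
 define A B C where "A = X ` space M" and "B = Y ` space M" and "C = Z ` space M"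
 note defs = A_def B_def C_def
 have fin: "finite A" "finite B" "finite C"
  using simple_functionD(1) X Y Z by (auto simp: defs)
 define p where "p a b c = prob ((X -` {a} \<inter> space M) \<inter> ((Y -` {b} \<inter> space M) \<inter> (Z -` {c} \<inter> space M)))" for a b c
 note ev = simple_functionD(2)[OF X] simple_functionD(2)[OF Y] simple_functionD(2)[OF Z]
 have XZ: "prob ((X -` {a} \<inter> space M) \<inter> (Z -` {c} \<inter> space M)) = (\<Sum>b\<in>B. p a b c)" for a c
  unfolding p_def 
  by (subst measure_fiber_sum[OF Y fin(2) _ sets.Int[OF ev(1) ev(3)]]) (auto simp: defs ac_simps)
 have YZ: "prob ((Y -` {b} \<inter> space M) \<inter> (Z -` {c} \<inter> space M)) = (\<Sum>a\<in>A. p a b c)" for b c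
  unfolding p_def
  by (subst measure_fiber_sum[OF X fin(1) _ sets.Int[OF ev(2) ev(3)]]) (auto simp: defs ac_simps)
 have ZZ: "prob (Z -` {c} \<inter> space M) = (\<Sum>a\<in>A. \<Sum>b\<in>B. p a b c)" for c
  by (subst measure_fiber_sum[OF X fin(1)]) (use ev XZ in \<open>auto simp: defs ac_simps\<close>)
 have s: "fent M (%x. (X x, Y x, Z x)) = (\<Sum>a\<in>A. \<Sum>b\<in>B. \<Sum>c\<in>C. ent (p a b c))"
  by (subst fent_superset[of "A \<times> B \<times> C"])
    (use fin in \<open>auto simp: defs sum.cartesian_product p_def vimage_def intro!: sum.cong arg_cong[where f=ent] arg_cong[where f=prob]\<close>)
 have s2: "fent M (%x. (X x, Z x)) = (\<Sum>a\<in>A. \<Sum>c\<in>C. ent (\<Sum>b\<in>B. p a b c))"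
  by (subst fent_superset[of "A \<times> C"])
    (use fin in \<open>auto simp: defs sum.cartesian_product XZ[symmetric, unfolded defs] vimage_def intro!: sum.cong arg_cong[where f=ent] arg_cong[where f=prob]\<close>)
 have s3: "fent M (%x. (Y x, Z x)) = (\<Sum>b\<in>B. \<Sum>c\<in>C. ent (\<Sum>a\<in>A. p a b c))"
  by (subst fent_superset[of "B \<times> C"])
    (use fin in \<open>auto simp: defs sum.cartesian_product YZ[symmetric, unfolded defs] vimage_def intro!: sum.cong arg_cong[where f=ent] arg_cong[where f=prob]\<close>)
 have s4: "fent M Z = (\<Sum>c\<in>C. ent (\<Sum>a\<in>A. \<Sum>b\<in>B. p a b c))"
  unfolding fent_def C_def[symmetric] by (simp add: ZZ)
 show ?thesis unfolding s s2 s3 s4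
  by (rule strong_subadditivity_sums[OF fin]) (simp add: p_def)
qed

text \<open>On a cell of Q the function X has one value up to the exceptional set R. Summing
  \<open>ent_split_close\<close> over the cells, with total mass 1 and exceptional mass at most s^2,
  each value of X costs s + s^2 / s = 2 s; this is why R is measured by s^2.\<close>

lemma fent_pair_close:
 assumes X: "simple_function M X" and Q: "simple_function M Q" and R: "R : events"
  and det: "!!x y. x : space M ==> y : space M ==> Q x = Q y ==> x \<notin> R ==> y \<notin> R ==> X x = X y"
  and s: "s > 0" "prob R <= s^2"
 shows "fent M (%x. (X x, Q x)) <= fent M Q + s^2 + 2 * real (card (X ` space M)) * s"
proof -
 define A C where "A = X ` space M" and "C = Q ` space M"
 note defs = A_def C_def
 have fin: "finite A" "finite C" using simple_functionD(1) X Q by (auto simp: defs)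
 note ev = simple_functionD(2)[OF X] simple_functionD(2)[OF Q]
 define p where "p a c = prob ((X -` {a} \<inter> space M) \<inter> (Q -` {c} \<inter> space M))" for a c
 define w where "w c = prob (Q -` {c} \<inter> space M)" for c
 define r where "r c = prob (R \<inter> (Q -` {c} \<inter> space M))" for c
 have w: "w c = (\<Sum>a\<in>A. p a c)" for c
  unfolding w_def p_def by (subst measure_fiber_sum[OF X fin(1)]) (use ev in \<open>auto simp: defs ac_simps\<close>)
 have "(\<Sum>c\<in>C. r c) = prob R"
  unfolding r_def by (subst measure_fiber_sum[OF Q fin(2)]) (use R in \<open>auto simp: defs ac_simps\<close>)
 hence rs: "(\<Sum>c\<in>C. r c) <= s^2" using s by simp
 have "(\<Sum>c\<in>C. w c) = prob (space M)"
  unfolding w_def by (subst (2) measure_fiber_sum[OF Q fin(2)]) (auto simp: defs intro!: sum.cong arg_cong[where f=prob])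
 hence ws: "(\<Sum>c\<in>C. w c) = 1" using prob_space by simp
 have cell: "(\<Sum>a\<in>A. ent (p a c)) <= ent (w c) + r c + real (card A) * (s * w c + r c / s)" if c: "c : C" for c
 proof -
  obtain x0 where x0: "x0 : space M" "Q x0 = c" using c by (auto simp: defs)
  \<comment> \<open>The value of X on the cell off R. A cell contained in R has no such value, and
    any value attained in it will do.\<close>
  define i where "i = (if EX x:space M. Q x = c & x \<notin> R then X (SOME x. x : space M & Q x = c & x \<notin> R) else X x0)"
  have iA: "i : A"
  proof (cases "EX x:space M. Q x = c & x \<notin> R")
   case True
   hence "(SOME x. x : space M & Q x = c & x \<notin> R) : space M"
    by (metis (mono_tags, lifting) someI_ex)
   thus ?thesis using True by (auto simp: i_def A_def)
  qed (use x0 in \<open>auto simp: i_def A_def\<close>)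
  have i: "X x = i \<or> x : R" if "x : space M" "Q x = c" for x
  proof (cases "x : R")
   case False
   hence ex: "EX x:space M. Q x = c & x \<notin> R" using that by auto
   hence "(SOME x. x : space M & Q x = c & x \<notin> R) : space M & Q (SOME x. x : space M & Q x = c & x \<notin> R) = c
     & (SOME x. x : space M & Q x = c & x \<notin> R) \<notin> R"
    by (metis (mono_tags, lifting) someI_ex)
   hence "X x = X (SOME x. x : space M & Q x = c & x \<notin> R)" using that False by (intro det) auto
   thus ?thesis using ex by (simp add: i_def)
  qed simp
  have "(\<Sum>a\<in>A-{i}. p a c) = prob (\<Union>a\<in>A-{i}. (X -` {a} \<inter> space M) \<inter> (Q -` {c} \<inter> space M))"
   unfolding p_def using fin ev
   by (intro finite_measure_finite_Union[symmetric]) (auto simp: disjoint_family_on_def)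
  also have "\<dots> <= r c" unfolding r_def
   using R ev i by (intro finite_measure_mono) auto
  finally show ?thesis
   by (intro ent_split_close[OF fin(1) _ iA w[symmetric] _ s(1)]) (auto simp: p_def w_def)
 qed
 have "fent M (%x. (X x, Q x)) = (\<Sum>c\<in>C. \<Sum>a\<in>A. ent (p a c))"
  by (subst sum.swap, subst fent_superset[of "A \<times> C"])
    (use fin in \<open>auto simp: defs p_def sum.cartesian_product vimage_def intro!: sum.cong arg_cong[where f=ent] arg_cong[where f=prob]\<close>)
 also have "\<dots> <= (\<Sum>c\<in>C. ent (w c) + r c + real (card A) * (s * w c + r c / s))"
  by (intro sum_mono cell)
 also have "\<dots> = fent M Q + (\<Sum>c\<in>C. r c) + real (card A) * (s * (\<Sum>c\<in>C. w c) + (\<Sum>c\<in>C. r c) / s)"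
  by (simp add: fent_def defs w_def sum.distrib flip: sum_distrib_left sum_divide_distrib)
 also have "\<dots> <= fent M Q + s^2 + real (card A) * (s * 1 + s^2 / s)"
  using rs ws s by (intro add_mono mult_left_mono divide_right_mono) auto
 also have "\<dots> = fent M Q + s^2 + 2 * real (card A) * s" using s by (simp add: power2_eq_square)
 finally show ?thesis by (simp add: defs)
qed

lemma fent_const: "(!!x. x : space M ==> X x = c) ==> fent M X = 0"
proof -
 assume a: "!!x. x : space M ==> X x = c"
 hence "X -` {c} \<inter> space M = space M" by auto
 moreover have "X ` space M \<subseteq> {c}" using a by auto
 ultimately show ?thesis by (subst fent_superset[of "{c}"]) (auto simp: prob_space)
qed

text \<open>Strong subadditivity conditioned on a constant function.\<close>

lemma fent_subadditive:
 assumes X: "simple_function M X" and Y: "simple_function M Y"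
 shows "fent M (%x. (X x, Y x)) <= fent M X + fent M Y"
proof -
 have "fent M (%x. (X x, Y x, ())) + fent M (%_. ()) <= fent M (%x. (X x, ())) + fent M (%x. (Y x, ()))"
  by (intro strong_subadditivity X Y) simp
 moreover have "fent M (%x. (X x, Y x, ())) = fent M (%x. (X x, Y x))"
  "fent M (%x. (X x, ())) = fent M X" "fent M (%x. (Y x, ())) = fent M Y"
  by (intro fent_relabel; simp)+
 ultimately show ?thesis using fent_nonneg[of "%_. ()"] by simp
qed

text \<open>Strong subadditivity for the triple (Y, Y, X), conditioned on X: the duplicated Y
  cancels.\<close>

lemma fent_mono_pair:
 assumes X: "simple_function M X" and Y: "simple_function M Y"
 shows "fent M X <= fent M (%x. (X x, Y x))"
proof -
 have "fent M (%x. (Y x, Y x, X x)) + fent M X <= fent M (%x. (Y x, X x)) + fent M (%x. (Y x, X x))"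
  by (intro strong_subadditivity X Y)
 moreover have "fent M (%x. (Y x, Y x, X x)) = fent M (%x. (Y x, X x))" "fent M (%x. (X x, Y x)) = fent M (%x. (Y x, X x))"
  by (intro fent_relabel; auto)+
 ultimately show ?thesis by simp
qed

end

section \<open>Entropy rates of itineraries and metric entropy\<close>

definition itinerary :: "('a => 'b) => ('a => 'a) => nat => 'a => 'b list"
 where "itinerary X T n x = map (%j. X ((T ^^ j) x)) [0..<n]"

lemma itinerary_eq_iff:
 "itinerary X T n x = itinerary X T n y \<longleftrightarrow> (ALL j<n. X ((T ^^ j) x) = X ((T ^^ j) y))"
 by (auto simp: itinerary_def)

lemma partition_entropy_fibers:
 "partition_entropy M ((%x. {y:space M. X y = X x}) ` space M) = fent M X"
proof -
 let ?F = "(%x. {y:space M. X y = X x}) ` space M"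
 have F: "?F = (%a. X -` {a} \<inter> space M) ` (X ` space M)" by (auto simp: image_def)
 have inj: "inj_on (%a. X -` {a} \<inter> space M) (X ` space M)" by (auto simp: inj_on_def)
 show ?thesis unfolding F partition_entropy_def fent_def
  by (subst sum.reindex[OF inj]) (simp add: ent_def sum_negf)
qed

definition cell :: "'a set set => 'a => 'a set" where "cell P x = (THE A. A : P & x : A)"

lemma cell_eq: "partition_on S P ==> A : P ==> x : A ==> cell P x = A"
 unfolding cell_def by (rule the_equality) (auto simp: partition_on_def disjoint_def)

locale measure_preserving = prob_space M for M :: "'a measure" and T :: "'a => 'a" +
 assumes measurable_T: "T : M \<rightarrow>\<^sub>M M" and distr_T: "distr M M T = M"
begin

lemma measurable_funpow [measurable]: "(T ^^ n) : M \<rightarrow>\<^sub>M M"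
 using measurable_T by (induction n) (auto intro: measurable_comp simp: id_def)

lemma funpow_space: "x : space M ==> (T ^^ n) x : space M"
 by (rule measurable_space[OF measurable_funpow])

lemma distr_funpow: "distr M M (T ^^ n) = M"
proof (induction n)
 case 0 show ?case by (simp add: id_def distr_id)
next
 case (Suc n)
 have "distr M M (T ^^ Suc n) = distr (distr M M (T ^^ n)) M T"
  by (subst distr_distr) (auto simp: measurable_T)
 thus ?case using Suc distr_T by (simp add: comp_def)
qed

lemma prob_funpow_vimage: "A : events ==> prob ((T ^^ n) -` A \<inter> space M) = prob A"
 by (subst measure_distr[symmetric, of "T ^^ n" M M]) (auto simp: distr_funpow)

lemma simple_function_funpow:
 assumes "simple_function M X" shows "simple_function M (%x. X ((T ^^ n) x))"
 unfolding simple_function_def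
proof (intro conjI ballI)
 have "(%x. X ((T ^^ n) x)) ` space M \<subseteq> X ` space M" using funpow_space by auto
 thus "finite ((%x. X ((T ^^ n) x)) ` space M)" using simple_functionD(1)[OF assms] finite_subset by blast
next
 fix a
 have "(%x. X ((T ^^ n) x)) -` {a} \<inter> space M = (T ^^ n) -` (X -` {a} \<inter> space M) \<inter> space M"
  using funpow_space by auto
 also have "\<dots> : events" using simple_functionD(2)[OF assms] by (intro measurable_sets[OF measurable_funpow])
 finally show "(%x. X ((T ^^ n) x)) -` {a} \<inter> space M : events" .
qed

lemma fent_funpow:
 assumes "simple_function M X" shows "fent M (%x. X ((T ^^ n) x)) = fent M X"
proof -
 have "(%x. X ((T ^^ n) x)) -` {a} \<inter> space M = (T ^^ n) -` (X -` {a} \<inter> space M) \<inter> space M" for a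
  using funpow_space by auto
 moreover have "prob ((T ^^ n) -` (X -` {a} \<inter> space M) \<inter> space M) = prob (X -` {a} \<inter> space M)" for a
  using simple_functionD(2)[OF assms] by (intro prob_funpow_vimage)
 ultimately show ?thesis
  by (subst fent_superset[of "X ` space M"]) (use funpow_space simple_functionD(1)[OF assms] in \<open>auto simp: fent_def\<close>)
qed

lemma simple_function_itinerary:
 assumes "simple_function M X" shows "simple_function M (itinerary X T n)"
proof (induction n)
 case 0 thus ?case by (simp add: itinerary_def)
next
 case (Suc n)
 have "simple_function M ((%(a, b). a @ [b]) \<circ> (%x. (itinerary X T n x, X ((T ^^ n) x))))"
  by (intro simple_function_compose simple_function_Pair Suc simple_function_funpow assms)
 moreover have "(%(a, b). a @ [b]) \<circ> (%x. (itinerary X T n x, X ((T ^^ n) x))) = itinerary X T (Suc n)"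
  by (auto simp: itinerary_def fun_eq_iff)
 ultimately show ?case by simp
qed

lemma fent_itinerary_add:
 assumes "simple_function M X"
 shows "fent M (itinerary X T (m + n)) <= fent M (itinerary X T m) + fent M (itinerary X T n)"
proof -
 have "fent M (itinerary X T (m + n)) = fent M (%x. (itinerary X T m x, itinerary X T n ((T ^^ m) x)))"
 proof (rule fent_relabel)
  fix x y
  have "(ALL j<m + n. X ((T ^^ j) x) = X ((T ^^ j) y)) \<longleftrightarrow>
    (ALL j<m. X ((T ^^ j) x) = X ((T ^^ j) y)) & (ALL j<n. X ((T ^^ (j + m)) x) = X ((T ^^ (j + m)) y))"
   apply auto
   by (metis add.commute add_less_cancel_left le_add_diff_inverse not_less)
  thus "itinerary X T (m + n) x = itinerary X T (m + n) y \<longleftrightarrow>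
   (itinerary X T m x, itinerary X T n ((T ^^ m) x)) = (itinerary X T m y, itinerary X T n ((T ^^ m) y))"
   by (simp add: itinerary_eq_iff funpow_add)
 qed
 also have "\<dots> <= fent M (itinerary X T m) + fent M (%x. itinerary X T n ((T ^^ m) x))"
  by (intro fent_subadditive simple_function_itinerary simple_function_funpow assms)
 also have "fent M (%x. itinerary X T n ((T ^^ m) x)) = fent M (itinerary X T n)"
  by (intro fent_funpow simple_function_itinerary assms)
 finally show ?thesis .
qed

lemma fent_itinerary_le:
 assumes "simple_function M X"
 shows "fent M (itinerary X T n) <= real n * fent M X"
proof (induction n)
 case 0 show ?case by (simp add: itinerary_def fent_const)
next
 case (Suc n)
 have "fent M (itinerary X T 1) = fent M X"
  by (intro fent_relabel) (simp add: itinerary_def)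
 thus ?case using fent_itinerary_add[OF assms, of n 1] Suc by (simp add: algebra_simps)
qed

lemma entropy_rate_exists:
 assumes "simple_function M X"
 obtains l where "(%n. fent M (itinerary X T n) / real n) \<longlonglongrightarrow> l" "0 <= l"
proof -
 have "!!n. 0 * real n <= fent M (itinerary X T n)" using fent_nonneg by simp
 with fekete[of "%n. fent M (itinerary X T n)" 0] fent_itinerary_add[OF assms] that show ?thesis by metis
qed

text \<open>The bridge from the set-based entropy to \<open>fent\<close>. Discarding empty
  intersections in \<open>partition_join\<close> is what makes the members exactly the fibres of the
  itinerary; for n = 0 this uses that the space is nonempty.\<close>

lemma dyn_partition_fibers:
 assumes P: "partition_on (space M) P"
 shows "dyn_partition M T P n =
  (%x. {y:space M. itinerary (cell P) T n y = itinerary (cell P) T n x}) ` space M"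
proof (induction n)
 case 0
 obtain x0 where "x0 : space M" using not_empty by auto
 thus ?case by (auto simp: itinerary_def)
next
 case (Suc n)
 let ?F = "%n x. {y:space M. itinerary (cell P) T n y = itinerary (cell P) T n x}"
 have suc: "?F (Suc n) x = ?F n x \<inter> {y:space M. cell P ((T ^^ n) y) = cell P ((T ^^ n) x)}" for x
  by (auto simp: itinerary_eq_iff less_Suc_eq)
 have pre: "(T ^^ n) -` A \<inter> space M = {y:space M. cell P ((T ^^ n) y) = cell P ((T ^^ n) x)}"
  if "A : P" "(T ^^ n) x : A" for A x
 proof -
  have "cell P ((T ^^ n) x) = A" using cell_eq[OF P that] .
  moreover have "z : A \<longleftrightarrow> cell P z = A" if "z : space M" for z
  proof -
   obtain B where "B : P" "z : B" using P \<open>z : space M\<close> by (auto simp: partition_on_def)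
   thus ?thesis using cell_eq[OF P] \<open>A : P\<close> by metis
  qed
  ultimately show ?thesis using funpow_space by auto
 qed
 show ?case
 proof (intro set_eqI iffI)
  fix S assume "S : dyn_partition M T P (Suc n)"
  then obtain x A where xA: "x : space M" "A : P" "S = ?F n x \<inter> ((T ^^ n) -` A \<inter> space M)" "S ~= {}"
   unfolding dyn_partition.simps partition_join_def Suc by auto
  then obtain z where z: "z : S" by auto
  hence "z : space M" "?F n z = ?F n x" "(T ^^ n) z : A" using xA by auto
  hence "S = ?F (Suc n) z" using xA(3) pre[OF xA(2)] unfolding suc by simp
  thus "S : ?F (Suc n) ` space M" using \<open>z : space M\<close> by auto
 next
  fix S assume "S : ?F (Suc n) ` space M"
  then obtain x where x: "x : space M" "S = ?F (Suc n) x" by auto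
  obtain A where A: "A : P" "(T ^^ n) x : A"
   using P funpow_space[OF x(1), of n] by (auto simp: partition_on_def)
  have "S = ?F n x \<inter> ((T ^^ n) -` A \<inter> space M)" using x(2) pre[OF A] unfolding suc by simp
  moreover have "x : S" using x by simp
  ultimately show "S : dyn_partition M T P (Suc n)"
   unfolding dyn_partition.simps partition_join_def Suc using x(1) A(1) by blast
 qed
qed

lemma simple_function_cell:
 assumes "finite P" "partition_on (space M) P" "P \<subseteq> events"
 shows "simple_function M (cell P)"
 unfolding simple_function_def
proof (intro conjI ballI)
 have im: "cell P ` space M \<subseteq> P"
  using assms(2) cell_eq[OF assms(2)] by (fastforce simp: partition_on_def)
 thus "finite (cell P ` space M)" using assms finite_subset by blast
 fix A assume "A : cell P ` space M"
 hence A: "A : P" using im by auto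
 have "cell P -` {A} \<inter> space M = A"
 proof (intro set_eqI iffI)
  fix x assume x: "x : cell P -` {A} \<inter> space M"
  then obtain B where "B : P" "x : B" using assms(2) by (auto simp: partition_on_def)
  thus "x : A" using cell_eq[OF assms(2)] x by auto
 qed (use A assms cell_eq[OF assms(2)] in \<open>auto simp: partition_on_def\<close>)
 thus "cell P -` {A} \<inter> space M : events" using A assms by auto
qed

text \<open>A partition enters through its cell map, whose values are sets. Functions of this type
  therefore represent all finite measurable partitions.\<close>

lemma metric_entropy_leI:
 assumes "!!(X :: 'a => 'a set) l. simple_function M X ==>
   (%n. fent M (itinerary X T n) / real n) \<longlonglongrightarrow> l ==> l <= c"
 shows "metric_entropy T M <= ereal c"
 unfolding metric_entropy_def
proof (rule SUP_least)
 fix P assume P: "P : {P. finite P & partition_on (space M) P & P \<subseteq> events}"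
 hence sf: "simple_function M (cell P)" by (intro simple_function_cell) auto
 obtain l where l: "(%n. fent M (itinerary (cell P) T n) / real n) \<longlonglongrightarrow> l"
  using entropy_rate_exists[OF sf] by blast
 have "partition_entropy M (dyn_partition M T P n) = fent M (itinerary (cell P) T n)" for n
  using P by (subst dyn_partition_fibers) (auto simp: partition_entropy_fibers)
 hence "lim (%n. partition_entropy M (dyn_partition M T P n) / real n) = l"
  using l by (simp add: limI)
 thus "ereal (lim (%n. partition_entropy M (dyn_partition M T P n) / real n)) <= ereal c"
  using assms[OF sf l] by simp
qed

lemma metric_entropy_geI:
 assumes X: "simple_function M X" and l: "(%n. fent M (itinerary X T n) / real n) \<longlonglongrightarrow> l"
 shows "ereal l <= metric_entropy T M"
proof -
 define P where "P = (%a. X -` {a} \<inter> space M) ` X ` space M"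
 have fin: "finite P" using simple_functionD(1)[OF X] by (simp add: P_def)
 have ev: "P \<subseteq> events" using simple_functionD(2)[OF X] by (auto simp: P_def)
 have part: "partition_on (space M) P"
  by (rule partition_onI) (auto simp: P_def disjnt_def)
 have cell: "cell P x = X -` {X x} \<inter> space M" if "x : space M" for x
  by (rule cell_eq[OF part]) (use that in \<open>auto simp: P_def\<close>)
 have cc: "cell P x = cell P y \<longleftrightarrow> X x = X y" if "x : space M" "y : space M" for x y
  using that cell by auto
 have "fent M (itinerary (cell P) T n) = fent M (itinerary X T n)" for n
  by (rule fent_relabel) (simp add: itinerary_eq_iff cc funpow_space)
 hence "partition_entropy M (dyn_partition M T P n) = fent M (itinerary X T n)" for n
  using part by (subst dyn_partition_fibers) (auto simp: partition_entropy_fibers)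
 hence "lim (%n. partition_entropy M (dyn_partition M T P n) / real n) = l"
  using l by (simp add: limI)
 thus ?thesis unfolding metric_entropy_def
  by (intro SUP_upper2[of P]) (use fin ev part in auto)
qed

text \<open>Chain rule: coordinates of the itinerary are added one at a time, and by strong
  subadditivity the cost of a new one given everything before is at most its cost given Q
  alone.\<close>

lemma fent_itinerary_pair:
 assumes X: "simple_function M X" and Q: "simple_function M Q"
  and c: "!!j. j < m ==> fent M (%x. (X ((T ^^ j) x), Q x)) <= fent M Q + c"
 shows "fent M (%x. (itinerary X T m x, Q x)) <= fent M Q + real m * c"
 using c
proof (induction m)
 case 0
 have "fent M (%x. (itinerary X T 0 x, Q x)) = fent M Q"
  by (rule fent_relabel) (simp add: itinerary_def)
 thus ?case by simp
next
 case (Suc m)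
 have "fent M (%x. (itinerary X T (Suc m) x, Q x)) = fent M (%x. (X ((T ^^ m) x), itinerary X T m x, Q x))"
  by (rule fent_relabel) (auto simp: itinerary_eq_iff less_Suc_eq)
 moreover have "fent M (%x. (X ((T ^^ m) x), itinerary X T m x, Q x)) + fent M Q <=
   fent M (%x. (X ((T ^^ m) x), Q x)) + fent M (%x. (itinerary X T m x, Q x))"
  by (intro strong_subadditivity simple_function_funpow simple_function_itinerary X Q)
 moreover have "fent M (%x. (X ((T ^^ m) x), Q x)) <= fent M Q + c" using Suc.prems by simp
 moreover have "fent M (%x. (itinerary X T m x, Q x)) <= fent M Q + real m * c"
  using Suc by simp
 ultimately show ?case by (simp add: algebra_simps)
qed

lemma measure_preserving_funpow: "measure_preserving M (T ^^ n)"
 by unfold_locales (auto simp: distr_funpow)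

text \<open>An approximate generator bound. K + L symbols of \<xi> under the n-th iterate determine
  K n symbols of X, each up to a small error; dividing by K n, the L look-ahead symbols disappear as
  K grows, and then s tends to 0. The exceptional set keeps the argument valid for arbitrary
  measurable X, to which a purely topological hypothesis could not apply.\<close>

lemma entropy_rate_le_fent:
 assumes X: "simple_function M X" and \<xi>: "simple_function M \<xi>" and n: "n >= 1"
  and approx: "!!s::real. s > 0 ==> EX L R. R : events & prob R <= s^2 &
   (ALL r<n. ALL x:space M. ALL y:space M. (ALL i<L. \<xi> ((T ^^ (i * n)) x) = \<xi> ((T ^^ (i * n)) y)) -->
     (T ^^ r) x \<notin> R --> (T ^^ r) y \<notin> R --> X ((T ^^ r) x) = X ((T ^^ r) y))"
  and l: "(%m. fent M (itinerary X T m) / real m) \<longlonglongrightarrow> l"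
 shows "l <= fent M \<xi> / real n"
proof -
 interpret n: measure_preserving M "T ^^ n" by (rule measure_preserving_funpow)
 define N where "N = real (card (X ` space M))"
 have main: "l <= fent M \<xi> / real n + (s^2 + 2 * N * s)" if s: "s > 0" for s :: real
 proof -
  obtain L R where R: "R : events" "prob R <= s^2"
   and det: "!!r x y. r < n ==> x : space M ==> y : space M ==>
     (!!i. i < L ==> \<xi> ((T ^^ (i * n)) x) = \<xi> ((T ^^ (i * n)) y)) ==>
     (T ^^ r) x \<notin> R ==> (T ^^ r) y \<notin> R ==> X ((T ^^ r) x) = X ((T ^^ r) y)"
   using approx[OF s] by blast
  define c where "c = s^2 + 2 * N * s"
  have step: "fent M (itinerary X T (K * n)) <= real (K + L) * fent M \<xi> + real (K * n) * c" for K
  proof -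
   \<comment> \<open>Even the last of the K blocks is followed by the L blocks that
     \<open>det\<close> looks at.\<close>
   define Q where "Q = itinerary \<xi> (T ^^ n) (K + L)"
   have Q: "simple_function M Q" unfolding Q_def by (intro n.simple_function_itinerary \<xi>)
   have "fent M (itinerary X T (K * n)) <= fent M (%x. (itinerary X T (K * n) x, Q x))"
    by (intro fent_mono_pair simple_function_itinerary X Q)
   also have "\<dots> <= fent M Q + real (K * n) * c"
   proof (rule fent_itinerary_pair[OF X Q])
    fix j assume j: "j < K * n"
    define k r where "k = j div n" and "r = j mod n"
    have kr: "j = r + k * n" "r < n" "k < K"
     using j n by (auto simp: k_def r_def less_mult_imp_div_less)
    have "fent M (%x. (X ((T ^^ j) x), Q x)) <= fent M Q + s^2 + 2 * real (card ((%x. X ((T ^^ j) x)) ` space M)) * s"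
    proof (rule fent_pair_close[OF simple_function_funpow[OF X] Q, where R="(T ^^ j) -` R \<inter> space M"])
     show "(T ^^ j) -` R \<inter> space M : events" using R by (intro measurable_sets[OF measurable_funpow])
     show "prob ((T ^^ j) -` R \<inter> space M) <= s^2" using R prob_funpow_vimage by simp
     fix x y assume xy: "x : space M" "y : space M" "Q x = Q y"
      "x \<notin> (T ^^ j) -` R \<inter> space M" "y \<notin> (T ^^ j) -` R \<inter> space M"
     have "X ((T ^^ r) ((T ^^ (k * n)) x)) = X ((T ^^ r) ((T ^^ (k * n)) y))"
     proof (rule det)
      fix i assume i: "i < L"
      hence "\<xi> (((T ^^ n) ^^ (i + k)) x) = \<xi> (((T ^^ n) ^^ (i + k)) y)"
       using xy(3) kr by (auto simp: Q_def itinerary_eq_iff)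
      hence "\<xi> ((T ^^ (i * n + k * n)) x) = \<xi> ((T ^^ (i * n + k * n)) y)"
       by (simp only: funpow_mult distrib_right mult.commute[of n])
      thus "\<xi> ((T ^^ (i * n)) ((T ^^ (k * n)) x)) = \<xi> ((T ^^ (i * n)) ((T ^^ (k * n)) y))"
       by (simp add: funpow_add)
     qed (use xy kr funpow_space in \<open>auto simp: funpow_add\<close>)
     thus "X ((T ^^ j) x) = X ((T ^^ j) y)" using kr by (simp add: funpow_add)
    qed (fact s)
    also have "2 * real (card ((%x. X ((T ^^ j) x)) ` space M)) * s <= 2 * N * s"
    proof -
     have "card ((%x. X ((T ^^ j) x)) ` space M) <= card (X ` space M)"
      using funpow_space by (intro card_mono simple_functionD(1)[OF X]) auto
     thus ?thesis using s by (simp add: N_def)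
    qed
    finally show "fent M (%x. (X ((T ^^ j) x), Q x)) <= fent M Q + c" by (simp add: c_def)
   qed
   also have "fent M Q <= real (K + L) * fent M \<xi>" unfolding Q_def by (intro n.fent_itinerary_le \<xi>)
   finally show ?thesis by simp
  qed
  have sm: "strict_mono (%K. Suc K * n)" using n by (intro strict_monoI_Suc) auto
  have lim1: "(%K. fent M (itinerary X T (Suc K * n)) / real (Suc K * n)) \<longlonglongrightarrow> l"
   using LIMSEQ_subseq_LIMSEQ[OF l sm] by (simp add: o_def)
  have "(%K. (1 + real L / real (Suc K)) * (fent M \<xi> / real n) + c) \<longlonglongrightarrow> (1 + 0) * (fent M \<xi> / real n) + c"
   by (intro tendsto_intros LIMSEQ_Suc[OF lim_const_over_n])
  moreover have "fent M (itinerary X T (Suc K * n)) / real (Suc K * n) <= (1 + real L / real (Suc K)) * (fent M \<xi> / real n) + c" for K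
  proof -

   have "fent M (itinerary X T (Suc K * n)) / real (Suc K * n) <= (real (Suc K + L) * fent M \<xi> + real (Suc K * n) * c) / real (Suc K * n)"
    using step[of "Suc K"] by (intro divide_right_mono) (auto intro: of_nat_0_le_iff)
   also have "\<dots> = (1 + real L / real (Suc K)) * (fent M \<xi> / real n) + c"
   proof -
    define a b where "a = real (Suc K)" and "b = real n"
    have ab: "a > 0" "b > 0" using n by (auto simp: a_def b_def)
    have e: "real (Suc K * n) = a * b" "real (Suc K + L) = a + real L"
     unfolding a_def b_def by (simp_all only: of_nat_mult of_nat_add)
    show ?thesis unfolding e unfolding a_def[symmetric] b_def[symmetric] 
     using ab by (simp add: field_simps)
   qed
   finally show ?thesis .
  qed
  ultimately have "l <= (1 + 0) * (fent M \<xi> / real n) + c"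
   using lim1 by (intro LIMSEQ_le) auto
  thus ?thesis by (simp add: c_def)
 qed
 have "((%s. fent M \<xi> / real n + (s^2 + 2 * N * s)) \<longlongrightarrow> fent M \<xi> / real n + (0^2 + 2 * N * 0)) (at_right 0)"
  by (intro tendsto_intros)
 hence "l <= fent M \<xi> / real n + (0^2 + 2 * N * 0)"
  by (rule tendsto_lowerbound) (use main in \<open>auto simp: eventually_at_right_less intro!: eventually_at_rightI[of 0 1]\<close>)
 thus ?thesis by simp
qed

end

section \<open>Compact sets with a continuous metric\<close>

text \<open>At the first differing place k the ternary expansions differ by 3^(-k), while all later
  digits together change the sum by at most half of that. Base 3 with digits 0 and 1 is chosen for
  this gap.\<close>

lemma digits_gap:
 fixes a b :: "nat => real"
 assumes a: "!!j. a j : {0,1}" and b: "!!j. b j : {0,1}"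
  and close: "\<bar>(\<Sum>j. a j * (1/3)^j) - (\<Sum>j. b j * (1/3)^j)\<bar> < (1/3)^J / 2" and j: "j <= J"
 shows "a j = b j"
proof (rule ccontr)
 assume ne: "a j ~= b j"
 define k where "k = (LEAST i. a i ~= b i)"
 have k: "a k ~= b k" unfolding k_def by (rule LeastI[of _ j]) (fact ne)
 have kj: "k <= j" unfolding k_def by (rule Least_le) (fact ne)
 have eq: "a i = b i" if "i < k" for i using that not_less_Least k_def by blast
 define c where "c i = a i - b i" for i
 have c1: "\<bar>c i\<bar> <= 1" for i using a[of i] b[of i] by (auto simp: c_def)
 have ck: "\<bar>c k\<bar> = 1" using a[of k] b[of k] k by (auto simp: c_def)
 have sg: "summable (%i. (1/3::real)^i)" by simp
 have bnd: "norm (e i * (1/3)^i) <= (1/3)^i" if "\<bar>e i\<bar> <= 1" for e :: "nat => real" and i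
  using that mult_right_mono[of "\<bar>e i\<bar>" 1 "(1/3)^i"] by (simp add: abs_mult)
 have sm: "summable (%i. e i * (1/3)^i)" if "!!i. \<bar>e i\<bar> <= 1" for e :: "nat => real"
  by (rule summable_comparison_test'[OF sg]) (use bnd that in blast)
 have sa: "summable (%i. a i * (1/3)^i)" by (rule sm) (use a in \<open>metis abs_0 abs_1 insertE empty_iff order_refl zero_le_one\<close>)
 have sb: "summable (%i. b i * (1/3)^i)" by (rule sm) (use b in \<open>metis abs_0 abs_1 insertE empty_iff order_refl zero_le_one\<close>)
 have sc: "summable (%i. c i * (1/3)^i)" by (rule sm) (fact c1)
 have "(\<Sum>j. a j * (1/3)^j) - (\<Sum>j. b j * (1/3)^j) = (\<Sum>i. c i * (1/3)^i)"
  by (subst suminf_diff[OF sa sb]) (simp add: c_def algebra_simps)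
 also have "\<dots> = (\<Sum>i. c (i + Suc k) * (1/3)^(i + Suc k)) + (\<Sum>i<Suc k. c i * (1/3)^i)"
  by (rule suminf_split_initial_segment[OF sc])
 also have "(\<Sum>i<Suc k. c i * (1/3)^i) = c k * (1/3)^k"
  using eq by (simp add: c_def)
 finally have e: "(\<Sum>j. a j * (1/3)^j) - (\<Sum>j. b j * (1/3)^j) = (\<Sum>i. c (i + Suc k) * (1/3)^(i + Suc k)) + c k * (1/3)^k" .
 have "(%i. (1/3::real)^(i + Suc k)) sums ((1 / (1 - 1/3)) * (1/3)^Suc k)"
  unfolding power_add by (intro sums_mult2 geometric_sums) simp
 hence gs: "(\<Sum>i. (1/3::real)^(i + Suc k)) = (1/3)^k / 2" "summable (%i. (1/3::real)^(i + Suc k))"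
  by (auto simp: sums_iff)
 have "norm (\<Sum>i. c (i + Suc k) * (1/3)^(i + Suc k)) <= (\<Sum>i. (1/3::real)^(i + Suc k))"
  by (rule norm_suminf_le[OF _ gs(2)]) (rule bnd, rule c1)
 hence "\<bar>(\<Sum>i. c (i + Suc k) * (1/3)^(i + Suc k))\<bar> <= (1/3)^k / 2" using gs(1) by simp
 moreover have "\<bar>c k * (1/3)^k\<bar> = (1/3)^k" using ck by (simp add: abs_mult)
 ultimately have "\<bar>(\<Sum>j. a j * (1/3)^j) - (\<Sum>j. b j * (1/3)^j)\<bar> >= (1/3)^k / 2"
  unfolding e by linarith
 moreover have "(1/3::real)^J <= (1/3)^k" using kj j by (intro power_decreasing) auto
 ultimately show False using close by linarith
qed

text \<open>The type carries a topology but no metric, so the metric is an ordinary function D that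
  has to separate points only within \<Lambda>. Continuity and compactness then force D to induce
  the topology of \<Lambda>.\<close>

locale compact_metrized =
 fixes \<Lambda> :: "'m::{t2_space, second_countable_topology} set" and D :: "'m => 'm => real"
 assumes compact: "compact \<Lambda>" and nonempty: "\<Lambda> ~= {}"
  and D_nonneg [simp]: "0 <= D x y" and D_refl [simp]: "D x x = 0"
  and D_commute: "D x y = D y x" and D_triangle: "D x z <= D x y + D y z"
  and D_eq_0: "x : \<Lambda> ==> y : \<Lambda> ==> D x y = 0 ==> x = y"
  and continuous_D: "x : \<Lambda> ==> continuous_on \<Lambda> (D x)"
begin

abbreviation borel\<Lambda> :: "'m measure" where "borel\<Lambda> \<equiv> restrict_space borel \<Lambda>"

lemma closed_\<Lambda>: "closed \<Lambda>" by (rule compact_imp_closed[OF compact])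
lemma borel_\<Lambda> [measurable]: "\<Lambda> : sets borel" by (rule borel_closed[OF closed_\<Lambda>])

lemma space_borel\<Lambda> [simp]: "space borel\<Lambda> = \<Lambda>" by (simp add: space_restrict_space)

lemma borel_measurable_continuous: "continuous_on \<Lambda> g ==> g : borel_measurable borel\<Lambda>"
 by (rule borel_measurable_continuous_on_restrict)

text \<open>The continuous function D x attains a positive minimum on the compact set \<Lambda> -
  U.\<close>

lemma D_openE:
 assumes "x : \<Lambda>" "open U" "x : U"
 obtains r where "r > 0" "!!y. y : \<Lambda> ==> D x y < r ==> y : U"
proof (cases "\<Lambda> - U = {}")
 case True thus ?thesis using that[of 1] by auto
next
 case False
 have "compact (\<Lambda> - U)" using compact_diff[OF compact \<open>open U\<close>] .
 moreover have "continuous_on (\<Lambda> - U) (D x)" using continuous_D[OF assms(1)] continuous_on_subset by blast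
 ultimately obtain y where y: "y : \<Lambda> - U" "!!z. z : \<Lambda> - U ==> D x y <= D x z"
  using continuous_attains_inf[of "\<Lambda> - U" "D x"] False by auto
 have "D x y ~= 0" using D_eq_0[of x y] y assms by auto
 hence "D x y > 0" using D_nonneg[of x y] by linarith
 thus ?thesis using that y by (meson DiffI not_less)
qed

lemma open_D_ball:
 assumes "x : \<Lambda>"
 obtains U where "open U" "!!y. y : \<Lambda> ==> y : U \<longleftrightarrow> D x y < r"
proof -
 have "openin (top_of_set \<Lambda>) (\<Lambda> \<inter> D x -` {..<r})"
  by (rule continuous_openin_preimage_gen[OF continuous_D[OF assms]]) auto
 then obtain U where "open U" "\<Lambda> \<inter> D x -` {..<r} = \<Lambda> \<inter> U" by (auto simp: openin_open)
 thus ?thesis by (intro that[of U]) auto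
qed

lemma finite_D_cover:
 assumes r: "!!x. x : \<Lambda> ==> r x > 0"
 obtains F where "finite F" "F \<subseteq> \<Lambda>" "!!y. y : \<Lambda> ==> EX x:F. D x y < r x"
proof -
 have "ALL x:\<Lambda>. EX U. open U & (ALL y:\<Lambda>. y : U \<longleftrightarrow> D x y < r x)" using open_D_ball by metis
 then obtain U where U: "!!x. x : \<Lambda> ==> open (U x)" "!!x y. x : \<Lambda> ==> y : \<Lambda> ==> y : U x \<longleftrightarrow> D x y < r x"
  by metis
 have "\<Lambda> \<subseteq> (\<Union>x\<in>\<Lambda>. U x)" using U(2) r by fastforce
 then obtain F where "F \<subseteq> \<Lambda>" "finite F" "\<Lambda> \<subseteq> (\<Union>x\<in>F. U x)"
  using compactE_image[OF compact, of \<Lambda> U] U(1) by metis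
 thus ?thesis using U(2) by (intro that[of F]) blast+
qed

text \<open>Formulated for an arbitrary relation P because it is the passage from local to uniform
  facts used for uniform continuity, separation of compact sets, expansion and the comparison with
  the Riemannian distance. Halved radii put both points into the ball of one centre.\<close>

lemma lebesgue_number:
 assumes "!!x. x : \<Lambda> ==> EX U. open U & x : U & (ALL y:U\<inter>\<Lambda>. ALL z:U\<inter>\<Lambda>. P y z)"
 obtains r where "r > 0" "!!y z. y : \<Lambda> ==> z : \<Lambda> ==> D y z <= r ==> P y z"
proof -
 have "EX r>0. ALL y:\<Lambda>. ALL z:\<Lambda>. D x y < r --> D x z < r --> P y z" if x: "x : \<Lambda>" for x
 proof -
  obtain U where U: "open U" "x : U" "ALL y:U\<inter>\<Lambda>. ALL z:U\<inter>\<Lambda>. P y z" using assms x by blast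
  obtain r where "r > 0" "!!y. y : \<Lambda> ==> D x y < r ==> y : U" using D_openE[OF x U(1,2)] by metis
  thus ?thesis using U(3) by (intro exI[of _ r]) auto
 qed
 then obtain r where r: "!!x. x : \<Lambda> ==> r x > 0"
  "!!x y z. x : \<Lambda> ==> y : \<Lambda> ==> z : \<Lambda> ==> D x y < r x ==> D x z < r x ==> P y z" by metis
 obtain F where F: "finite F" "F \<subseteq> \<Lambda>" "!!y. y : \<Lambda> ==> EX x:F. D x y < r x / 2"
  using finite_D_cover[of "%x. r x / 2"] r(1) by auto
 have Fne: "F ~= {}" using F nonempty by auto
 define e where "e = Min ((%x. r x / 2) ` F)"
 have e0: "e > 0" unfolding e_def using F Fne r(1) by (subst Min_gr_iff) auto
 have ele: "e <= r x / 2" if "x : F" for x unfolding e_def using F that by (intro Min_le) auto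
 show ?thesis
 proof (rule that[of "e / 2"])
  fix y z assume yz: "y : \<Lambda>" "z : \<Lambda>" "D y z <= e / 2"
  obtain x where x: "x : F" "D x y < r x / 2" using F yz by blast
  have "D x z < r x" using D_triangle[of x z y] ele[OF x(1)] x yz e0 by simp
  moreover have "D x y < r x" using x r(1)[of x] F by auto
  ultimately show "P y z" using r(2) x F yz by blast
 qed (use e0 in simp)
qed

lemma uniformly_continuous_map:
 assumes f: "continuous_on \<Lambda> f" "f ` \<Lambda> \<subseteq> \<Lambda>" and e: "e > 0"
 obtains r where "r > 0" "!!y z. y : \<Lambda> ==> z : \<Lambda> ==> D y z <= r ==> D (f y) (f z) < e"
proof (rule lebesgue_number[of "%y z. D (f y) (f z) < e"])
 fix x assume x: "x : \<Lambda>"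
 obtain V where V: "open V" "!!y. y : \<Lambda> ==> y : V \<longleftrightarrow> D (f x) y < e/2"
  using open_D_ball[of "f x"] f x by (metis image_subset_iff)
 obtain U where U: "open U" "x : U" "!!y. y : \<Lambda> ==> y : U ==> f y : V"
  using f x e V unfolding continuous_on_topological
  by (metis D_refl half_gt_zero image_subset_iff)
 show "EX U. open U & x : U & (ALL y:U \<inter> \<Lambda>. ALL z:U \<inter> \<Lambda>. D (f y) (f z) < e)"
 proof (intro exI conjI ballI)
  fix y z assume "y : U \<inter> \<Lambda>" "z : U \<inter> \<Lambda>"
  hence "D (f x) (f y) < e/2" "D (f x) (f z) < e/2" using U(3) V(2) f by auto
  thus "D (f y) (f z) < e" using D_triangle[of "f y" "f z" "f x"] D_commute[of "f y" "f x"] by linarith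
 qed (use U in auto)
qed (use that in auto)

definition nbhd :: "'m set => real => 'm set" where "nbhd K r = {y:\<Lambda>. EX x:K. D x y < r}"

lemma nbhd_openE:
 assumes "K \<subseteq> \<Lambda>" obtains U where "open U" "nbhd K r = U \<inter> \<Lambda>"
proof -
 have "ALL x:\<Lambda>. EX U. open U & (ALL y:\<Lambda>. y : U \<longleftrightarrow> D x y < r)" using open_D_ball by metis
 then obtain U where U: "!!x. x : \<Lambda> ==> open (U x)" "!!x y. x : \<Lambda> ==> y : \<Lambda> ==> y : U x \<longleftrightarrow> D x y < r"
  by metis
 show ?thesis
  by (rule that[of "\<Union>x\<in>K. U x"]) (use U assms in \<open>auto simp: nbhd_def subset_iff\<close>)
qed

lemma sets_borel\<Lambda>_Int: "B : sets borel ==> B \<inter> \<Lambda> : sets borel\<Lambda>"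
 by (auto simp: sets_restrict_space)

lemma sets_nbhd: "K \<subseteq> \<Lambda> ==> nbhd K r : sets borel\<Lambda>"
 by (rule nbhd_openE[of K r]) (auto intro: sets_borel\<Lambda>_Int)

lemma sets_compact: "compact K ==> K \<subseteq> \<Lambda> ==> K : sets borel\<Lambda>"
 using sets_borel\<Lambda>_Int[of K] compact_imp_closed[of K] by (simp add: inf_absorb1)

lemma compact_separated:
 assumes "closed K" "closed K'" "K \<inter> K' = {}"
 obtains r where "r > 0" "!!x y. x : K \<inter> \<Lambda> ==> y : K' \<inter> \<Lambda> ==> r < D x y"
proof (rule lebesgue_number[of "%y z. \<not> (y : K & z : K')"])
 fix x assume "x : \<Lambda>"
 have "x : - K \<or> x : - K'" using assms by auto
 thus "EX U. open U & x : U & (ALL y:U \<inter> \<Lambda>. ALL z:U \<inter> \<Lambda>. \<not> (y : K & z : K'))"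
  using assms by (metis ComplD IntD1 open_Compl)
next
 fix r assume "r > 0" "!!y z. y : \<Lambda> ==> z : \<Lambda> ==> D y z <= r ==> \<not> (y : K & z : K')"
 thus ?thesis by (intro that[of r]) (auto, meson not_less)
qed

lemma measure_nbhd_tendsto:
 assumes \<eta>: "finite_measure \<eta>" "sets \<eta> = sets borel\<Lambda>" and K: "compact K" "K \<subseteq> \<Lambda>" and e: "e > 0"
 obtains r where "r > 0" "measure \<eta> (nbhd K r - K) < e"
proof -
 interpret finite_measure \<eta> by fact
 have Kc: "closed K" using K compact_imp_closed by blast
 define N where "N n = nbhd K (1 / real (Suc n))" for n
 have Nm: "N n : sets \<eta>" for n unfolding N_def using \<eta> sets_nbhd K by simp
 have Km: "K : sets \<eta>" using sets_compact[OF K] \<eta> by simp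
 have KN: "K \<subseteq> N n" for n unfolding N_def nbhd_def using K by force
 have dec: "decseq N"
 proof (rule antimonoI)
  fix m n :: nat assume "m <= n"
  hence "1 / real (Suc n) <= 1 / real (Suc m)" by (simp add: field_simps)
  thus "N n <= N m" unfolding N_def nbhd_def by force
 qed
 have int: "(\<Inter>n. N n) = K"
 proof (intro equalityI subsetI)
  fix y assume y: "y : (\<Inter>n. N n)"
  show "y : K"
  proof (rule ccontr)
   assume "y \<notin> K"
   hence "K \<inter> {y} = {}" by auto
   then obtain r where r: "r > 0" "!!x z. x : K \<inter> \<Lambda> ==> z : {y} \<inter> \<Lambda> ==> r < D x z"
    using compact_separated[OF Kc closed_singleton] by metis
   obtain n where n: "1 / real (Suc n) < r" using nat_approx_posE r(1) by blast
   have yn: "y : N n" using y by simp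
   then obtain x where "x : K" "D x y < 1 / real (Suc n)" "y : \<Lambda>" unfolding N_def nbhd_def by auto
   thus False using r(2)[of x y] n K by auto
  qed
 qed (use KN in auto)
 have "(%n. measure \<eta> (N n)) \<longlonglongrightarrow> measure \<eta> (\<Inter>n. N n)"
  by (rule finite_Lim_measure_decseq) (use Nm dec in auto)
 hence "(%n. measure \<eta> (N n) - measure \<eta> K) \<longlonglongrightarrow> measure \<eta> K - measure \<eta> K"
  unfolding int by (intro tendsto_intros)
 hence "\<forall>\<^sub>F n in sequentially. measure \<eta> (N n) - measure \<eta> K < e"
  using e order_tendstoD(2)[of _ 0] by simp
 then obtain n where "measure \<eta> (N n) - measure \<eta> K < e" by (auto simp: eventually_sequentially)
 hence "measure \<eta> (N n - K) < e" using finite_measure_Diff[OF Nm Km KN] by simp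
 thus ?thesis using that[of "1 / real (Suc n)"] unfolding N_def by simp
qed

text \<open>The induction runs over the sigma-algebra generated by the closed sets. The class
  \<open>Q\<close> asks for a compact set inside and an open set outside at once, since only this
  two-sided property passes to complements.\<close>

lemma regular:
 assumes \<eta>: "finite_measure \<eta>" "sets \<eta> = sets borel\<Lambda>" and A: "A : sets \<eta>" and e: "e > 0"
 obtains K where "compact K" "K \<subseteq> A" "measure \<eta> (A - K) < e"
proof -
 interpret finite_measure \<eta> by fact
 have sp: "space \<eta> = \<Lambda>" using sets_eq_imp_space_eq[OF \<eta>(2)] by simp
 define Q where "Q A \<longleftrightarrow> (ALL e>0. EX K U. compact K & open U & K \<subseteq> A & A \<subseteq> U \<inter> \<Lambda> & measure \<eta> (U \<inter> \<Lambda> - K) < e)" for A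
 have Um: "U \<inter> \<Lambda> : sets \<eta>" if "open U" for U using that sets_borel\<Lambda>_Int \<eta> by simp
 have Km: "K : sets \<eta>" if "compact K" "K \<subseteq> \<Lambda>" for K using sets_compact that \<eta> by simp
 have Q: "Q (B \<inter> \<Lambda>)" if "B : sigma_sets UNIV (Collect closed)" for B
  using that
 proof (induction B)
  case (Basic B)
  have BK: "compact (B \<inter> \<Lambda>)" "B \<inter> \<Lambda> \<subseteq> \<Lambda>" using Basic compact by (auto simp: closed_Int_compact)
  show ?case unfolding Q_def
  proof (intro allI impI)
   fix e :: real assume "e > 0"
   then obtain r where r: "r > 0" "measure \<eta> (nbhd (B \<inter> \<Lambda>) r - (B \<inter> \<Lambda>)) < e"
    using measure_nbhd_tendsto[OF \<eta> BK] by metis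
   obtain U where U: "open U" "nbhd (B \<inter> \<Lambda>) r = U \<inter> \<Lambda>" using nbhd_openE[OF BK(2)] by metis
   have "B \<inter> \<Lambda> \<subseteq> nbhd (B \<inter> \<Lambda>) r" using r by (force simp: nbhd_def)
   thus "EX K U. compact K & open U & K \<subseteq> B \<inter> \<Lambda> & B \<inter> \<Lambda> \<subseteq> U \<inter> \<Lambda> & measure \<eta> (U \<inter> \<Lambda> - K) < e"
    using U r BK by (intro exI[of _ "B \<inter> \<Lambda>"] exI[of _ U]) auto
  qed
 next
  case Empty show ?case unfolding Q_def by (intro allI impI exI[of _ "{}"]) auto
 next
  case (Compl B)
  show ?case unfolding Q_def
  proof (intro allI impI)
   fix e :: real assume "e > 0"
   then obtain K U where KU: "compact K" "open U" "K \<subseteq> B \<inter> \<Lambda>" "B \<inter> \<Lambda> \<subseteq> U \<inter> \<Lambda>" "measure \<eta> (U \<inter> \<Lambda> - K) < e"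
    using Compl unfolding Q_def by meson
   have "- K \<inter> \<Lambda> - (\<Lambda> - U) = U \<inter> \<Lambda> - K" by auto
   thus "EX K U. compact K & open U & K \<subseteq> (UNIV - B) \<inter> \<Lambda> & (UNIV - B) \<inter> \<Lambda> \<subseteq> U \<inter> \<Lambda> & measure \<eta> (U \<inter> \<Lambda> - K) < e"
    using KU compact_diff[OF compact, of U] compact_imp_closed[of K]
    by (intro exI[of _ "\<Lambda> - U"] exI[of _ "- K"]) auto
  qed
 next
  case (Union B)
  show ?case unfolding Q_def
  proof (intro allI impI)
   fix e :: real assume e: "e > 0"
   \<comment> \<open>Half of e is spread geometrically over the members of the union; the other half
     pays for keeping only finitely many of the compact sets, because their infinite union need not
     be compact.\<close>
   have "ALL i. EX K U. compact K & open U & K \<subseteq> B i \<inter> \<Lambda> & B i \<inter> \<Lambda> \<subseteq> U \<inter> \<Lambda> & measure \<eta> (U \<inter> \<Lambda> - K) < e / 2 * (1/2)^Suc i"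
   proof
   fix i
   have "0 < e / 2 * (1/2)^Suc i" using e by simp
   thus "EX K U. compact K & open U & K \<subseteq> B i \<inter> \<Lambda> & B i \<inter> \<Lambda> \<subseteq> U \<inter> \<Lambda> & measure \<eta> (U \<inter> \<Lambda> - K) < e / 2 * (1/2)^Suc i"
    using Union(2)[of i] unfolding Q_def by blast
  qed
   then obtain K U where KU: "!!i. compact (K i)" "!!i. open (U i)" "!!i. K i \<subseteq> B i \<inter> \<Lambda>" "!!i. B i \<inter> \<Lambda> \<subseteq> U i \<inter> \<Lambda>"
    "!!i. measure \<eta> (U i \<inter> \<Lambda> - K i) < e / 2 * (1/2)^Suc i" by metis
   define V where "V = (\<Union>i. U i)"
   have Ki: "K i : sets \<eta>" for i using KU(1,3) Km by blast
   have Vm: "V \<inter> \<Lambda> : sets \<eta>" unfolding V_def using KU by (intro Um) auto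
   have sE: "(%i. e / 2 * (1/2::real)^Suc i) sums (e / 2)"
    using sums_mult[OF power_half_series, of "e/2"] by simp
   have dm: "U i \<inter> \<Lambda> - K i : sets \<eta>" for i using Um[OF KU(2)] Ki by auto
   have smm: "summable (%i. measure \<eta> (U i \<inter> \<Lambda> - K i))"
    by (rule summable_comparison_test'[OF sums_summable[OF sE]]) (use KU(5) in \<open>simp add: less_imp_le\<close>)
   have "measure \<eta> (V \<inter> \<Lambda> - (\<Union>i. K i)) <= measure \<eta> (\<Union>i. U i \<inter> \<Lambda> - K i)"
    using dm by (intro finite_measure_mono) (auto simp: V_def)
   also have "\<dots> <= (\<Sum>i. measure \<eta> (U i \<inter> \<Lambda> - K i))"
    by (rule finite_measure_subadditive_countably) (use dm smm in auto)
   also have "\<dots> <= (\<Sum>i. e / 2 * (1/2)^Suc i)"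
    by (intro suminf_le smm sums_summable[OF sE] less_imp_le KU(5))
   also have "\<dots> = e / 2" using sE by (simp add: sums_iff)
   finally have le: "measure \<eta> (V \<inter> \<Lambda> - (\<Union>i. K i)) <= e / 2" .
   define W where "W n = V \<inter> \<Lambda> - (\<Union>i<n. K i)" for n
   have "(%n. measure \<eta> (W n)) \<longlonglongrightarrow> measure \<eta> (\<Inter>n. W n)"
   proof (rule finite_Lim_measure_decseq)
    show "range W \<subseteq> sets \<eta>" unfolding W_def using Vm Ki by auto
    show "decseq W" unfolding W_def by (rule antimonoI) (auto; meson order_less_le_trans)
   qed
   moreover have "(\<Inter>n. W n) = V \<inter> \<Lambda> - (\<Union>i. K i)" by (auto simp: W_def)
   ultimately have lim: "(%n. measure \<eta> (W n)) \<longlonglongrightarrow> measure \<eta> (V \<inter> \<Lambda> - (\<Union>i. K i))" by simp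
   have "\<forall>\<^sub>F n in sequentially. measure \<eta> (W n) < e"
    by (rule order_tendstoD(2)[OF lim]) (use le e in linarith)
   then obtain n where n: "measure \<eta> (W n) < e" by (auto simp: eventually_sequentially)
   show "EX K U. compact K & open U & K \<subseteq> \<Union> (range B) \<inter> \<Lambda> & \<Union> (range B) \<inter> \<Lambda> \<subseteq> U \<inter> \<Lambda> & measure \<eta> (U \<inter> \<Lambda> - K) < e"
    using n KU(1-4) unfolding W_def V_def
    by (intro exI[of _ "\<Union>i<n. K i"] exI[of _ "\<Union>i. U i"]) (auto intro!: compact_UN; blast)
  qed
 qed
 obtain B where B: "B : sigma_sets UNIV (Collect closed)" "A = B \<inter> \<Lambda>"
  using A unfolding \<eta>(2) sets_restrict_space borel_eq_closed by auto
 then obtain K U where KU: "compact K" "open U" "K \<subseteq> A" "A \<subseteq> U \<inter> \<Lambda>" "measure \<eta> (U \<inter> \<Lambda> - K) < e"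
  using Q[OF B(1)] e unfolding Q_def by meson
 have "K : sets \<eta>" using KU by (intro Km) auto
 hence "measure \<eta> (A - K) <= measure \<eta> (U \<inter> \<Lambda> - K)"
  using KU Um by (intro finite_measure_mono) auto
 thus ?thesis using that KU by force
qed

end

section \<open>Weak sequential compactness of probability measures\<close>

context compact_metrized
begin

lemma continuous_boundedE:
 fixes g :: "'m => real"
 assumes "continuous_on \<Lambda> g"
 obtains B where "B >= 0" "!!x. x : \<Lambda> ==> \<bar>g x\<bar> <= B"
proof -
 have "bounded (g ` \<Lambda>)" by (rule compact_imp_bounded[OF compact_continuous_image[OF assms compact]])
 then obtain B where B: "ALL y:g ` \<Lambda>. norm y <= B" unfolding bounded_iff by blast
 thus ?thesis by (intro that[of "max B 0"]) auto
qed

text \<open>The ternary digits of \<kappa> x record to which balls of a countable family x belongs,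
  the centres running through finite nets of radius 1 / (n + 1). The code is merely measurable, but
  its inverse is uniformly continuous, which is the direction needed to pull weak limits back from
  the line.\<close>

lemma cantor_code:
 obtains \<kappa> :: "'m => real" where "\<kappa> : borel_measurable borel\<Lambda>" "!!x. 0 <= \<kappa> x" "!!x. \<kappa> x <= 3/2"
  "!!e. e > 0 ==> EX \<delta>>0. ALL x:\<Lambda>. ALL y:\<Lambda>. \<bar>\<kappa> x - \<kappa> y\<bar> < \<delta> --> D x y < e"
proof -
 have "ALL n. EX F. finite F & F \<subseteq> \<Lambda> & (ALL y:\<Lambda>. EX x:F. D x y < 1 / real (Suc n))"
 proof
  fix n
  have "0 < 1 / real (Suc n)" by simp
  thus "EX F. finite F & F \<subseteq> \<Lambda> & (ALL y:\<Lambda>. EX x:F. D x y < 1 / real (Suc n))"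
   using finite_D_cover[of "%_. 1 / real (Suc n)"] by metis
 qed
 then obtain F where F: "!!n. finite (F n)" "!!n. F n \<subseteq> \<Lambda>"
  "!!n y. y : \<Lambda> ==> EX x:F n. D x y < 1 / real (Suc n)" by metis
 define S where "S = (\<Union>n. F n \<times> {1 / real (Suc n)})"
 have Sc: "countable S" unfolding S_def using F(1) by (intro countable_UN countable_SIGMA) (auto intro: countable_finite)
 have Sne: "S ~= {}" using F(3) nonempty unfolding S_def by blast
 define pq where "pq = from_nat_into S"
 have rng: "range pq = S" unfolding pq_def by (rule range_from_nat_into[OF Sne Sc])
 have p: "fst (pq j) : \<Lambda>" for j
 proof -
  have "pq j : S" using rng by auto
  thus ?thesis using F(2) unfolding S_def by fastforce
 qed
 define c :: "'m => nat => real" where "c x j = (if D (fst (pq j)) x < snd (pq j) then 1 else 0)" for x j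
 have c: "c x j : {0,1}" for x j by (simp add: c_def)
 define \<kappa> where "\<kappa> x = (\<Sum>j. c x j * (1/3)^j)" for x
 have cle: "0 <= c x j * (1/3)^j" "c x j * (1/3)^j <= (1/3)^j" for x j by (auto simp: c_def)
 have sg: "(%j. (1/3::real)^j) sums (3/2)" using geometric_sums[of "1/3::real"] by simp
 have sc: "summable (%j. c x j * (1/3)^j)" for x
  by (rule summable_comparison_test'[OF sums_summable[OF sg]]) (use cle in auto)
 show ?thesis
 proof (rule that[of \<kappa>])
  have "(%x. c x j) : borel_measurable borel\<Lambda>" for j
   unfolding c_def using borel_measurable_continuous[OF continuous_D[OF p[of j]]] by measurable
  thus "\<kappa> : borel_measurable borel\<Lambda>" unfolding \<kappa>_def by measurable
  show "0 <= \<kappa> x" for x unfolding \<kappa>_def by (intro suminf_nonneg sc cle)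
  show "\<kappa> x <= 3/2" for x
   unfolding \<kappa>_def sums_unique[OF sg] by (rule suminf_le[OF cle(2) sc sums_summable[OF sg]])
  fix e :: real assume e: "e > 0"
  obtain n where n: "1 / real (Suc n) < e / 2" using nat_approx_posE[of "e/2"] e by auto
  have "ALL x:F n. EX j. pq j = (x, 1 / real (Suc n))"
  proof
   fix x assume "x : F n"
   hence "(x, 1 / real (Suc n)) : S" unfolding S_def by auto
   thus "EX j. pq j = (x, 1 / real (Suc n))" using rng by (metis imageE)
  qed
  \<comment> \<open>Only finitely many digits, those of the n-th net, have to agree for two points
    to share a small ball.\<close>
  then obtain idx where idx: "!!x. x : F n ==> pq (idx x) = (x, 1 / real (Suc n))" by metis
  define J where "J = Max (insert 0 (idx ` F n))"
  have J: "idx x <= J" if "x : F n" for x unfolding J_def using F(1) that by (intro Max_ge) auto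
  have "D x y < e" if xy: "x : \<Lambda>" "y : \<Lambda>" "\<bar>\<kappa> x - \<kappa> y\<bar> < (1/3)^J / 2" for x y
  proof -
   obtain z where z: "z : F n" "D z x < 1 / real (Suc n)" using F(3) xy by blast
   have "c x (idx z) = c y (idx z)"
    by (rule digits_gap[of "c x" "c y" J]) (use c xy J[OF z(1)] in \<open>auto simp: \<kappa>_def\<close>)
   hence "D z y < 1 / real (Suc n)" using z(2) idx[OF z(1)] by (simp add: c_def split: if_splits)
   thus ?thesis using D_triangle[of x y z] D_commute[of x z] z(2) n by linarith
  qed
  thus "EX \<delta>>0. ALL x:\<Lambda>. ALL y:\<Lambda>. \<bar>\<kappa> x - \<kappa> y\<bar> < \<delta> --> D x y < e"
   by (intro exI[of _ "(1/3)^J / 2"]) auto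
 qed
qed

text \<open>The image measures on the line under the code are tight and have a weakly convergent
  subsequence. The limit lives on the closure C of the coded set, and the inverse of the code
  extends continuously to C, so the limit can be mapped back to \<Lambda>.\<close>

lemma weak_compactness:
 fixes \<nu> :: "nat => 'm measure"
 assumes \<nu>: "!!k. prob_space (\<nu> k)" "!!k. sets (\<nu> k) = sets borel\<Lambda>"
 obtains r \<mu> where "strict_mono (r :: nat => nat)" "prob_space \<mu>" "sets \<mu> = sets borel\<Lambda>"
  "!!g :: 'm => real. continuous_on \<Lambda> g ==> (%k. integral\<^sup>L (\<nu> (r k)) g) \<longlonglongrightarrow> integral\<^sup>L \<mu> g"
proof -
 obtain \<kappa> :: "'m => real" where \<kappa>: "\<kappa> : borel_measurable borel\<Lambda>" "!!x. 0 <= \<kappa> x" "!!x. \<kappa> x <= 3/2"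
  "!!e. e > 0 ==> EX \<delta>>0. ALL x:\<Lambda>. ALL y:\<Lambda>. \<bar>\<kappa> x - \<kappa> y\<bar> < \<delta> --> D x y < e"
  using cantor_code by metis
 have sp: "space (\<nu> k) = \<Lambda>" for k using sets_eq_imp_space_eq[OF \<nu>(2)] by simp
 have \<kappa>m [measurable]: "\<kappa> : borel_measurable (\<nu> k)" for k
  using \<kappa>(1) measurable_cong_sets[OF \<nu>(2) refl] by blast
 define M where "M k = distr (\<nu> k) borel \<kappa>" for k
 have rd: "real_distribution (M k)" for k
  unfolding M_def real_distribution_def real_distribution_axioms_def
  using prob_space.prob_space_distr[OF \<nu>(1) \<kappa>m] by auto
 have "tight M"
  unfolding tight_def
 proof (intro conjI allI impI)
  fix e :: real assume "e > 0"
  have "measure (M n) {-1<..2} > 1 - e" for n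
  proof -
   interpret prob_space "\<nu> n" by (rule \<nu>(1))
   have "\<kappa> -` {-1<..2} \<inter> space (\<nu> n) = space (\<nu> n)"       proof -
    have "-1 < \<kappa> x" "\<kappa> x <= 2" for x using \<kappa>(2)[of x] \<kappa>(3)[of x] by linarith+
    thus ?thesis by auto
   qed
   hence "measure (M n) {-1<..2} = 1" unfolding M_def by (simp add: measure_distr prob_space)
   thus ?thesis using \<open>e > 0\<close> by simp
  qed
  thus "EX a b. a < b & (ALL n. 1 - e < measure (M n) {a<..b})" by (intro exI[of _ "-1"] exI[of _ 2]) auto
 qed (rule rd)
 then obtain r N where r: "strict_mono r" "real_distribution N" "weak_conv_m (M \<circ> id \<circ> r) N"
  using tight_imp_convergent_subsubsequence[of M id] by (auto simp: strict_mono_id)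
 interpret N: real_distribution N by (rule r(2))
 have conv: "(%k. integral\<^sup>L (M (r k)) h) \<longlonglongrightarrow> integral\<^sup>L N h"
  if "continuous_on UNIV h" "!!x. norm (h x) <= B" for h :: "real => real" and B
  using weak_conv_imp_integral_bdd_continuous_conv[of "M \<circ> id \<circ> r" N h B] rd r that
  by (auto simp: continuous_on_eq_continuous_at)
 have intM: "integral\<^sup>L (M k) h = integral\<^sup>L (\<nu> k) (%x. h (\<kappa> x))" if "h : borel_measurable borel" for k and h :: "real => real"
  unfolding M_def using that by (intro integral_distr) auto
 define C where "C = closure (\<kappa> ` \<Lambda>)"
 have Cc: "closed C" by (simp add: C_def)
 have Cne: "C ~= {}" using nonempty by (simp add: C_def)
 have \<kappa>C: "\<kappa> x : C" if "x : \<Lambda>" for x unfolding C_def by (rule subsetD[OF closure_subset]) (use that in simp)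
 have AEC: "AE u in N. u : C"
 proof -
  \<comment> \<open>A bounded continuous test function vanishing exactly on C; all its integrals
    along the sequence are zero, hence so is the limiting one.\<close>
  define h where "h u = min 1 (infdist u C)" for u :: real
  have hc: "continuous_on UNIV h" unfolding h_def by (intro continuous_intros)
  have hb: "norm (h u) <= 1" for u unfolding h_def using infdist_nonneg[of u C] by auto
  have hm: "h : borel_measurable borel" using hc by (rule borel_measurable_continuous_onI)
  have "integral\<^sup>L (M k) h = 0" for k
  proof -
   have "integral\<^sup>L (M k) h = integral\<^sup>L (\<nu> k) (%x. 0)" unfolding intM[OF hm]
    by (intro Bochner_Integration.integral_cong) (use \<kappa>C sp in \<open>auto simp: h_def\<close>)
   thus ?thesis by simp
  qed
  hence i0: "integral\<^sup>L N h = 0" using conv[OF hc hb] LIMSEQ_unique[OF _ tendsto_const[of 0]] by auto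
  have "integrable N h" by (rule N.integrable_const_bound[of _ 1]) (use hb hm in auto)
  hence "AE u in N. h u = 0"
   using integral_nonneg_eq_0_iff_AE[of N h] i0 infdist_nonneg[of _ C] by (auto simp: h_def)
  thus ?thesis
  proof (rule AE_mp, intro AE_I2 impI)
   fix u assume "h u = 0"
   hence "infdist u C = 0" by (simp add: h_def min_def split: if_splits)
   thus "u : C" using in_closed_iff_infdist_zero[OF Cc Cne] by simp
  qed
 qed
 \<comment> \<open>The point of \<Lambda> on which the codes near u accumulate. It exists by the
   finite intersection property of the closures of the sets \<open>N\<close>.\<close>
 define \<pi> where "\<pi> u = (SOME x. x : \<Lambda> & (ALL e>0. EX \<delta>>0. ALL y:\<Lambda>. \<bar>\<kappa> y - u\<bar> < \<delta> --> D x y < e))" for u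
 have \<pi>: "\<pi> u : \<Lambda> & (ALL e>0. EX \<delta>>0. ALL y:\<Lambda>. \<bar>\<kappa> y - u\<bar> < \<delta> --> D (\<pi> u) y < e)" if u: "u : C" for u
 proof -
  define N where "N \<delta> = {y:\<Lambda>. \<bar>\<kappa> y - u\<bar> < \<delta>}" for \<delta>
  have Nne: "N \<delta> ~= {}" if "\<delta> > 0" for \<delta>
  proof -
   obtain v where "v : \<kappa> ` \<Lambda>" "dist v u < \<delta>" using u \<open>\<delta> > 0\<close> unfolding C_def by (meson closure_approachable)
   thus ?thesis by (auto simp: N_def dist_real_def)
  qed
  have "\<Lambda> \<inter> (\<Inter>\<delta>\<in>{0<..}. closure (N \<delta>)) ~= {}"
  proof (rule compact_imp_fip_image[OF compact])
   fix I' :: "real set" assume I: "finite I'" "I' \<subseteq> {0<..}"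
   define d where "d = Min (insert 1 I')"
   have "d > 0" unfolding d_def using I by (subst Min_gr_iff) auto
   then obtain y where y: "y : N d" using Nne by blast
   have "y : N \<delta>" if "\<delta> : I'" for \<delta>
   proof -
    have "d <= \<delta>" unfolding d_def using I that by (intro Min_le) auto
    thus ?thesis using y by (auto simp: N_def)
   qed
   hence "y : closure (N \<delta>)" if "\<delta> : I'" for \<delta> using that by (intro subsetD[OF closure_subset])
   hence "y : \<Lambda> \<inter> (\<Inter>\<delta>\<in>I'. closure (N \<delta>))" using y by (auto simp: N_def)
   thus "\<Lambda> \<inter> (\<Inter>\<delta>\<in>I'. closure (N \<delta>)) ~= {}" by auto
  qed auto
  then obtain x where x: "x : \<Lambda>" "!!\<delta>. \<delta> > 0 ==> x : closure (N \<delta>)" by auto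
  have "EX \<delta>>0. ALL y:\<Lambda>. \<bar>\<kappa> y - u\<bar> < \<delta> --> D x y < e" if e: "e > 0" for e
  proof -
   obtain \<delta> where \<delta>: "\<delta> > 0" "!!y z. y : \<Lambda> ==> z : \<Lambda> ==> \<bar>\<kappa> y - \<kappa> z\<bar> < \<delta> ==> D y z < e/2"
    using \<kappa>(4)[of "e/2"] e by auto
   obtain U where U: "open U" "!!y. y : \<Lambda> ==> y : U \<longleftrightarrow> D x y < e/2" using open_D_ball[OF x(1)] by metis
   have "x : U" using U(2)[OF x(1)] e by simp
   then obtain z where z: "z : N (\<delta>/2)" "z : U"
    using x(2)[of "\<delta>/2"] \<delta>(1) U(1) unfolding closure_iff_nhds_not_empty
    by (metis half_gt_zero disjoint_iff order_refl)
   have zD: "z : \<Lambda>" "D x z < e/2" using z U(2) by (auto simp: N_def)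
   show ?thesis
   proof (intro exI[of _ "\<delta>/2"] conjI ballI impI)
    fix y assume y: "y : \<Lambda>" "\<bar>\<kappa> y - u\<bar> < \<delta>/2"
    have "\<bar>\<kappa> z - u\<bar> < \<delta>/2" using z by (simp add: N_def)
    hence "\<bar>\<kappa> z - \<kappa> y\<bar> < \<delta>" using y(2) by linarith
    hence "D z y < e/2" using \<delta>(2) zD y by blast
    thus "D x y < e" using D_triangle[of x y z] zD by linarith
   qed (use \<delta> in simp)
  qed
  thus ?thesis unfolding \<pi>_def by (rule_tac someI[of _ x]) (use x in auto)
 qed
 have cont\<pi>: "continuous_on C \<pi>"
  unfolding continuous_on_topological
 proof (intro ballI allI impI)
  fix u B assume u: "u : C" "open B" "\<pi> u : B"
  obtain e where e: "e > 0" "!!y. y : \<Lambda> ==> D (\<pi> u) y < e ==> y : B"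
   using D_openE[OF _ u(2,3)] \<pi>[OF u(1)] by metis
  obtain \<delta> where \<delta>: "\<delta> > 0" "!!y. y : \<Lambda> ==> \<bar>\<kappa> y - u\<bar> < \<delta> ==> D (\<pi> u) y < e/2"
   using \<pi>[OF u(1)] e(1) by (metis half_gt_zero)
  have "\<pi> v : B" if v: "v : C" "dist v u < \<delta>/2" for v
  proof -
   obtain \<delta>' where \<delta>': "\<delta>' > 0" "!!y. y : \<Lambda> ==> \<bar>\<kappa> y - v\<bar> < \<delta>' ==> D (\<pi> v) y < e/2"
    using \<pi>[OF v(1)] e(1) by (metis half_gt_zero)
   have "min \<delta>' (\<delta>/2) > 0" using \<delta> \<delta>' by simp
   then obtain w where "w : \<kappa> ` \<Lambda>" "dist w v < min \<delta>' (\<delta>/2)"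
    using v(1) unfolding C_def by (meson closure_approachable)
   then obtain y where y: "y : \<Lambda>" "\<bar>\<kappa> y - v\<bar> < \<delta>'" "\<bar>\<kappa> y - v\<bar> < \<delta>/2" by (auto simp: dist_real_def)
   have "\<bar>\<kappa> y - u\<bar> < \<delta>" using y(3) v(2) unfolding dist_real_def by linarith
   hence "D (\<pi> u) y < e/2" "D (\<pi> v) y < e/2" using \<delta> \<delta>' y by auto
   hence "D (\<pi> u) (\<pi> v) < e" using D_triangle[of "\<pi> u" "\<pi> v" y] D_commute[of y "\<pi> v"] by linarith
   thus ?thesis using e(2) \<pi>[OF v(1)] by blast
  qed
  thus "EX A. open A & u : A & (ALL y:C. y : A --> \<pi> y : B)"
   using \<delta>(1) by (intro exI[of _ "ball u (\<delta>/2)"]) (auto simp: dist_commute)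
 qed
 have \<pi>\<kappa>: "\<pi> (\<kappa> x) = x" if x: "x : \<Lambda>" for x
 proof -
  have P: "\<pi> (\<kappa> x) : \<Lambda>" "!!e. e > 0 ==> EX \<delta>>0. ALL y:\<Lambda>. \<bar>\<kappa> y - \<kappa> x\<bar> < \<delta> --> D (\<pi> (\<kappa> x)) y < e"
   using \<pi>[OF \<kappa>C[OF x]] by auto
  have "D (\<pi> (\<kappa> x)) x < e" if "e > 0" for e using P(2)[OF that] x by force
  hence "D (\<pi> (\<kappa> x)) x = 0" using D_nonneg by (metis less_eq_real_def less_irrefl)
  thus ?thesis using D_eq_0 P(1) x by blast
 qed
 obtain x0 where x0: "x0 : \<Lambda>" using nonempty by auto
 \<comment> \<open>Off C, a null set of the limit, any constant in \<Lambda> makes the map total and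
   keeps it measurable.\<close>
 define \<pi>' where "\<pi>' u = (if u : C then \<pi> u else x0)" for u
 have "\<pi>' : borel_measurable borel" unfolding \<pi>'_def
  by (intro borel_measurable_continuous_on_if borel_closed Cc cont\<pi> continuous_on_const)
 hence \<pi>m: "\<pi>' : N \<rightarrow>\<^sub>M borel\<Lambda>"
  by (intro measurable_restrict_space2) (use \<pi> x0 in \<open>auto simp: \<pi>'_def\<close>)
 define \<mu> where "\<mu> = distr N borel\<Lambda> \<pi>'"
 show ?thesis
 proof (rule that[OF r(1)])
  show "prob_space \<mu>" unfolding \<mu>_def by (rule N.prob_space_distr[OF \<pi>m])
  show "sets \<mu> = sets borel\<Lambda>" by (simp add: \<mu>_def)
  fix g :: "'m => real" assume g: "continuous_on \<Lambda> g"
  obtain B where B0: "B >= 0" and B: "!!x. x : \<Lambda> ==> norm (g x) <= B"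
   using continuous_boundedE[OF g] by auto
  have gp: "continuous_on C (%u. g (\<pi> u))"
   by (rule continuous_on_compose2[OF g cont\<pi>]) (use \<pi> in auto)
  \<comment> \<open>Weak convergence on the line tests functions on the whole line, whereas the
    transported function lives on C; a Tietze extension with the same bound closes the gap.\<close>
  obtain h where h: "continuous_on UNIV h" "!!u. u : C ==> h u = g (\<pi> u)" "!!u. norm (h u) <= B"
   using Tietze[OF gp, of UNIV B] Cc B0 B \<pi> by auto
  have hm: "h : borel_measurable borel" using h(1) by (rule borel_measurable_continuous_onI)
  have "integral\<^sup>L (M k) h = integral\<^sup>L (\<nu> k) g" for k unfolding intM[OF hm]
   by (intro Bochner_Integration.integral_cong) (use h(2) \<kappa>C \<pi>\<kappa> sp in auto)
  moreover have "integral\<^sup>L N h = integral\<^sup>L \<mu> g"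
  proof -
   have "integral\<^sup>L \<mu> g = integral\<^sup>L N (%u. g (\<pi>' u))"
    unfolding \<mu>_def by (rule integral_distr[OF \<pi>m borel_measurable_continuous[OF g]])
   also have "\<dots> = integral\<^sup>L N h"
   proof (rule integral_cong_AE)
    show "(%u. g (\<pi>' u)) : borel_measurable N" by (rule measurable_compose[OF \<pi>m borel_measurable_continuous[OF g]])
    show "AE u in N. g (\<pi>' u) = h u" using AEC by (rule AE_mp) (auto simp: h(2) \<pi>'_def)
   qed (use hm in auto)
   finally show ?thesis by simp
  qed
  ultimately show "(%k. integral\<^sup>L (\<nu> (r k)) g) \<longlonglongrightarrow> integral\<^sup>L \<mu> g"
   using conv[OF h(1) h(3)] by simp
 qed
qed

end

section \<open>Expanding maps with specification\<close>

text \<open>Both a + c and - a + c are subadditive. Their Fekete limits are opposite numbers, and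
  since each limit is also a lower bound, the deviation from a linear sequence is at most c for
  every n, not only asymptotically.\<close>

lemma almost_additive_sequence:
 fixes a :: "nat => real"
 assumes a: "!!m n. m >= 1 ==> n >= 1 ==> \<bar>a (m + n) - a m - a n\<bar> <= c"
 obtains P where "(%n. a n / real n) \<longlonglongrightarrow> P" "!!n. n >= 1 ==> \<bar>a n - real n * P\<bar> <= c"
proof -
 have c0: "c >= 0" using a[of 1 1] by simp
 have bd: "\<bar>a n\<bar> <= real n * (\<bar>a 1\<bar> + c)" if "n >= 1" for n
  using that
 proof (induction n rule: dec_induct)
  case base thus ?case using c0 by simp
 next
  case (step n)
  thus ?case using a[of n 1] by (simp add: algebra_simps)
 qed
 have up: "a (m + n) + c <= a m + c + (a n + c)" if "m >= 1" "n >= 1" for m n using a[OF that] by linarith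
 have lo: "- a (m + n) + c <= - a m + c + (- a n + c)" if "m >= 1" "n >= 1" for m n using a[OF that] by linarith
 have b1: "- (\<bar>a 1\<bar> + c) * real n <= a n + c" if "n >= 1" for n
  using abs_le_D2[OF bd[OF that]] c0 by (simp add: algebra_simps)
 have b2: "- (\<bar>a 1\<bar> + c) * real n <= - a n + c" if "n >= 1" for n
  using abs_le_D1[OF bd[OF that]] c0 by (simp add: algebra_simps)
 obtain l1 where l1: "(%n. (a n + c) / real n) \<longlonglongrightarrow> l1" "!!n. n >= 1 ==> l1 <= (a n + c) / real n"
  using fekete[of "%n. a n + c" "- (\<bar>a 1\<bar> + c)", OF up b1] by metis
 obtain l2 where l2: "(%n. (- a n + c) / real n) \<longlonglongrightarrow> l2" "!!n. n >= 1 ==> l2 <= (- a n + c) / real n"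
  using fekete[of "%n. - a n + c" "- (\<bar>a 1\<bar> + c)", OF lo b2] by metis
 have cn: "(%n. c / real n) \<longlonglongrightarrow> 0" by (rule lim_const_over_n)
 have "(%n. (a n + c) / real n - c / real n) \<longlonglongrightarrow> l1 - 0" by (intro tendsto_diff l1 cn)
 hence L1: "(%n. a n / real n) \<longlonglongrightarrow> l1" by (simp add: add_divide_distrib)
 have "(%n. c / real n - (- a n + c) / real n) \<longlonglongrightarrow> 0 - l2" by (intro tendsto_diff l2 cn)
 moreover have "c / real n - (- a n + c) / real n = a n / real n" for n by (simp flip: diff_divide_distrib)
 ultimately have "(%n. a n / real n) \<longlonglongrightarrow> - l2" by simp
 hence eq: "l1 = - l2" using L1 LIMSEQ_unique by blast
 show ?thesis
 proof (rule that[OF L1])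
  fix n :: nat assume n: "n >= 1"
  show "\<bar>a n - real n * l1\<bar> <= c" using l1(2)[OF n] l2(2)[OF n] n eq by (simp add: field_simps abs_le_iff)
 qed
qed

text \<open>Specification here ends exactly at y after a gap of N steps, independent of n. This
  exactness allows preimages of different points to be compared by injections. Expansivity at 64
  \<rho> leaves room for repeated triangle inequalities between Bowen balls.\<close>

locale expanding_map = compact_metrized \<Lambda> D
 for \<Lambda> :: "'m::{t2_space, second_countable_topology} set" and D +
 fixes f :: "'m => 'm" and \<rho> :: real and N :: nat
 assumes continuous_f: "continuous_on \<Lambda> f" and f_image: "f ` \<Lambda> = \<Lambda>"
  and \<rho>_pos: "\<rho> > 0" and N_pos: "N >= 1"
  and expansive: "e > 0 ==> EX L. ALL x:\<Lambda>. ALL y:\<Lambda>. (ALL j<=L. D ((f ^^ j) x) ((f ^^ j) y) <= 64 * \<rho>) --> D x y <= e"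
  and specif: "x : \<Lambda> ==> y : \<Lambda> ==>
   EX z:\<Lambda>. (ALL j<=n. D ((f ^^ j) x) ((f ^^ j) z) <= \<rho>) & (f ^^ (n + N)) z = y"
begin

lemma funpow_image: "(f ^^ n) ` \<Lambda> = \<Lambda>"
proof (induction n)
 case (Suc n)
 have "(f ^^ Suc n) ` \<Lambda> = f ` (f ^^ n) ` \<Lambda>" by (simp add: image_image)
 thus ?case using Suc f_image by simp
qed simp

lemma funpow_mem: "x : \<Lambda> ==> (f ^^ n) x : \<Lambda>" using funpow_image by blast

lemma continuous_funpow: "continuous_on \<Lambda> (f ^^ n)"
proof (induction n)
 case (Suc n)
 have "continuous_on \<Lambda> (f \<circ> (f ^^ n))"
  by (rule continuous_on_compose[OF Suc]) (simp add: funpow_image continuous_f)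
 thus ?case by simp
qed (simp add: id_def)

text \<open>Time n is included, as in \<open>dyn_ball\<close>, so the distortion hypothesis applies
  to \<Theta> n on a ball of order n.\<close>

definition bowen :: "nat => 'm => real => 'm set"
 where "bowen n x r = {y:\<Lambda>. ALL j<=n. D ((f ^^ j) x) ((f ^^ j) y) <= r}"

definition pre :: "nat => 'm => 'm set" where "pre n y = {z:\<Lambda>. (f ^^ n) z = y}"

lemma bowen_mono: "r <= s ==> bowen n x r \<subseteq> bowen n x s" by (force simp: bowen_def)

lemma bowen_self: "x : \<Lambda> ==> 0 <= r ==> x : bowen n x r" by (simp add: bowen_def)

lemma bowen_triangle: "y : bowen n x r ==> z : bowen n x s ==> z : bowen n y (r + s)"
proof -
 assume "y : bowen n x r" "z : bowen n x s"
 moreover have "D ((f ^^ j) y) ((f ^^ j) z) <= D ((f ^^ j) x) ((f ^^ j) y) + D ((f ^^ j) x) ((f ^^ j) z)" for j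
  using D_triangle[of "(f ^^ j) y" "(f ^^ j) z" "(f ^^ j) x"] D_commute[of "(f ^^ j) x" "(f ^^ j) y"] by linarith
 ultimately show ?thesis by (auto simp: bowen_def) (meson add_mono order_trans)
qed

lemma bowen_commute: "x : \<Lambda> ==> y : bowen n x r ==> x : bowen n y r"
 by (auto simp: bowen_def D_commute)

text \<open>Orbits that stay close up to time n and then coincide are close forever, so expansivity
  makes the points arbitrarily close.\<close>

lemma funpow_inject:
 assumes "x : \<Lambda>" "y : \<Lambda>" "(f ^^ n) x = (f ^^ n) y" "!!j. j < n ==> D ((f ^^ j) x) ((f ^^ j) y) <= 64 * \<rho>"
 shows "x = y"
proof -
 have "D ((f ^^ j) x) ((f ^^ j) y) <= 64 * \<rho>" for j
 proof (cases "j < n")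
  case False
  then obtain i where "j = i + n" by (metis add.commute le_Suc_ex not_less)
  thus ?thesis using assms(3) \<rho>_pos by (simp add: funpow_add)
 qed (use assms in auto)
 hence "D x y <= e" if "e > 0" for e using expansive[OF that] assms by blast
 hence "D x y = 0" using D_nonneg by (metis antisym dense_ge)
 thus ?thesis using D_eq_0 assms by blast
qed

text \<open>Distinct n-step preimages of one point are uniformly separated, so sending each to a
  nearby net point is injective and the net bounds their number.\<close>

lemma card_pre_bound:
 obtains q :: nat where "!!w. finite (pre n w) & card (pre n w) <= q"
proof -
 have "EX r>0. ALL y:\<Lambda>. ALL z:\<Lambda>. D y z <= r --> D ((f ^^ j) y) ((f ^^ j) z) < 64 * \<rho>" for j
  using uniformly_continuous_map[OF continuous_funpow, where e = "64 * \<rho>" and n1 = j] funpow_image \<rho>_pos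
  by (metis mult_pos_pos order_refl zero_less_numeral)
 then obtain r where r: "!!j. r j > 0" "!!j y z. y : \<Lambda> ==> z : \<Lambda> ==> D y z <= r j ==> D ((f ^^ j) y) ((f ^^ j) z) < 64 * \<rho>"
  by metis
 define s where "s = Min (r ` {..n})"
 have s: "s > 0" "!!j. j <= n ==> s <= r j" unfolding s_def using r(1) by (auto simp: Min_gr_iff)
 obtain F where F: "finite F" "!!y. y : \<Lambda> ==> EX x:F. D x y < s / 2"
  using finite_D_cover[of "%_. s / 2"] s(1) by (metis half_gt_zero)
 define h where "h y = (SOME x. x : F & D x y < s / 2)" for y
 have h: "h y : F" "D (h y) y < s / 2" if "y : \<Lambda>" for y
  using F(2)[OF that] unfolding h_def by (metis (mono_tags, lifting) someI_ex)+
 have inj: "inj_on h (pre n w)" for w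
 proof (rule inj_onI)
  fix x y assume xy: "x : pre n w" "y : pre n w" "h x = h y"
  have xy': "x : \<Lambda>" "y : \<Lambda>" "(f ^^ n) x = (f ^^ n) y" using xy by (auto simp: pre_def)
  have "D x y <= s" using D_triangle[of x y "h x"] D_commute[of x "h x"] h(2)[OF xy'(1)] h(2)[OF xy'(2)] xy(3) by auto
  hence "!!j. j < n ==> D ((f ^^ j) x) ((f ^^ j) y) <= 64 * \<rho>"
   using r(2) s(2) xy' by (meson less_imp_le order_trans)
  thus "x = y" using funpow_inject xy' by blast
 qed
 have sub: "h ` pre n w \<subseteq> F" for w using h(1) by (auto simp: pre_def)
 have "finite (pre n w) & card (pre n w) <= card F" for w
  using inj sub F(1) by (meson card_inj_on_le inj_on_finite)
 thus ?thesis using that by blast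
qed

lemma finite_pre: "finite (pre n w)" using card_pre_bound by metis

lemma pre_nonempty: "w : \<Lambda> ==> pre n w ~= {}"
proof -
 assume "w : \<Lambda>"
 then obtain z where "z : \<Lambda>" "w = (f ^^ n) z" using funpow_image[of n] by (metis imageE)
 thus ?thesis by (auto simp: pre_def)
qed

section \<open>Partition functions over preimages and the pressure\<close>

definition Q :: real where "Q = (SOME q. 1 <= q & (ALL w. real (card (pre N w)) <= q))"

lemma Q: "1 <= Q" "real (card (pre N w)) <= Q"
proof -
 obtain q :: nat where "!!w. card (pre N w) <= q" using card_pre_bound[of N] by metis
 hence "1 <= max 1 (real q) & (ALL w. real (card (pre N w)) <= max 1 (real q))" by (auto simp: le_max_iff_disj)
 hence "1 <= Q & (ALL w. real (card (pre N w)) <= Q)" unfolding Q_def by (rule someI)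
 thus "1 <= Q" "real (card (pre N w)) <= Q" by auto
qed

lemma sum_pre_add:
 fixes F :: "'m => real"
 shows "(\<Sum>z\<in>{z:pre (m + n) y. (f ^^ m) z : B}. F z) = (\<Sum>w\<in>pre n y \<inter> B. \<Sum>z\<in>pre m w. F z)"
proof -
 have "{z:pre (m + n) y. (f ^^ m) z : B} = (\<Union>w\<in>pre n y \<inter> B. pre m w)"
  using funpow_mem by (auto simp: pre_def funpow_add add.commute[of m n])
 moreover have "(\<Sum>z\<in>(\<Union>w\<in>pre n y \<inter> B. pre m w). F z) = (\<Sum>w\<in>pre n y \<inter> B. \<Sum>z\<in>pre m w. F z)"
  by (rule sum.UNION_disjoint) (use finite_pre in \<open>auto simp: pre_def\<close>)
 ultimately show ?thesis by simp
qed

text \<open>For a sequence of Birkhoff sums this is the n-th power of the transfer operator applied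
  to the constant 1.\<close>

definition Z :: "(nat => 'm => real) => nat => 'm => real"
 where "Z \<Theta> n y = (\<Sum>z\<in>pre n y. exp (\<Theta> n z))"

text \<open>One constant bounds the defect of additivity, the variation on Bowen balls and the cost
  of a specification gap. Gibbs constants become functions of C alone, which makes them uniform for
  t in bounded intervals.\<close>

definition tame :: "real => (nat => 'm => real) => bool" where
 "tame C \<Theta> \<longleftrightarrow> C >= 0 & (ALL n>=1. continuous_on \<Lambda> (\<Theta> n)) &
  (ALL m>=1. ALL n>=1. ALL x:\<Lambda>. \<bar>\<Theta> (m + n) x - \<Theta> m x - \<Theta> n ((f ^^ m) x)\<bar> <= C) &
  (ALL n>=1. ALL x:\<Lambda>. ALL y:bowen n x (64 * \<rho>). \<bar>\<Theta> n x - \<Theta> n y\<bar> <= C) &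
  (ALL x:\<Lambda>. \<bar>\<Theta> N x\<bar> <= C)"

context
 fixes C :: real and \<Theta> :: "nat => 'm => real"
 assumes tame: "tame C \<Theta>"
begin

lemma C_nonneg: "C >= 0" and continuous_\<Theta>: "n >= 1 ==> continuous_on \<Lambda> (\<Theta> n)"
 using tame unfolding tame_def by simp_all

lemma \<Theta>_add: "m >= 1 ==> n >= 1 ==> x : \<Lambda> ==> \<bar>\<Theta> (m + n) x - \<Theta> m x - \<Theta> n ((f ^^ m) x)\<bar> <= C"
 using tame unfolding tame_def by simp

lemma \<Theta>_bowen: 
 assumes "n >= 1" "x : \<Lambda>" "y : bowen n x r" "r <= 64 * \<rho>" shows "\<bar>\<Theta> n x - \<Theta> n y\<bar> <= C"
proof -
 have "y : bowen n x (64 * \<rho>)" using bowen_mono[OF assms(4)] assms(3) by blast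
 thus ?thesis using tame assms(1,2) unfolding tame_def by simp
qed

lemma \<Theta>_N: "x : \<Lambda> ==> \<bar>\<Theta> N x\<bar> <= C"
 using tame unfolding tame_def by simp

lemma Z_pos: "y : \<Lambda> ==> Z \<Theta> n y > 0"
 unfolding Z_def by (rule sum_pos) (simp_all add: finite_pre pre_nonempty)

lemma Z_add:
 assumes "m >= 1" "n >= 1"
 shows "Z \<Theta> (m + n) y <= exp C * (\<Sum>w\<in>pre n y. exp (\<Theta> n w) * Z \<Theta> m w)"
  and "exp (- C) * (\<Sum>w\<in>pre n y. exp (\<Theta> n w) * Z \<Theta> m w) <= Z \<Theta> (m + n) y"
proof -
 have split: "Z \<Theta> (m + n) y = (\<Sum>w\<in>pre n y. \<Sum>z\<in>pre m w. exp (\<Theta> (m + n) z))"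
  using sum_pre_add[of _ m n y UNIV] by (simp add: Z_def)
 have t: "\<bar>\<Theta> (m + n) z - (\<Theta> m z + \<Theta> n w)\<bar> <= C" if "z : pre m w" for z w
  using \<Theta>_add[OF assms, of z] that by (auto simp: pre_def)
 have "(\<Sum>w\<in>pre n y. \<Sum>z\<in>pre m w. exp (\<Theta> (m + n) z)) <= (\<Sum>w\<in>pre n y. \<Sum>z\<in>pre m w. exp C * (exp (\<Theta> n w) * exp (\<Theta> m z)))"
 proof (intro sum_mono)
  fix w z assume "z : pre m w"
  thus "exp (\<Theta> (m + n) z) <= exp C * (exp (\<Theta> n w) * exp (\<Theta> m z))"
   using t[of z w] by (simp flip: exp_add)
 qed
 thus "Z \<Theta> (m + n) y <= exp C * (\<Sum>w\<in>pre n y. exp (\<Theta> n w) * Z \<Theta> m w)"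
  unfolding split by (simp add: Z_def sum_distrib_left)
 have "(\<Sum>w\<in>pre n y. \<Sum>z\<in>pre m w. exp (-C) * (exp (\<Theta> n w) * exp (\<Theta> m z))) <= (\<Sum>w\<in>pre n y. \<Sum>z\<in>pre m w. exp (\<Theta> (m + n) z))"
 proof (intro sum_mono)
  fix w z assume "z : pre m w"
  thus "exp (-C) * (exp (\<Theta> n w) * exp (\<Theta> m z)) <= exp (\<Theta> (m + n) z)"
   using t[of z w] by (simp flip: exp_add)
 qed
 thus "exp (- C) * (\<Sum>w\<in>pre n y. exp (\<Theta> n w) * Z \<Theta> m w) <= Z \<Theta> (m + n) y"
  unfolding split by (simp add: Z_def sum_distrib_left)
qed

lemma Z_N:
 assumes w: "w : \<Lambda>" shows "exp (- C) <= Z \<Theta> N w" "Z \<Theta> N w <= Q * exp C"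
proof -
 obtain z where z: "z : pre N w" using pre_nonempty[OF w] by auto
 have "exp (- C) <= exp (\<Theta> N z)" using \<Theta>_N[of z] z by (auto simp: pre_def)
 also have "\<dots> <= Z \<Theta> N w" unfolding Z_def by (rule member_le_sum[OF z]) (auto simp: finite_pre)
 finally show "exp (- C) <= Z \<Theta> N w" .
 have "Z \<Theta> N w <= (\<Sum>z\<in>pre N w. exp C)" unfolding Z_def
  by (intro sum_mono) (use \<Theta>_N in \<open>auto simp: pre_def abs_le_iff\<close>)
 also have "\<dots> <= Q * exp C" using Q(2) by (simp add: mult_right_mono)
 finally show "Z \<Theta> N w <= Q * exp C" .
qed

text \<open>Each n-step preimage of y is shadowed by a point that reaches y' after N further steps.
  The correspondence is injective, since two preimages sharing a shadow are 2 \<rho>-close up to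
  time n. The factor collects one C each for variation, additivity and the gap.\<close>

lemma Z_shift:
 assumes n: "n >= 1" and y: "y : \<Lambda>" "y' : \<Lambda>"
 shows "Z \<Theta> n y <= exp (3 * C) * Z \<Theta> (n + N) y'"
proof -
 have "ALL z:\<Lambda>. EX z'. z' : bowen n z \<rho> & (f ^^ (n + N)) z' = y'"
 proof
  fix z assume "z : \<Lambda>"
  from specif[OF this y(2), of n] show "EX z'. z' : bowen n z \<rho> & (f ^^ (n + N)) z' = y'"
   unfolding bowen_def by auto
 qed
 then obtain h where h: "!!z. z : \<Lambda> ==> h z : bowen n z \<rho>" "!!z. z : \<Lambda> ==> (f ^^ (n + N)) (h z) = y'" by metis
 have inj: "inj_on h (pre n y)"
 proof (rule inj_onI)
  fix z1 z2 assume z: "z1 : pre n y" "z2 : pre n y" "h z1 = h z2"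
  have zL: "z1 : \<Lambda>" "z2 : \<Lambda>" "(f ^^ n) z1 = (f ^^ n) z2" using z by (auto simp: pre_def)
  have "z1 : bowen n (h z1) \<rho>" "z2 : bowen n (h z1) \<rho>"
   using bowen_commute[OF zL(1) h(1)[OF zL(1)]] bowen_commute[OF zL(2) h(1)[OF zL(2)]] z(3) by simp_all
  hence "z2 : bowen n z1 (\<rho> + \<rho>)" using bowen_triangle by blast
  hence "D ((f ^^ j) z1) ((f ^^ j) z2) <= \<rho> + \<rho>" if "j < n" for j using that by (simp add: bowen_def)
  hence "D ((f ^^ j) z1) ((f ^^ j) z2) <= 64 * \<rho>" if "j < n" for j using that \<rho>_pos by fastforce
  thus "z1 = z2" using funpow_inject zL by blast
 qed
 have im: "h ` pre n y \<subseteq> pre (n + N) y'" using h by (auto simp: pre_def bowen_def)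
 have "Z \<Theta> n y <= (\<Sum>z\<in>pre n y. exp (3 * C) * exp (\<Theta> (n + N) (h z)))"
  unfolding Z_def
 proof (rule sum_mono)
  fix z assume "z : pre n y"
  hence z: "z : \<Lambda>" by (simp add: pre_def)
  have hz: "h z : \<Lambda>" using h(1)[OF z] by (simp add: bowen_def)
  have "\<bar>\<Theta> n z - \<Theta> n (h z)\<bar> <= C" by (rule \<Theta>_bowen[OF n z h(1)[OF z]]) (use \<rho>_pos in simp)
  moreover have "\<bar>\<Theta> (n + N) (h z) - \<Theta> n (h z) - \<Theta> N ((f ^^ n) (h z))\<bar> <= C" by (rule \<Theta>_add[OF n N_pos hz])
  moreover have "\<bar>\<Theta> N ((f ^^ n) (h z))\<bar> <= C" by (rule \<Theta>_N[OF funpow_mem[OF hz]])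
  ultimately have "\<Theta> n z <= 3 * C + \<Theta> (n + N) (h z)" by linarith
  thus "exp (\<Theta> n z) <= exp (3 * C) * exp (\<Theta> (n + N) (h z))" by (simp flip: exp_add)
 qed
 also have "\<dots> = exp (3 * C) * (\<Sum>u\<in>h ` pre n y. exp (\<Theta> (n + N) u))"
  by (simp add: sum.reindex[OF inj] sum_distrib_left)
 also have "\<dots> <= exp (3 * C) * Z \<Theta> (n + N) y'"
  unfolding Z_def by (intro mult_left_mono sum_mono2 im finite_pre) auto
 finally show ?thesis .
qed

text \<open>Going back from order n + N to order n sums over at most Q gap preimages and costs exp
  (2 C) more, which added to the 3 C of \<open>Z_shift\<close> gives 5 C.\<close>

lemma Z_compare:
 assumes n: "n >= 1" and y: "y : \<Lambda>" "y' : \<Lambda>"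
 shows "Z \<Theta> n y <= Q * exp (5 * C) * Z \<Theta> n y'"
proof -
 have "Z \<Theta> (n + N) y' <= exp C * (\<Sum>w\<in>pre n y'. exp (\<Theta> n w) * Z \<Theta> N w)"
  using Z_add(1)[OF N_pos n] by (simp add: add.commute)
 also have "\<dots> <= exp C * (\<Sum>w\<in>pre n y'. exp (\<Theta> n w) * (Q * exp C))"
  by (intro mult_left_mono sum_mono Z_N) (auto simp: pre_def)
 also have "\<dots> = Q * exp (2 * C) * Z \<Theta> n y'"
 proof -
  have "exp (2 * C) = exp C * exp C" by (simp flip: exp_add)
  thus ?thesis by (simp add: Z_def sum_distrib_left ac_simps)
 qed
 finally have "exp (3 * C) * Z \<Theta> (n + N) y' <= exp (3 * C) * (Q * exp (2 * C) * Z \<Theta> n y')" by simp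
 also have "\<dots> = Q * exp (5 * C) * Z \<Theta> n y'" by (simp add: mult_exp_exp)
 finally show ?thesis using Z_shift[OF n y] by linarith
qed

lemma ln_Z_add:
 assumes m: "m >= 1" and n: "n >= 1" and y: "y : \<Lambda>"
 shows "\<bar>ln (Z \<Theta> (m + n) y) - ln (Z \<Theta> m y) - ln (Z \<Theta> n y)\<bar> <= 6 * C + ln Q"
proof -
 let ?k = "Q * exp (5 * C)"
 have Qp: "Q > 0" using Q(1) by linarith
 have Zw: "Z \<Theta> m w <= ?k * Z \<Theta> m y" "Z \<Theta> m y / ?k <= Z \<Theta> m w" if "w : pre n y" for w
  using Z_compare[OF m, of w y] Z_compare[OF m, of y w] that y Qp by (auto simp: pre_def field_simps)
 note pos = Z_pos[OF y]
 have "Z \<Theta> (m + n) y <= exp C * (\<Sum>w\<in>pre n y. exp (\<Theta> n w) * (?k * Z \<Theta> m y))"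
  by (rule order_trans[OF Z_add(1)[OF m n]]) (intro mult_left_mono sum_mono Zw; simp)
 also have "\<dots> = exp (6 * C) * Q * (Z \<Theta> m y * Z \<Theta> n y)"
 proof -
  have "exp (6 * C) = exp C * exp (5 * C)" by (simp flip: exp_add)
  thus ?thesis by (simp add: Z_def[of _ n] sum_distrib_right flip: sum_distrib_left) (simp add: ac_simps sum_distrib_left)
 qed
 finally have "ln (Z \<Theta> (m + n) y) <= ln (exp (6 * C) * Q * (Z \<Theta> m y * Z \<Theta> n y))" using pos Qp by (subst ln_le_cancel_iff) auto
 hence 1: "ln (Z \<Theta> (m + n) y) <= 6 * C + ln Q + ln (Z \<Theta> m y) + ln (Z \<Theta> n y)"
  using pos Qp by (simp add: ln_mult less_imp_neq[THEN not_sym])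
 have "exp (- (6 * C)) / Q * (Z \<Theta> m y * Z \<Theta> n y) = exp (- C) * (\<Sum>w\<in>pre n y. exp (\<Theta> n w) * (Z \<Theta> m y / ?k))"
 proof -
  have "exp (- (6 * C)) = exp (-C) / exp (5 * C)" by (simp flip: exp_diff)
  thus ?thesis by (simp add: Z_def[of _ n] sum_distrib_right sum_divide_distrib flip: sum_distrib_left) 
    (simp add: ac_simps sum_distrib_left sum_divide_distrib)
 qed
 also have "\<dots> <= Z \<Theta> (m + n) y"
  by (rule order_trans[OF _ Z_add(2)[OF m n]]) (intro mult_left_mono sum_mono Zw; simp)
 finally have "ln (exp (- (6 * C)) / Q * (Z \<Theta> m y * Z \<Theta> n y)) <= ln (Z \<Theta> (m + n) y)" using pos Qp by (subst ln_le_cancel_iff) auto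
 hence 2: "- (6 * C) - ln Q + ln (Z \<Theta> m y) + ln (Z \<Theta> n y) <= ln (Z \<Theta> (m + n) y)"
  using pos Qp by (simp add: ln_mult ln_div less_imp_neq[THEN not_sym])
 show ?thesis using 1 2 by linarith
qed

text \<open>6 C + ln Q for the deviation from linear growth at one base point, and 5 C + ln Q for
  changing the base point, with one C to spare.\<close>

definition c2 :: real where "c2 = 12 * C + 2 * ln Q"

lemma pressure_exists:
 obtains P where "!!n y. n >= 1 ==> y : \<Lambda> ==> exp (- c2 + real n * P) <= Z \<Theta> n y"
  "!!n y. n >= 1 ==> y : \<Lambda> ==> Z \<Theta> n y <= exp (c2 + real n * P)"
proof -
 obtain y0 where y0: "y0 : \<Lambda>" using nonempty by auto
 obtain P where P: "!!n. n >= 1 ==> \<bar>ln (Z \<Theta> n y0) - real n * P\<bar> <= 6 * C + ln Q"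
  using almost_additive_sequence[of "%n. ln (Z \<Theta> n y0)", OF ln_Z_add[OF _ _ y0]] by blast
 have Qp: "Q > 0" using Q(1) by linarith
 have cmp: "ln (Z \<Theta> n y) <= ln Q + 5 * C + ln (Z \<Theta> n y')" if "n >= 1" "y : \<Lambda>" "y' : \<Lambda>" for n y y'
 proof -
  have "ln (Z \<Theta> n y) <= ln (Q * exp (5 * C) * Z \<Theta> n y')"
   using Z_compare[OF that] Z_pos that Qp by (subst ln_le_cancel_iff) auto
  thus ?thesis using Z_pos[OF that(3), of n] Qp by (simp add: ln_mult less_imp_neq[THEN not_sym])
 qed
 have b: "\<bar>ln (Z \<Theta> n y) - real n * P\<bar> <= c2" if "n >= 1" "y : \<Lambda>" for n y
  using P[OF that(1)] cmp[OF that y0] cmp[OF that(1) y0 that(2)] C_nonneg unfolding c2_def by linarith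
 show ?thesis
 proof (rule that[of P])
  fix n y assume a: "n >= (1::nat)" "y : \<Lambda>"
  have e: "Z \<Theta> n y = exp (ln (Z \<Theta> n y))" using Z_pos[OF a(2)] by simp
  show "exp (- c2 + real n * P) <= Z \<Theta> n y" by (subst e, subst exp_le_cancel_iff) (use b[OF a] in linarith)
  show "Z \<Theta> n y <= exp (c2 + real n * P)" by (subst e, subst exp_le_cancel_iff) (use b[OF a] in linarith)
 qed
qed

end

end

section \<open>Gibbs measures\<close>

context expanding_map
begin

lemma continuous_D_funpow: "x : \<Lambda> ==> continuous_on \<Lambda> (%y. D ((f ^^ j) x) ((f ^^ j) y))"
 by (rule continuous_on_compose2[OF continuous_D continuous_funpow]) (auto simp: funpow_mem funpow_image)

lemma closed_bowen: "x : \<Lambda> ==> closed (bowen n x r)"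
proof -
 assume x: "x : \<Lambda>"
 have "closed (\<Inter>j\<in>{..n}. \<Lambda> \<inter> (%y. D ((f ^^ j) x) ((f ^^ j) y)) -` {..r})"
  by (intro closed_INT ballI continuous_closed_preimage continuous_D_funpow closed_\<Lambda> x) auto
 moreover have "bowen n x r = (\<Inter>j\<in>{..n}. \<Lambda> \<inter> (%y. D ((f ^^ j) x) ((f ^^ j) y)) -` {..r})"
  by (auto simp: bowen_def)
 ultimately show ?thesis by simp
qed

lemma sets_bowen: "x : \<Lambda> ==> bowen n x r : sets borel\<Lambda>"
proof -
 assume "x : \<Lambda>"
 hence "bowen n x r \<inter> \<Lambda> : sets borel\<Lambda>" by (intro sets_borel\<Lambda>_Int borel_closed closed_bowen)
 moreover have "bowen n x r \<inter> \<Lambda> = bowen n x r" by (auto simp: bowen_def)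
 ultimately show ?thesis by simp
qed

text \<open>The requirement 5 C + 3 c2 + |N P| of the lower Gibbs estimate, with |N P| replaced by
  its bound c2 + C + ln Q. The upper estimate needs less.\<close>

definition K :: "real => real" where "K C = 54 * C + 9 * ln Q"

context
 fixes C :: real and \<Theta> :: "nat => 'm => real" and P :: real
 assumes tame: "tame C \<Theta>"
  and Z_lower: "!!n y. n >= 1 ==> y : \<Lambda> ==> exp (- c2 C + real n * P) <= Z \<Theta> n y"
  and Z_upper: "!!n y. n >= 1 ==> y : \<Lambda> ==> Z \<Theta> n y <= exp (c2 C + real n * P)"
begin

text \<open>The m-th iterate is injective on the preimages in question, because two points of a ball
  of radius 32 \<rho> are within 64 \<rho> up to time m. Hence they inject into the l-step preimages
  of y.\<close>

lemma sum_bowen_upper: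
 assumes m: "m >= 1" and l: "l >= 1" and x: "x : \<Lambda>" and y: "y : \<Lambda>"
 shows "(\<Sum>u\<in>pre (m + l) y \<inter> bowen m x (32 * \<rho>). exp (\<Theta> (m + l) u)) <= exp (\<Theta> m x + 2 * C) * Z \<Theta> l y"
proof -
 let ?S = "pre (m + l) y \<inter> bowen m x (32 * \<rho>)"
 have inj: "inj_on (f ^^ m) ?S"
 proof (rule inj_onI)
  fix u v assume uv: "u : ?S" "v : ?S" "(f ^^ m) u = (f ^^ m) v"
  hence "v : bowen m u (32 * \<rho> + 32 * \<rho>)" using bowen_triangle by blast
  hence "D ((f ^^ j) u) ((f ^^ j) v) <= 64 * \<rho>" if "j < m" for j using that by (simp add: bowen_def)
  thus "u = v" using uv funpow_inject[of u v m] by (auto simp: pre_def)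
 qed
 have im: "(f ^^ m) ` ?S \<subseteq> pre l y"
  by (auto simp: pre_def funpow_mem) (metis add.commute comp_apply funpow_add)
 have "(\<Sum>u\<in>?S. exp (\<Theta> (m + l) u)) <= (\<Sum>u\<in>?S. exp (\<Theta> m x + 2 * C) * exp (\<Theta> l ((f ^^ m) u)))"
 proof (rule sum_mono)
  fix u assume u: "u : ?S"
  hence uL: "u : \<Lambda>" by (simp add: pre_def)
  have "\<bar>\<Theta> (m + l) u - \<Theta> m u - \<Theta> l ((f ^^ m) u)\<bar> <= C" by (rule \<Theta>_add[OF tame m l uL])
  moreover have "\<bar>\<Theta> m x - \<Theta> m u\<bar> <= C" by (rule \<Theta>_bowen[OF tame m x, of u "32 * \<rho>"]) (use u \<rho>_pos in auto)
  ultimately have "\<Theta> (m + l) u <= \<Theta> m x + 2 * C + \<Theta> l ((f ^^ m) u)" by linarith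
  thus "exp (\<Theta> (m + l) u) <= exp (\<Theta> m x + 2 * C) * exp (\<Theta> l ((f ^^ m) u))" by (simp flip: exp_add)
 qed
 also have "\<dots> = exp (\<Theta> m x + 2 * C) * (\<Sum>w\<in>(f ^^ m) ` ?S. exp (\<Theta> l w))"
  by (simp add: sum.reindex[OF inj] sum_distrib_left)
 also have "\<dots> <= exp (\<Theta> m x + 2 * C) * Z \<Theta> l y"
  unfolding Z_def by (intro mult_left_mono sum_mono2 im finite_pre) auto
 finally show ?thesis .
qed

text \<open>Specification places above every l-step preimage w of y a point of the small ball that
  reaches w after m + N steps. The 4 C are two uses of additivity, the gap and the
  variation.\<close>

lemma sum_bowen_lower:
 assumes m: "m >= 1" and l: "l >= 1" and x: "x : \<Lambda>" and y: "y : \<Lambda>"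
 shows "exp (\<Theta> m x - 4 * C) * Z \<Theta> l y <= (\<Sum>u\<in>pre (m + N + l) y \<inter> bowen m x \<rho>. exp (\<Theta> (m + N + l) u))"
proof -
 let ?S = "pre (m + N + l) y \<inter> bowen m x \<rho>"
 have "ALL w:\<Lambda>. EX u. u : bowen m x \<rho> & (f ^^ (m + N)) u = w"
 proof
  fix w assume "w : \<Lambda>"
  from specif[OF x this, of m] show "EX u. u : bowen m x \<rho> & (f ^^ (m + N)) u = w"
   unfolding bowen_def by auto
 qed
 then obtain h where h: "!!w. w : \<Lambda> ==> h w : bowen m x \<rho>" "!!w. w : \<Lambda> ==> (f ^^ (m + N)) (h w) = w" by metis
 have inj: "inj_on h (pre l y)"
  by (rule inj_on_inverseI[of _ "f ^^ (m + N)"]) (use h in \<open>auto simp: pre_def\<close>)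
 have im: "h ` pre l y \<subseteq> ?S"
 proof
  fix u assume "u : h ` pre l y"
  then obtain w where w: "w : \<Lambda>" "(f ^^ l) w = y" "u = h w" by (auto simp: pre_def)
  have "(f ^^ (m + N + l)) u = (f ^^ l) ((f ^^ (m + N)) u)" by (simp add: add.commute[of "m + N"] funpow_add)
  thus "u : ?S" using w h by (auto simp: pre_def bowen_def)
 qed
 have "exp (\<Theta> m x - 4 * C) * Z \<Theta> l y = (\<Sum>w\<in>pre l y. exp (\<Theta> m x - 4 * C) * exp (\<Theta> l w))"
  by (simp add: Z_def sum_distrib_left)
 also have "\<dots> <= (\<Sum>w\<in>pre l y. exp (\<Theta> (m + N + l) (h w)))"
 proof (rule sum_mono)
  fix w assume "w : pre l y"
  hence w: "w : \<Lambda>" by (simp add: pre_def)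
  let ?u = "h w"
  have u: "?u : \<Lambda>" using h(1)[OF w] by (simp add: bowen_def)
  have "\<bar>\<Theta> (m + (N + l)) ?u - \<Theta> m ?u - \<Theta> (N + l) ((f ^^ m) ?u)\<bar> <= C" by (rule \<Theta>_add[OF tame m _ u]) (use l in simp)
  moreover have "\<bar>\<Theta> (N + l) ((f ^^ m) ?u) - \<Theta> N ((f ^^ m) ?u) - \<Theta> l ((f ^^ N) ((f ^^ m) ?u))\<bar> <= C"
   by (rule \<Theta>_add[OF tame N_pos l funpow_mem[OF u]])
  moreover have "(f ^^ N) ((f ^^ m) ?u) = w" using h(2)[OF w] by (simp add: add.commute[of m] funpow_add)
  moreover have "\<bar>\<Theta> N ((f ^^ m) ?u)\<bar> <= C" by (rule \<Theta>_N[OF tame funpow_mem[OF u]])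
  moreover have "\<bar>\<Theta> m x - \<Theta> m ?u\<bar> <= C" by (rule \<Theta>_bowen[OF tame m x h(1)[OF w]]) (use \<rho>_pos in simp)
  ultimately have "\<Theta> m x - 4 * C + \<Theta> l w <= \<Theta> (m + N + l) ?u" by (simp add: add.assoc)
  thus "exp (\<Theta> m x - 4 * C) * exp (\<Theta> l w) <= exp (\<Theta> (m + N + l) ?u)" by (simp flip: exp_add)
 qed
 also have "\<dots> = (\<Sum>u\<in>h ` pre l y. exp (\<Theta> (m + N + l) u))" by (simp add: sum.reindex[OF inj])
 also have "\<dots> <= (\<Sum>u\<in>?S. exp (\<Theta> (m + N + l) u))" by (intro sum_mono2 im) (auto simp: finite_pre)
 finally show ?thesis .
qed

text \<open>Summing over the k-step preimages of a fixed w multiplies its weight by about exp (k P),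
  whatever w is. So all images under k steps have comparable normalized weights.\<close>

lemma sum_pre_transfer:
 fixes B :: "'m set"
 assumes k: "k >= 1" and l: "l >= 1" and y: "y : \<Lambda>"
 defines "T \<equiv> (\<Sum>z\<in>{z:pre (k + l) y. (f ^^ k) z : B}. exp (\<Theta> (k + l) z))"
  and "U \<equiv> (\<Sum>u\<in>pre l y \<inter> B. exp (\<Theta> l u))"
 shows "T <= exp (C + c2 C + real k * P) * U" and "exp (- C - c2 C + real k * P) * U <= T"
proof -
 have split: "T = (\<Sum>w\<in>pre l y \<inter> B. \<Sum>z\<in>pre k w. exp (\<Theta> (k + l) z))"
  unfolding T_def by (rule sum_pre_add)
 have t: "\<bar>\<Theta> (k + l) z - (\<Theta> k z + \<Theta> l w)\<bar> <= C" if "z : pre k w" for z w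
  using \<Theta>_add[OF tame k l, of z] that by (auto simp: pre_def)
 have "T <= (\<Sum>w\<in>pre l y \<inter> B. exp C * exp (\<Theta> l w) * exp (c2 C + real k * P))"
  unfolding split
 proof (rule sum_mono)
  fix w assume w: "w : pre l y \<inter> B"
  have "(\<Sum>z\<in>pre k w. exp (\<Theta> (k + l) z)) <= (\<Sum>z\<in>pre k w. exp C * exp (\<Theta> l w) * exp (\<Theta> k z))"
  proof (rule sum_mono)
   fix z assume "z : pre k w"
   thus "exp (\<Theta> (k + l) z) <= exp C * exp (\<Theta> l w) * exp (\<Theta> k z)" using t[of z w] by (simp flip: exp_add)
  qed
  also have "\<dots> = exp C * exp (\<Theta> l w) * Z \<Theta> k w" by (simp add: Z_def sum_distrib_left)
  also have "\<dots> <= exp C * exp (\<Theta> l w) * exp (c2 C + real k * P)"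
   using w by (intro mult_left_mono Z_upper[OF k]) (auto simp: pre_def)
  finally show "(\<Sum>z\<in>pre k w. exp (\<Theta> (k + l) z)) <= exp C * exp (\<Theta> l w) * exp (c2 C + real k * P)" .
 qed
 also have "\<dots> = exp (C + c2 C + real k * P) * U"
  unfolding U_def sum_distrib_left by (intro sum.cong refl) (simp add: mult_exp_exp ac_simps)
 finally show "T <= exp (C + c2 C + real k * P) * U" .
 have "exp (- C - c2 C + real k * P) * U = (\<Sum>w\<in>pre l y \<inter> B. exp (- C) * exp (\<Theta> l w) * exp (- c2 C + real k * P))"
  unfolding U_def sum_distrib_left by (intro sum.cong refl) (simp add: mult_exp_exp algebra_simps)
 also have "\<dots> <= T"
  unfolding split
 proof (rule sum_mono)
  fix w assume w: "w : pre l y \<inter> B"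
  have "exp (- C) * exp (\<Theta> l w) * exp (- c2 C + real k * P) <= exp (- C) * exp (\<Theta> l w) * Z \<Theta> k w"
   using w by (intro mult_left_mono Z_lower[OF k]) (auto simp: pre_def)
  also have "\<dots> = (\<Sum>z\<in>pre k w. exp (- C) * exp (\<Theta> l w) * exp (\<Theta> k z))" by (simp add: Z_def sum_distrib_left)
  also have "\<dots> <= (\<Sum>z\<in>pre k w. exp (\<Theta> (k + l) z))"
  proof (rule sum_mono)
   fix z assume "z : pre k w"
   thus "exp (- C) * exp (\<Theta> l w) * exp (\<Theta> k z) <= exp (\<Theta> (k + l) z)" using t[of z w] by (simp flip: exp_add)
  qed
  finally show "exp (- C) * exp (\<Theta> l w) * exp (- c2 C + real k * P) <= (\<Sum>z\<in>pre k w. exp (\<Theta> (k + l) z))" .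
 qed
 finally show "exp (- C - c2 C + real k * P) * U <= T" .
qed

lemma NP_bound: "\<bar>real N * P\<bar> <= c2 C + C + ln Q"
proof -
 obtain y where y: "y : \<Lambda>" using nonempty by auto
 have Qp: "Q > 0" using Q(1) by linarith
 have "exp (- c2 C + real N * P) <= Q * exp C" using Z_lower[OF N_pos y] Z_N[OF tame y] by linarith
 also have "\<dots> = exp (ln Q + C)" using Qp by (simp add: exp_add)
 finally have 1: "real N * P <= c2 C + C + ln Q" by simp
 have "exp (- C) <= exp (c2 C + real N * P)" using Z_upper[OF N_pos y] Z_N[OF tame y] by linarith
 hence "- (c2 C + C) <= real N * P" by simp
 moreover have "ln Q >= 0" using Q(1) by simp
 ultimately show ?thesis using 1 by linarith
qed

text \<open>The weights live on preimages of order 2 n, while images are taken only for k = 1..n: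
  the remaining order l = 2 n - k is at least n, enough to see a Bowen ball of order m plus a gap.
  Averaging over k makes the invariance defect telescope to two terms of total weight 1 / n.\<close>

lemma atomic_gibbs:
 assumes n: "n >= 1"
 obtains \<mu> where "prob_space \<mu>" "sets \<mu> = sets borel\<Lambda>"
  "!!m x. 1 <= m ==> m + N < n ==> x : \<Lambda> ==> exp (\<Theta> m x - real m * P - K C) <= measure \<mu> (bowen m x \<rho>)"
  "!!m x. 1 <= m ==> m + N < n ==> x : \<Lambda> ==> measure \<mu> (bowen m x (32 * \<rho>)) <= exp (\<Theta> m x - real m * P + K C)"
  "!!g B. continuous_on \<Lambda> g ==> (!!x. x : \<Lambda> ==> \<bar>g x\<bar> <= B) ==>
   \<bar>(\<integral>x. g (f x) \<partial>\<mu>) - (\<integral>x. g x \<partial>\<mu>)\<bar> <= 2 * B / real n"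
proof -
 obtain y where y: "y : \<Lambda>" using nonempty by auto
 define Zn where "Zn = Z \<Theta> (2 * n) y"
 have Zn: "Zn > 0" unfolding Zn_def by (rule Z_pos[OF tame y])
 have n2: "2 * n >= 1" using n by simp
 \<comment> \<open>Times and preimages are treated as one finite weighted space that h maps to
   \<Lambda>, so that integrals become double sums.\<close>
 define A where "A = {1..n} \<times> pre (2 * n) y"
 have finA: "finite A" unfolding A_def using finite_pre by auto
 define w where "w kz = exp (\<Theta> (2 * n) (snd kz)) / (real n * Zn)" for kz :: "nat \<times> 'm"
 have w0: "0 <= w kz" for kz unfolding w_def using Zn by simp
 define S where "S = point_measure A w"
 define h where "h kz = (f ^^ fst kz) (snd kz)" for kz :: "nat \<times> 'm"
 have hL: "h kz : \<Lambda>" if "kz : A" for kz using that unfolding h_def A_def by (auto simp: pre_def funpow_mem)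
 have hm: "h : S \<rightarrow>\<^sub>M borel\<Lambda>" unfolding S_def point_measure_def using hL by (simp add: measurable_density_eq1 Pi_iff)
 define \<mu> where "\<mu> = distr S borel\<Lambda> h"
 have int: "integral\<^sup>L \<mu> g = (\<Sum>k=1..n. \<Sum>z\<in>pre (2*n) y. exp (\<Theta> (2*n) z) / (real n * Zn) * g ((f ^^ k) z))"
  if "g : borel_measurable borel\<Lambda>" for g :: "'m => real"
 proof -
  have "integral\<^sup>L \<mu> g = integral\<^sup>L S (%kz. g (h kz))" unfolding \<mu>_def by (rule integral_distr[OF hm that])
  also have "\<dots> = (\<Sum>kz\<in>A. w kz * g (h kz))" unfolding S_def
   using lebesgue_integral_point_measure_finite[OF finA, of w "%kz. g (h kz)"] w0 by simp
  also have "\<dots> = (\<Sum>k=1..n. \<Sum>z\<in>pre (2*n) y. exp (\<Theta> (2*n) z) / (real n * Zn) * g ((f ^^ k) z))"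
   unfolding A_def by (subst sum.cartesian_product) (simp add: w_def h_def split_beta)
  finally show ?thesis .
 qed
 have tot: "(\<Sum>z\<in>pre (2*n) y. exp (\<Theta> (2*n) z) / (real n * Zn)) = 1 / real n"
  using Zn unfolding Zn_def by (simp add: Z_def flip: sum_divide_distrib)
 have prob: "prob_space \<mu>"
 proof
  have "(\<Sum>kz\<in>A. w kz) = 1"
  proof -
   have "(\<Sum>kz\<in>A. w kz) = (\<Sum>k=1..n. \<Sum>z\<in>pre (2*n) y. exp (\<Theta> (2*n) z) / (real n * Zn))"
    unfolding A_def by (subst sum.cartesian_product) (simp add: w_def split_beta)
   thus ?thesis unfolding tot using n by simp
  qed
  moreover have "emeasure \<mu> (space \<mu>) = emeasure S (space S)"
  proof -
   have "h -` space borel\<Lambda> \<inter> space S = space S" using measurable_space[OF hm] by blast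
   thus ?thesis unfolding \<mu>_def space_distr using emeasure_distr[OF hm sets.top] by simp
  qed
  moreover have "emeasure S (space S) = ennreal (\<Sum>kz\<in>A. w kz)"
   unfolding S_def using finA w0 by (simp add: space_point_measure emeasure_point_measure_finite sum_ennreal)
  ultimately show "emeasure \<mu> (space \<mu>) = 1" by simp
 qed
 interpret prob_space \<mu> by (rule prob)
 have sets: "sets \<mu> = sets borel\<Lambda>" by (simp add: \<mu>_def)
 have meas: "measure \<mu> B = (\<Sum>k=1..n. (\<Sum>z\<in>{z:pre (2*n) y. (f ^^ k) z : B}. exp (\<Theta> (2*n) z)) / (real n * Zn))"
  if "B : sets borel\<Lambda>" for B
 proof -
  have Bs: "B : sets \<mu>" using that sets by simp
  have "measure \<mu> B = integral\<^sup>L \<mu> (indicator B)"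
   using Bs by (simp add: sets.sets_into_space inf_absorb1)
  also have "\<dots> = (\<Sum>k=1..n. \<Sum>z\<in>pre (2*n) y. exp (\<Theta> (2*n) z) / (real n * Zn) * indicator B ((f ^^ k) z))"
   by (rule int) (use that in simp)
  also have "\<dots> = (\<Sum>k=1..n. (\<Sum>z\<in>{z:pre (2*n) y. (f ^^ k) z : B}. exp (\<Theta> (2*n) z)) / (real n * Zn))"
   unfolding sum_divide_distrib
   by (intro sum.cong refl sum.mono_neutral_cong_right) (auto simp: finite_pre indicator_def)
  finally show ?thesis .
 qed
 have Zl: "exp (- c2 C + real (2*n) * P) <= Zn" and Zu: "Zn <= exp (c2 C + real (2*n) * P)"
  unfolding Zn_def using Z_lower[OF n2 y] Z_upper[OF n2 y] .
 have Cnn: "C >= 0" by (rule C_nonneg[OF tame])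
 have Kge: "C + c2 C + 2 * C + c2 C + c2 C <= K C" "5 * C + 3 * c2 C + \<bar>real N * P\<bar> <= K C"
  using NP_bound Cnn ln_ge_zero[OF Q(1)] unfolding K_def c2_def[OF tame] by auto
 have avg_le: "(\<Sum>k=1..n. a k / (real n * Zn)) <= b" if "!!k. k : {1..n} ==> a k <= b * Zn" for a b
 proof -
  have "(\<Sum>k=1..n. a k / (real n * Zn)) <= (\<Sum>k=1..n. b * Zn / (real n * Zn))"
   using that Zn n by (intro sum_mono divide_right_mono) auto
  thus ?thesis using Zn n by simp
 qed
 have avg_ge: "b <= (\<Sum>k=1..n. a k / (real n * Zn))" if "!!k. k : {1..n} ==> b * Zn <= a k" for a b
 proof -
  have "(\<Sum>k=1..n. b * Zn / (real n * Zn)) <= (\<Sum>k=1..n. a k / (real n * Zn))"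
   using that Zn n by (intro sum_mono divide_right_mono) auto
  thus ?thesis using Zn n by simp
 qed
 show ?thesis
 proof (rule that[OF prob sets])
  fix m x assume mx: "1 <= m" "m + N < n" "x : \<Lambda>"
  show "measure \<mu> (bowen m x (32 * \<rho>)) <= exp (\<Theta> m x - real m * P + K C)"
   unfolding meas[OF sets_bowen[OF mx(3)]]
  proof (rule avg_le)
   fix k assume k: "k : {1..n}"
   define l where "l = 2 * n - k"
   define l' where "l' = l - m"
   have kl: "2 * n = k + l" "l = m + l'" "l' >= 1" "l >= 1" "k >= 1" using k mx by (auto simp: l_def l'_def)
   have "(\<Sum>z\<in>{z:pre (2*n) y. (f ^^ k) z : bowen m x (32 * \<rho>)}. exp (\<Theta> (2*n) z))
     <= exp (C + c2 C + real k * P) * (\<Sum>u\<in>pre l y \<inter> bowen m x (32 * \<rho>). exp (\<Theta> l u))"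
    unfolding kl(1) by (rule sum_pre_transfer(1)[OF kl(5,4) y])
   also have "\<dots> <= exp (C + c2 C + real k * P) * (exp (\<Theta> m x + 2 * C) * Z \<Theta> l' y)"
    unfolding kl(2) by (intro mult_left_mono sum_bowen_upper mx kl y) auto
   also have "\<dots> <= exp (C + c2 C + real k * P) * (exp (\<Theta> m x + 2 * C) * exp (c2 C + real l' * P))"
    by (intro mult_left_mono Z_upper kl y) auto
   also have "\<dots> <= exp (\<Theta> m x - real m * P + K C) * exp (- c2 C + real (2 * n) * P)"
    unfolding mult_exp_exp exp_le_cancel_iff using Kge(1) kl(1,2) by (simp add: algebra_simps)
   also have "\<dots> <= exp (\<Theta> m x - real m * P + K C) * Zn" by (intro mult_left_mono Zl) auto
   finally show "(\<Sum>z\<in>{z:pre (2*n) y. (f ^^ k) z : bowen m x (32 * \<rho>)}. exp (\<Theta> (2*n) z))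
     <= exp (\<Theta> m x - real m * P + K C) * Zn" .
  qed
  show "exp (\<Theta> m x - real m * P - K C) <= measure \<mu> (bowen m x \<rho>)"
   unfolding meas[OF sets_bowen[OF mx(3)]]
  proof (rule avg_ge)
   fix k assume k: "k : {1..n}"
   define l where "l = 2 * n - k"
   define l' where "l' = l - m - N"
   have kl: "2 * n = k + l" "l = m + N + l'" "l' >= 1" "l >= 1" "k >= 1" using k mx by (auto simp: l_def l'_def)
   have "exp (\<Theta> m x - real m * P - K C) * Zn <= exp (\<Theta> m x - real m * P - K C) * exp (c2 C + real (2 * n) * P)"
    by (intro mult_left_mono Zu) auto
   also have "\<dots> <= exp (- C - c2 C + real k * P) * (exp (\<Theta> m x - 4 * C) * exp (- c2 C + real l' * P))"
    unfolding mult_exp_exp exp_le_cancel_iff using Kge(2) kl(1,2) by (simp add: algebra_simps)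
   also have "\<dots> <= exp (- C - c2 C + real k * P) * (exp (\<Theta> m x - 4 * C) * Z \<Theta> l' y)"
    by (intro mult_left_mono Z_lower kl y) auto
   also have "\<dots> <= exp (- C - c2 C + real k * P) * (\<Sum>u\<in>pre l y \<inter> bowen m x \<rho>. exp (\<Theta> l u))"
    unfolding kl(2) by (intro mult_left_mono sum_bowen_lower mx kl y) auto
   also have "\<dots> <= (\<Sum>z\<in>{z:pre (2*n) y. (f ^^ k) z : bowen m x \<rho>}. exp (\<Theta> (2*n) z))"
    unfolding kl(1) by (rule sum_pre_transfer(2)[OF kl(5,4) y])
   finally show "exp (\<Theta> m x - real m * P - K C) * Zn <= (\<Sum>z\<in>{z:pre (2*n) y. (f ^^ k) z : bowen m x \<rho>}. exp (\<Theta> (2*n) z))" .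
  qed
 next
  fix g B assume g: "continuous_on \<Lambda> g" "!!x. x : \<Lambda> ==> \<bar>g x\<bar> <= (B::real)"
  have gf: "continuous_on \<Lambda> (%x. g (f x))"
   by (rule continuous_on_compose2[OF g(1) continuous_f]) (simp add: f_image)
  have "(\<integral>x. g (f x) \<partial>\<mu>) - (\<integral>x. g x \<partial>\<mu>) = (\<Sum>k=1..n. \<Sum>z\<in>pre (2*n) y. exp (\<Theta> (2*n) z) / (real n * Zn) * (g ((f ^^ Suc k) z) - g ((f ^^ k) z)))"
   by (subst int[OF borel_measurable_continuous[OF g(1)]], subst int[OF borel_measurable_continuous[OF gf]])
     (simp add: sum_subtractf right_diff_distrib)
  also have "\<dots> = (\<Sum>z\<in>pre (2*n) y. exp (\<Theta> (2*n) z) / (real n * Zn) * (\<Sum>k=1..n. g ((f ^^ Suc k) z) - g ((f ^^ k) z)))"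
   by (subst sum.swap) (simp only: sum_distrib_left)
  also have "\<dots> = (\<Sum>z\<in>pre (2*n) y. exp (\<Theta> (2*n) z) / (real n * Zn) * (g ((f ^^ Suc n) z) - g ((f ^^ 1) z)))"
  proof (intro sum.cong refl arg_cong2[where f="(*)"])
   fix z
   have "(\<Sum>k=1..n. g ((f ^^ Suc k) z) - g ((f ^^ k) z)) = g ((f ^^ Suc n) z) - g ((f ^^ 1) z)"
    using n by (induction n rule: dec_induct) auto
   thus "(\<Sum>k=1..n. g ((f ^^ Suc k) z) - g ((f ^^ k) z)) = g ((f ^^ Suc n) z) - g ((f ^^ 1) z)" .
  qed
  finally have e: "(\<integral>x. g (f x) \<partial>\<mu>) - (\<integral>x. g x \<partial>\<mu>) = (\<Sum>z\<in>pre (2*n) y. exp (\<Theta> (2*n) z) / (real n * Zn) * (g ((f ^^ Suc n) z) - g ((f ^^ 1) z)))" .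
  have "\<bar>(\<integral>x. g (f x) \<partial>\<mu>) - (\<integral>x. g x \<partial>\<mu>)\<bar> <= (\<Sum>z\<in>pre (2*n) y. exp (\<Theta> (2*n) z) / (real n * Zn) * (2 * B))"
   unfolding e
  proof (rule order_trans[OF sum_abs sum_mono])
   fix z assume "z : pre (2*n) y"
   hence "z : \<Lambda>" by (simp add: pre_def)
   hence "\<bar>g ((f ^^ Suc n) z)\<bar> <= B" "\<bar>g ((f ^^ 1) z)\<bar> <= B" using g(2) funpow_mem by blast+
   hence "\<bar>g ((f ^^ Suc n) z) - g ((f ^^ 1) z)\<bar> <= 2 * B" by linarith
   hence "exp (\<Theta> (2*n) z) / (real n * Zn) * \<bar>g ((f ^^ Suc n) z) - g ((f ^^ 1) z)\<bar> <= exp (\<Theta> (2*n) z) / (real n * Zn) * (2 * B)"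
    using Zn by (intro mult_left_mono) auto
   thus "\<bar>exp (\<Theta> (2*n) z) / (real n * Zn) * (g ((f ^^ Suc n) z) - g ((f ^^ 1) z))\<bar> <= exp (\<Theta> (2*n) z) / (real n * Zn) * (2 * B)"
    using Zn by (simp only: abs_mult) simp
  qed
  also have "\<dots> = 2 * B / real n" by (subst sum_distrib_right[symmetric]) (simp add: tot)
  finally show "\<bar>(\<integral>x. g (f x) \<partial>\<mu>) - (\<integral>x. g x \<partial>\<mu>)\<bar> <= 2 * B / real n" .
 qed
qed

end

end

section \<open>Continuous test functions and identification of measures\<close>

definition clamp01 :: "real => real" where "clamp01 u = max 0 (min 1 u)"

lemma clamp01_bounds: "0 <= clamp01 u" "clamp01 u <= 1"
 and clamp01_ge1: "1 <= u ==> clamp01 u = 1" and clamp01_le0: "u <= 0 ==> clamp01 u = 0"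
 by (auto simp: clamp01_def)

lemma continuous_clamp01: "continuous_on S g ==> continuous_on S (%x. clamp01 (g x))"
 unfolding clamp01_def by (intro continuous_intros)

context compact_metrized
begin

lemma integrable_continuous:
 fixes g :: "'m => real"
 assumes "prob_space \<mu>" "sets \<mu> = sets borel\<Lambda>" "continuous_on \<Lambda> g"
 shows "integrable \<mu> g"
proof -
 interpret prob_space \<mu> by fact
 obtain B where "!!x. x : \<Lambda> ==> \<bar>g x\<bar> <= B" using continuous_boundedE[OF assms(3)] by metis
 moreover have "space \<mu> = \<Lambda>" using sets_eq_imp_space_eq[OF assms(2)] by simp
 moreover have "g : borel_measurable \<mu>"
  using borel_measurable_continuous[OF assms(3)] measurable_cong_sets[OF assms(2) refl] by blast
 ultimately show ?thesis by (intro integrable_const_bound[of _ B]) auto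
qed

lemma measure_sandwich:
 fixes g :: "'m => real"
 assumes \<mu>: "prob_space \<mu>" "sets \<mu> = sets borel\<Lambda>" and g: "continuous_on \<Lambda> g"
  and A: "A : sets borel\<Lambda>"
 shows "(!!x. x : \<Lambda> ==> 0 <= g x) ==> (!!x. x : A ==> 1 <= g x) ==> measure \<mu> A <= integral\<^sup>L \<mu> g"
  and "(!!x. x : \<Lambda> ==> g x <= 1) ==> (!!x. x : \<Lambda> - A ==> g x <= 0) ==> integral\<^sup>L \<mu> g <= measure \<mu> A"
proof -
 interpret prob_space \<mu> by fact
 have sp: "space \<mu> = \<Lambda>" using sets_eq_imp_space_eq[OF \<mu>(2)] by simp
 have As: "A : sets \<mu>" using A \<mu> by simp
 have ind: "measure \<mu> A = integral\<^sup>L \<mu> (indicator A)" using As by (simp add: sets.sets_into_space inf_absorb1)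
 have ii: "integrable \<mu> (indicator A :: 'm => real)" using As by (intro integrable_const_bound[of _ 1]) auto
 note ig = integrable_continuous[OF \<mu> g]
 have AL: "A \<subseteq> \<Lambda>" using sets.sets_into_space[OF As] sp by simp
 show "measure \<mu> A <= integral\<^sup>L \<mu> g" if "!!x. x : \<Lambda> ==> 0 <= g x" "!!x. x : A ==> 1 <= g x"
  unfolding ind by (rule integral_mono[OF ii ig]) (use that sp in \<open>auto simp: indicator_def\<close>)
 show "integral\<^sup>L \<mu> g <= measure \<mu> A" if "!!x. x : \<Lambda> ==> g x <= 1" "!!x. x : \<Lambda> - A ==> g x <= 0"
  unfolding ind by (rule integral_mono[OF ig ii]) (use that sp in \<open>auto simp: indicator_def\<close>)
qed

text \<open>A compact K exhausts A from inside for \<mu>, and a neighbourhood of K has nearly the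
  \<nu>-measure of K. A continuous function between the two indicators transfers the
  comparison.\<close>

lemma measure_le_of_integrals:
 assumes \<mu>: "prob_space \<mu>" "sets \<mu> = sets borel\<Lambda>" and \<nu>: "prob_space \<nu>" "sets \<nu> = sets borel\<Lambda>"
  and eq: "!!g :: 'm => real. continuous_on \<Lambda> g ==> integral\<^sup>L \<mu> g = integral\<^sup>L \<nu> g"
  and A: "A : sets borel\<Lambda>"
 shows "measure \<mu> A <= measure \<nu> A"
proof (rule field_le_epsilon)
 fix e :: real assume e: "e > 0"
 interpret \<mu>: prob_space \<mu> by fact
 interpret \<nu>: prob_space \<nu> by fact
 have sp: "space \<mu> = \<Lambda>" using sets_eq_imp_space_eq[OF \<mu>(2)] by simp
 obtain K where K: "compact K" "K \<subseteq> A" "measure \<mu> (A - K) < e / 2"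
  using regular[of \<mu> A "e/2"] \<mu> A e \<mu>.finite_measure_axioms by auto
 have AL: "A \<subseteq> \<Lambda>" using sets.sets_into_space[OF A] by simp
 have KL: "K \<subseteq> \<Lambda>" using K AL by simp
 obtain r where r: "r > 0" "measure \<nu> (nbhd K r - K) < e / 2"
  using measure_nbhd_tendsto[OF \<nu>.finite_measure_axioms \<nu>(2) K(1) KL, of "e/2"] e by auto
 have "ALL x:\<Lambda>. EX U. open U & (ALL y:\<Lambda>. y : U \<longleftrightarrow> D x y < r / 2)" using open_D_ball by metis
 then obtain U where U: "!!x. x : \<Lambda> ==> open (U x)" "!!x y. x : \<Lambda> ==> y : \<Lambda> ==> y : U x \<longleftrightarrow> D x y < r / 2"
  by metis
 have "K \<subseteq> (\<Union>x\<in>K. U x)"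
 proof
  fix x assume "x : K"
  thus "x : (\<Union>x\<in>K. U x)" using U(2)[of x x] r KL by auto
 qed
 then obtain F where F: "F \<subseteq> K" "finite F" "K \<subseteq> (\<Union>x\<in>F. U x)"
  using compactE_image[OF K(1), of K U] U(1) KL by blast
 \<comment> \<open>A Urysohn function for K made of finitely many single-point distances: some
   factor vanishes on K, and all factors equal 1 off the r-neighbourhood.\<close>
 define g where "g y = 1 - (\<Prod>x\<in>F. 1 - clamp01 (2 - D x y * (2 / r)))" for y
 have fac: "0 <= 1 - clamp01 (2 - D x y * (2 / r))" "1 - clamp01 (2 - D x y * (2 / r)) <= 1" for x y
  using clamp01_bounds[of "2 - D x y * (2 / r)"] by auto
 have pr: "0 <= (\<Prod>x\<in>F. 1 - clamp01 (2 - D x y * (2 / r)))" "(\<Prod>x\<in>F. 1 - clamp01 (2 - D x y * (2 / r))) <= 1" for y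
  using fac by (auto intro!: prod_nonneg prod_le_1)
 have gc: "continuous_on \<Lambda> g" unfolding g_def
  by (intro continuous_intros continuous_on_prod continuous_clamp01 continuous_D) (use F KL in auto)
 have g1: "1 <= g y" if y: "y : K" for y
 proof -
  obtain x where x: "x : F" "D x y < r / 2" using F y U(2) KL by blast
  have "2 - D x y * (2 / r) >= 1" using x r by (simp add: field_simps)
  hence "(\<Prod>x\<in>F. 1 - clamp01 (2 - D x y * (2 / r))) = 0"
   using F(2) x(1) clamp01_ge1 by (intro prod_zero bexI[of _ x]) auto
  thus ?thesis by (simp add: g_def)
 qed
 have g0: "g y <= 0" if y: "y : \<Lambda> - nbhd K r" for y
 proof -
  have "1 - clamp01 (2 - D x y * (2 / r)) = 1" if "x : F" for x
  proof -
   have "D x y >= r" using y that F by (auto simp: nbhd_def not_less)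
   hence "2 - D x y * (2 / r) <= 0" using r by (simp add: field_simps)
   thus ?thesis by (simp add: clamp01_le0)
  qed
  thus ?thesis by (simp add: g_def)
 qed
 have Ks: "K : sets borel\<Lambda>" by (rule sets_compact[OF K(1) KL])
 have ns: "nbhd K r : sets borel\<Lambda>" by (rule sets_nbhd[OF KL])
 have "measure \<mu> K <= integral\<^sup>L \<mu> g"
  by (rule measure_sandwich(1)[OF \<mu> gc Ks]) (use g1 pr in \<open>auto simp: g_def\<close>)
 also have "\<dots> = integral\<^sup>L \<nu> g" by (rule eq[OF gc])
 also have "\<dots> <= measure \<nu> (nbhd K r)"
  by (rule measure_sandwich(2)[OF \<nu> gc ns]) (use g0 pr in \<open>auto simp: g_def\<close>)
 also have "\<dots> <= measure \<nu> (K \<union> (nbhd K r - K))"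
  using Ks ns \<nu>(2) by (intro \<nu>.finite_measure_mono) auto
 also have "\<dots> <= measure \<nu> K + measure \<nu> (nbhd K r - K)"
  using Ks ns \<nu>(2) by (intro measure_Un_le) auto
 finally have 1: "measure \<mu> K <= measure \<nu> K + e / 2" using r by linarith
 have "measure \<nu> K <= measure \<nu> A" using K A \<nu>(2) by (intro \<nu>.finite_measure_mono) auto
 moreover have "measure \<mu> (A - K) = measure \<mu> A - measure \<mu> K"
  using K A Ks \<mu>(2) by (intro \<mu>.finite_measure_Diff) auto
 ultimately show "measure \<mu> A <= measure \<nu> A + e" using 1 K(3) by linarith
qed

lemma measure_eq_of_integrals:
 assumes \<mu>: "prob_space \<mu>" "sets \<mu> = sets borel\<Lambda>" and \<nu>: "prob_space \<nu>" "sets \<nu> = sets borel\<Lambda>"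
  and eq: "!!g :: 'm => real. continuous_on \<Lambda> g ==> integral\<^sup>L \<mu> g = integral\<^sup>L \<nu> g"
 shows "\<mu> = \<nu>"
proof (rule measure_eqI)
 interpret \<mu>: prob_space \<mu> by fact
 interpret \<nu>: prob_space \<nu> by fact
 fix A assume "A : sets \<mu>"
 hence A: "A : sets borel\<Lambda>" using \<mu> by simp
 have "measure \<mu> A = measure \<nu> A"
  using measure_le_of_integrals[OF \<mu> \<nu> eq A] measure_le_of_integrals[OF \<nu> \<mu> eq[symmetric] A] by simp
 thus "emeasure \<mu> A = emeasure \<nu> A" by (simp add: \<mu>.emeasure_eq_measure \<nu>.emeasure_eq_measure)
qed (use assms in simp)

end

lemma simple_function_selector:
 assumes "finite E" "!!e. e : E ==> A e : sets M" "space M \<subseteq> (\<Union>e\<in>E. A e)"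
 obtains \<xi> where "simple_function M \<xi>" "!!x. x : space M ==> \<xi> x : E & x : A (\<xi> x)"
proof -
 have "EX \<xi>. simple_function M \<xi> & (ALL x:space M. x : (\<Union>e\<in>E. A e) --> \<xi> x : E & x : A (\<xi> x))"
  using assms(1,2)
 proof (induction E rule: finite_induct)
  case empty show ?case by (intro exI[of _ "%_. undefined"]) auto
 next
  case (insert e E)
  then obtain \<xi> where \<xi>: "simple_function M \<xi>" "ALL x:space M. x : (\<Union>e\<in>E. A e) --> \<xi> x : E & x : A (\<xi> x)"
   by auto
  have "simple_function M (%x. if x : A e then e else \<xi> x)"
   using insert.prems \<xi> by (intro simple_function_If_set[where A = "A e"] simple_function_const) (auto simp: sets.sets_into_space)
  thus ?case using \<xi>(2) by (intro exI[of _ "%x. if x : A e then e else \<xi> x"]) auto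
 qed
 thus ?thesis using that assms(3) by blast
qed

section \<open>Gibbs measures as weak limits\<close>

context expanding_map
begin

lemma measurable_f: "f : borel\<Lambda> \<rightarrow>\<^sub>M borel\<Lambda>"
 by (intro measurable_restrict_space2 borel_measurable_continuous_on_restrict continuous_f) (use f_image in auto)

lemma invariant_measuresD:
 assumes "\<eta> : invariant_measures \<Lambda> f"
 shows "prob_space \<eta>" "sets \<eta> = sets borel\<Lambda>" "space \<eta> = \<Lambda>" "measure_preserving \<eta> f"
proof -
 show s: "prob_space \<eta>" "sets \<eta> = sets borel\<Lambda>" using assms by (auto simp: invariant_measures_def)
 show "space \<eta> = \<Lambda>" using sets_eq_imp_space_eq[OF s(2)] by simp
 show "measure_preserving \<eta> f" using assms
  by (auto simp: invariant_measures_def measure_preserving_def measure_preserving_axioms_def)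
qed

lemma invariant_measuresI:
 assumes \<mu>: "prob_space \<mu>" "sets \<mu> = sets borel\<Lambda>"
  and inv: "!!g :: 'm => real. continuous_on \<Lambda> g ==> (\<integral>x. g (f x) \<partial>\<mu>) = (\<integral>x. g x \<partial>\<mu>)"
 shows "\<mu> : invariant_measures \<Lambda> f"
proof -
 interpret prob_space \<mu> by fact
 have fm: "f : \<mu> \<rightarrow>\<^sub>M \<mu>" using measurable_f measurable_cong_sets[OF \<mu>(2) \<mu>(2)] by blast
 have "distr \<mu> \<mu> f = \<mu>"
 proof (rule measure_eq_of_integrals)
  show "prob_space (distr \<mu> \<mu> f)" by (rule prob_space_distr[OF fm])
  fix g :: "'m => real" assume g: "continuous_on \<Lambda> g"
  have "g : borel_measurable \<mu>"
   using borel_measurable_continuous[OF g] measurable_cong_sets[OF \<mu>(2) refl] by blast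
  hence "integral\<^sup>L (distr \<mu> \<mu> f) g = (\<integral>x. g (f x) \<partial>\<mu>)" by (rule integral_distr[OF fm])
  thus "integral\<^sup>L (distr \<mu> \<mu> f) g = integral\<^sup>L \<mu> g" using inv[OF g] by simp
 qed (use \<mu> in auto)
 thus ?thesis using fm \<mu> by (simp add: invariant_measures_def)
qed

text \<open>The radii of the lower and the upper bound, in units of \<rho>, are separate parameters
  because weak limits enlarge the former and shrink the latter.\<close>

definition gibbs :: "real => real => real => real => (nat => 'm => real) => 'm measure => bool" where
 "gibbs a b c P \<Theta> \<mu> \<longleftrightarrow> (ALL m>=1. ALL x:\<Lambda>. exp (\<Theta> m x - real m * P - c) <= measure \<mu> (bowen m x (a * \<rho>)) &
   measure \<mu> (bowen m x (b * \<rho>)) <= exp (\<Theta> m x - real m * P + c))"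

text \<open>Potentials and pressures may vary along the sequence, so one lemma yields both existence
  from atomic measures and continuity in t. Spheres may carry mass, which is why the radii have to
  change.\<close>

lemma gibbs_limit:
 assumes \<nu>: "!!k. prob_space (\<nu> k)" "!!k. sets (\<nu> k) = sets borel\<Lambda>"
  and P: "Pk \<longlonglongrightarrow> P" and \<Theta>: "!!m x. m >= 1 ==> x : \<Lambda> ==> (%k. \<Theta>k k m x) \<longlonglongrightarrow> \<Theta> m x"
  and lower: "!!m x. m >= 1 ==> x : \<Lambda> ==>
   \<forall>\<^sub>F k in sequentially. exp (\<Theta>k k m x - real m * Pk k - c) <= measure (\<nu> k) (bowen m x (a * \<rho>))"
  and upper: "!!m x. m >= 1 ==> x : \<Lambda> ==>
   \<forall>\<^sub>F k in sequentially. measure (\<nu> k) (bowen m x (b * \<rho>)) <= exp (\<Theta>k k m x - real m * Pk k + c)"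
  and inv: "!!g :: 'm => real. continuous_on \<Lambda> g ==> (%k. (\<integral>x. g (f x) \<partial>\<nu> k) - (\<integral>x. g x \<partial>\<nu> k)) \<longlonglongrightarrow> 0"
  and ab: "a < a'" "b' < b"
 obtains r \<mu> where "strict_mono (r :: nat => nat)" "\<mu> : invariant_measures \<Lambda> f" "gibbs a' b' c P \<Theta> \<mu>"
  "!!g :: 'm => real. continuous_on \<Lambda> g ==> (%k. integral\<^sup>L (\<nu> (r k)) g) \<longlonglongrightarrow> integral\<^sup>L \<mu> g"
proof -
 obtain r \<mu> where r: "strict_mono (r :: nat => nat)" and \<mu>: "prob_space \<mu>" "sets \<mu> = sets borel\<Lambda>"
  and conv: "!!g :: 'm => real. continuous_on \<Lambda> g ==> (%k. integral\<^sup>L (\<nu> (r k)) g) \<longlonglongrightarrow> integral\<^sup>L \<mu> g"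
  by (rule weak_compactness[OF \<nu>]) (rule that)
 have "\<mu> : invariant_measures \<Lambda> f"
 proof (rule invariant_measuresI[OF \<mu>])
  fix g :: "'m => real" assume g: "continuous_on \<Lambda> g"
  have gf: "continuous_on \<Lambda> (%x. g (f x))"
   by (rule continuous_on_compose2[OF g continuous_f]) (simp add: f_image)
  have "(%k. (\<integral>x. g (f x) \<partial>\<nu> (r k)) - (\<integral>x. g x \<partial>\<nu> (r k))) \<longlonglongrightarrow> (\<integral>x. g (f x) \<partial>\<mu>) - (\<integral>x. g x \<partial>\<mu>)"
   by (intro tendsto_diff conv g gf)
  moreover have "(%k. (\<integral>x. g (f x) \<partial>\<nu> (r k)) - (\<integral>x. g x \<partial>\<nu> (r k))) \<longlonglongrightarrow> 0"
   using LIMSEQ_subseq_LIMSEQ[OF inv[OF g] r] by (simp add: o_def)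
  ultimately show "(\<integral>x. g (f x) \<partial>\<mu>) = (\<integral>x. g x \<partial>\<mu>)" using LIMSEQ_unique by fastforce
 qed
 moreover have "gibbs a' b' c P \<Theta> \<mu>"
  unfolding gibbs_def
 proof (intro allI impI ballI conjI)
  fix m x assume m: "m >= (1::nat)" and x: "x : \<Lambda>"
  \<comment> \<open>Equal to 1 on the Bowen ball of radius s \<rho> and to 0 off that of radius t
    \<rho>; being continuous, it passes through weak limits.\<close>
  define \<phi> where "\<phi> s t y = (\<Prod>j\<le>m. clamp01 ((t * \<rho> - D ((f ^^ j) x) ((f ^^ j) y)) / (t * \<rho> - s * \<rho>)))" for s t y
  have \<phi>c: "continuous_on \<Lambda> (\<phi> s t)" if "s < t" for s t
   unfolding \<phi>_def
   by (intro continuous_on_prod continuous_clamp01 continuous_on_divide continuous_on_diff continuous_on_const continuous_D_funpow x)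
     (use that \<rho>_pos in auto)
  have \<phi>0: "0 <= \<phi> s t y" "\<phi> s t y <= 1" for s t y unfolding \<phi>_def
   using clamp01_bounds by (auto intro!: prod_nonneg prod_le_1)
  have \<phi>1: "1 <= \<phi> s t y" if "s < t" "y : bowen m x (s * \<rho>)" for s t y
  proof -
   have st: "t * \<rho> - s * \<rho> > 0" using that \<rho>_pos by simp
   have "clamp01 ((t * \<rho> - D ((f ^^ j) x) ((f ^^ j) y)) / (t * \<rho> - s * \<rho>)) = 1" if "j <= m" for j
    using \<open>y : bowen m x (s * \<rho>)\<close> that st by (intro clamp01_ge1) (auto simp: bowen_def)
   thus ?thesis by (simp add: \<phi>_def)
  qed
  have \<phi>z: "\<phi> s t y <= 0" if st': "s < t" and y: "y : \<Lambda> - bowen m x (t * \<rho>)" for s t y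
  proof -
   have st: "t * \<rho> - s * \<rho> > 0" using st' \<rho>_pos by simp
   obtain j where j: "j <= m" "D ((f ^^ j) x) ((f ^^ j) y) > t * \<rho>" using y by (auto simp: bowen_def)
   have "clamp01 ((t * \<rho> - D ((f ^^ j) x) ((f ^^ j) y)) / (t * \<rho> - s * \<rho>)) = 0"
    using j st by (intro clamp01_le0) (auto simp: divide_nonpos_pos)
   hence "\<phi> s t y = 0" unfolding \<phi>_def using j(1) by (intro prod_zero) auto
   thus ?thesis by simp
  qed
  have sand: "measure \<eta> (bowen m x (s * \<rho>)) <= integral\<^sup>L \<eta> (\<phi> s t)" "integral\<^sup>L \<eta> (\<phi> s t) <= measure \<eta> (bowen m x (t * \<rho>))"
   if "prob_space \<eta>" "sets \<eta> = sets borel\<Lambda>" "s < t" for \<eta> s t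
   using measure_sandwich[OF that(1,2) \<phi>c[OF that(3)] sets_bowen[OF x]] \<phi>0 \<phi>1[OF that(3)] \<phi>z[OF that(3)] by auto
  have lim: "(%k. exp (\<Theta>k (r k) m x - real m * Pk (r k) + z)) \<longlonglongrightarrow> exp (\<Theta> m x - real m * P + z)" for z
   using LIMSEQ_subseq_LIMSEQ[OF \<Theta>[OF m x] r] LIMSEQ_subseq_LIMSEQ[OF P r]
   by (intro tendsto_intros) (auto simp: o_def)
  have "exp (\<Theta> m x - real m * P + - c) <= integral\<^sup>L \<mu> (\<phi> a a')"
  proof (rule tendsto_le[OF _ conv[OF \<phi>c[OF ab(1)]] lim])
   show "\<forall>\<^sub>F k in sequentially. exp (\<Theta>k (r k) m x - real m * Pk (r k) + - c) <= integral\<^sup>L (\<nu> (r k)) (\<phi> a a')"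
    using eventually_subseq[OF r lower[OF m x]]
    by eventually_elim (use sand(1)[OF \<nu> ab(1)] in \<open>auto intro: order_trans\<close>)
  qed simp
  also have "\<dots> <= measure \<mu> (bowen m x (a' * \<rho>))" by (rule sand(2)[OF \<mu> ab(1)])
  finally show "exp (\<Theta> m x - real m * P - c) <= measure \<mu> (bowen m x (a' * \<rho>))" by simp
  have "measure \<mu> (bowen m x (b' * \<rho>)) <= integral\<^sup>L \<mu> (\<phi> b' b)" by (rule sand(1)[OF \<mu> ab(2)])
  also have "integral\<^sup>L \<mu> (\<phi> b' b) <= exp (\<Theta> m x - real m * P + c)"
  proof (rule tendsto_le[OF _ lim conv[OF \<phi>c[OF ab(2)]]])
   show "\<forall>\<^sub>F k in sequentially. integral\<^sup>L (\<nu> (r k)) (\<phi> b' b) <= exp (\<Theta>k (r k) m x - real m * Pk (r k) + c)"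
    using eventually_subseq[OF r upper[OF m x]]
    by eventually_elim (use sand(2)[OF \<nu> ab(2)] in \<open>auto intro: order_trans\<close>)
  qed simp
  finally show "measure \<mu> (bowen m x (b' * \<rho>)) <= exp (\<Theta> m x - real m * P + c)" .
 qed
 ultimately show ?thesis using that r conv by blast
qed

lemma gibbs_exists:
 assumes tame: "tame C \<Theta>"
 obtains P \<mu> where "\<mu> : invariant_measures \<Lambda> f" "gibbs 2 30 (K C) P \<Theta> \<mu>"
proof -
 obtain P where P: "!!n y. n >= 1 ==> y : \<Lambda> ==> exp (- c2 C + real n * P) <= Z \<Theta> n y"
  "!!n y. n >= 1 ==> y : \<Lambda> ==> Z \<Theta> n y <= exp (c2 C + real n * P)"
  using pressure_exists[OF tame] by blast
 define A where "A n \<mu> \<longleftrightarrow> prob_space \<mu> & sets \<mu> = sets borel\<Lambda> &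
  (ALL m x. 1 <= m --> m + N < Suc n --> x : \<Lambda> --> exp (\<Theta> m x - real m * P - K C) <= measure \<mu> (bowen m x \<rho>)) &
  (ALL m x. 1 <= m --> m + N < Suc n --> x : \<Lambda> --> measure \<mu> (bowen m x (32 * \<rho>)) <= exp (\<Theta> m x - real m * P + K C)) &
  (ALL g B. continuous_on \<Lambda> g --> (ALL x:\<Lambda>. \<bar>g x\<bar> <= B) -->
   \<bar>(\<integral>x. g (f x) \<partial>\<mu>) - (\<integral>x. g x \<partial>\<mu>)\<bar> <= 2 * B / real (Suc n))" for n \<mu>
 have "EX \<mu>. A n \<mu>" for n
 proof (rule atomic_gibbs[OF tame P, of "Suc n"])
  fix \<mu> assume a: "prob_space \<mu>" "sets \<mu> = sets borel\<Lambda>"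
   "!!m x. 1 <= m ==> m + N < Suc n ==> x : \<Lambda> ==> exp (\<Theta> m x - real m * P - K C) <= measure \<mu> (bowen m x \<rho>)"
   "!!m x. 1 <= m ==> m + N < Suc n ==> x : \<Lambda> ==> measure \<mu> (bowen m x (32 * \<rho>)) <= exp (\<Theta> m x - real m * P + K C)"
   "!!g B. continuous_on \<Lambda> g ==> (!!x. x : \<Lambda> ==> \<bar>g x\<bar> <= B) ==>
    \<bar>(\<integral>x. g (f x) \<partial>\<mu>) - (\<integral>x. g x \<partial>\<mu>)\<bar> <= 2 * B / real (Suc n)"
  have "A n \<mu>"
   unfolding A_def
  proof (intro conjI allI impI a(1,2))
   fix g :: "'m => real" and B assume "continuous_on \<Lambda> g" "ALL x:\<Lambda>. \<bar>g x\<bar> <= B"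
   thus "\<bar>(\<integral>x. g (f x) \<partial>\<mu>) - (\<integral>x. g x \<partial>\<mu>)\<bar> <= 2 * B / real (Suc n)" by (intro a(5)) auto
  qed (rule a(3) a(4); assumption)+
  thus ?thesis by blast
 qed auto
 then obtain \<nu> where A: "!!n. A n (\<nu> n)" by metis
 have \<nu>: "!!n. prob_space (\<nu> n)" "!!n. sets (\<nu> n) = sets borel\<Lambda>"
  "!!n m x. 1 <= m ==> m + N < Suc n ==> x : \<Lambda> ==> exp (\<Theta> m x - real m * P - K C) <= measure (\<nu> n) (bowen m x \<rho>)"
  "!!n m x. 1 <= m ==> m + N < Suc n ==> x : \<Lambda> ==> measure (\<nu> n) (bowen m x (32 * \<rho>)) <= exp (\<Theta> m x - real m * P + K C)"
  "!!n g B. continuous_on \<Lambda> g ==> ALL x:\<Lambda>. \<bar>g x\<bar> <= B ==>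
   \<bar>(\<integral>x. g (f x) \<partial>\<nu> n) - (\<integral>x. g x \<partial>\<nu> n)\<bar> <= 2 * B / real (Suc n)"
  using A unfolding A_def by simp_all
 show ?thesis
 proof (rule gibbs_limit[of \<nu> "%_. P" P "%_. \<Theta>" \<Theta> "K C" 1 32 2 30])
  fix m x assume m: "m >= (1::nat)" "x : \<Lambda>"
  show "\<forall>\<^sub>F k in sequentially. exp (\<Theta> m x - real m * P - K C) <= measure (\<nu> k) (bowen m x (1 * \<rho>))"
   using eventually_ge_at_top[of "m + N"] by eventually_elim (use \<nu>(3) m in auto)
  show "\<forall>\<^sub>F k in sequentially. measure (\<nu> k) (bowen m x (32 * \<rho>)) <= exp (\<Theta> m x - real m * P + K C)"
   using eventually_ge_at_top[of "m + N"] by eventually_elim (use \<nu>(4) m in auto)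
 next
  fix g :: "'m => real" assume g: "continuous_on \<Lambda> g"
  obtain B where B: "ALL x:\<Lambda>. \<bar>g x\<bar> <= B" using continuous_boundedE[OF g] by metis
  have "(%k. 2 * B / real (Suc k)) \<longlonglongrightarrow> 0" by (rule LIMSEQ_Suc[OF lim_const_over_n])
  thus "(%k. (\<integral>x. g (f x) \<partial>\<nu> k) - (\<integral>x. g x \<partial>\<nu> k)) \<longlonglongrightarrow> 0"
   by (rule Lim_null_comparison[rotated]) (simp add: \<nu>(5)[OF g B] del: of_nat_Suc)
 qed (use that \<nu> in auto)
qed

lemma integrable_\<Theta>:
 "tame C \<Theta> ==> \<eta> : invariant_measures \<Lambda> f ==> n >= 1 ==> integrable \<eta> (\<Theta> n)"
 using integrable_continuous[OF invariant_measuresD(1,2) continuous_\<Theta>] by blast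

text \<open>Invariance turns pointwise almost additivity into almost additivity of the numerical
  sequence of integrals, with the same constant.\<close>

lemma mean_potential_bound:
 assumes tame: "tame C \<Theta>" and \<eta>: "\<eta> : invariant_measures \<Lambda> f"
 shows "n >= 1 ==> \<bar>(\<integral>x. \<Theta> n x \<partial>\<eta>) - real n * mean_potential \<Theta> \<eta>\<bar> <= C"
  and "(%n. (\<integral>x. \<Theta> n x \<partial>\<eta>) / real n) \<longlonglongrightarrow> mean_potential \<Theta> \<eta>"
proof -
 interpret measure_preserving \<eta> f by (rule invariant_measuresD(4)[OF \<eta>])
 note sp = invariant_measuresD(3)[OF \<eta>] and se = invariant_measuresD(2)[OF \<eta>]
 have aa: "\<bar>(\<integral>x. \<Theta> (m + n) x \<partial>\<eta>) - (\<integral>x. \<Theta> m x \<partial>\<eta>) - (\<integral>x. \<Theta> n x \<partial>\<eta>)\<bar> <= C" if mn: "m >= 1" "n >= 1" for m n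
 proof -
  have i1: "integrable \<eta> (\<Theta> (m + n))" by (rule integrable_\<Theta>[OF tame \<eta>]) (use mn in simp)
  note i2 = integrable_\<Theta>[OF tame \<eta> mn(1)] and i3 = integrable_\<Theta>[OF tame \<eta> mn(2)]
  have "distr \<eta> \<eta> (f ^^ m) = \<eta>" by (rule distr_funpow)
  hence i4: "integrable \<eta> (%x. \<Theta> n ((f ^^ m) x))" and e: "(\<integral>x. \<Theta> n ((f ^^ m) x) \<partial>\<eta>) = (\<integral>x. \<Theta> n x \<partial>\<eta>)"
   using integrable_distr[OF measurable_funpow[of m], of "\<Theta> n"] 
    integral_distr[OF measurable_funpow[of m] borel_measurable_integrable[OF i3]] i3 by auto
  have "(\<integral>x. \<Theta> (m + n) x \<partial>\<eta>) - (\<integral>x. \<Theta> m x \<partial>\<eta>) - (\<integral>x. \<Theta> n x \<partial>\<eta>) = (\<integral>x. \<Theta> (m + n) x - \<Theta> m x - \<Theta> n ((f ^^ m) x) \<partial>\<eta>)"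
   using i1 i2 i4 e by simp
  also have "\<bar>\<dots>\<bar> <= (\<integral>x. \<bar>\<Theta> (m + n) x - \<Theta> m x - \<Theta> n ((f ^^ m) x)\<bar> \<partial>\<eta>)" by (rule integral_abs_bound)
  also have "\<dots> <= (\<integral>x. C \<partial>\<eta>)"
   by (intro integral_mono integrable_abs Bochner_Integration.integrable_diff i1 i2 i4)
     (use \<Theta>_add[OF tame mn] sp in auto)
  also have "\<dots> = C" by (simp add: prob_space)
  finally show ?thesis .
 qed
 obtain L where L: "(%n. (\<integral>x. \<Theta> n x \<partial>\<eta>) / real n) \<longlonglongrightarrow> L" "!!n. n >= 1 ==> \<bar>(\<integral>x. \<Theta> n x \<partial>\<eta>) - real n * L\<bar> <= C"
  using almost_additive_sequence[OF aa] by blast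
 have "mean_potential \<Theta> \<eta> = L" unfolding mean_potential_def using limI[OF L(1)] by simp
 thus "n >= 1 ==> \<bar>(\<integral>x. \<Theta> n x \<partial>\<eta>) - real n * mean_potential \<Theta> \<eta>\<bar> <= C"
  "(%n. (\<integral>x. \<Theta> n x \<partial>\<eta>) / real n) \<longlonglongrightarrow> mean_potential \<Theta> \<eta>" using L by auto
qed

end

section \<open>Equilibrium states\<close>

lemma (in prob_space) sum_fiber_eq_integral:
 fixes t :: "'b => real"
 assumes Y: "simple_function M Y"
 shows "integrable M (%y. t (Y y))"
  and "(\<Sum>a\<in>Y ` space M. prob (Y -` {a} \<inter> space M) * t a) = (\<integral>y. t (Y y) \<partial>M)"
proof -
 note fin = simple_functionD(1)[OF Y] and ev = simple_functionD(2)[OF Y]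
 let ?c = "%a. Y -` {a} \<inter> space M"
 have ii: "integrable M (%y. t a * indicator (?c a) y)" for a
  using ev by (intro integrable_mult_right integrable_const_bound[of _ 1]) auto
 have eq: "t (Y y) = (\<Sum>a\<in>Y ` space M. t a * indicator (?c a) y)" if "y : space M" for y
 proof -
  have "(\<Sum>a\<in>Y ` space M. t a * indicator (?c a) y) = (\<Sum>a\<in>{Y y}. t a * indicator (?c a) y)"
   by (rule sum.mono_neutral_right) (use fin that in \<open>auto simp: indicator_def\<close>)
  thus ?thesis using that by (simp add: indicator_def)
 qed
 have i: "integrable M (%y. \<Sum>a\<in>Y ` space M. t a * indicator (?c a) y)" by (intro Bochner_Integration.integrable_sum ii)
 show "integrable M (%y. t (Y y))"
  using i Bochner_Integration.integrable_cong[OF refl[of M] eq] by simp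
 have "(\<integral>y. t (Y y) \<partial>M) = (\<integral>y. (\<Sum>a\<in>Y ` space M. t a * indicator (?c a) y) \<partial>M)"
  by (rule Bochner_Integration.integral_cong[OF refl eq])
 also have "\<dots> = (\<Sum>a\<in>Y ` space M. (\<integral>y. t a * indicator (?c a) y \<partial>M))"
  by (rule Bochner_Integration.integral_sum[OF ii])
 also have "\<dots> = (\<Sum>a\<in>Y ` space M. prob (?c a) * t a)"
  using ev by (intro sum.cong refl) (simp add: mult.commute)
 finally show "(\<Sum>a\<in>Y ` space M. prob (?c a) * t a) = (\<integral>y. t (Y y) \<partial>M)" by simp
qed

text \<open>The finite variational principle for weights of arbitrary total mass q. The extra
  \<open>ent\<close> of q is the price of not normalizing, and allows the inequality to be used on
  part of a partition.\<close>

lemma log_sum_inequality: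
 fixes p a :: "'b => real"
 assumes fin: "finite W" and p: "!!e. e : W ==> 0 <= p e" and S: "S > 0" "(\<Sum>e\<in>W. exp (a e)) <= S"
 shows "(\<Sum>e\<in>W. ent (p e) + p e * a e) <= (\<Sum>e\<in>W. p e) * ln S + ent (\<Sum>e\<in>W. p e)"
proof -
 define q where "q = (\<Sum>e\<in>W. p e)"
 have q0: "q >= 0" unfolding q_def by (intro sum_nonneg p)
 show ?thesis
 proof (cases "q = 0")
  case True
  hence "ALL e:W. p e = 0" using p fin by (simp add: q_def sum_nonneg_eq_0_iff)
  thus ?thesis using True by (simp add: q_def)
 next
  case False
  hence q: "q > 0" using q0 by simp
  have trm: "ent (p e) + p e * a e <= exp (a e) * q / S - p e + p e * (ln S - ln q)" if e: "e : W" for e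
  proof (cases "p e = 0")
   case True thus ?thesis using q S by simp
  next
   case False
   hence pe: "p e > 0" using p[OF e] by simp
   have "ln (exp (a e) * q / (S * p e)) <= exp (a e) * q / (S * p e) - 1"
    by (rule ln_le_minus_one) (use pe q S in simp)
   hence "p e * ln (exp (a e) * q / (S * p e)) <= p e * (exp (a e) * q / (S * p e) - 1)" using pe by simp
   moreover have "ln (exp (a e) * q / (S * p e)) = a e + ln q - ln S - ln (p e)" using pe q S by (simp add: ln_div ln_mult)
   moreover have "p e * (exp (a e) * q / (S * p e) - 1) = exp (a e) * q / S - p e" using pe S by (simp add: field_simps)
   ultimately have "p e * (a e + ln q - ln S - ln (p e)) <= exp (a e) * q / S - p e" by simp
   thus ?thesis by (simp add: ent_def algebra_simps)
  qed
  have "(\<Sum>e\<in>W. ent (p e) + p e * a e) <= (\<Sum>e\<in>W. exp (a e) * q / S - p e + p e * (ln S - ln q))"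
   by (rule sum_mono[OF trm])
  also have "\<dots> = (\<Sum>e\<in>W. exp (a e)) * (q / S) - q + q * (ln S - ln q)"
   unfolding sum.distrib sum_subtractf q_def
   by (simp only: sum_distrib_right[symmetric] sum_divide_distrib[symmetric] times_divide_eq_right)
  also have "\<dots> <= S * (q / S) - q + q * (ln S - ln q)"
   using S q by (intro add_right_mono diff_right_mono mult_right_mono) auto
  also have "\<dots> = q * ln S + ent q" using S by (simp add: ent_def algebra_simps)
  finally show ?thesis by (simp add: q_def)
 qed
qed

context expanding_map
begin

lemma funpow_uniform:
 assumes "e > 0"
 obtains r where "r > 0" "!!y z j. y : \<Lambda> ==> z : \<Lambda> ==> D y z <= r ==> j <= n ==> D ((f ^^ j) y) ((f ^^ j) z) < e"
proof -
 have "EX r>0. ALL y:\<Lambda>. ALL z:\<Lambda>. D y z <= r --> D ((f ^^ j) y) ((f ^^ j) z) < e" for j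
  using uniformly_continuous_map[OF continuous_funpow, where e = e and n1 = j] funpow_image assms
  by (metis order_refl)
 then obtain r where r: "!!j. r j > 0" "!!j y z. y : \<Lambda> ==> z : \<Lambda> ==> D y z <= r j ==> D ((f ^^ j) y) ((f ^^ j) z) < e"
  by metis
 define s where "s = Min (r ` {..n})"
 have s: "s > 0" "!!j. j <= n ==> s <= r j" unfolding s_def using r(1) by (auto simp: Min_gr_iff)
 show ?thesis
 proof (rule that[OF s(1)])
  fix y z j assume "y : \<Lambda>" "z : \<Lambda>" "D y z <= s" "j <= n"
  thus "D ((f ^^ j) y) ((f ^^ j) z) < e" using r(2)[of y z j] s(2)[of j] by linarith
 qed
qed

lemma sets_D_ball: "x : \<Lambda> ==> {y:\<Lambda>. D x y < r} : sets borel\<Lambda>"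
proof -
 assume "x : \<Lambda>"
 then obtain U where U: "open U" "!!y. y : \<Lambda> ==> y : U \<longleftrightarrow> D x y < r" using open_D_ball by metis
 have "{y:\<Lambda>. D x y < r} = U \<inter> \<Lambda>" using U(2) by auto
 thus ?thesis using sets_borel\<Lambda>_Int[OF borel_open[OF U(1)]] by simp
qed

text \<open>A maximal 10 \<rho>-separated part of a fine net. The points are close enough for their
  20 \<rho>-balls to cover \<Lambda>, yet far enough apart for their 5 \<rho>-balls to be
  disjoint.\<close>

lemma separated_cover:
 obtains E where "finite E" "E \<subseteq> \<Lambda>" "!!y. y : \<Lambda> ==> EX e:E. y : bowen n e (20 * \<rho>)"
  "!!e e'. e : E ==> e' : E ==> e ~= e' ==> e' \<notin> bowen n e (10 * \<rho>)"
proof -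
 obtain r where r: "r > 0" "!!y z j. y : \<Lambda> ==> z : \<Lambda> ==> D y z <= r ==> j <= n ==> D ((f ^^ j) y) ((f ^^ j) z) < 10 * \<rho>"
  using funpow_uniform[of "10 * \<rho>" n] \<rho>_pos by (metis mult_pos_pos zero_less_numeral)
 obtain F where F: "finite F" "F \<subseteq> \<Lambda>" "!!y. y : \<Lambda> ==> EX x:F. D x y < r"
  using finite_D_cover[of "%_. r"] r(1) by metis
 define sep where "sep E \<longleftrightarrow> (ALL e:E. ALL e':E. e ~= e' --> e' \<notin> bowen n e (10 * \<rho>))" for E
 define S where "S = {E. E \<subseteq> F & sep E}"
 have "finite S" using F(1) by (simp add: S_def)
 moreover have "{} : S" by (simp add: sep_def S_def)
 hence "S ~= {}" by blast
 ultimately obtain E where "E : S" "ALL b:S. E \<subseteq> b --> E = b" using finite_has_maximal by blast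
 hence E: "E \<subseteq> F" "sep E" "!!E'. E' \<subseteq> F ==> sep E' ==> E \<subseteq> E' ==> E' = E"
  by (auto simp: S_def)
 show ?thesis
 proof (rule that[of E])
  show "finite E" "E \<subseteq> \<Lambda>" using E(1) F finite_subset by auto
  show "e' \<notin> bowen n e (10 * \<rho>)" if "e : E" "e' : E" "e ~= e'" for e e' using E(2) that by (auto simp: sep_def)
  fix y assume y: "y : \<Lambda>"
  obtain x where x: "x : F" "D x y < r" using F(3)[OF y] by auto
  have xL: "x : \<Lambda>" using x F by auto
  have yx: "y : bowen n x (10 * \<rho>)" using r(2)[OF xL y] x y by (force simp: bowen_def)
  have "EX e:E. x : bowen n e (10 * \<rho>)"
  proof (cases "x : E")
   case True thus ?thesis using bowen_self[OF xL, of "10 * \<rho>" n] \<rho>_pos by auto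
  next
   case False
   hence "\<not> sep (insert x E)" using E(3)[of "insert x E"] E(1) x by auto
   then obtain e where "e : E" "x : bowen n e (10 * \<rho>) \<or> e : bowen n x (10 * \<rho>)"
    using E(2) unfolding sep_def by blast
   thus ?thesis using bowen_commute[OF xL] by auto
  qed
  then obtain e where e: "e : E" "x : bowen n e (10 * \<rho>)" by auto
  have eL: "e : \<Lambda>" using e E F by auto
  have "e : bowen n x (10 * \<rho>)" by (rule bowen_commute[OF eL e(2)])
  hence "y : bowen n e (10 * \<rho> + 10 * \<rho>)" using yx bowen_triangle by blast
  thus "EX e:E. y : bowen n e (20 * \<rho>)" using e by auto
 qed
qed

text \<open>Cells of an itinerary of a fine partition lie in Bowen balls, whose measure the upper
  Gibbs bound controls. So - ln of the mass of a cell is at least m P - \<Theta> m - c at a point of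
  the cell, and integrating bounds the entropy from below.\<close>

lemma gibbs_entropy_lower:
 assumes tame: "tame C \<Theta>" and \<mu>: "\<mu> : invariant_measures \<Lambda> f" and b: "0 < b" "b <= 64"
  and upper: "!!m x. m >= 1 ==> x : \<Lambda> ==> measure \<mu> (bowen m x (b * \<rho>)) <= exp (\<Theta> m x - real m * P + c)"
 shows "ereal (P - mean_potential \<Theta> \<mu>) <= metric_entropy f \<mu>"
proof -
 interpret measure_preserving \<mu> f by (rule invariant_measuresD(4)[OF \<mu>])
 note sp = invariant_measuresD(3)[OF \<mu>] and se = invariant_measuresD(2)[OF \<mu>]
 define r where "r = b * \<rho>"
 have r: "r > 0" using b \<rho>_pos by (simp add: r_def)
 obtain F where F: "finite F" "F \<subseteq> \<Lambda>" "!!y. y : \<Lambda> ==> EX x:F. D x y < r / 2"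
  using finite_D_cover[of "%_. r / 2"] r by (metis half_gt_zero)
 obtain X where X: "simple_function \<mu> X" "!!y. y : space \<mu> ==> X y : F & y : {z:\<Lambda>. D (X y) z < r / 2}"
 proof (rule simple_function_selector[of F "%x. {z:\<Lambda>. D x z < r / 2}" \<mu>])
  show "space \<mu> \<subseteq> (\<Union>x\<in>F. {z:\<Lambda>. D x z < r / 2})" using F(3) sp by auto
  show "{z:\<Lambda>. D x z < r / 2} : sets \<mu>" if "x : F" for x using sets_D_ball se F(2) that by blast
 qed (use F that in blast)+
 have X2: "D y z < r" if "y : \<Lambda>" "z : \<Lambda>" "X y = X z" for y z
  using X(2)[of y] X(2)[of z] that sp D_triangle[of y z "X y"] D_commute[of y "X y"] by auto
 obtain l where l: "(%n. fent \<mu> (itinerary X f n) / real n) \<longlonglongrightarrow> l"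
  using entropy_rate_exists[OF X(1)] by metis
 \<comment> \<open>The itinerary has length m + 1 because a Bowen ball of order m includes time
   m.\<close>
 have est: "real m * P - c - C - (\<integral>x. \<Theta> m x \<partial>\<mu>) <= fent \<mu> (itinerary X f (Suc m))" if m: "m >= 1" for m
 proof -
  define Y where "Y = itinerary X f (Suc m)"
  have Y: "simple_function \<mu> Y" unfolding Y_def by (rule simple_function_itinerary[OF X(1)])
  define x where "x a = (SOME y. y : \<Lambda> & Y y = a)" for a
  have x: "x a : \<Lambda> & Y (x a) = a" if "a : Y ` \<Lambda>" for a
   unfolding x_def by (rule someI_ex) (use that in auto)
  have cell: "y : bowen m (x (Y y)) r" if y: "y : \<Lambda>" for y
  proof -
   have "x (Y y) : \<Lambda>" "Y (x (Y y)) = Y y" using x[of "Y y"] y by auto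
   hence "ALL j<Suc m. X ((f ^^ j) (x (Y y))) = X ((f ^^ j) y)" unfolding Y_def itinerary_eq_iff by simp
   hence "ALL j<=m. D ((f ^^ j) (x (Y y))) ((f ^^ j) y) < r"
    using X2 funpow_mem y \<open>x (Y y) : \<Lambda>\<close> by (simp add: less_Suc_eq_le)
   thus ?thesis using y by (auto simp: bowen_def less_imp_le)
  qed
  have term1: "prob (Y -` {a} \<inter> space \<mu>) * (real m * P - c - \<Theta> m (x a)) <= ent (prob (Y -` {a} \<inter> space \<mu>))"
   if a: "a : Y ` space \<mu>" for a
  proof (cases "prob (Y -` {a} \<inter> space \<mu>) = 0")
   case False
   hence p: "prob (Y -` {a} \<inter> space \<mu>) > 0" using measure_nonneg[of \<mu> "Y -` {a} \<inter> space \<mu>"] by linarith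
   have xa: "x a : \<Lambda>" using x a sp by auto
   have "Y -` {a} \<inter> space \<mu> \<subseteq> bowen m (x a) r" using cell sp by auto
   hence "prob (Y -` {a} \<inter> space \<mu>) <= prob (bowen m (x a) r)"
    using sets_bowen[OF xa] se by (intro finite_measure_mono) auto
   also have "\<dots> <= exp (\<Theta> m (x a) - real m * P + c)" unfolding r_def by (rule upper[OF m xa])
   finally have "ln (prob (Y -` {a} \<inter> space \<mu>)) <= \<Theta> m (x a) - real m * P + c"
    using p by (metis exp_gt_zero ln_exp ln_le_cancel_iff)
   hence "real m * P - c - \<Theta> m (x a) <= - ln (prob (Y -` {a} \<inter> space \<mu>))" by linarith
   from mult_left_mono[OF this, of "prob (Y -` {a} \<inter> space \<mu>)"] show ?thesis using p by (simp add: ent_def)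
  qed simp
  have "real m * P - c - C - (\<integral>x. \<Theta> m x \<partial>\<mu>) = (\<integral>y. real m * P - c - C - \<Theta> m y \<partial>\<mu>)"
   using integrable_\<Theta>[OF tame \<mu> m] by (simp add: prob_space)
  also have "\<dots> <= (\<integral>y. real m * P - c - \<Theta> m (x (Y y)) \<partial>\<mu>)"
  proof (rule integral_mono)
   show "integrable \<mu> (%y. real m * P - c - C - \<Theta> m y)"
    using integrable_\<Theta>[OF tame \<mu> m] by simp
   show "integrable \<mu> (%y. real m * P - c - \<Theta> m (x (Y y)))"
    using sum_fiber_eq_integral(1)[OF Y, of "%a. real m * P - c - \<Theta> m (x a)"] .
   fix y assume "y : space \<mu>"
   hence y: "y : \<Lambda>" using sp by simp
   have xL: "x (Y y) : \<Lambda>" using x[of "Y y"] y by simp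
   have r64: "r <= 64 * \<rho>" using b \<rho>_pos unfolding r_def by (intro mult_right_mono) auto
   have "\<bar>\<Theta> m (x (Y y)) - \<Theta> m y\<bar> <= C"
    by (rule \<Theta>_bowen[OF tame m xL cell[OF y] r64])
   thus "real m * P - c - C - \<Theta> m y <= real m * P - c - \<Theta> m (x (Y y))" by linarith
  qed
  also have "\<dots> = (\<Sum>a\<in>Y ` space \<mu>. prob (Y -` {a} \<inter> space \<mu>) * (real m * P - c - \<Theta> m (x a)))"
   using sum_fiber_eq_integral(2)[OF Y, of "%a. real m * P - c - \<Theta> m (x a)"] by simp
  also have "\<dots> <= fent \<mu> Y" unfolding fent_def by (rule sum_mono[OF term1])
  finally show ?thesis by (simp add: Y_def)
 qed
 have l1: "(%m. fent \<mu> (itinerary X f (Suc m)) / real (Suc m) * (real (Suc m) / real m)) \<longlonglongrightarrow> l * 1"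
  by (intro tendsto_mult LIMSEQ_Suc[OF l] LIMSEQ_Suc_n_over_n)
 have l2: "(%m. P - (c + C) / real m - (\<integral>x. \<Theta> m x \<partial>\<mu>) / real m) \<longlonglongrightarrow> P - 0 - mean_potential \<Theta> \<mu>"
  by (intro tendsto_diff tendsto_const lim_const_over_n mean_potential_bound(2)[OF tame \<mu>])
 have "P - 0 - mean_potential \<Theta> \<mu> <= l * 1"
 proof (rule LIMSEQ_le[OF l2 l1], intro exI[of _ 1] allI impI)
  fix m :: nat assume m: "1 <= m"
  have "P - (c + C) / real m - (\<integral>x. \<Theta> m x \<partial>\<mu>) / real m = (real m * P - c - C - (\<integral>x. \<Theta> m x \<partial>\<mu>)) / real m"
   using m by (simp add: field_simps)
  also have "\<dots> <= fent \<mu> (itinerary X f (Suc m)) / real m"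
   by (intro divide_right_mono est m) simp
  also have "\<dots> = fent \<mu> (itinerary X f (Suc m)) / real (Suc m) * (real (Suc m) / real m)" by simp
  finally show "P - (c + C) / real m - (\<integral>x. \<Theta> m x \<partial>\<mu>) / real m
   <= fent \<mu> (itinerary X f (Suc m)) / real (Suc m) * (real (Suc m) / real m)" .
 qed
 hence "ereal (P - mean_potential \<Theta> \<mu>) <= ereal l" by simp
 also have "\<dots> <= metric_entropy f \<mu>" by (rule metric_entropy_geI[OF X(1) l])
 finally show ?thesis .
qed

text \<open>For expansive maps a function whose fibres stay 64 \<rho>-close for n steps generates
  under the n-th iterate: enough of its symbols bring two points arbitrarily close. An arbitrary X
  is then determined off a small set, because on compact subsets its level sets are
  separated.\<close>

lemma entropy_le_partition:
 assumes \<eta>: "\<eta> : invariant_measures \<Lambda> f" and \<xi>: "simple_function \<eta> \<xi>" and n: "n >= 1"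
  and gen: "!!x y j. x : \<Lambda> ==> y : \<Lambda> ==> \<xi> x = \<xi> y ==> j <= n ==> D ((f ^^ j) x) ((f ^^ j) y) <= 64 * \<rho>"
 shows "metric_entropy f \<eta> <= ereal (fent \<eta> \<xi> / real n)"
proof -
 interpret measure_preserving \<eta> f by (rule invariant_measuresD(4)[OF \<eta>])
 note sp = invariant_measuresD(3)[OF \<eta>] and se = invariant_measuresD(2)[OF \<eta>]
 show ?thesis
 proof (rule metric_entropy_leI)
  fix X :: "'m => 'm set" and l
  assume X: "simple_function \<eta> X" and l: "(%n. fent \<eta> (itinerary X f n) / real n) \<longlonglongrightarrow> l"
  show "l <= fent \<eta> \<xi> / real n"
  proof (rule entropy_rate_le_fent[OF X \<xi> n _ l])
   fix s :: real assume s: "s > 0"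
   define A where "A = X ` \<Lambda>"
   have finA: "finite A" using simple_functionD(1)[OF X] sp by (simp add: A_def)
   \<comment> \<open>One share for each value of X; adding 1 keeps the quotient meaningful
     independently of the number of values.\<close>
   define d where "d = s^2 / (real (card A) + 1)"
   have d: "d > 0" "real (card A) * d <= s^2" using s by (auto simp: d_def field_simps)
   have cm: "X -` {a} \<inter> space \<eta> : events" for a using simple_functionD(2)[OF X] .
   have "EX K. compact K & K \<subseteq> X -` {a} \<inter> space \<eta> & prob (X -` {a} \<inter> space \<eta> - K) < d" for a
    using regular[OF finite_measure_axioms se cm[of a] d(1)] by metis
   then obtain K where K: "!!a. compact (K a)" "!!a. K a \<subseteq> X -` {a} \<inter> space \<eta>"
    "!!a. prob (X -` {a} \<inter> space \<eta> - K a) < d" by metis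
   have Ks: "K a : events" for a using sets_compact[OF K(1)] K(2) sp se by auto
   define R where "R = (\<Union>a\<in>A. X -` {a} \<inter> space \<eta> - K a)"
   have Rm: "R : events" unfolding R_def using finA cm Ks by auto
   have "prob R <= (\<Sum>a\<in>A. prob (X -` {a} \<inter> space \<eta> - K a))"
    unfolding R_def by (rule finite_measure_subadditive_finite) (use finA cm Ks in auto)
   also have "\<dots> <= (\<Sum>a\<in>A. d)" by (intro sum_mono less_imp_le K)
   finally have Rs: "prob R <= s^2" using d(2) by simp
   \<comment> \<open>Near x, the open set avoiding all K a that miss x meets only those containing
     x, and the K a are pairwise disjoint.\<close>
   obtain r0 where r0: "r0 > 0" "!!y z. y : \<Lambda> ==> z : \<Lambda> ==> D y z <= r0 ==>
     \<not> (EX a:A. EX b:A. a ~= b & y : K a & z : K b)"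
   proof (rule lebesgue_number[of "%y z. \<not> (EX a:A. EX b:A. a ~= b & y : K a & z : K b)"])
    fix x assume "x : \<Lambda>"
    define U where "U = - (\<Union>a\<in>{a:A. x \<notin> K a}. K a)"
    have "closed (\<Union>a\<in>{a:A. x \<notin> K a}. K a)" using finA K(1) by (intro closed_UN) (auto intro: compact_imp_closed)
    hence "open U" unfolding U_def by (rule open_Compl)
    moreover have "x : U" by (simp add: U_def)
    moreover have "a = b" if "y : U" "z : U" "a : A" "b : A" "y : K a" "z : K b" for y z a b
    proof -
     have "x : K a" "x : K b" using that by (auto simp: U_def)
     thus ?thesis using K(2)[of a] K(2)[of b] by auto
    qed
    ultimately show "EX U. open U & x : U & (ALL y:U \<inter> \<Lambda>. ALL z:U \<inter> \<Lambda>. \<not> (EX a:A. EX b:A. a ~= b & y : K a & z : K b))"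
     by (intro exI[of _ U]) blast
   qed (use that in blast)
   obtain L' where L': "!!x y. x : \<Lambda> ==> y : \<Lambda> ==> (!!j. j <= L' ==> D ((f ^^ j) x) ((f ^^ j) y) <= 64 * \<rho>) ==> D x y <= r0"
    using expansive[OF r0(1)] by blast
   \<comment> \<open>A window of L' + 1 blocks of length n contains times q to q + L' for every q <
     n, which is what expansivity needs after the shift by q.\<close>
   show "EX L R. R : events & prob R <= s^2 &
    (ALL r<n. ALL x:space \<eta>. ALL y:space \<eta>. (ALL i<L. \<xi> ((f ^^ (i * n)) x) = \<xi> ((f ^^ (i * n)) y)) -->
     (f ^^ r) x \<notin> R --> (f ^^ r) y \<notin> R --> X ((f ^^ r) x) = X ((f ^^ r) y))"
   proof (intro exI[of _ "Suc L'"] exI[of _ R] conjI Rm Rs allI ballI impI)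
    fix q x y assume q: "q < n" and xy: "x : space \<eta>" "y : space \<eta>"
     and eq: "ALL i<Suc L'. \<xi> ((f ^^ (i * n)) x) = \<xi> ((f ^^ (i * n)) y)" and nR: "(f ^^ q) x \<notin> R" "(f ^^ q) y \<notin> R"
    have L: "x : \<Lambda>" "y : \<Lambda>" using xy sp by auto
    have near: "D ((f ^^ j) x) ((f ^^ j) y) <= 64 * \<rho>" if "j < Suc L' * n" for j
    proof -
     define i t where "i = j div n" and "t = j mod n"
     have jt: "j = t + i * n" "t <= n" "i < Suc L'"
      using n that less_mult_imp_div_less[OF that] by (auto simp: i_def t_def less_imp_le)
     have "D ((f ^^ t) ((f ^^ (i * n)) x)) ((f ^^ t) ((f ^^ (i * n)) y)) <= 64 * \<rho>"
      by (rule gen) (use funpow_mem L eq jt in auto)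
     thus ?thesis by (simp add: jt(1) funpow_add)
    qed
    have "D ((f ^^ q) x) ((f ^^ q) y) <= r0"
    proof (rule L')
     fix j assume "j <= L'"
     moreover have "L' * 1 <= L' * n" using n by (intro mult_le_mono) auto
     ultimately have "j + q < Suc L' * n" unfolding mult_Suc mult_1_right using q by linarith
     from near[OF this] show "D ((f ^^ j) ((f ^^ q) x)) ((f ^^ j) ((f ^^ q) y)) <= 64 * \<rho>" by (simp add: funpow_add)
    qed (use funpow_mem L in auto)
    hence no: "\<not> (EX a:A. EX b:A. a ~= b & (f ^^ q) x : K a & (f ^^ q) y : K b)"
     using r0(2) funpow_mem L by blast
    have inK: "z : K (X z) & X z : A" if "z : \<Lambda>" "z \<notin> R" for z
     using that sp unfolding R_def A_def by auto
    show "X ((f ^^ q) x) = X ((f ^^ q) y)"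
     using no inK[OF funpow_mem[OF L(1)] nR(1)] inK[OF funpow_mem[OF L(2)] nR(2)] by blast
   qed
  qed
 qed
qed

text \<open>Cells around points of a separated set are split into those meeting A and the others.
  The disjoint 2 \<rho>-balls of the former lie in V, so the lower Gibbs bound makes their total
  weight small by the factor v, and the entropy drops by \<eta>(A) times - ln v. With A and V empty
  this is the variational inequality; with A carrying \<eta>-mass but no \<mu>-mass it forces
  absolute continuity. The constant is C for centres against cells, C for the mean, c from Gibbs and
  1 for each part of the split.\<close>

lemma entropy_estimate:
 assumes tame: "tame C \<Theta>" and \<eta>: "\<eta> : invariant_measures \<Lambda> f"
  and \<mu>: "prob_space \<mu>" "sets \<mu> = sets borel\<Lambda>"
  and lower: "!!m x. m >= 1 ==> x : \<Lambda> ==> exp (\<Theta> m x - real m * P - c) <= measure \<mu> (bowen m x (2 * \<rho>))"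
  and n: "n >= 1" and A: "A : sets borel\<Lambda>" and V: "V : sets borel\<Lambda>" "measure \<mu> V <= v" "0 < v" "v <= 1"
  and AV: "!!e. e : \<Lambda> ==> bowen n e (20 * \<rho>) \<inter> A ~= {} ==> bowen n e (2 * \<rho>) \<subseteq> V"
 shows "metric_entropy f \<eta> <= ereal (P - mean_potential \<Theta> \<eta> + (2 * C + c + 2 + measure \<eta> A * ln v) / real n)"
proof -
 interpret measure_preserving \<eta> f by (rule invariant_measuresD(4)[OF \<eta>])
 interpret \<mu>: prob_space \<mu> by (rule \<mu>)
 note sp = invariant_measuresD(3)[OF \<eta>] and se = invariant_measuresD(2)[OF \<eta>]
 obtain E where E: "finite E" "E \<subseteq> \<Lambda>" "!!y. y : \<Lambda> ==> EX e:E. y : bowen n e (20 * \<rho>)"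
  "!!e e'. e : E ==> e' : E ==> e ~= e' ==> e' \<notin> bowen n e (10 * \<rho>)"
  using separated_cover[of n] by blast
 obtain \<xi> where \<xi>: "simple_function \<eta> \<xi>" "!!x. x : space \<eta> ==> \<xi> x : E & x : bowen n (\<xi> x) (20 * \<rho>)"
 proof (rule simple_function_selector[of E "%e. bowen n e (20 * \<rho>)" \<eta>])
  show "space \<eta> \<subseteq> (\<Union>e\<in>E. bowen n e (20 * \<rho>))" using E(3) sp by auto
 qed (use E sets_bowen se in auto)
 have gen: "D ((f ^^ j) x) ((f ^^ j) y) <= 64 * \<rho>" if "x : \<Lambda>" "y : \<Lambda>" "\<xi> x = \<xi> y" "j <= n" for x y j
 proof -
  have "x : bowen n (\<xi> x) (20 * \<rho>)" "y : bowen n (\<xi> x) (20 * \<rho>)"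
   using \<xi>(2)[of x] \<xi>(2)[of y] that sp by auto
  hence "y : bowen n x (20 * \<rho> + 20 * \<rho>)" by (rule bowen_triangle)
  hence "D ((f ^^ j) x) ((f ^^ j) y) <= 20 * \<rho> + 20 * \<rho>" using that by (simp add: bowen_def)
  thus ?thesis using \<rho>_pos by linarith
 qed
 define p where "p e = prob (\<xi> -` {e} \<inter> space \<eta>)" for e
 have im: "\<xi> ` space \<eta> \<subseteq> E" using \<xi>(2) by auto
 have fe: "fent \<eta> \<xi> = (\<Sum>e\<in>E. ent (p e))" unfolding p_def by (rule fent_superset[OF E(1) im])
 have p0: "p e = 0" if "e : E - \<xi> ` space \<eta>" for e
 proof -
  have "\<xi> -` {e} \<inter> space \<eta> = {}" using that by auto
  thus ?thesis by (simp add: p_def)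
 qed
 have int: "(\<Sum>e\<in>E. p e * t e) = (\<integral>y. t (\<xi> y) \<partial>\<eta>)" for t :: "'m => real"
 proof -
  have "(\<Sum>e\<in>E. p e * t e) = (\<Sum>e\<in>\<xi> ` space \<eta>. p e * t e)"
   by (rule sum.mono_neutral_right) (use E im p0 in auto)
  thus ?thesis using sum_fiber_eq_integral(2)[OF \<xi>(1), of t] by (simp add: p_def)
 qed
 have ps: "(\<Sum>e\<in>E. p e) = 1" using int[of "%_. 1"] by (simp add: prob_space)
 have int\<Theta>: "(\<integral>y. \<Theta> n y \<partial>\<eta>) <= (\<Sum>e\<in>E. p e * \<Theta> n e) + C"
 proof -
  note i\<Theta> = integrable_\<Theta>[OF tame \<eta> n] and i\<xi> = sum_fiber_eq_integral(1)[OF \<xi>(1), of "\<Theta> n"]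
  have "(\<integral>y. \<Theta> n y \<partial>\<eta>) <= (\<integral>y. \<Theta> n (\<xi> y) + C \<partial>\<eta>)"
  proof (rule integral_mono[OF i\<Theta>])
   show "integrable \<eta> (%y. \<Theta> n (\<xi> y) + C)" using i\<xi> by simp
   fix y assume "y : space \<eta>"
   hence "\<xi> y : \<Lambda>" "y : bowen n (\<xi> y) (20 * \<rho>)" using \<xi>(2) E(2) by auto
   from \<Theta>_bowen[OF tame n this] show "\<Theta> n y <= \<Theta> n (\<xi> y) + C" using \<rho>_pos by simp
  qed
  also have "\<dots> = (\<Sum>e\<in>E. p e * \<Theta> n e) + C" unfolding int using i\<xi> by (simp add: prob_space)
  finally show ?thesis .
 qed
 define W where "W = {e:E. bowen n e (20 * \<rho>) \<inter> A ~= {}}"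
 have WE: "W \<subseteq> E" "finite W" "finite (E - W)" using E(1) by (auto simp: W_def)
 define q where "q = (\<Sum>e\<in>W. p e)"
 have q1: "(\<Sum>e\<in>E - W. p e) = 1 - q" unfolding q_def using sum.subset_diff[OF WE(1) E(1), of p] ps by simp
 have pnn: "0 <= p e" for e by (simp add: p_def)
 have q01: "0 <= q" "q <= 1" using q1 sum_nonneg[of "E - W" p] sum_nonneg[of W p] pnn by (auto simp: q_def)
 have qA: "prob A <= q"
 proof -
  have "prob A <= prob (\<Union>e\<in>W. \<xi> -` {e} \<inter> space \<eta>)"
  proof (rule finite_measure_mono)
   show "A \<subseteq> (\<Union>e\<in>W. \<xi> -` {e} \<inter> space \<eta>)"
   proof
    fix x assume x: "x : A"
    hence "x : space \<eta>" using A se sets.sets_into_space by blast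
    thus "x : (\<Union>e\<in>W. \<xi> -` {e} \<inter> space \<eta>)" using \<xi>(2)[of x] x by (auto simp: W_def)
   qed
   show "(\<Union>e\<in>W. \<xi> -` {e} \<inter> space \<eta>) : events" 
    using simple_functionD(2)[OF \<xi>(1)] WE by (intro sets.finite_UN) simp_all
  qed
  also have "\<dots> <= q" unfolding q_def p_def
   by (rule finite_measure_subadditive_finite) (use simple_functionD(2)[OF \<xi>(1)] WE in auto)
  finally show ?thesis .
 qed
 \<comment> \<open>Lower Gibbs bounds turn weights into measures of disjoint balls, so the sum is
   bounded by the measure of a union.\<close>
 have sumexp: "(\<Sum>e\<in>S. exp (\<Theta> n e)) <= exp (real n * P + c) * u"
  if S: "S \<subseteq> E" "finite S" and u: "measure \<mu> (\<Union>e\<in>S. bowen n e (2 * \<rho>)) <= u" for S u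
 proof -
  have "(\<Sum>e\<in>S. exp (\<Theta> n e)) <= (\<Sum>e\<in>S. exp (real n * P + c) * measure \<mu> (bowen n e (2 * \<rho>)))"
  proof (rule sum_mono)
   fix e assume "e : S"
   hence "exp (\<Theta> n e - real n * P - c) <= measure \<mu> (bowen n e (2 * \<rho>))" using lower[OF n] S E by auto
   hence "exp (real n * P + c) * exp (\<Theta> n e - real n * P - c) <= exp (real n * P + c) * measure \<mu> (bowen n e (2 * \<rho>))" by simp
   thus "exp (\<Theta> n e) <= exp (real n * P + c) * measure \<mu> (bowen n e (2 * \<rho>))" by (simp add: mult_exp_exp)
  qed
  also have "\<dots> = exp (real n * P + c) * measure \<mu> (\<Union>e\<in>S. bowen n e (2 * \<rho>))"
  proof -
   have "measure \<mu> (\<Union>e\<in>S. bowen n e (2 * \<rho>)) = (\<Sum>e\<in>S. measure \<mu> (bowen n e (2 * \<rho>)))"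
   proof (rule \<mu>.finite_measure_finite_Union[OF S(2)])
    show "(%e. bowen n e (2 * \<rho>)) ` S \<subseteq> sets \<mu>" using sets_bowen S E \<mu> by auto
    show "disjoint_family_on (%e. bowen n e (2 * \<rho>)) S"
     unfolding disjoint_family_on_def
    proof (intro ballI impI)
     fix e e' assume e: "e : S" "e' : S" "e ~= e'"
     have eL: "e : \<Lambda>" "e' : \<Lambda>" using e S E by auto
     show "bowen n e (2 * \<rho>) \<inter> bowen n e' (2 * \<rho>) = {}"
     proof (rule ccontr)
      assume "\<not> ?thesis"
      then obtain y where "y : bowen n e (2 * \<rho>)" "y : bowen n e' (2 * \<rho>)" by auto
      hence "e' : bowen n e (2 * \<rho> + 2 * \<rho>)" using bowen_triangle bowen_commute eL by meson
      hence "e' : bowen n e (10 * \<rho>)" using bowen_mono[of "2 * \<rho> + 2 * \<rho>" "10 * \<rho>"] \<rho>_pos by auto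
      thus False using E(4) e S by auto
     qed
    qed
   qed
   thus ?thesis by (simp add: sum_distrib_left)
  qed
  also have "\<dots> <= exp (real n * P + c) * u" using u by simp
  finally show ?thesis .
 qed
 have ent1: "ent t <= 1" if "0 <= t" "t <= 1" for t
  using ent_le_sqrt[OF that] that real_sqrt_le_1_iff[of t] by linarith
 have W1: "(\<Sum>e\<in>W. ent (p e) + p e * \<Theta> n e) <= q * (real n * P + c + ln v) + 1"
 proof -
  have "measure \<mu> (\<Union>e\<in>W. bowen n e (2 * \<rho>)) <= measure \<mu> V"
   using V AV E(2) \<mu> by (intro \<mu>.finite_measure_mono) (auto simp: W_def)
  hence "(\<Sum>e\<in>W. exp (\<Theta> n e)) <= exp (real n * P + c) * v" using sumexp[OF WE(1,2)] V by simp
  from log_sum_inequality[OF WE(2) _ _ this, of p]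
  have "(\<Sum>e\<in>W. ent (p e) + p e * \<Theta> n e) <= q * ln (exp (real n * P + c) * v) + ent q" using pnn V by (simp add: q_def)
  also have "ln (exp (real n * P + c) * v) = real n * P + c + ln v" using V by (simp add: ln_mult)
  finally show ?thesis using ent1[OF q01] by linarith
 qed
 have W2: "(\<Sum>e\<in>E - W. ent (p e) + p e * \<Theta> n e) <= (1 - q) * (real n * P + c) + 1"
 proof -
  have "(\<Sum>e\<in>E - W. exp (\<Theta> n e)) <= exp (real n * P + c) * 1" by (rule sumexp[OF _ WE(3)]) auto
  hence "(\<Sum>e\<in>E - W. exp (\<Theta> n e)) <= exp (real n * P + c)" by simp
  from log_sum_inequality[OF WE(3) _ _ this, of p]
  have "(\<Sum>e\<in>E - W. ent (p e) + p e * \<Theta> n e) <= (1 - q) * (real n * P + c) + ent (1 - q)" using pnn by (simp add: q1)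
  thus ?thesis using ent1[of "1 - q"] q01 by linarith
 qed
 have "fent \<eta> \<xi> + (\<Sum>e\<in>E. p e * \<Theta> n e) = (\<Sum>e\<in>E. ent (p e) + p e * \<Theta> n e)" by (simp add: fe sum.distrib)
 also have "\<dots> = (\<Sum>e\<in>W. ent (p e) + p e * \<Theta> n e) + (\<Sum>e\<in>E - W. ent (p e) + p e * \<Theta> n e)"
  using sum.subset_diff[OF WE(1) E(1)] by (simp add: add.commute)
 also have "\<dots> <= real n * P + c + 2 + q * ln v" using W1 W2 by (simp add: algebra_simps)
 also have "\<dots> <= real n * P + c + 2 + prob A * ln v"
  using qA V by (simp add: mult_right_mono_neg)
 finally have "fent \<eta> \<xi> <= real n * P + c + 2 + prob A * ln v + C - (\<integral>y. \<Theta> n y \<partial>\<eta>)" using int\<Theta> by linarith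
 also have "\<dots> <= real n * P + c + 2 + prob A * ln v + 2 * C - real n * mean_potential \<Theta> \<eta>"
  using mean_potential_bound(1)[OF tame \<eta> n] by linarith
 finally have "fent \<eta> \<xi> / real n <= (real n * P + c + 2 + prob A * ln v + 2 * C - real n * mean_potential \<Theta> \<eta>) / real n"
  by (intro divide_right_mono) auto
 also have "\<dots> = P - mean_potential \<Theta> \<eta> + (2 * C + c + 2 + prob A * ln v) / real n"
  using n by (simp add: field_simps)
 finally have "ereal (fent \<eta> \<xi> / real n) <= ereal (P - mean_potential \<Theta> \<eta> + (2 * C + c + 2 + prob A * ln v) / real n)" by simp
 thus ?thesis using entropy_le_partition[OF \<eta> \<xi>(1) n gen] by (rule order_trans[rotated])
qed

end

section \<open>Absolute continuity, ergodicity and uniqueness\<close>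

context expanding_map
begin

lemma gibbs_entropy_upper:
 assumes tame: "tame C \<Theta>" and \<eta>: "\<eta> : invariant_measures \<Lambda> f"
  and \<mu>: "prob_space \<mu>" "sets \<mu> = sets borel\<Lambda>"
  and lower: "!!m x. m >= 1 ==> x : \<Lambda> ==> exp (\<Theta> m x - real m * P - c) <= measure \<mu> (bowen m x (2 * \<rho>))"
 shows "metric_entropy f \<eta> <= ereal (P - mean_potential \<Theta> \<eta>)"
proof -
 let ?h = "P - mean_potential \<Theta> \<eta>"
 have est: "metric_entropy f \<eta> <= ereal (?h + (2 * C + c + 2) / real n)" if n: "n >= 1" for n
  using entropy_estimate[OF tame \<eta> \<mu> lower n, of "{}" "{}" 1] by simp
 have lim: "(%n. ereal (?h + (2 * C + c + 2) / real n)) \<longlonglongrightarrow> ereal (?h + 0)"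
  by (intro tendsto_ereal tendsto_add tendsto_const lim_const_over_n)
 have "metric_entropy f \<eta> <= ereal (?h + 0)"
  by (rule tendsto_lowerbound[OF lim]) (use est in \<open>auto simp: eventually_sequentially intro!: exI[of _ 1]\<close>)
 thus ?thesis by simp
qed

text \<open>Expansivity shrinks Bowen balls of radius up to 64 \<rho> uniformly as the order grows;
  a + b adds the radii of the ball meeting A and of the ball to be enclosed.\<close>

lemma bowen_subset_nbhd:
 assumes r: "r > 0" and A: "A \<subseteq> \<Lambda>"
 obtains L where "!!n e a b. n >= L ==> e : \<Lambda> ==> a + b <= 64 ==> bowen n e (a * \<rho>) \<inter> A ~= {} ==> bowen n e (b * \<rho>) \<subseteq> nbhd A r"
proof -
 obtain L where L: "!!x y. x : \<Lambda> ==> y : \<Lambda> ==> (!!j. j <= L ==> D ((f ^^ j) x) ((f ^^ j) y) <= 64 * \<rho>) ==> D x y <= r / 2"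
  using expansive[of "r / 2"] r by (metis half_gt_zero)
 show ?thesis
 proof (rule that[of L], rule subsetI)
  fix n e a b w
  assume n: "n >= L" and e: "e : \<Lambda>" and ab: "a + b <= 64" and ne: "bowen n e (a * \<rho>) \<inter> A ~= {}" and w: "w : bowen n e (b * \<rho>)"
  obtain u where u: "u : bowen n e (a * \<rho>)" "u : A" using ne by auto
  have "w : bowen n u (a * \<rho> + b * \<rho>)" by (rule bowen_triangle[OF u(1) w])
  moreover have "a * \<rho> + b * \<rho> <= 64 * \<rho>" using ab \<rho>_pos by (simp flip: distrib_right)
  ultimately have "w : \<Lambda>" "ALL j<=n. D ((f ^^ j) u) ((f ^^ j) w) <= 64 * \<rho>" by (auto simp: bowen_def intro: order_trans)
  moreover have "u : \<Lambda>" using u A by auto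
  ultimately have "D u w <= r / 2" using n by (intro L) auto
  thus "w : nbhd A r" using u \<open>w : \<Lambda>\<close> r by (auto simp: nbhd_def intro!: bexI[of _ u])
 qed
qed

text \<open>If \<eta> charged a \<mu>-null set, a compact part of it would have neighbourhoods of
  arbitrarily small \<mu>-measure v. The term with ln v in \<open>entropy_estimate\<close> would
  then outweigh the constants and push the entropy of \<eta> strictly below its equilibrium
  value.\<close>

lemma equilibrium_absolutely_continuous:
 assumes tame: "tame C \<Theta>" and \<eta>: "\<eta> : invariant_measures \<Lambda> f"
  and \<mu>: "prob_space \<mu>" "sets \<mu> = sets borel\<Lambda>"
  and lower: "!!m x. m >= 1 ==> x : \<Lambda> ==> exp (\<Theta> m x - real m * P - c) <= measure \<mu> (bowen m x (2 * \<rho>))"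
  and eq: "ereal (P - mean_potential \<Theta> \<eta>) <= metric_entropy f \<eta>"
  and A: "A : sets borel\<Lambda>" "measure \<mu> A = 0"
 shows "measure \<eta> A = 0"
proof (rule ccontr)
 assume "measure \<eta> A ~= 0"
 then have a: "measure \<eta> A > 0" using measure_nonneg[of \<eta> A] by linarith
 interpret \<mu>: prob_space \<mu> by (rule \<mu>)
 interpret \<eta>: prob_space \<eta> by (rule invariant_measuresD(1)[OF \<eta>])
 note se = invariant_measuresD(2)[OF \<eta>]
 define a where "a = measure \<eta> A"
 have a0: "a > 0" using a by (simp add: a_def)
 obtain B where B: "compact B" "B \<subseteq> A" "measure \<eta> (A - B) < a / 2"
  using regular[OF \<eta>.finite_measure_axioms se, of A "a/2"] A(1) se a0 by auto
 have BL: "B \<subseteq> \<Lambda>" using B sets.sets_into_space[OF A(1)] by auto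
 have Bs: "B : sets borel\<Lambda>" by (rule sets_compact[OF B(1) BL])
 have "measure \<eta> (A - B) = a - measure \<eta> B" unfolding a_def
  using A(1) Bs se B by (intro \<eta>.finite_measure_Diff) auto
 hence Bp: "measure \<eta> B > a / 2" using B by linarith
 have "measure \<mu> B <= measure \<mu> A" using B A \<mu> by (intro \<mu>.finite_measure_mono) auto
 hence mB: "measure \<mu> B = 0" using A measure_nonneg[of \<mu> B] by linarith
 define M where "M = \<bar>2 * C + c + 2\<bar>"
 \<comment> \<open>Chosen so that (a / 2) ln v = - M - 1, one less than what the constants can
   compensate.\<close>
 define v where "v = exp (- ((2 * M + 2) / a))"
 have v: "0 < v" "v <= 1" "ln v = - ((2 * M + 2) / a)" using a0 by (auto simp: v_def M_def)
 obtain r where r: "r > 0" "measure \<mu> (nbhd B r - B) < v"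
  using measure_nbhd_tendsto[OF \<mu>.finite_measure_axioms \<mu>(2) B(1) BL v(1)] by metis
 have nb: "nbhd B r : sets borel\<Lambda>" by (rule sets_nbhd[OF BL])
 have BN: "B \<subseteq> nbhd B r" using BL r by (force simp: nbhd_def)
 have "measure \<mu> (nbhd B r - B) = measure \<mu> (nbhd B r) - measure \<mu> B"
  using nb Bs \<mu> BN by (intro \<mu>.finite_measure_Diff) auto
 hence nv: "measure \<mu> (nbhd B r) <= v" using mB r by linarith
 obtain L where L: "!!n e a b. n >= L ==> e : \<Lambda> ==> a + b <= 64 ==> bowen n e (a * \<rho>) \<inter> B ~= {} ==> bowen n e (b * \<rho>) \<subseteq> nbhd B r"
  using bowen_subset_nbhd[OF r(1) BL] by metis
 define n where "n = Suc L"
 have n: "n >= 1" "n >= L" by (auto simp: n_def)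
 have "metric_entropy f \<eta> <= ereal (P - mean_potential \<Theta> \<eta> + (2 * C + c + 2 + measure \<eta> B * ln v) / real n)"
  by (rule entropy_estimate[OF tame \<eta> \<mu> lower n(1) Bs nb nv v(1,2)]) (use L[OF n(2), of _ 20 2] in auto)
 hence "ereal (P - mean_potential \<Theta> \<eta>) <= ereal (P - mean_potential \<Theta> \<eta> + (2 * C + c + 2 + measure \<eta> B * ln v) / real n)"
  using eq order_trans by blast
 hence "0 <= (2 * C + c + 2 + measure \<eta> B * ln v) / real n" by simp
 hence "0 <= 2 * C + c + 2 + measure \<eta> B * ln v" using n by (simp add: zero_le_divide_iff)
 moreover have "measure \<eta> B * ln v <= (a / 2) * ln v"
  using Bp v a0 by (intro mult_right_mono_neg) (auto simp: M_def)
 moreover have "(a / 2) * ln v = - M - 1" using a0 v by (simp add: field_simps)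
 ultimately show False unfolding M_def by linarith
qed

text \<open>The Gibbs bounds give a quasi-independence: balls of order n around points e and e' can
  be joined by specification into disjoint balls of order n + N + n, whose measure is at least a
  fixed multiple of the product. So, after a gap, A would flow into its complement with positive
  measure.\<close>

lemma gibbs_ergodic:
 assumes tame: "tame C \<Theta>" and \<mu>: "\<mu> : invariant_measures \<Lambda> f" and gibbs: "gibbs 2 30 c P \<Theta> \<mu>"
  and A: "A : sets borel\<Lambda>" and inv: "!!n. measure \<mu> (A \<inter> (f ^^ n) -` (\<Lambda> - A)) = 0"
 shows "measure \<mu> A = 0 \<or> measure \<mu> (\<Lambda> - A) = 0"
proof (rule ccontr)
 assume neg: "\<not> ?thesis"
 interpret measure_preserving \<mu> f by (rule invariant_measuresD(4)[OF \<mu>])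
 note sp = invariant_measuresD(3)[OF \<mu>] and se = invariant_measuresD(2)[OF \<mu>]
 define A' where "A' = \<Lambda> - A"
 have A': "A' : sets borel\<Lambda>" using sets.compl_sets[OF A] by (simp add: A'_def)
 define a a' where "a = prob A" and "a' = prob A'"
 have a: "a > 0" "a' > 0" using neg measure_nonneg[of \<mu>] by (auto simp: a_def a'_def A'_def less_le)
 have inner: "EX B. compact B & B \<subseteq> S & B : sets borel\<Lambda> & prob S / 2 <= prob B"
  if S: "S : sets borel\<Lambda>" "prob S > 0" for S
 proof -
  obtain B where B: "compact B" "B \<subseteq> S" "prob (S - B) < prob S / 2"
   using regular[OF finite_measure_axioms se, of S "prob S / 2"] S se by auto
  have BL: "B \<subseteq> \<Lambda>" using B sets.sets_into_space[OF S(1)] by auto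
  have Bs: "B : sets borel\<Lambda>" by (rule sets_compact[OF B(1) BL])
  have "prob (S - B) = prob S - prob B" using S Bs se B by (intro finite_measure_Diff) auto
  thus ?thesis using B Bs by (intro exI[of _ B]) auto
 qed
 obtain B where B: "compact B" "B \<subseteq> A" "B : sets borel\<Lambda>" "a / 2 <= prob B"
  using inner[OF A] a by (auto simp: a_def)
 obtain B' where B': "compact B'" "B' \<subseteq> A'" "B' : sets borel\<Lambda>" "a' / 2 <= prob B'"
  using inner[OF A'] a by (auto simp: a'_def)
 have BL: "B \<subseteq> \<Lambda>" "B' \<subseteq> \<Lambda>" using sets.sets_into_space[OF B(3)] sets.sets_into_space[OF B'(3)] by auto
 \<comment> \<open>4 C from splitting \<Theta> along the joined orbit, 3 c from one lower and two
   upper Gibbs bounds, and N P from the steps in the gap.\<close>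
 define \<kappa> where "\<kappa> = exp (- 4 * C - 3 * c - real N * P)"
 \<comment> \<open>The two neighbourhoods together lose strictly less than 2 \<tau>, which is
   exactly the lower bound \<kappa> (a / 2) (a' / 2) for the flow.\<close>
 define \<tau> where "\<tau> = \<kappa> * a * a' / 8"
 have \<tau>: "\<tau> > 0" unfolding \<tau>_def \<kappa>_def using a by simp
 obtain r where r: "r > 0" "prob (nbhd B r - B) < \<tau>"
  using measure_nbhd_tendsto[OF finite_measure_axioms se B(1) BL(1) \<tau>] by metis
 obtain r' where r': "r' > 0" "prob (nbhd B' r' - B') < \<tau>"
  using measure_nbhd_tendsto[OF finite_measure_axioms se B'(1) BL(2) \<tau>] by metis
 obtain L where L: "!!n e a b. n >= L ==> e : \<Lambda> ==> a + b <= 64 ==> bowen n e (a * \<rho>) \<inter> B ~= {} ==> bowen n e (b * \<rho>) \<subseteq> nbhd B r"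
  using bowen_subset_nbhd[OF r(1) BL(1)] by metis
 obtain L' where L': "!!n e a b. n >= L' ==> e : \<Lambda> ==> a + b <= 64 ==> bowen n e (a * \<rho>) \<inter> B' ~= {} ==> bowen n e (b * \<rho>) \<subseteq> nbhd B' r'"
  using bowen_subset_nbhd[OF r'(1) BL(2)] by metis
 define n where "n = Suc (L + L')"
 have n: "n >= 1" "n >= L" "n >= L'" by (auto simp: n_def)
 obtain E where E: "finite E" "E \<subseteq> \<Lambda>" "!!y. y : \<Lambda> ==> EX e:E. y : bowen n e (20 * \<rho>)"
  "!!e e'. e : E ==> e' : E ==> e ~= e' ==> e' \<notin> bowen n e (10 * \<rho>)"
  using separated_cover[of n] by blast
 define W where "W = {e:E. bowen n e (20 * \<rho>) \<inter> B ~= {}}"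
 define W' where "W' = {e:E. bowen n e (20 * \<rho>) \<inter> B' ~= {}}"
 have W: "finite W" "W \<subseteq> \<Lambda>" "finite W'" "W' \<subseteq> \<Lambda>" "W \<subseteq> E" "W' \<subseteq> E" using E by (auto simp: W_def W'_def)
 have "ALL e:\<Lambda>. ALL e':\<Lambda>. EX z. z : bowen n e \<rho> & (f ^^ (n + N)) z = e'"
 proof (intro ballI)
  fix e e' assume "e : \<Lambda>" "e' : \<Lambda>"
  from specif[OF this, of n] show "EX z. z : bowen n e \<rho> & (f ^^ (n + N)) z = e'" by (auto simp: bowen_def)
 qed
 then obtain z where z: "!!e e'. e : \<Lambda> ==> e' : \<Lambda> ==> z e e' : bowen n e \<rho>"
  "!!e e'. e : \<Lambda> ==> e' : \<Lambda> ==> (f ^^ (n + N)) (z e e') = e'" by metis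
 have zL: "z e e' : \<Lambda>" if "e : \<Lambda>" "e' : \<Lambda>" for e e' using z(1)[OF that] by (simp add: bowen_def)
 \<comment> \<open>Points following e for n steps and then, after the gap, e' for n steps. The
   radius 2 \<rho> is that of the lower Gibbs bound.\<close>
 define T where "T e e' = bowen (n + N + n) (z e e') (2 * \<rho>)" for e e'
 have T1: "y : bowen n e (3 * \<rho>)" and T2: "(f ^^ (n + N)) y : bowen n e' (2 * \<rho>)"
  if e: "e : \<Lambda>" "e' : \<Lambda>" and y: "y : T e e'" for e e' y
 proof -
  have "y : bowen n (z e e') (2 * \<rho>)" using y by (auto simp: T_def bowen_def)
  hence "y : bowen n e (\<rho> + 2 * \<rho>)" using z(1)[OF e] bowen_commute[OF e(1)] bowen_triangle bowen_commute[OF zL[OF e]]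
   by (metis bowen_triangle bowen_commute e(1) zL[OF e])
  thus "y : bowen n e (3 * \<rho>)" by simp
  have "D ((f ^^ j) e') ((f ^^ j) ((f ^^ (n + N)) y)) <= 2 * \<rho>" if j: "j <= n" for j
  proof -
   have "D ((f ^^ (j + (n + N))) (z e e')) ((f ^^ (j + (n + N))) y) <= 2 * \<rho>"
    using y j by (simp add: T_def bowen_def)
   thus ?thesis by (simp only: funpow_add o_apply z(2)[OF e, unfolded funpow_add o_apply])
  qed
  thus "(f ^^ (n + N)) y : bowen n e' (2 * \<rho>)" using y funpow_mem by (auto simp: T_def bowen_def)
 qed
 have disj: "e1 = e2" if e: "e1 : E" "e2 : E" and y: "y : bowen n e1 (5 * \<rho>)" "y : bowen n e2 (5 * \<rho>)" for e1 e2 y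
 proof (rule ccontr)
  assume ne: "e1 ~= e2"
  have eL: "e1 : \<Lambda>" "e2 : \<Lambda>" using e E by auto
  have "y : bowen n e1 (5 * \<rho>)" "e2 : bowen n y (5 * \<rho>)" using y bowen_commute[OF eL(2)] by auto
  moreover have "e1 : bowen n y (5 * \<rho>)" using y bowen_commute[OF eL(1)] by auto
  ultimately have "e2 : bowen n e1 (5 * \<rho> + 5 * \<rho>)" using bowen_triangle by blast
  thus False using E(4)[OF e ne] by simp
 qed
 have small: "bowen n e (b * \<rho>) \<subseteq> bowen n e (5 * \<rho>)" if "b <= 5" for e b
  by (rule bowen_mono) (use that \<rho>_pos in auto)
 have Ts: "T e e' : events" if "e : \<Lambda>" "e' : \<Lambda>" for e e' unfolding T_def se by (rule sets_bowen[OF zL[OF that]])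
 have Tlow: "\<kappa> * (prob (bowen n e (20 * \<rho>)) * prob (bowen n e' (20 * \<rho>))) <= prob (T e e')"
  if e: "e : \<Lambda>" "e' : \<Lambda>" for e e'
 proof -
  let ?z = "z e e'"
  have gl: "exp (\<Theta> (n + N + n) ?z - real (n + N + n) * P - c) <= prob (T e e')"
  proof -
   have "n + N + n >= 1" using n by simp
   thus ?thesis unfolding T_def using gibbs zL[OF e] unfolding gibbs_def by blast
  qed
  have gu: "prob (bowen n x (20 * \<rho>)) <= exp (\<Theta> n x - real n * P + c)" if "x : \<Lambda>" for x
  proof -
   have "prob (bowen n x (20 * \<rho>)) <= prob (bowen n x (30 * \<rho>))"
    using bowen_mono[of "20 * \<rho>" "30 * \<rho>"] \<rho>_pos sets_bowen[OF that] se by (intro finite_measure_mono) auto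
   thus ?thesis using gibbs that n unfolding gibbs_def by force
  qed
  have "\<bar>\<Theta> (n + (N + n)) ?z - \<Theta> n ?z - \<Theta> (N + n) ((f ^^ n) ?z)\<bar> <= C" by (rule \<Theta>_add[OF tame n(1) _ zL[OF e]]) (use n in simp)
  moreover have "\<bar>\<Theta> (N + n) ((f ^^ n) ?z) - \<Theta> N ((f ^^ n) ?z) - \<Theta> n ((f ^^ N) ((f ^^ n) ?z))\<bar> <= C"
   by (rule \<Theta>_add[OF tame N_pos n(1) funpow_mem[OF zL[OF e]]])
  moreover have "(f ^^ N) ((f ^^ n) ?z) = e'" using z(2)[OF e] by (simp add: add.commute[of n] funpow_add)
  moreover have "\<bar>\<Theta> N ((f ^^ n) ?z)\<bar> <= C" by (rule \<Theta>_N[OF tame funpow_mem[OF zL[OF e]]])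
  moreover have "\<bar>\<Theta> n e - \<Theta> n ?z\<bar> <= C" by (rule \<Theta>_bowen[OF tame n(1) e(1) z(1)[OF e]]) (use \<rho>_pos in simp)
  ultimately have \<Theta>: "\<Theta> n e + \<Theta> n e' - 4 * C <= \<Theta> (n + N + n) ?z" by (simp add: add.assoc)
  have "\<kappa> * (prob (bowen n e (20 * \<rho>)) * prob (bowen n e' (20 * \<rho>)))
   <= \<kappa> * (exp (\<Theta> n e - real n * P + c) * exp (\<Theta> n e' - real n * P + c))"
   by (intro mult_left_mono mult_mono gu e) (auto simp: \<kappa>_def)
  also have "\<dots> <= exp (\<Theta> (n + N + n) ?z - real (n + N + n) * P - c)"
   unfolding \<kappa>_def mult_exp_exp exp_le_cancel_iff using \<Theta> by (simp add: algebra_simps)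
  finally show ?thesis using gl by linarith
 qed
 have cover: "prob S <= (\<Sum>e\<in>{e:E. bowen n e (20 * \<rho>) \<inter> S ~= {}}. prob (bowen n e (20 * \<rho>)))"
  if S: "S : sets borel\<Lambda>" for S
 proof -
  let ?W = "{e:E. bowen n e (20 * \<rho>) \<inter> S ~= {}}"
  have fW: "finite ?W" using E by simp
  have sW: "(%e. bowen n e (20 * \<rho>)) ` ?W \<subseteq> events" using E sets_bowen se by auto
  have "S \<subseteq> (\<Union>e\<in>?W. bowen n e (20 * \<rho>))"
  proof
   fix y assume y: "y : S"
   hence "y : \<Lambda>" using sets.sets_into_space[OF S] by auto
   then obtain e where "e : E" "y : bowen n e (20 * \<rho>)" using E(3) by blast
   thus "y : (\<Union>e\<in>?W. bowen n e (20 * \<rho>))" using y by blast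
  qed
  hence "prob S <= prob (\<Union>e\<in>?W. bowen n e (20 * \<rho>))"
   using fW sW by (intro finite_measure_mono) auto
  also have "\<dots> <= (\<Sum>e\<in>?W. prob (bowen n e (20 * \<rho>)))"
   by (rule finite_measure_subadditive_finite[OF fW sW])
  finally show ?thesis .
 qed
 define V where "V = (\<Union>p\<in>W \<times> W'. T (fst p) (snd p))"
 have "\<kappa> * (prob B * prob B') <= \<kappa> * ((\<Sum>e\<in>W. prob (bowen n e (20 * \<rho>))) * (\<Sum>e'\<in>W'. prob (bowen n e' (20 * \<rho>))))"
  using cover[OF B(3)] cover[OF B'(3)] unfolding W_def W'_def
  by (intro mult_left_mono mult_mono sum_nonneg) (auto simp: \<kappa>_def)
 also have "\<dots> = (\<Sum>p\<in>W \<times> W'. \<kappa> * (prob (bowen n (fst p) (20 * \<rho>)) * prob (bowen n (snd p) (20 * \<rho>))))"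
  unfolding sum_product sum.cartesian_product by (simp add: sum_distrib_left split_beta)
 also have "\<dots> <= (\<Sum>p\<in>W \<times> W'. prob (T (fst p) (snd p)))"
  by (intro sum_mono Tlow) (use W in auto)
 also have "\<dots> = prob V"
  unfolding V_def
 proof (rule finite_measure_finite_Union[symmetric])
  show "disjoint_family_on (%p. T (fst p) (snd p)) (W \<times> W')"
   unfolding disjoint_family_on_def
  proof (intro ballI impI)
   fix p q assume pq: "p : W \<times> W'" "q : W \<times> W'" "p ~= q"
   show "T (fst p) (snd p) \<inter> T (fst q) (snd q) = {}"
   proof (rule ccontr)
    assume "\<not> ?thesis"
    then obtain y where y: "y : T (fst p) (snd p)" "y : T (fst q) (snd q)" by auto
    have in\<Lambda>: "fst p : \<Lambda>" "snd p : \<Lambda>" "fst q : \<Lambda>" "snd q : \<Lambda>" and inE: "fst p : E" "snd p : E" "fst q : E" "snd q : E"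
     using pq W by auto
    have "fst p = fst q" by (rule disj[OF inE(1,3), of y]) (use T1[OF in\<Lambda>(1,2) y(1)] T1[OF in\<Lambda>(3,4) y(2)] small[of 3] in auto)
    moreover have "snd p = snd q"
     by (rule disj[OF inE(2,4), of "(f ^^ (n + N)) y"]) (use T2[OF in\<Lambda>(1,2) y(1)] T2[OF in\<Lambda>(3,4) y(2)] small[of 2] in auto)
    ultimately show False using pq(3) by (simp add: prod_eq_iff)
   qed
  qed
  show "(%p. T (fst p) (snd p)) ` (W \<times> W') \<subseteq> events" using Ts subsetD[OF W(2)] subsetD[OF W(4)] by auto
 qed (use W in auto)
 finally have big: "\<kappa> * (prob B * prob B') <= prob V" .
 let ?M = "n + N"
 have nb: "nbhd B r : events" "nbhd B' r' : events" using sets_nbhd BL se by auto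
 have ev: "A : events" "A' : events" "B : events" "B' : events" using A A' B(3) B'(3) se by auto
 have "V \<subseteq> (A \<inter> ((f ^^ ?M) -` A' \<inter> space \<mu>)) \<union> (nbhd B r - B) \<union> ((f ^^ ?M) -` (nbhd B' r' - B') \<inter> space \<mu>)"
 proof
  fix y assume "y : V"
  then obtain e e' where e: "e : W" "e' : W'" "y : T e e'" by (auto simp: V_def)
  have eL: "e : \<Lambda>" "e' : \<Lambda>" using e W by auto
  have "y : nbhd B r" using L[OF n(2) eL(1), of 20 3] e(1) T1[OF eL e(3)] by (auto simp: W_def)
  moreover have "(f ^^ ?M) y : nbhd B' r'" using L'[OF n(3) eL(2), of 20 2] e(2) T2[OF eL e(3)] by (auto simp: W'_def)
  moreover have "y : space \<mu>" using T1[OF eL e(3)] sp by (simp add: bowen_def)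
  ultimately show "y : (A \<inter> ((f ^^ ?M) -` A' \<inter> space \<mu>)) \<union> (nbhd B r - B) \<union> ((f ^^ ?M) -` (nbhd B' r' - B') \<inter> space \<mu>)"
   using B(2) B'(2) by auto
 qed
 hence "prob V <= prob ((A \<inter> ((f ^^ ?M) -` A' \<inter> space \<mu>)) \<union> (nbhd B r - B) \<union> ((f ^^ ?M) -` (nbhd B' r' - B') \<inter> space \<mu>))"
  using ev nb measurable_sets[OF measurable_funpow] by (intro finite_measure_mono) auto
 also have "\<dots> <= prob (A \<inter> ((f ^^ ?M) -` A' \<inter> space \<mu>)) + prob (nbhd B r - B) + prob ((f ^^ ?M) -` (nbhd B' r' - B') \<inter> space \<mu>)"
 proof -
  have s1: "A \<inter> ((f ^^ ?M) -` A' \<inter> space \<mu>) : events" "nbhd B r - B : events" "(f ^^ ?M) -` (nbhd B' r' - B') \<inter> space \<mu> : events"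
   using ev nb by (auto intro!: measurable_sets[OF measurable_funpow])
  show ?thesis using measure_Un_le[OF sets.Un[OF s1(1,2)] s1(3)] measure_Un_le[OF s1(1,2)] by linarith
 qed
 also have "prob ((f ^^ ?M) -` (nbhd B' r' - B') \<inter> space \<mu>) = prob (nbhd B' r' - B')"
  using ev nb by (intro prob_funpow_vimage) auto
 also have "A \<inter> ((f ^^ ?M) -` A' \<inter> space \<mu>) = A \<inter> (f ^^ ?M) -` (\<Lambda> - A)"
  using sets.sets_into_space[OF A] sp by (auto simp: A'_def)
 also have "prob (A \<inter> (f ^^ ?M) -` (\<Lambda> - A)) = 0" by (rule inv)
 finally have "prob V < 2 * \<tau>" using r r' by linarith
 moreover have "\<kappa> * (a / 2 * (a' / 2)) <= \<kappa> * (prob B * prob B')"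
  using B B' a by (intro mult_left_mono mult_mono) (auto simp: \<kappa>_def)
 moreover have "\<kappa> * (a / 2 * (a' / 2)) = 2 * \<tau>" by (simp add: \<tau>_def)
 ultimately show False using big by linarith
qed

text \<open>The set A where the density exceeds 1 is invariant up to null sets: A minus its preimage
  and the preimage minus A have equal mass for both measures, yet \<eta> exceeds \<mu> on the first
  unless it is null, and stays below \<mu> on the second. Ergodicity leaves A null, since a full A
  would have \<eta>-mass above 1. So \<eta> is dominated by \<mu>, and complements give
  equality.\<close>

lemma absolutely_continuous_ergodic_unique:
 assumes \<mu>: "\<mu> : invariant_measures \<Lambda> f" and \<eta>: "\<eta> : invariant_measures \<Lambda> f"
  and ac: "!!A. A : sets borel\<Lambda> ==> measure \<mu> A = 0 ==> measure \<eta> A = 0"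
  and erg: "!!A. A : sets borel\<Lambda> ==> (!!n. measure \<mu> (A \<inter> (f ^^ n) -` (\<Lambda> - A)) = 0) ==>
   measure \<mu> A = 0 \<or> measure \<mu> (\<Lambda> - A) = 0"
 shows "\<eta> = \<mu>"
proof -
 interpret \<mu>: measure_preserving \<mu> f by (rule invariant_measuresD(4)[OF \<mu>])
 interpret \<eta>: measure_preserving \<eta> f by (rule invariant_measuresD(4)[OF \<eta>])
 note sp = invariant_measuresD(3)[OF \<mu>] and se = invariant_measuresD(2)[OF \<mu>]
 note sp' = invariant_measuresD(3)[OF \<eta>] and se' = invariant_measuresD(2)[OF \<eta>]
 have "absolutely_continuous \<mu> \<eta>"
  unfolding absolutely_continuous_def null_sets_def using ac se se'
  by (auto simp: \<mu>.emeasure_eq_measure \<eta>.emeasure_eq_measure)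
 then obtain h where h: "h : borel_measurable \<mu>" "density \<mu> h = \<eta>"
  using \<mu>.Radon_Nikodym[of \<eta>] se se' by auto
 have dens: "ennreal (measure \<eta> S) = (\<integral>\<^sup>+x. h x * indicator S x \<partial>\<mu>)" if "S : sets borel\<Lambda>" for S
  using emeasure_density[OF h(1), of S] that se h(2) by (simp add: \<eta>.emeasure_eq_measure)
 define A where "A = {x:\<Lambda>. h x > 1}"
 have A: "A : sets borel\<Lambda>"
  using borel_measurable_less[OF borel_measurable_const h(1), of 1] by (simp add: A_def sp se)
 have gt: "measure \<eta> S > measure \<mu> S" if S: "S : sets borel\<Lambda>" "S \<subseteq> A" "measure \<mu> S > 0" for S
 proof -
  have Sm: "S : sets \<mu>" using S se by simp
  have "(\<integral>\<^sup>+x. indicator S x \<partial>\<mu>) < (\<integral>\<^sup>+x. h x * indicator S x \<partial>\<mu>)"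
  proof (rule nn_integral_less)
   show "(\<integral>\<^sup>+x. indicator S x \<partial>\<mu>) ~= \<infinity>" using Sm by (simp add: \<mu>.emeasure_eq_measure)
   show "AE x in \<mu>. indicator S x <= h x * indicator S x" using S(2) by (intro AE_I2) (auto simp: A_def indicator_def less_imp_le)
   show "\<not> (AE x in \<mu>. h x * indicator S x <= indicator S x)"
   proof
    assume "AE x in \<mu>. h x * indicator S x <= (indicator S x :: ennreal)"
    hence "AE x in \<mu>. x \<notin> S" by (rule AE_mp) (use S(2) in \<open>auto simp: A_def indicator_def intro!: AE_I2\<close>)
    hence "measure \<mu> S = 0" using \<mu>.prob_eq_0 Sm by (simp add: \<mu>.prob_eq_0[OF Sm])
    thus False using S by simp
   qed
  qed (use h Sm in auto)
  hence "ennreal (measure \<mu> S) < ennreal (measure \<eta> S)" using dens[OF S(1)] Sm by (simp add: \<mu>.emeasure_eq_measure)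
  thus ?thesis by (simp add: ennreal_less_iff)
 qed
 have le: "measure \<eta> S <= measure \<mu> S" if S: "S : sets borel\<Lambda>" "AE x in \<mu>. x : S --> x \<notin> A" for S
 proof -
  have Sm: "S : sets \<mu>" using S se by simp
  have "(\<integral>\<^sup>+x. h x * indicator S x \<partial>\<mu>) <= (\<integral>\<^sup>+x. indicator S x \<partial>\<mu>)"
  proof (rule nn_integral_mono_AE, rule AE_mp[OF S(2)], rule AE_I2, rule impI)
   fix x assume "x : space \<mu>" "x : S --> x \<notin> A"
   thus "h x * indicator S x <= indicator S x" using sp by (auto simp: A_def indicator_def not_less)
  qed
  hence "ennreal (measure \<eta> S) <= ennreal (measure \<mu> S)" using dens[OF S(1)] Sm by (simp add: \<mu>.emeasure_eq_measure)
  thus ?thesis by simp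
 qed
 define F where "F = f -` A \<inter> \<Lambda>"
 have F: "F : sets borel\<Lambda>" using measurable_sets[OF \<mu>.measurable_T, of A] A se sp by (simp add: F_def)
 have pF: "measure \<mu> F = measure \<mu> A" "measure \<eta> F = measure \<eta> A"
  using \<mu>.prob_funpow_vimage[of A 1] \<eta>.prob_funpow_vimage[of A 1] A se se' sp sp' by (auto simp: F_def)
 have swap: "measure \<nu> (A - F) = measure \<nu> (F - A)"
  if "prob_space \<nu>" "sets \<nu> = sets borel\<Lambda>" "measure \<nu> F = measure \<nu> A" for \<nu>
 proof -
  interpret \<nu>: prob_space \<nu> by fact
  have "measure \<nu> (A - F) = measure \<nu> A - measure \<nu> (A \<inter> F)" "measure \<nu> (F - A) = measure \<nu> F - measure \<nu> (F \<inter> A)"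
   using A F that(2) by (auto intro!: \<nu>.finite_measure_Diff')
  thus ?thesis using that by (simp add: Int_commute)
 qed
 have sw: "measure \<mu> (A - F) = measure \<mu> (F - A)" "measure \<eta> (A - F) = measure \<eta> (F - A)"
  using swap[of \<mu>] swap[of \<eta>] \<mu>.prob_space_axioms \<eta>.prob_space_axioms se se' pF by auto
 have AF0: "measure \<mu> (A - F) = 0"
 proof (rule ccontr)
  assume "measure \<mu> (A - F) ~= 0"
  hence "measure \<mu> (A - F) > 0" using measure_nonneg[of \<mu> "A - F"] by linarith
  hence "measure \<mu> (A - F) < measure \<eta> (A - F)" using A F by (intro gt) auto
  moreover have "measure \<eta> (F - A) <= measure \<mu> (F - A)" using A F by (intro le) auto
  ultimately show False using sw by simp
 qed
 \<comment> \<open>A point that leaves A by time n + 1 has either left it by time n or leaves it in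
   the last step; the latter is a preimage of the null set A - F.\<close>
 have inv: "measure \<mu> (A \<inter> (f ^^ n) -` (\<Lambda> - A)) = 0" for n
 proof (induction n)
  case (Suc n)
  have AL: "A \<subseteq> \<Lambda>" by (auto simp: A_def)
  have m1: "(f ^^ n) -` (A - F) \<inter> space \<mu> : sets \<mu>" using A F se by (intro measurable_sets[OF \<mu>.measurable_funpow]) auto
  have m2': "(f ^^ k) -` (\<Lambda> - A) \<inter> space \<mu> : sets \<mu>" for k
   using sets.compl_sets[OF A] se by (intro measurable_sets[OF \<mu>.measurable_funpow]) auto
  have m2: "A \<inter> (f ^^ k) -` (\<Lambda> - A) : sets \<mu>" for k
  proof -
   have "A \<inter> (f ^^ k) -` (\<Lambda> - A) = A \<inter> ((f ^^ k) -` (\<Lambda> - A) \<inter> space \<mu>)" using AL sp by auto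
   thus ?thesis using m2' A se by auto
  qed
  have "A \<inter> (f ^^ Suc n) -` (\<Lambda> - A) \<subseteq> (A \<inter> (f ^^ n) -` (\<Lambda> - A)) \<union> ((f ^^ n) -` (A - F) \<inter> space \<mu>)"
   using AL sp funpow_mem by (auto simp: F_def)
  hence "measure \<mu> (A \<inter> (f ^^ Suc n) -` (\<Lambda> - A)) <= measure \<mu> ((A \<inter> (f ^^ n) -` (\<Lambda> - A)) \<union> ((f ^^ n) -` (A - F) \<inter> space \<mu>))"
   using m1 m2 by (intro \<mu>.finite_measure_mono) auto
  also have "\<dots> <= measure \<mu> (A \<inter> (f ^^ n) -` (\<Lambda> - A)) + measure \<mu> ((f ^^ n) -` (A - F) \<inter> space \<mu>)"
   using m1 m2 by (intro measure_Un_le)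
  also have "measure \<mu> ((f ^^ n) -` (A - F) \<inter> space \<mu>) = measure \<mu> (A - F)"
   using A F se by (intro \<mu>.prob_funpow_vimage) auto
  finally show ?case using Suc AF0 measure_nonneg[of \<mu> "A \<inter> (f ^^ Suc n) -` (\<Lambda> - A)"] by linarith
 qed simp
 have A0: "measure \<mu> A = 0"
 proof (rule ccontr)
  assume ne: "measure \<mu> A ~= 0"
  hence "measure \<mu> (\<Lambda> - A) = 0" using erg[OF A inv] by simp
  hence "measure \<mu> A = 1" using \<mu>.prob_compl[of A] A se sp by simp
  hence "measure \<eta> A > 1" using gt[OF A] by auto
  thus False using \<eta>.prob_le_1[of A] by linarith
 qed
 have "AE x in \<mu>. x \<notin> A" using A0 \<mu>.prob_eq_0[of A] A se by simp
 hence le': "measure \<eta> S <= measure \<mu> S" if "S : sets borel\<Lambda>" for S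
  by (intro le that) auto
 show ?thesis
 proof (rule measure_eqI)
  fix S assume "S : sets \<eta>"
  hence S: "S : sets borel\<Lambda>" using se' by simp
  have "measure \<eta> (\<Lambda> - S) <= measure \<mu> (\<Lambda> - S)" using sets.compl_sets[OF S] by (intro le') simp
  hence "measure \<mu> S <= measure \<eta> S" using \<mu>.prob_compl[of S] \<eta>.prob_compl[of S] S se se' sp sp' by simp
  hence "measure \<eta> S = measure \<mu> S" using le'[OF S] by simp
  thus "emeasure \<eta> S = emeasure \<mu> S" by (simp add: \<mu>.emeasure_eq_measure \<eta>.emeasure_eq_measure)
 qed (use se se' in simp)
qed

text \<open>Uniqueness is recorded for measures satisfying the lower entropy inequality, which is
  the form \<open>gibbs_entropy_lower\<close> provides for weak limits.\<close>

theorem thermodynamics: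
 assumes tame: "tame C \<Theta>"
 obtains P \<mu> where "\<mu> : invariant_measures \<Lambda> f" "gibbs 2 30 (K C) P \<Theta> \<mu>"
  "top_pressure \<Lambda> f \<Theta> = ereal P" "metric_entropy f \<mu> = ereal (P - mean_potential \<Theta> \<mu>)"
  "!!\<eta>. \<eta> : invariant_measures \<Lambda> f ==> metric_entropy f \<eta> <= ereal (P - mean_potential \<Theta> \<eta>)"
  "!!\<eta>. \<eta> : invariant_measures \<Lambda> f ==> ereal (P - mean_potential \<Theta> \<eta>) <= metric_entropy f \<eta> ==> \<eta> = \<mu>"
  "equilibrium_state \<Lambda> f \<Theta> = \<mu>"
proof -
 obtain P \<mu> where \<mu>: "\<mu> : invariant_measures \<Lambda> f" and g: "gibbs 2 30 (K C) P \<Theta> \<mu>"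
  using gibbs_exists[OF tame] by metis
 note pm = invariant_measuresD(1,2)[OF \<mu>]
 have lower: "exp (\<Theta> m x - real m * P - K C) <= measure \<mu> (bowen m x (2 * \<rho>))" if "m >= 1" "x : \<Lambda>" for m x
  using g that by (simp add: gibbs_def)
 have upper: "measure \<mu> (bowen m x (30 * \<rho>)) <= exp (\<Theta> m x - real m * P + K C)" if "m >= 1" "x : \<Lambda>" for m x
  using g that by (simp add: gibbs_def)
 have le: "metric_entropy f \<eta> <= ereal (P - mean_potential \<Theta> \<eta>)" if "\<eta> : invariant_measures \<Lambda> f" for \<eta>
  by (rule gibbs_entropy_upper[OF tame that pm lower])
 have "ereal (P - mean_potential \<Theta> \<mu>) <= metric_entropy f \<mu>"
  by (rule gibbs_entropy_lower[OF tame \<mu> _ _ upper]) auto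
 hence eq: "metric_entropy f \<mu> = ereal (P - mean_potential \<Theta> \<mu>)" using le[OF \<mu>] by simp
 have uniq: "\<eta> = \<mu>" if \<eta>: "\<eta> : invariant_measures \<Lambda> f" and ge: "ereal (P - mean_potential \<Theta> \<eta>) <= metric_entropy f \<eta>" for \<eta>
  by (rule absolutely_continuous_ergodic_unique[OF \<mu> \<eta>])
    (use equilibrium_absolutely_continuous[OF tame \<eta> pm lower ge] gibbs_ergodic[OF tame \<mu> g] in blast)+
 have sum_le: "metric_entropy f \<eta> + ereal (mean_potential \<Theta> \<eta>) <= ereal P" if "\<eta> : invariant_measures \<Lambda> f" for \<eta>
 proof -
  have "metric_entropy f \<eta> + ereal (mean_potential \<Theta> \<eta>) <= ereal (P - mean_potential \<Theta> \<eta>) + ereal (mean_potential \<Theta> \<eta>)"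
   by (intro add_right_mono le that)
  thus ?thesis by simp
 qed
 have tp: "top_pressure \<Lambda> f \<Theta> = ereal P"
 proof (rule antisym)
  show "top_pressure \<Lambda> f \<Theta> <= ereal P" unfolding top_pressure_def by (rule SUP_least) (rule sum_le)
  show "ereal P <= top_pressure \<Lambda> f \<Theta>" unfolding top_pressure_def
   by (rule SUP_upper2[OF \<mu>]) (simp add: eq)
 qed
 have "equilibrium_state \<Lambda> f \<Theta> = \<mu>"
  unfolding equilibrium_state_def
 proof (rule the_equality)
  show "is_equilibrium_state \<Lambda> f \<Theta> \<mu>" using \<mu> eq tp by (simp add: is_equilibrium_state_def)
  fix \<eta> assume "is_equilibrium_state \<Lambda> f \<Theta> \<eta>"
  hence \<eta>: "\<eta> : invariant_measures \<Lambda> f" "metric_entropy f \<eta> + ereal (mean_potential \<Theta> \<eta>) = ereal P"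
   by (auto simp: is_equilibrium_state_def tp)
  have "ereal (P - mean_potential \<Theta> \<eta>) <= metric_entropy f \<eta>"
   using \<eta>(2) by (cases "metric_entropy f \<eta>") auto
  thus "\<eta> = \<mu>" by (rule uniq[OF \<eta>(1)])
 qed
 thus ?thesis using that \<mu> g tp eq le uniq by blast
qed

end

section \<open>Free energy\<close>

context expanding_map
begin

lemma tame_add_scaled:
 assumes \<Phi>: "tame C \<Phi>" and \<Psi>: "tame C' \<Psi>" and T: "\<bar>t\<bar> <= T"
 shows "tame (C + T * C') (seq_add_scaled \<Phi> t \<Psi>)"
proof -
 have C: "C >= 0" "C' >= 0" using \<Phi> \<Psi> C_nonneg by auto
 have b: "\<bar>u + t * v\<bar> <= C + T * C'" if "\<bar>u\<bar> <= C" "\<bar>v\<bar> <= C'" for u v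
 proof -
  have "\<bar>t * v\<bar> <= T * C'" unfolding abs_mult using T that by (intro mult_mono) auto
  thus ?thesis using that by linarith
 qed
 show ?thesis unfolding tame_def
 proof (intro conjI allI impI ballI)
  show "0 <= C + T * C'" using C T by (intro add_nonneg_nonneg mult_nonneg_nonneg) auto
  fix n :: nat assume n: "1 <= n"
  show "continuous_on \<Lambda> (seq_add_scaled \<Phi> t \<Psi> n)"
   unfolding seq_add_scaled_def by (intro continuous_intros continuous_\<Theta>[OF \<Phi> n] continuous_\<Theta>[OF \<Psi> n])
  fix x assume x: "x : \<Lambda>"
  show "\<bar>seq_add_scaled \<Phi> t \<Psi> n x - seq_add_scaled \<Phi> t \<Psi> n y\<bar> <= C + T * C'" if "y : bowen n x (64 * \<rho>)" for y
   using b[OF \<Theta>_bowen[OF \<Phi> n x that order_refl] \<Theta>_bowen[OF \<Psi> n x that order_refl]]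
   by (simp add: seq_add_scaled_def algebra_simps)
 next
  fix m n :: nat and x assume mn: "1 <= m" "1 <= n" "x : \<Lambda>"
  show "\<bar>seq_add_scaled \<Phi> t \<Psi> (m + n) x - seq_add_scaled \<Phi> t \<Psi> m x - seq_add_scaled \<Phi> t \<Psi> n ((f ^^ m) x)\<bar> <= C + T * C'"
   using b[OF \<Theta>_add[OF \<Phi> mn] \<Theta>_add[OF \<Psi> mn]] by (simp add: seq_add_scaled_def algebra_simps)
 next
  fix x assume x: "x : \<Lambda>"
  show "\<bar>seq_add_scaled \<Phi> t \<Psi> N x\<bar> <= C + T * C'"
   using b[OF \<Theta>_N[OF \<Phi> x] \<Theta>_N[OF \<Psi> x]] by (simp add: seq_add_scaled_def)
 qed
qed

lemma mean_potential_add_scaled: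
 assumes \<Phi>: "tame C \<Phi>" and \<Psi>: "tame C' \<Psi>" and \<eta>: "\<eta> : invariant_measures \<Lambda> f"
 shows "mean_potential (seq_add_scaled \<Phi> t \<Psi>) \<eta> = mean_potential \<Phi> \<eta> + t * mean_potential \<Psi> \<eta>"
proof -
 have "(%n. (\<integral>x. \<Phi> n x \<partial>\<eta>) / real n + t * ((\<integral>x. \<Psi> n x \<partial>\<eta>) / real n)) \<longlonglongrightarrow> mean_potential \<Phi> \<eta> + t * mean_potential \<Psi> \<eta>"
  by (intro tendsto_intros mean_potential_bound(2)[OF \<Phi> \<eta>] mean_potential_bound(2)[OF \<Psi> \<eta>])
 moreover have "\<forall>\<^sub>F n in sequentially. (\<integral>x. \<Phi> n x \<partial>\<eta>) / real n + t * ((\<integral>x. \<Psi> n x \<partial>\<eta>) / real n)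
   = (1 / real n) * (\<integral>x. seq_add_scaled \<Phi> t \<Psi> n x \<partial>\<eta>)"
  using eventually_ge_at_top[of 1]
 proof eventually_elim
  case (elim n)
  show ?case unfolding seq_add_scaled_def
   using integrable_\<Theta>[OF \<Phi> \<eta> elim] integrable_\<Theta>[OF \<Psi> \<eta> elim] elim by (simp add: field_simps)
 qed
 ultimately have "(%n. (1 / real n) * (\<integral>x. seq_add_scaled \<Phi> t \<Psi> n x \<partial>\<eta>)) \<longlonglongrightarrow> mean_potential \<Phi> \<eta> + t * mean_potential \<Psi> \<eta>"
  by (rule Lim_transform_eventually)
 thus ?thesis unfolding mean_potential_def[of "seq_add_scaled \<Phi> t \<Psi>"] by (rule limI)
qed

text \<open>The mean is, uniformly in the measure, within C / n of the integral of the continuous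
  function \<Psi> n / n.\<close>

lemma mean_potential_continuous:
 assumes \<Psi>: "tame C \<Psi>" and \<nu>: "!!k. \<nu> k : invariant_measures \<Lambda> f" and \<mu>: "\<mu> : invariant_measures \<Lambda> f"
  and conv: "!!g :: 'm => real. continuous_on \<Lambda> g ==> (%k. integral\<^sup>L (\<nu> k) g) \<longlonglongrightarrow> integral\<^sup>L \<mu> g"
 shows "(%k. mean_potential \<Psi> (\<nu> k)) \<longlonglongrightarrow> mean_potential \<Psi> \<mu>"
proof (rule LIMSEQ_I)
 fix e :: real assume e: "e > 0"
 have C: "C >= 0" using C_nonneg[OF \<Psi>] .
 obtain n :: nat where n0: "3 * (C + 1) / e < real n" using reals_Archimedean2 by blast
 have "0 < 3 * (C + 1) / e" using C e by simp
 hence n: "n >= 1" using n0 by (cases n) auto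
 have "3 * (C + 1) < real n * e" using n0 e by (simp add: field_simps)
 hence Cn: "C / real n < e / 3" using n C by (simp add: field_simps)
 have approx: "\<bar>mean_potential \<Psi> \<eta> - (\<integral>x. \<Psi> n x \<partial>\<eta>) / real n\<bar> <= C / real n" if "\<eta> : invariant_measures \<Lambda> f" for \<eta>
 proof -
  have "mean_potential \<Psi> \<eta> - (\<integral>x. \<Psi> n x \<partial>\<eta>) / real n = - (((\<integral>x. \<Psi> n x \<partial>\<eta>) - real n * mean_potential \<Psi> \<eta>) / real n)"
   using n by (simp add: field_simps)
  hence "\<bar>mean_potential \<Psi> \<eta> - (\<integral>x. \<Psi> n x \<partial>\<eta>) / real n\<bar> = \<bar>(\<integral>x. \<Psi> n x \<partial>\<eta>) - real n * mean_potential \<Psi> \<eta>\<bar> / real n"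
   by (simp only: abs_minus_cancel abs_divide abs_of_nat)
  also have "\<dots> <= C / real n" using mean_potential_bound(1)[OF \<Psi> that n] by (intro divide_right_mono) auto
  finally show ?thesis .
 qed
 have lim: "(%k. (\<integral>x. \<Psi> n x \<partial>\<nu> k) / real n) \<longlonglongrightarrow> (\<integral>x. \<Psi> n x \<partial>\<mu>) / real n"
  using n by (intro tendsto_divide conv continuous_\<Theta>[OF \<Psi> n] tendsto_const) auto
 have "e / 3 > 0" using e by simp
 from LIMSEQ_D[OF lim this] obtain k0 where
  k0: "!!k. k >= k0 ==> \<bar>(\<integral>x. \<Psi> n x \<partial>\<nu> k) / real n - (\<integral>x. \<Psi> n x \<partial>\<mu>) / real n\<bar> < e / 3"
  unfolding real_norm_def by blast
 have "norm (mean_potential \<Psi> (\<nu> k) - mean_potential \<Psi> \<mu>) < e" if "k >= k0" for k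
  using k0[OF that] approx[OF \<nu>[of k]] approx[OF \<mu>] Cn unfolding real_norm_def by linarith
 thus "EX no. ALL n>=no. norm (mean_potential \<Psi> (\<nu> n) - mean_potential \<Psi> \<mu>) < e" by blast
qed

lemma mean_potential_bounded:
 assumes \<Psi>: "tame C \<Psi>"
 obtains B where "!!\<eta>. \<eta> : invariant_measures \<Lambda> f ==> \<bar>mean_potential \<Psi> \<eta>\<bar> <= B"
proof -
 have one: "(1::nat) >= 1" by simp
 obtain b where b: "!!x. x : \<Lambda> ==> \<bar>\<Psi> 1 x\<bar> <= b" using continuous_boundedE[OF continuous_\<Theta>[OF \<Psi> one]] by metis
 show ?thesis
 proof (rule that[of "b + C"])
  fix \<eta> assume \<eta>: "\<eta> : invariant_measures \<Lambda> f"
  interpret prob_space \<eta> by (rule invariant_measuresD(1)[OF \<eta>])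
  have "\<bar>\<integral>x. \<Psi> 1 x \<partial>\<eta>\<bar> <= (\<integral>x. \<bar>\<Psi> 1 x\<bar> \<partial>\<eta>)" by (rule integral_abs_bound)
  also have "\<dots> <= (\<integral>x. b \<partial>\<eta>)"
   by (intro integral_mono integrable_abs integrable_\<Theta>[OF \<Psi> \<eta> one]) (use b invariant_measuresD(3)[OF \<eta>] in auto)
  also have "\<dots> = b" by (simp add: prob_space)
  finally show "\<bar>mean_potential \<Psi> \<eta>\<bar> <= b + C" using mean_potential_bound(1)[OF \<Psi> \<eta> one] by simp
 qed
qed

text \<open>Differentiability of the pressure is obtained through a continuous selection of
  subgradients, with no perturbation theory. The last conclusion isolates the one way in which
  strict convexity can fail.\<close>

lemma tame_family:
 assumes \<Phi>: "tame C \<Phi>" and \<Psi>: "tame C' \<Psi>"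
 obtains Pr :: "real => real" and \<mu> :: "real => 'm measure" where
  "!!t. \<mu> t : invariant_measures \<Lambda> f"
  "!!t. top_pressure \<Lambda> f (seq_add_scaled \<Phi> t \<Psi>) = ereal (Pr t)"
  "!!t. equilibrium_state \<Lambda> f (seq_add_scaled \<Phi> t \<Psi>) = \<mu> t"
  "!!t. metric_entropy f (\<mu> t) = ereal (Pr t - mean_potential \<Phi> (\<mu> t) - t * mean_potential \<Psi> (\<mu> t))"
  "!!t \<eta>. \<eta> : invariant_measures \<Lambda> f ==> metric_entropy f \<eta> <= ereal (Pr t - mean_potential \<Phi> \<eta> - t * mean_potential \<Psi> \<eta>)"
  "!!t t'. Pr t + (t' - t) * mean_potential \<Psi> (\<mu> t) <= Pr t'"
  "continuous_on UNIV (%t. mean_potential \<Psi> (\<mu> t))"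
  "!!t t'. t ~= t' ==> mean_potential \<Psi> (\<mu> t) = mean_potential \<Psi> (\<mu> t') ==>
   EX c B. ALL n>=1. ALL x:\<Lambda>. \<bar>\<Psi> n x - real n * c\<bar> <= B"
proof -
 let ?\<Theta> = "%t. seq_add_scaled \<Phi> t \<Psi>"
 define \<mu> where "\<mu> t = equilibrium_state \<Lambda> f (?\<Theta> t)" for t
 define Pr where "Pr t = real_of_ereal (top_pressure \<Lambda> f (?\<Theta> t))" for t
 define m where "m = mean_potential \<Psi>"
 \<comment> \<open>Serves all t with |t| <= T at once, so the Gibbs constants stay fixed along a
   convergent sequence of parameters.\<close>
 define CT where "CT T = C + T * C'" for T
 have tm: "tame (CT T) (?\<Theta> t)" if "\<bar>t\<bar> <= T" for t T unfolding CT_def by (rule tame_add_scaled[OF \<Phi> \<Psi> that])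
 have th: "\<mu> t : invariant_measures \<Lambda> f" "gibbs 2 30 (K (CT T)) (Pr t) (?\<Theta> t) (\<mu> t)"
  "top_pressure \<Lambda> f (?\<Theta> t) = ereal (Pr t)" "metric_entropy f (\<mu> t) = ereal (Pr t - mean_potential (?\<Theta> t) (\<mu> t))"
  "!!\<eta>. \<eta> : invariant_measures \<Lambda> f ==> metric_entropy f \<eta> <= ereal (Pr t - mean_potential (?\<Theta> t) \<eta>)"
  "!!\<eta>. \<eta> : invariant_measures \<Lambda> f ==> ereal (Pr t - mean_potential (?\<Theta> t) \<eta>) <= metric_entropy f \<eta> ==> \<eta> = \<mu> t"
  if T: "\<bar>t\<bar> <= T" for t T
 proof -
  obtain P \<nu> where *: "\<nu> : invariant_measures \<Lambda> f" "gibbs 2 30 (K (CT T)) P (?\<Theta> t) \<nu>"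
   "top_pressure \<Lambda> f (?\<Theta> t) = ereal P" "metric_entropy f \<nu> = ereal (P - mean_potential (?\<Theta> t) \<nu>)"
   "!!\<eta>. \<eta> : invariant_measures \<Lambda> f ==> metric_entropy f \<eta> <= ereal (P - mean_potential (?\<Theta> t) \<eta>)"
   "!!\<eta>. \<eta> : invariant_measures \<Lambda> f ==> ereal (P - mean_potential (?\<Theta> t) \<eta>) <= metric_entropy f \<eta> ==> \<eta> = \<nu>"
   "equilibrium_state \<Lambda> f (?\<Theta> t) = \<nu>"
   by (rule thermodynamics[OF tm[OF T]]) (rule that)
  have e: "Pr t = P" "\<mu> t = \<nu>" using *(3,7) by (simp_all add: Pr_def \<mu>_def)
  show "\<mu> t : invariant_measures \<Lambda> f" "gibbs 2 30 (K (CT T)) (Pr t) (?\<Theta> t) (\<mu> t)"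
   "top_pressure \<Lambda> f (?\<Theta> t) = ereal (Pr t)" "metric_entropy f (\<mu> t) = ereal (Pr t - mean_potential (?\<Theta> t) (\<mu> t))"
   "!!\<eta>. \<eta> : invariant_measures \<Lambda> f ==> metric_entropy f \<eta> <= ereal (Pr t - mean_potential (?\<Theta> t) \<eta>)"
   "!!\<eta>. \<eta> : invariant_measures \<Lambda> f ==> ereal (Pr t - mean_potential (?\<Theta> t) \<eta>) <= metric_entropy f \<eta> ==> \<eta> = \<mu> t"
   unfolding e using * by blast+
 qed
 note th1 = th[OF order_refl]
 have mp: "mean_potential (?\<Theta> t) \<eta> = mean_potential \<Phi> \<eta> + t * m \<eta>" if "\<eta> : invariant_measures \<Lambda> f" for t \<eta>
  unfolding m_def by (rule mean_potential_add_scaled[OF \<Phi> \<Psi> that])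
 have ineq: "metric_entropy f \<eta> <= ereal (Pr t - mean_potential \<Phi> \<eta> - t * m \<eta>)" if "\<eta> : invariant_measures \<Lambda> f" for t \<eta>
  using th1(5)[OF that, of t] mp[OF that] by (simp add: algebra_simps)
 have eq: "metric_entropy f (\<mu> t) = ereal (Pr t - mean_potential \<Phi> (\<mu> t) - t * m (\<mu> t))" for t
  using th1(4)[of t] mp[OF th1(1)] by (simp add: algebra_simps)
 have sub: "Pr t + (t' - t) * m (\<mu> t) <= Pr t'" for t t'
  using ineq[OF th1(1), of t t'] eq[of t] by (simp add: algebra_simps)
 obtain B where B: "!!\<eta>. \<eta> : invariant_measures \<Lambda> f ==> \<bar>m \<eta>\<bar> <= B"
  using mean_potential_bounded[OF \<Psi>] unfolding m_def by metis
 have lip: "\<bar>Pr t' - Pr t\<bar> <= B * \<bar>t' - t\<bar>" for t t'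
 proof -
  have "\<bar>(t' - t) * m (\<mu> t)\<bar> <= \<bar>t' - t\<bar> * B" "\<bar>(t - t') * m (\<mu> t')\<bar> <= \<bar>t - t'\<bar> * B"
   unfolding abs_mult by (intro mult_left_mono B th1(1); simp)+
  thus ?thesis using sub[of t t'] sub[of t' t] by (simp add: abs_minus_commute[of t t'] mult.commute[of B])
 qed
 \<comment> \<open>From a subsequence staying away from the limit, extract a weak limit. It is Gibbs
   for t, with radii 3 and 20 after the loss; its upper bound makes it an equilibrium state, so by
   uniqueness it is \<mu> t, and the means converge after all.\<close>
 have cont: "(%k. m (\<mu> (tk k))) \<longlonglongrightarrow> m (\<mu> t)" if tk: "tk \<longlonglongrightarrow> t" for tk t
 proof (rule ccontr)
  assume "\<not> ?thesis"
  then obtain e where e: "e > 0" "ALL n. EX k>=n. norm (m (\<mu> (tk k)) - m (\<mu> t)) >= e"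
   by (auto simp: LIMSEQ_iff not_less)
  hence "infinite {k. norm (m (\<mu> (tk k)) - m (\<mu> t)) >= e}"
   unfolding infinite_nat_iff_unbounded_le by auto
  then obtain q :: "nat => nat" where q: "strict_mono q" "!!k. norm (m (\<mu> (tk (q k))) - m (\<mu> t)) >= e"
   using infinite_enumerate by blast
  define u where "u k = tk (q k)" for k
  have u: "u \<longlonglongrightarrow> t" unfolding u_def using LIMSEQ_subseq_LIMSEQ[OF tk q(1)] by (simp add: o_def)
  have "Bseq u" using u by (rule convergent_imp_Bseq[OF convergentI])
  then obtain T where T: "!!k. \<bar>u k\<bar> <= T" unfolding Bseq_def by auto
  have Pu: "(%k. Pr (u k)) \<longlonglongrightarrow> Pr t"
  proof (rule LIM_zero_cancel, rule Lim_null_comparison)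
   show "\<forall>\<^sub>F k in sequentially. norm (Pr (u k) - Pr t) <= B * \<bar>u k - t\<bar>" using lip by simp
   have "(%k. B * \<bar>u k - t\<bar>) \<longlonglongrightarrow> B * \<bar>t - t\<bar>" by (intro tendsto_intros u)
   thus "(%k. B * \<bar>u k - t\<bar>) \<longlonglongrightarrow> 0" by simp
  qed
  have \<Theta>u: "(%k. ?\<Theta> (u k) n x) \<longlonglongrightarrow> ?\<Theta> t n x" for n x
   unfolding seq_add_scaled_def by (intro tendsto_intros u)
  note g = th(2)[OF T]
  obtain r \<nu> where r: "strict_mono (r :: nat => nat)" and \<nu>: "\<nu> : invariant_measures \<Lambda> f"
   and g': "gibbs 3 20 (K (CT T)) (Pr t) (?\<Theta> t) \<nu>"
   and conv: "!!g :: 'm => real. continuous_on \<Lambda> g ==> (%k. integral\<^sup>L (\<mu> (u (r k))) g) \<longlonglongrightarrow> integral\<^sup>L \<nu> g"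
  proof (rule gibbs_limit[of "%k. \<mu> (u k)" "%k. Pr (u k)" "Pr t" "%k. ?\<Theta> (u k)" "?\<Theta> t" "K (CT T)" 2 30 3 20])
   show "prob_space (\<mu> (u k))" "sets (\<mu> (u k)) = sets borel\<Lambda>" for k
    using invariant_measuresD(1,2)[OF th1(1)] by auto
   fix n x assume "n >= (1::nat)" "x : \<Lambda>"
   thus "\<forall>\<^sub>F k in sequentially. exp (?\<Theta> (u k) n x - real n * Pr (u k) - K (CT T)) <= measure (\<mu> (u k)) (bowen n x (2 * \<rho>))"
    "\<forall>\<^sub>F k in sequentially. measure (\<mu> (u k)) (bowen n x (30 * \<rho>)) <= exp (?\<Theta> (u k) n x - real n * Pr (u k) + K (CT T))"
    using g unfolding gibbs_def by (auto intro!: always_eventually)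
  next
   fix g :: "'m => real" assume "continuous_on \<Lambda> g"
   have "(\<integral>x. g (f x) \<partial>\<mu> (u k)) = (\<integral>x. g x \<partial>\<mu> (u k))" for k
   proof -
    interpret measure_preserving "\<mu> (u k)" f by (rule invariant_measuresD(4)[OF th1(1)])
    have "g : borel_measurable (\<mu> (u k))"
     using borel_measurable_continuous[OF \<open>continuous_on \<Lambda> g\<close>] measurable_cong_sets[OF invariant_measuresD(2)[OF th1(1)] refl] by blast
    from integral_distr[OF measurable_T this] show ?thesis by (simp add: distr_T)
   qed
   thus "(%k. (\<integral>x. g (f x) \<partial>\<mu> (u k)) - (\<integral>x. g x \<partial>\<mu> (u k))) \<longlonglongrightarrow> 0" by simp
  qed (use Pu \<Theta>u in auto)
  have tmt: "tame (CT \<bar>t\<bar>) (?\<Theta> t)" by (rule tm) simp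
  have "ereal (Pr t - mean_potential (?\<Theta> t) \<nu>) <= metric_entropy f \<nu>"
   by (rule gibbs_entropy_lower[OF tmt \<nu>, of 20 "Pr t" "K (CT T)"]) (use g' in \<open>auto simp: gibbs_def\<close>)
  hence \<nu>eq: "\<nu> = \<mu> t" by (rule th1(6)[OF \<nu>])
  have "(%k. m (\<mu> (u (r k)))) \<longlonglongrightarrow> m (\<mu> t)"
   unfolding m_def using mean_potential_continuous[OF \<Psi> th1(1) \<nu> conv] \<nu>eq by simp
  then obtain k where "norm (m (\<mu> (u (r k))) - m (\<mu> t)) < e"
   using LIMSEQ_D[OF _ e(1)] by blast
  thus False using q(2)[of "r k"] by (simp add: u_def)
 qed
 \<comment> \<open>Equal means make \<mu> t an equilibrium state for t' as well, so it satisfies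
   both Gibbs estimates on the same balls. Their quotient bounds (t' - t) \<Psi> n up to a linear
   term.\<close>
 have inj: "EX c B. ALL n>=1. ALL x:\<Lambda>. \<bar>\<Psi> n x - real n * c\<bar> <= B" if ne: "t ~= t'" and mm: "m (\<mu> t) = m (\<mu> t')" for t t'
 proof -
  have "Pr t' - mean_potential (?\<Theta> t') (\<mu> t) <= Pr t - mean_potential (?\<Theta> t) (\<mu> t)"
   using sub[of t' t] mp[OF th1(1)] mm by (simp add: algebra_simps)
  hence "ereal (Pr t' - mean_potential (?\<Theta> t') (\<mu> t)) <= metric_entropy f (\<mu> t)" using th1(4)[of t] by simp
  hence eqm: "\<mu> t = \<mu> t'" by (rule th1(6)[OF th1(1)])
  interpret prob_space "\<mu> t" by (rule invariant_measuresD(1)[OF th1(1)])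
  define k k' where "k = K (CT \<bar>t\<bar>)" and "k' = K (CT \<bar>t'\<bar>)"
  note g = th1(2)[of t, folded k_def] and g' = th1(2)[of t', folded k'_def, folded eqm]
  have cmp: "?\<Theta> a n x - real n * Pr a - ka <= ?\<Theta> b n x - real n * Pr b + kb"
   if "gibbs 2 30 ka (Pr a) (?\<Theta> a) (\<mu> t)" "gibbs 2 30 kb (Pr b) (?\<Theta> b) (\<mu> t)" "n >= 1" "x : \<Lambda>" for a b ka kb n x
  proof -
   have "exp (?\<Theta> a n x - real n * Pr a - ka) <= prob (bowen n x (2 * \<rho>))" using that by (simp add: gibbs_def)
   also have "\<dots> <= prob (bowen n x (30 * \<rho>))"
    using bowen_mono[of "2 * \<rho>" "30 * \<rho>"] \<rho>_pos sets_bowen[OF that(4)] invariant_measuresD(2)[OF th1(1)] by (intro finite_measure_mono) auto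
   also have "\<dots> <= exp (?\<Theta> b n x - real n * Pr b + kb)" using that by (simp add: gibbs_def)
   finally show ?thesis by simp
  qed
  define c where "c = (Pr t' - Pr t) / (t' - t)"
  have "\<bar>\<Psi> n x - real n * c\<bar> <= (k + k') / \<bar>t' - t\<bar>" if n: "n >= 1" and x: "x : \<Lambda>" for n x
  proof -
   have "\<bar>(t' - t) * \<Psi> n x - real n * (Pr t' - Pr t)\<bar> <= k + k'"
    using cmp[OF g g' n x] cmp[OF g' g n x] by (simp add: seq_add_scaled_def algebra_simps abs_le_iff)
   moreover have "(t' - t) * \<Psi> n x - real n * (Pr t' - Pr t) = (t' - t) * (\<Psi> n x - real n * c)"
    using ne by (simp add: c_def field_simps)
   ultimately have "\<bar>t' - t\<bar> * \<bar>\<Psi> n x - real n * c\<bar> <= k + k'" by (simp only: abs_mult)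
   thus ?thesis using ne by (simp add: pos_le_divide_eq mult.commute)
  qed
  thus ?thesis by blast
 qed
 show ?thesis
 proof (rule that[of \<mu> Pr])
  show "continuous_on UNIV (%t. mean_potential \<Psi> (\<mu> t))"
   unfolding continuous_on_sequentially using cont by (auto simp: m_def o_def)
 qed (use th1 eq ineq sub inj in \<open>auto simp: m_def \<mu>_def\<close>)
qed

text \<open>Replacing \<Theta> m along the orbit by differences of \<Theta> at times m apart makes
  the Birkhoff sum telescope to a block of m values, each close to \<Theta> n. The error C / m per
  step can be made small by the choice of m.\<close>

lemma birkhoff_average_approximation:
 assumes \<Theta>: "tame C \<Theta>" and m: "m >= 1"
 obtains c where "!!n x. n >= 1 ==> x : \<Lambda> ==>
  \<bar>\<Theta> n x - birkhoff_sum f (%y. \<Theta> m y / real m) n x\<bar> <= real n * (C / real m) + c"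
proof -
 \<comment> \<open>The entry of index 0 is arbitrary in \<open>tame\<close>; setting it to 0 makes
   almost additivity hold for all indices.\<close>
 define \<theta> where "\<theta> j x = (if j = 0 then 0 else \<Theta> j x)" for j x
 have "EX b. ALL x:\<Lambda>. \<bar>\<theta> i x\<bar> <= b" for i
 proof (cases "i = 0")
  case False
  hence "i >= 1" by simp
  from continuous_boundedE[OF continuous_\<Theta>[OF \<Theta> this]] obtain b where "!!x. x : \<Lambda> ==> \<bar>\<Theta> i x\<bar> <= b" by metis
  thus ?thesis using False by (auto simp: \<theta>_def)
 qed (auto simp: \<theta>_def)
 then obtain b where b: "!!i x. x : \<Lambda> ==> \<bar>\<theta> i x\<bar> <= b i" by metis
 have C: "C >= 0" by (rule C_nonneg[OF \<Theta>])
 define B where "B = (\<Sum>i<m. b i)"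
 have add: "\<bar>\<theta> (j + i) x - \<theta> j x - \<theta> i ((f ^^ j) x)\<bar> <= C" if "x : \<Lambda>" for j i x
  using \<Theta>_add[OF \<Theta>, of j i x] that C by (cases "j = 0"; cases "i = 0") (auto simp: \<theta>_def)
 show ?thesis
 proof (rule that[of "(2 * B + real m * C) / real m"])
  fix n x assume n: "n >= (1::nat)" and x: "x : \<Lambda>"
  have tele: "(\<Sum>j<n. \<theta> (j + m) x - \<theta> j x) = (\<Sum>i<m. \<theta> (n + i) x) - (\<Sum>i<m. \<theta> i x)"
  proof (induction n)
   case 0 show ?case by simp
  next
   case (Suc n)
   have shift: "(\<Sum>i<m. \<theta> (Suc n + i) x) - (\<Sum>i<m. \<theta> (n + i) x) = \<theta> (n + m) x - \<theta> n x"
    unfolding sum_subtractf[symmetric] using sum_lessThan_telescope[of "%i. \<theta> (n + i) x" m] by simp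
   show ?case using Suc shift by simp
  qed
  have e1: "\<bar>(\<Sum>j<n. \<theta> (j + m) x - \<theta> j x) - (\<Sum>j<n. \<Theta> m ((f ^^ j) x))\<bar> <= real n * C"
  proof -
   have "\<bar>\<Sum>j<n. \<theta> (j + m) x - \<theta> j x - \<Theta> m ((f ^^ j) x)\<bar> <= (\<Sum>j<n. C)"
    by (rule order_trans[OF sum_abs sum_mono]) (use add[OF x, of _ m] m in \<open>simp add: \<theta>_def[of m]\<close>)
   thus ?thesis by (simp add: sum_subtractf)
  qed
  have e2: "\<bar>(\<Sum>i<m. \<theta> (n + i) x) - real m * \<Theta> n x\<bar> <= real m * C + B"
  proof -
   have "\<bar>\<Sum>i<m. \<theta> (n + i) x - \<Theta> n x\<bar> <= (\<Sum>i<m. C + b i)"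
   proof (rule order_trans[OF sum_abs sum_mono])
    fix i
    have "\<bar>\<theta> (n + i) x - \<theta> n x - \<theta> i ((f ^^ n) x)\<bar> <= C" by (rule add[OF x])
    moreover have "\<bar>\<theta> i ((f ^^ n) x)\<bar> <= b i" by (rule b[OF funpow_mem[OF x]])
    ultimately show "\<bar>\<theta> (n + i) x - \<Theta> n x\<bar> <= C + b i" using n by (simp add: \<theta>_def[of n])
   qed
   thus ?thesis by (simp add: sum_subtractf sum.distrib B_def)
  qed
  have e3: "\<bar>\<Sum>i<m. \<theta> i x\<bar> <= B" unfolding B_def by (rule order_trans[OF sum_abs sum_mono]) (rule b[OF x])
  have "\<bar>real m * \<Theta> n x - (\<Sum>j<n. \<Theta> m ((f ^^ j) x))\<bar> <= real n * C + (2 * B + real m * C)"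
   using e1 e2 e3 tele by linarith
  hence "\<bar>real m * \<Theta> n x - (\<Sum>j<n. \<Theta> m ((f ^^ j) x))\<bar> / real m <= (real n * C + (2 * B + real m * C)) / real m"
   by (intro divide_right_mono) auto
  also have "\<bar>real m * \<Theta> n x - (\<Sum>j<n. \<Theta> m ((f ^^ j) x))\<bar> / real m = \<bar>(real m * \<Theta> n x - (\<Sum>j<n. \<Theta> m ((f ^^ j) x))) / real m\<bar>" by simp
  also have "(real m * \<Theta> n x - (\<Sum>j<n. \<Theta> m ((f ^^ j) x))) / real m = \<Theta> n x - birkhoff_sum f (%y. \<Theta> m y / real m) n x"
   using m by (simp add: birkhoff_sum_def diff_divide_distrib sum_divide_distrib)
  finally show "\<bar>\<Theta> n x - birkhoff_sum f (%y. \<Theta> m y / real m) n x\<bar> <= real n * (C / real m) + (2 * B + real m * C) / real m"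
   by (simp add: add_divide_distrib)
 qed
qed

end

section \<open>Legendre duality\<close>

text \<open>Convexity of E and its differentiability are both encoded by a continuous selection of
  subgradients; injectivity of the selection is strict convexity.\<close>

locale smooth_convex =
 fixes E \<sigma> :: "real => real"
 assumes subgradient: "E t + (t' - t) * \<sigma> t <= E t'"
  and continuous_\<sigma>: "continuous_on UNIV \<sigma>" and inj_\<sigma>: "inj \<sigma>" and E_0: "E 0 = 0"
begin

lemma \<sigma>_less: assumes "t < t'" shows "\<sigma> t < \<sigma> t'"
proof -
 have "(t' - t) * \<sigma> t <= (t' - t) * \<sigma> t'"
  using subgradient[of t t'] subgradient[of t' t] by (simp add: algebra_simps)
 hence "\<sigma> t <= \<sigma> t'" using assms by simp
 moreover have "\<sigma> t ~= \<sigma> t'" using inj_\<sigma> assms by (auto dest: injD)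
 ultimately show ?thesis by simp
qed

lemma \<sigma>_less_iff: "\<sigma> t < \<sigma> t' \<longleftrightarrow> t < t'"
 using \<sigma>_less by (metis less_asym linorder_neqE)

lemma \<sigma>_le_iff: "\<sigma> t <= \<sigma> t' \<longleftrightarrow> t <= t'"
 using \<sigma>_less_iff[of t' t] by (simp flip: not_less)

text \<open>Use the subgradient at t up to the midpoint and the one at the midpoint from there on;
  the second is strictly steeper in the direction of t'.\<close>

lemma strict_subgradient: assumes "t ~= t'" shows "E t + (t' - t) * \<sigma> t < E t'"
proof -
 define m where "m = (t + t') / 2"
 have 1: "E m + (t' - m) * \<sigma> m <= E t'" "E t + (m - t) * \<sigma> t <= E m" by (rule subgradient)+
 have d: "t' - m = (t' - t) / 2" "m - t = (t' - t) / 2" by (auto simp: m_def field_simps)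
 have "(t' - t) / 2 * \<sigma> t < (t' - t) / 2 * \<sigma> m"
 proof (cases "t < t'")
  case True
  hence "\<sigma> t < \<sigma> m" by (intro \<sigma>_less) (simp add: m_def)
  thus ?thesis using True by (intro mult_strict_left_mono) auto
 next
  case False
  hence "t' < t" using assms by simp
  hence "\<sigma> m < \<sigma> t" by (intro \<sigma>_less) (simp add: m_def)
  thus ?thesis using \<open>t' < t\<close> by (intro mult_strict_left_mono_neg) auto
 qed
 thus ?thesis using 1 unfolding d by (simp add: field_simps)
qed

text \<open>The two subgradient inequalities trap the difference quotient between \<sigma> t and
  \<sigma> (t + h), and continuity of \<sigma> closes the gap.\<close>

lemma DERIV_E: "DERIV E t :> \<sigma> t"
proof -
 have "((%h. (E (t + h) - E t) / h) \<longlongrightarrow> \<sigma> t) (at 0)"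
 proof (rule tendsto_sandwich)
  have c: "((%h. \<sigma> (t + h)) \<longlongrightarrow> \<sigma> (t + 0)) (at 0)"
   using continuous_\<sigma> unfolding continuous_on_eq_continuous_at[OF open_UNIV]
   by (intro isCont_tendsto_compose[where g=\<sigma>] tendsto_intros) auto
  have "((%h. min (\<sigma> t) (\<sigma> (t + h))) \<longlongrightarrow> min (\<sigma> t) (\<sigma> (t + 0))) (at 0)" by (intro tendsto_min tendsto_const c)
  thus "((%h. min (\<sigma> t) (\<sigma> (t + h))) \<longlongrightarrow> \<sigma> t) (at 0)" by simp
  have "((%h. max (\<sigma> t) (\<sigma> (t + h))) \<longlongrightarrow> max (\<sigma> t) (\<sigma> (t + 0))) (at 0)" by (intro tendsto_max tendsto_const c)
  thus "((%h. max (\<sigma> t) (\<sigma> (t + h))) \<longlongrightarrow> \<sigma> t) (at 0)" by simp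
  have s: "h * \<sigma> t <= E (t + h) - E t" "E (t + h) - E t <= h * \<sigma> (t + h)" for h
   using subgradient[of t "t + h"] subgradient[of "t + h" t] by (auto simp: algebra_simps)
  show "\<forall>\<^sub>F h in at 0. min (\<sigma> t) (\<sigma> (t + h)) <= (E (t + h) - E t) / h"
   unfolding eventually_at_filter
  proof (intro always_eventually allI impI)
   fix h :: real assume "h ~= 0"
   thus "min (\<sigma> t) (\<sigma> (t + h)) <= (E (t + h) - E t) / h"
    using s[of h] by (cases "h > 0") (auto simp: field_simps min_le_iff_disj)
  qed
  show "\<forall>\<^sub>F h in at 0. (E (t + h) - E t) / h <= max (\<sigma> t) (\<sigma> (t + h))"
   unfolding eventually_at_filter
  proof (intro always_eventually allI impI)
   fix h :: real assume "h ~= 0"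
   thus "(E (t + h) - E t) / h <= max (\<sigma> t) (\<sigma> (t + h))"
    using s[of h] by (cases "h > 0") (auto simp: field_simps le_max_iff_disj)
  qed
 qed
 thus ?thesis by (simp add: DERIV_def)
qed

lemma deriv_E: "deriv E t = \<sigma> t" by (rule DERIV_imp_deriv[OF DERIV_E])

text \<open>Strict monotonicity keeps the extremes from being attained, and the intermediate value
  theorem fills what lies between. Extended reals allow unbounded ranges.\<close>

lemma range_\<sigma>: "{s. (INF t. ereal (\<sigma> t)) < ereal s & ereal s < (SUP t. ereal (\<sigma> t))} = range \<sigma>"
proof (intro set_eqI iffI)
 fix s assume "s : {s. (INF t. ereal (\<sigma> t)) < ereal s & ereal s < (SUP t. ereal (\<sigma> t))}"
 then obtain t1 t2 where t: "\<sigma> t1 < s" "s < \<sigma> t2" unfolding mem_Collect_eq INF_less_iff less_SUP_iff by auto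
 hence "t1 < t2" using \<sigma>_less_iff[of t1 t2] by linarith
 hence "EX t. t1 <= t & t <= t2 & \<sigma> t = s"
  using t continuous_\<sigma> by (intro IVT') (auto intro: continuous_on_subset)
 thus "s : range \<sigma>" by auto
next
 fix s assume "s : range \<sigma>"
 then obtain t where t: "s = \<sigma> t" by auto
 have "(INF t. ereal (\<sigma> t)) <= ereal (\<sigma> (t - 1))" "ereal (\<sigma> (t + 1)) <= (SUP t. ereal (\<sigma> t))"
  by (auto intro: INF_lower SUP_upper)
 moreover have "ereal (\<sigma> (t - 1)) < ereal s" "ereal s < ereal (\<sigma> (t + 1))" using \<sigma>_less t by auto
 ultimately show "s : {s. (INF t. ereal (\<sigma> t)) < ereal s & ereal s < (SUP t. ereal (\<sigma> t))}"
  using order_le_less_trans order_less_le_trans by blast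
qed

lemma open_range_\<sigma>: "open (range \<sigma>)"
 unfolding range_\<sigma>[symmetric] by (intro open_Collect_conj open_Collect_less continuous_intros)

lemma convex_range_\<sigma>: "convex (range \<sigma>)"
 using connected_continuous_image[OF continuous_\<sigma> connected_UNIV] by (simp add: is_interval_connected_1[symmetric] is_interval_convex_1)

text \<open>The Legendre transform evaluated at its maximizer; it is meaningful on the range of
  \<sigma>.\<close>

definition leg :: "real => real" where "leg s = (let t = inv \<sigma> s in t * s - E t)"

lemma leg_\<sigma>: "leg (\<sigma> t) = t * \<sigma> t - E t" by (simp add: leg_def inj_\<sigma>)

lemma le_leg: "t' * \<sigma> t - E t' <= leg (\<sigma> t)"
 using subgradient[of t t'] by (simp add: leg_\<sigma> algebra_simps)

lemma less_leg: "t' ~= t ==> t' * \<sigma> t - E t' < leg (\<sigma> t)"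
 using strict_subgradient[of t t'] by (simp add: leg_\<sigma> algebra_simps)

lemma leg_nonneg: "s : range \<sigma> ==> 0 <= leg s"
 using le_leg[of 0] by (auto simp: E_0)

lemma leg_eq_0_iff: "s : range \<sigma> ==> leg s = 0 \<longleftrightarrow> s = \<sigma> 0"
proof -
 assume "s : range \<sigma>"
 then obtain t where t: "s = \<sigma> t" by auto
 show ?thesis
 proof (cases "t = 0")
  case False
  hence "leg s > 0" using less_leg[of 0 t] by (simp add: E_0 t)
  thus ?thesis using False inj_\<sigma> t by (auto dest: injD)
 qed (simp add: t leg_\<sigma> E_0)
qed

lemma strictly_convex_leg: "strictly_convex_on (range \<sigma>) leg"
 unfolding strictly_convex_on_def
proof (intro conjI convex_range_\<sigma> ballI allI impI)
 fix x y u v :: real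
 assume xy: "x : range \<sigma>" "y : range \<sigma>" and uv: "u > 0" "v > 0" "x ~= y & u + v = 1"
 have "u * x + v * y : range \<sigma>" using convexD[OF convex_range_\<sigma> xy, of u v] uv by simp
 then obtain t where t: "u * x + v * y = \<sigma> t" by auto
 obtain a b where ab: "x = \<sigma> a" "y = \<sigma> b" using xy by auto
 have z: "\<sigma> t - x = v * (y - x)" "\<sigma> t - y = u * (x - y)"
 proof -
  have "u = 1 - v" "v = 1 - u" using uv by auto
  show "\<sigma> t - x = v * (y - x)" using t \<open>u = 1 - v\<close> by (simp add: algebra_simps)
  show "\<sigma> t - y = u * (x - y)" using t \<open>v = 1 - u\<close> by (simp add: algebra_simps)
 qed
 have "t ~= a" "t ~= b" using z uv ab by auto
 hence l: "t * x - E t < leg x" "t * y - E t < leg y" using less_leg ab by auto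
 have "leg (u * x + v * y) = u * (t * x - E t) + v * (t * y - E t)"
 proof -
  have "u * (t * x - E t) + v * (t * y - E t) = t * (u * x + v * y) - (u + v) * E t" by (simp add: algebra_simps)
  thus ?thesis using uv t by (simp add: leg_\<sigma>)
 qed
 also have "\<dots> < u * leg x + v * leg y"
  using l uv by (intro add_strict_mono mult_strict_left_mono) auto
 finally show "leg (u * x + v * y) < u * leg x + v * leg y" .
qed

lemma convex_leg: "convex_on (range \<sigma>) leg"
proof (rule convex_onI[OF _ convex_range_\<sigma>])
 fix t x y :: real assume a: "0 < t" "t < 1" "x : range \<sigma>" "y : range \<sigma>"
 show "leg ((1 - t) *\<^sub>R x + t *\<^sub>R y) <= (1 - t) * leg x + t * leg y"
 proof (cases "x = y")
  case True thus ?thesis by (simp add: algebra_simps)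
 next
  case False
  have "leg ((1 - t) * x + t * y) < (1 - t) * leg x + t * leg y"
   using strictly_convex_leg[unfolded strictly_convex_on_def, THEN conjunct2, rule_format, of x y "1 - t" t] a False by simp
  thus ?thesis by simp
 qed
qed

text \<open>The interval lies on one side of the minimum point \<sigma> 0, where the transform is
  monotone. The nearer endpoint is excluded from the interval, so a slope bound is needed to
  approach its value from inside.\<close>

lemma Inf_leg:
 assumes a: "a : range \<sigma>" and b: "b : range \<sigma>" and ab: "a < b" and out: "\<sigma> 0 \<notin> {a<..<b}"
 shows "(INF s\<in>{a<..<b}. leg s) = min (leg a) (leg b)"
proof -
 obtain ta tb where t: "a = \<sigma> ta" "b = \<sigma> tb" using a b by auto
 have inJ: "s : range \<sigma>" if "s : {a<..<b}" for s
 proof -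
  have "s : closed_segment a b" using that by (auto simp: closed_segment_eq_real_ivl)
  thus ?thesis using convex_range_\<sigma> a b unfolding convex_contains_segment by blast
 qed
 have ne: "{a<..<b} ~= {}" using ab by (simp add: dense)
 have bb: "bdd_below (leg ` {a<..<b})" by (rule bdd_belowI2[of _ 0]) (use leg_nonneg inJ in blast)
 \<comment> \<open>\<open>w\<close> is the endpoint closest to \<open>\<sigma> 0\<close>; \<open>leg\<close> increases away from it, with slope at most \<open>k\<close>.\<close>
 have main: "(INF s\<in>{a<..<b}. leg s) = leg w"
  if ge: "!!s. s : {a<..<b} ==> leg w <= leg s" and up: "!!s. s : {a<..<b} ==> leg s <= leg w + k * \<bar>s - w\<bar>"
   and w: "w = a \<or> w = b" and k: "k >= 0" for w k
 proof (rule antisym)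
  show "leg w <= (INF s\<in>{a<..<b}. leg s)" by (rule cINF_greatest[OF ne ge])
  show "(INF s\<in>{a<..<b}. leg s) <= leg w"
  proof (rule field_le_epsilon)
   fix e :: real assume e: "e > 0"
   define \<delta> where "\<delta> = min ((b - a) / 2) (e / (k + 1))"
   have \<delta>: "\<delta> > 0" "\<delta> <= (b - a) / 2" "\<delta> <= e / (k + 1)"
    unfolding \<delta>_def by (use ab e k in simp, rule min.cobounded1, rule min.cobounded2)
   define s where "s = (if w = a then a + \<delta> else b - \<delta>)"
   have s: "s : {a<..<b}" "\<bar>s - w\<bar> = \<delta>" using \<delta> w ab by (auto simp: s_def)
   have "(INF s\<in>{a<..<b}. leg s) <= leg s" by (rule cINF_lower[OF bb s(1)])
   also have "\<dots> <= leg w + k * \<delta>" using up[OF s(1)] s(2) by simp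
   also have "k * \<delta> <= (k + 1) * \<delta>" using \<delta> by simp
   also have "\<dots> <= e" using \<delta>(3) k by (simp add: field_simps)
   finally show "(INF s\<in>{a<..<b}. leg s) <= leg w + e" by simp
  qed
 qed
 show ?thesis
 proof (cases "\<sigma> 0 <= a")
  case True
  hence ta: "0 <= ta" using \<sigma>_le_iff t by simp
  have mono: "leg x <= leg y" if xr: "x : range \<sigma>" and yr: "y : range \<sigma>" and "a <= x" "x <= y" for x y
  proof -
   obtain tx ty where xy: "x = \<sigma> tx" "y = \<sigma> ty" using xr yr by auto
   have "ta <= tx" using that xy t \<sigma>_le_iff by simp
   hence "tx * x <= tx * y" using ta that by (intro mult_left_mono) auto
   thus ?thesis using le_leg[of tx ty] xy by (simp add: leg_\<sigma>)
  qed
  have "(INF s\<in>{a<..<b}. leg s) = leg a"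
  proof (rule main[of a tb])
   fix s assume s: "s : {a<..<b}"
   show "leg a <= leg s" by (rule mono) (use s inJ a in auto)
   obtain ts where ts: "s = \<sigma> ts" using inJ[OF s] by auto
   have "ts <= tb" using s ts t \<sigma>_le_iff[of ts tb] by simp
   hence "ts * (s - a) <= tb * (s - a)" using s by (intro mult_right_mono) auto
   thus "leg s <= leg a + tb * \<bar>s - a\<bar>" using le_leg[of ts ta] ts t s by (simp add: leg_\<sigma> algebra_simps)
  qed (use ta t ab \<sigma>_less_iff in \<open>auto intro: less_imp_le order_trans\<close>)
  moreover have "leg a <= leg b" by (rule mono) (use a b ab in auto)
  ultimately show ?thesis by simp
 next
  case False
  hence b0: "b <= \<sigma> 0" using out by auto
  hence tb: "tb <= 0" using \<sigma>_le_iff t by simp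
  have mono: "leg y <= leg x" if xr: "x : range \<sigma>" and yr: "y : range \<sigma>" and "y <= b" "x <= y" for x y
  proof -
   obtain tx ty where xy: "x = \<sigma> tx" "y = \<sigma> ty" using xr yr by auto
   have "ty <= tb" using that xy t \<sigma>_le_iff by simp
   hence "ty * y <= ty * x" using tb that by (intro mult_left_mono_neg) auto
   thus ?thesis using le_leg[of ty tx] xy by (simp add: leg_\<sigma>)
  qed
  have "(INF s\<in>{a<..<b}. leg s) = leg b"
  proof (rule main[of b "- ta"])
   fix s assume s: "s : {a<..<b}"
   show "leg b <= leg s" by (rule mono) (use s inJ b in auto)
   obtain ts where ts: "s = \<sigma> ts" using inJ[OF s] by auto
   have "ta <= ts" using s ts t \<sigma>_le_iff[of ta ts] by simp
   hence "ts * (s - b) <= ta * (s - b)" using s by (intro mult_right_mono_neg) auto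
   thus "leg s <= leg b + - ta * \<bar>s - b\<bar>" using le_leg[of ts tb] ts t s by (simp add: leg_\<sigma> algebra_simps)
  next
   have "ta < tb" using t ab \<sigma>_less_iff by simp
   thus "0 <= - ta" using tb by simp
  qed simp
  moreover have "leg b <= leg a" by (rule mono) (use a b ab in auto)
  ultimately show ?thesis by simp
 qed
qed

text \<open>The error bound grows with |t|, so closeness on compact intervals alone says nothing
  about the supremum. For |t| large the concave function s t - E t falls at rate at least \<delta>,
  which absorbs the growth of the error as soon as \<epsilon> < \<delta>.\<close>

lemma legendre_limit:
 assumes F: "!!\<epsilon> t. 0 < \<epsilon> ==> \<epsilon> < 1 ==> \<bar>F \<epsilon> t - E t\<bar> <= (2 + \<bar>t\<bar>) * \<epsilon>" and s: "s : range \<sigma>"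
 shows "((%\<epsilon>. SUP t. ereal (s * t - F \<epsilon> t)) \<longlongrightarrow> ereal (leg s)) (at_right 0)"
proof -
 obtain t0 where t0: "s = \<sigma> t0" using s by auto
 \<comment> \<open>The slopes of s t - E t one unit to either side of the maximizer are at least
   \<delta> in absolute value and point inwards.\<close>
 define \<delta> where "\<delta> = min (s - \<sigma> (t0 - 1)) (\<sigma> (t0 + 1) - s)"
 have \<delta>: "\<delta> > 0" unfolding \<delta>_def using \<sigma>_less t0 by simp
 define T where "T = \<bar>t0\<bar> + 1"
 have up: "s * t - F \<epsilon> t <= leg s + (2 + T) * \<epsilon>" if e: "0 < \<epsilon>" "\<epsilon> < 1" "\<epsilon> < \<delta>" for \<epsilon> t
 proof -
  have "s * t - F \<epsilon> t <= s * t - E t + (2 + \<bar>t\<bar>) * \<epsilon>" using F[OF e(1,2), of t] by linarith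
  moreover have "s * t - E t + (2 + \<bar>t\<bar>) * \<epsilon> <= leg s + (2 + T) * \<epsilon>"
  proof (cases "\<bar>t\<bar> <= T")
   case True
   hence "(2 + \<bar>t\<bar>) * \<epsilon> <= (2 + T) * \<epsilon>" using e by (intro mult_right_mono) auto
   moreover have "s * t - E t <= leg s" using le_leg[of t t0] t0 by (simp add: mult.commute)
   ultimately show ?thesis by linarith
  next
   case False
   \<comment> \<open>The reference point one unit from the maximizer on the side of t; the loss
     \<delta> |t - t1| between the two outweighs the additional error.\<close>
   define t1 where "t1 = (if t > 0 then t0 + 1 else t0 - 1)"
   have 1: "\<bar>t1\<bar> <= T" by (auto simp: t1_def T_def)
   have 2: "\<delta> * \<bar>t - t1\<bar> <= (t - t1) * (\<sigma> t1 - s)"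
   proof (cases "t > 0")
    case True
    have "t - t1 >= 0" using True False by (auto simp: t1_def T_def)
    hence "\<delta> * (t - t1) <= (\<sigma> t1 - s) * (t - t1)" using True by (intro mult_right_mono) (auto simp: \<delta>_def t1_def)
    thus ?thesis using \<open>t - t1 >= 0\<close> by (simp add: mult.commute)
   next
    case f: False
    have tt: "t1 - t >= 0" using f False by (auto simp: t1_def T_def)
    hence "\<delta> * (t1 - t) <= (s - \<sigma> t1) * (t1 - t)" using f by (intro mult_right_mono) (auto simp: \<delta>_def t1_def)
    thus ?thesis using tt by (simp add: algebra_simps abs_if)
   qed
   have "\<epsilon> * \<bar>t - t1\<bar> <= \<delta> * \<bar>t - t1\<bar>" using e by (intro mult_right_mono) auto
   moreover have "\<bar>t\<bar> * \<epsilon> <= (\<bar>t1\<bar> + \<bar>t - t1\<bar>) * \<epsilon>" using e by (intro mult_right_mono) auto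
   moreover have "E t1 + (t - t1) * \<sigma> t1 <= E t" by (rule subgradient)
   ultimately have "s * t - E t + (2 + \<bar>t\<bar>) * \<epsilon> <= s * t1 - E t1 + (2 + \<bar>t1\<bar>) * \<epsilon>"
    using 2 by (simp add: algebra_simps)
   moreover have "s * t1 - E t1 <= leg s" using le_leg[of t1 t0] t0 by (simp add: mult.commute)
   moreover have "(2 + \<bar>t1\<bar>) * \<epsilon> <= (2 + T) * \<epsilon>" using e 1 by (intro mult_right_mono) auto
   ultimately show ?thesis by linarith
  qed
  ultimately show ?thesis by linarith
 qed
 have lo: "leg s - (2 + T) * \<epsilon> <= s * t0 - F \<epsilon> t0" if e: "0 < \<epsilon>" "\<epsilon> < 1" for \<epsilon>
 proof -
  have "(2 + \<bar>t0\<bar>) * \<epsilon> <= (2 + T) * \<epsilon>" using e by (intro mult_right_mono) (auto simp: T_def)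
  thus ?thesis using F[OF e, of t0] t0 by (simp add: leg_\<sigma> mult.commute)
 qed
 have ev: "\<forall>\<^sub>F \<epsilon> in at_right (0::real). 0 < \<epsilon> & \<epsilon> < 1 & \<epsilon> < \<delta>"
  unfolding eventually_at_right[OF zero_less_one] using \<delta> by (intro exI[of _ "min 1 \<delta>"]) auto
 show ?thesis
 proof (rule tendsto_sandwich)
  show "\<forall>\<^sub>F \<epsilon> in at_right 0. ereal (leg s - (2 + T) * \<epsilon>) <= (SUP t. ereal (s * t - F \<epsilon> t))"
   using ev by eventually_elim (auto intro!: SUP_upper2[of t0] lo)
  show "\<forall>\<^sub>F \<epsilon> in at_right 0. (SUP t. ereal (s * t - F \<epsilon> t)) <= ereal (leg s + (2 + T) * \<epsilon>)"
   using ev by eventually_elim (auto intro!: SUP_least up)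
  have "((%\<epsilon>. ereal (leg s - (2 + T) * \<epsilon>)) \<longlongrightarrow> ereal (leg s - (2 + T) * 0)) (at_right 0)" by (intro tendsto_intros)
  thus "((%\<epsilon>. ereal (leg s - (2 + T) * \<epsilon>)) \<longlongrightarrow> ereal (leg s)) (at_right 0)" by simp
  have "((%\<epsilon>. ereal (leg s + (2 + T) * \<epsilon>)) \<longlongrightarrow> ereal (leg s + (2 + T) * 0)) (at_right 0)" by (intro tendsto_intros)
  thus "((%\<epsilon>. ereal (leg s + (2 + T) * \<epsilon>)) \<longlongrightarrow> ereal (leg s)) (at_right 0)" by simp
 qed
qed

end

lemma considered_familyD: "considered_family d \<alpha> \<Lambda> f \<Psi> g ==> admissible_family d \<alpha> \<Lambda> f \<Psi> g"
 by (simp add: considered_family_def)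

section \<open>Admissible families and the Legendre transform of sequences\<close>

context expanding_map
begin

lemma mean_potential_birkhoff_sum:
 assumes g: "continuous_on \<Lambda> g" and \<eta>: "\<eta> : invariant_measures \<Lambda> f"
 shows "(\<integral>x. birkhoff_sum f g n x \<partial>\<eta>) = real n * (\<integral>x. g x \<partial>\<eta>)"
  and "integrable \<eta> (birkhoff_sum f g n)"
  and "mean_potential (birkhoff_sum f g) \<eta> = (\<integral>x. g x \<partial>\<eta>)"
proof -
 interpret measure_preserving \<eta> f by (rule invariant_measuresD(4)[OF \<eta>])
 have i: "integrable \<eta> g" by (rule integrable_continuous[OF invariant_measuresD(1,2)[OF \<eta>] g])
 have ij: "integrable \<eta> (%x. g ((f ^^ j) x))" and ej: "(\<integral>x. g ((f ^^ j) x) \<partial>\<eta>) = (\<integral>x. g x \<partial>\<eta>)" for j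
  using integrable_distr[OF measurable_funpow[of j], of g] integral_distr[OF measurable_funpow[of j] borel_measurable_integrable[OF i]] i
  by (auto simp: distr_funpow)
 show e: "(\<integral>x. birkhoff_sum f g n x \<partial>\<eta>) = real n * (\<integral>x. g x \<partial>\<eta>)" for n
  unfolding birkhoff_sum_def by (subst Bochner_Integration.integral_sum[OF ij]) (simp add: ej)
 show "integrable \<eta> (birkhoff_sum f g n)"
  unfolding birkhoff_sum_def by (rule Bochner_Integration.integrable_sum[OF ij])
 have "\<forall>\<^sub>F n in sequentially. (\<integral>x. g x \<partial>\<eta>) = (1 / real n) * (\<integral>x. birkhoff_sum f g n x \<partial>\<eta>)"
  using eventually_ge_at_top[of 1] by eventually_elim (simp add: e)
 hence "(%n. (1 / real n) * (\<integral>x. birkhoff_sum f g n x \<partial>\<eta>)) \<longlonglongrightarrow> (\<integral>x. g x \<partial>\<eta>)"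
  by (rule Lim_transform_eventually[OF tendsto_const])
 thus "mean_potential (birkhoff_sum f g) \<eta> = (\<integral>x. g x \<partial>\<eta>)"
  unfolding mean_potential_def by (rule limI)
qed

text \<open>Uniform closeness of \<Theta> n to the Birkhoff sums passes to integrals, and by
  invariance the integral of a Birkhoff sum is n times that of g. The approximation is thus uniform
  over all invariant measures.\<close>

lemma admissible_mean_potential:
 assumes \<Theta>: "tame C \<Theta>" and g: "continuous_on \<Lambda> g"
  and lim: "limsup (%n. ereal (1 / real n) * (SUP x\<in>\<Lambda>. ereal \<bar>\<Theta> n x - birkhoff_sum f g n x\<bar>)) < ereal \<epsilon>"
  and \<eta>: "\<eta> : invariant_measures \<Lambda> f"
 shows "\<bar>(\<integral>x. g x \<partial>\<eta>) - mean_potential \<Theta> \<eta>\<bar> <= \<epsilon>"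
proof -
 interpret prob_space \<eta> by (rule invariant_measuresD(1)[OF \<eta>])
 have "\<forall>\<^sub>F n in sequentially. ereal (1 / real n) * (SUP x\<in>\<Lambda>. ereal \<bar>\<Theta> n x - birkhoff_sum f g n x\<bar>) < ereal \<epsilon>"
  by (rule Limsup_lessD[OF lim])
 hence ev: "\<forall>\<^sub>F n in sequentially. \<bar>(\<integral>x. \<Theta> n x \<partial>\<eta>) / real n - (\<integral>x. g x \<partial>\<eta>)\<bar> <= \<epsilon>"
  using eventually_ge_at_top[of 1]
 proof eventually_elim
  case (elim n)
  have pt: "\<bar>\<Theta> n x - birkhoff_sum f g n x\<bar> <= real n * \<epsilon>" if "x : \<Lambda>" for x
  proof -
   have "ereal (1 / real n) * ereal \<bar>\<Theta> n x - birkhoff_sum f g n x\<bar> <= ereal (1 / real n) * (SUP x\<in>\<Lambda>. ereal \<bar>\<Theta> n x - birkhoff_sum f g n x\<bar>)"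
    by (intro ereal_mult_left_mono SUP_upper that) auto
   also have "\<dots> < ereal \<epsilon>" by (rule elim(1))
   finally have "1 / real n * \<bar>\<Theta> n x - birkhoff_sum f g n x\<bar> < \<epsilon>" by simp
   thus ?thesis using elim(2) by (simp add: field_simps)
  qed
  note i1 = integrable_\<Theta>[OF \<Theta> \<eta> elim(2)] and i2 = mean_potential_birkhoff_sum(2)[OF g \<eta>, of n]
  have "\<bar>(\<integral>x. \<Theta> n x \<partial>\<eta>) - real n * (\<integral>x. g x \<partial>\<eta>)\<bar> = \<bar>\<integral>x. \<Theta> n x - birkhoff_sum f g n x \<partial>\<eta>\<bar>"
   using i1 i2 by (simp add: mean_potential_birkhoff_sum(1)[OF g \<eta>])
  also have "\<dots> <= (\<integral>x. \<bar>\<Theta> n x - birkhoff_sum f g n x\<bar> \<partial>\<eta>)" by (rule integral_abs_bound)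
  also have "\<dots> <= (\<integral>x. real n * \<epsilon> \<partial>\<eta>)"
   by (intro integral_mono integrable_abs Bochner_Integration.integrable_diff i1 i2)
     (use pt invariant_measuresD(3)[OF \<eta>] in auto)
  finally have "\<bar>(\<integral>x. \<Theta> n x \<partial>\<eta>) - real n * (\<integral>x. g x \<partial>\<eta>)\<bar> <= real n * \<epsilon>" by (simp add: prob_space)
  hence "\<bar>(\<integral>x. \<Theta> n x \<partial>\<eta>) - real n * (\<integral>x. g x \<partial>\<eta>)\<bar> / real n <= \<epsilon>" using elim(2) by (simp add: field_simps)
  moreover have "\<bar>(\<integral>x. \<Theta> n x \<partial>\<eta>) - real n * (\<integral>x. g x \<partial>\<eta>)\<bar> / real n = \<bar>((\<integral>x. \<Theta> n x \<partial>\<eta>) - real n * (\<integral>x. g x \<partial>\<eta>)) / real n\<bar>" by simp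
  moreover have "((\<integral>x. \<Theta> n x \<partial>\<eta>) - real n * (\<integral>x. g x \<partial>\<eta>)) / real n = (\<integral>x. \<Theta> n x \<partial>\<eta>) / real n - (\<integral>x. g x \<partial>\<eta>)"
   using elim(2) by (simp add: field_simps)
  ultimately show ?case by simp
 qed
 have "(%n. \<bar>(\<integral>x. \<Theta> n x \<partial>\<eta>) / real n - (\<integral>x. g x \<partial>\<eta>)\<bar>) \<longlonglongrightarrow> \<bar>mean_potential \<Theta> \<eta> - (\<integral>x. g x \<partial>\<eta>)\<bar>"
  by (intro tendsto_intros mean_potential_bound(2)[OF \<Theta> \<eta>])
 from tendsto_upperbound[OF this ev] show ?thesis by (simp add: abs_minus_commute)
qed

lemma top_pressure_close:
 assumes P: "top_pressure \<Lambda> f \<Theta> = ereal P" and inv: "\<mu> : invariant_measures \<Lambda> f" "metric_entropy f \<mu> = ereal h"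
  and close: "!!\<eta>. \<eta> : invariant_measures \<Lambda> f ==> \<bar>mean_potential \<Theta>' \<eta> - mean_potential \<Theta> \<eta>\<bar> <= \<delta>"
 obtains P' where "top_pressure \<Lambda> f \<Theta>' = ereal P'" "\<bar>P' - P\<bar> <= \<delta>"
proof -
 have up: "top_pressure \<Lambda> f \<Theta>' <= ereal (P + \<delta>)"
  unfolding top_pressure_def
 proof (rule SUP_least)
  fix \<eta> assume \<eta>: "\<eta> : invariant_measures \<Lambda> f"
  have "mean_potential \<Theta>' \<eta> <= mean_potential \<Theta> \<eta> + \<delta>" using close[OF \<eta>] by linarith
  hence "metric_entropy f \<eta> + ereal (mean_potential \<Theta>' \<eta>) <= metric_entropy f \<eta> + (ereal (mean_potential \<Theta> \<eta>) + ereal \<delta>)"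
   by (intro add_left_mono) simp
  also have "\<dots> = metric_entropy f \<eta> + ereal (mean_potential \<Theta> \<eta>) + ereal \<delta>" by (simp only: add.assoc)
  also have "\<dots> <= ereal P + ereal \<delta>"
   unfolding P[symmetric] top_pressure_def by (intro add_right_mono SUP_upper \<eta>)
  finally show "metric_entropy f \<eta> + ereal (mean_potential \<Theta>' \<eta>) <= ereal (P + \<delta>)" by simp
 qed
 have "ereal P <= top_pressure \<Lambda> f \<Theta>' + ereal \<delta>"
  unfolding P[symmetric] top_pressure_def[of _ _ \<Theta>]
 proof (rule SUP_least)
  fix \<eta> assume \<eta>: "\<eta> : invariant_measures \<Lambda> f"
  have "mean_potential \<Theta> \<eta> <= mean_potential \<Theta>' \<eta> + \<delta>" using close[OF \<eta>] by linarith
  hence "metric_entropy f \<eta> + ereal (mean_potential \<Theta> \<eta>) <= metric_entropy f \<eta> + (ereal (mean_potential \<Theta>' \<eta>) + ereal \<delta>)"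
   by (intro add_left_mono) simp
  also have "\<dots> = metric_entropy f \<eta> + ereal (mean_potential \<Theta>' \<eta>) + ereal \<delta>" by (simp only: add.assoc)
  also have "\<dots> <= top_pressure \<Lambda> f \<Theta>' + ereal \<delta>"
   unfolding top_pressure_def by (intro add_right_mono SUP_upper \<eta>)
  finally show "metric_entropy f \<eta> + ereal (mean_potential \<Theta> \<eta>) <= top_pressure \<Lambda> f \<Theta>' + ereal \<delta>" .
 qed
 thus ?thesis using up that by (cases "top_pressure \<Lambda> f \<Theta>'") (auto simp: abs_le_iff)
qed

text \<open>One third of e bounds C / m, one third the approximation of \<Theta> m / m by a Hoelder
  function. The last third makes the limsup strictly smaller than e.\<close>

lemma admissible_family_exists:
 assumes \<Theta>: "tame C \<Theta>"
  and dense: "!!g e. continuous_on \<Lambda> g ==> e > 0 ==> EX h. holder_on d \<alpha> \<Lambda> h & (ALL x:\<Lambda>. \<bar>g x - h x\<bar> < e)"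
 obtains g where "admissible_family d \<alpha> \<Lambda> f \<Theta> g"
proof -
 have "EX h. holder_on d \<alpha> \<Lambda> h &
  limsup (%n. ereal (1 / real n) * (SUP x\<in>\<Lambda>. ereal \<bar>\<Theta> n x - birkhoff_sum f h n x\<bar>)) < ereal e" if e: "e > 0" for e
 proof -
  have C: "C >= 0" by (rule C_nonneg[OF \<Theta>])
  obtain m :: nat where m0: "3 * (C + 1) / e < real m" using reals_Archimedean2 by blast
  have "0 < 3 * (C + 1) / e" using C e by simp
  hence m: "m >= 1" using m0 by (cases m) auto
  have "3 * (C + 1) < real m * e" using m0 e by (simp add: field_simps)
  hence Cm: "C / real m <= e / 3" using m C by (simp add: field_simps)
  have cont: "continuous_on \<Lambda> (%y. \<Theta> m y / real m)" using m by (intro continuous_intros continuous_\<Theta>[OF \<Theta> m]) auto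
  obtain h where h: "holder_on d \<alpha> \<Lambda> h" "ALL x:\<Lambda>. \<bar>\<Theta> m x / real m - h x\<bar> < e / 3"
   using dense[OF cont, of "e/3"] e by auto
  obtain c where c: "!!n x. n >= 1 ==> x : \<Lambda> ==> \<bar>\<Theta> n x - birkhoff_sum f (%y. \<Theta> m y / real m) n x\<bar> <= real n * (C / real m) + c"
   using birkhoff_average_approximation[OF \<Theta> m] by metis
  have bound: "ereal (1 / real n) * (SUP x\<in>\<Lambda>. ereal \<bar>\<Theta> n x - birkhoff_sum f h n x\<bar>) <= ereal (2 * e / 3 + c / real n)"
   if n: "n >= 1" for n
  proof -
   have "(SUP x\<in>\<Lambda>. ereal \<bar>\<Theta> n x - birkhoff_sum f h n x\<bar>) <= ereal (real n * (2 * e / 3) + c)"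
   proof (rule SUP_least)
    fix x assume x: "x : \<Lambda>"
    have "\<bar>birkhoff_sum f (%y. \<Theta> m y / real m) n x - birkhoff_sum f h n x\<bar> <= (\<Sum>j<n. e / 3)"
     unfolding birkhoff_sum_def sum_subtractf[symmetric]
     by (rule order_trans[OF sum_abs sum_mono]) (use h(2) funpow_mem[OF x] in \<open>auto intro: less_imp_le\<close>)
    moreover have "real n * (C / real m) <= real n * (e / 3)" using Cm by (intro mult_left_mono) auto
    moreover have "(\<Sum>j<n. e / 3) = real n * (e / 3)" "real n * (2 * e / 3) = real n * (e / 3) + real n * (e / 3)"
     by (simp_all add: algebra_simps)
    ultimately have "\<bar>\<Theta> n x - birkhoff_sum f h n x\<bar> <= real n * (2 * e / 3) + c"
     using c[OF n x] by linarith
    thus "ereal \<bar>\<Theta> n x - birkhoff_sum f h n x\<bar> <= ereal (real n * (2 * e / 3) + c)" by simp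
   qed
   hence "ereal (1 / real n) * (SUP x\<in>\<Lambda>. ereal \<bar>\<Theta> n x - birkhoff_sum f h n x\<bar>) <= ereal (1 / real n) * ereal (real n * (2 * e / 3) + c)"
    by (intro ereal_mult_left_mono) auto
   also have "\<dots> = ereal (2 * e / 3 + c / real n)" using n by (simp add: field_simps)
   finally show ?thesis .
  qed
  have "limsup (%n. ereal (1 / real n) * (SUP x\<in>\<Lambda>. ereal \<bar>\<Theta> n x - birkhoff_sum f h n x\<bar>)) <= limsup (%n. ereal (2 * e / 3 + c / real n))"
   by (rule Limsup_mono) (use bound in \<open>auto simp: eventually_sequentially intro!: exI[of _ 1]\<close>)
  also have "\<dots> = ereal (2 * e / 3 + 0)"
   by (intro lim_imp_Limsup tendsto_ereal tendsto_add tendsto_const lim_const_over_n) simp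
  also have "\<dots> < ereal e" using e by simp
  finally show ?thesis using h(1) by blast
 qed
 hence ex: "ALL e:{0<..}. EX h. holder_on d \<alpha> \<Lambda> h &
  limsup (%n. ereal (1 / real n) * (SUP x\<in>\<Lambda>. ereal \<bar>\<Theta> n x - birkhoff_sum f h n x\<bar>)) < ereal e" by simp
 from bchoice[OF ex] obtain g where "ALL e:{0<..}. holder_on d \<alpha> \<Lambda> (g e) &
  limsup (%n. ereal (1 / real n) * (SUP x\<in>\<Lambda>. ereal \<bar>\<Theta> n x - birkhoff_sum f (g e) n x\<bar>)) < ereal e" ..
 thus ?thesis by (intro that[of g]) (auto simp: admissible_family_def)
qed


lemma cohomologous_to_const_integral:
 assumes "cohomologous_to_const \<Lambda> f g"
 obtains c where "!!\<eta>. \<eta> : invariant_measures \<Lambda> f ==> (\<integral>x. g x \<partial>\<eta>) = c"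
proof -
 obtain u c where u: "continuous_on \<Lambda> u" "!!x. x : \<Lambda> ==> g x = u (f x) - u x + c"
  using assms by (auto simp: cohomologous_to_const_def)
 show ?thesis
 proof (rule that[of c])
  fix \<eta> assume \<eta>: "\<eta> : invariant_measures \<Lambda> f"
  interpret measure_preserving \<eta> f by (rule invariant_measuresD(4)[OF \<eta>])
  have i: "integrable \<eta> u" by (rule integrable_continuous[OF invariant_measuresD(1,2)[OF \<eta>] u(1)])
  have i': "integrable \<eta> (%x. u (f x))" and e: "(\<integral>x. u (f x) \<partial>\<eta>) = (\<integral>x. u x \<partial>\<eta>)"
   using integrable_distr[OF measurable_T, of u] integral_distr[OF measurable_T borel_measurable_integrable[OF i]] i
   by (auto simp: distr_T)
  have "(\<integral>x. g x \<partial>\<eta>) = (\<integral>x. u (f x) - u x + c \<partial>\<eta>)"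
   by (rule Bochner_Integration.integral_cong) (use u(2) invariant_measuresD(3)[OF \<eta>] in auto)
  also have "\<dots> = c" using i i' e by (simp add: prob_space)
  finally show "(\<integral>x. g x \<partial>\<eta>) = c" .
 qed
qed

text \<open>The constant c itself is a Hoelder function whose Birkhoff sums stay at bounded distance
  from \<Psi>, so it serves for every \<epsilon>.\<close>

lemma bounded_imp_cohomologous:
 assumes "EX c B. ALL n>=1. ALL x:\<Lambda>. \<bar>\<Psi> n x - real n * c\<bar> <= B"
 shows "seq_cohomologous_to_const d \<alpha> \<Lambda> f \<Psi>"
proof -
 obtain c B where cB: "!!n x. n >= 1 ==> x : \<Lambda> ==> \<bar>\<Psi> n x - real n * c\<bar> <= B" using assms by blast
 have "limsup (%n. ereal (1 / real n) * (SUP x\<in>\<Lambda>. ereal \<bar>\<Psi> n x - birkhoff_sum f (%_. c) n x\<bar>)) < ereal e" if e: "e > 0" for e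
 proof -
  have "limsup (%n. ereal (1 / real n) * (SUP x\<in>\<Lambda>. ereal \<bar>\<Psi> n x - birkhoff_sum f (%_. c) n x\<bar>)) <= limsup (%n. ereal (B / real n))"
  proof (rule Limsup_mono)
   show "\<forall>\<^sub>F n in sequentially. ereal (1 / real n) * (SUP x\<in>\<Lambda>. ereal \<bar>\<Psi> n x - birkhoff_sum f (%_. c) n x\<bar>) <= ereal (B / real n)"
    using eventually_ge_at_top[of 1]
   proof eventually_elim
    case (elim n)
    have "(SUP x\<in>\<Lambda>. ereal \<bar>\<Psi> n x - birkhoff_sum f (%_. c) n x\<bar>) <= ereal B"
     by (rule SUP_least) (use cB elim in \<open>auto simp: birkhoff_sum_def\<close>)
    hence "ereal (1 / real n) * (SUP x\<in>\<Lambda>. ereal \<bar>\<Psi> n x - birkhoff_sum f (%_. c) n x\<bar>) <= ereal (1 / real n) * ereal B"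
     by (intro ereal_mult_left_mono) auto
    thus ?case by simp
   qed
  qed
  also have "\<dots> = ereal 0" by (rule lim_imp_Limsup) (auto intro!: lim_const_over_n)
  finally show ?thesis using e by (auto intro: le_less_trans)
 qed
 hence "admissible_family d \<alpha> \<Lambda> f \<Psi> (%_ _. c)"
  by (auto simp: admissible_family_def holder_on_def intro!: exI[of _ 0])
 moreover have "cohomologous_to_const \<Lambda> f (%_. c)"
  unfolding cohomologous_to_const_def by (intro exI[of _ "%_. 0"] exI[of _ c]) auto
 ultimately show ?thesis unfolding seq_cohomologous_to_const_def by (auto intro: always_eventually)
qed

text \<open>A function cohomologous to a constant has the same integral against all invariant
  measures. If the sequence is not cohomologous to a constant, two invariant measures have different
  means, and a close enough approximation must distinguish them. Hence the restriction on families
  is automatic for small \<epsilon>.\<close>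

lemma admissible_imp_considered:
 assumes \<Theta>: "tame C \<Theta>" and holder_continuous: "!!g. holder_on d \<alpha> \<Lambda> g ==> continuous_on \<Lambda> g"
  and adm: "admissible_family d \<alpha> \<Lambda> f \<Theta> g"
 shows "considered_family d \<alpha> \<Lambda> f \<Theta> g"
 unfolding considered_family_def
proof (intro conjI adm impI)
 assume nc: "\<not> seq_cohomologous_to_const d \<alpha> \<Lambda> f \<Theta>"
 \<comment> \<open>The pencil of the sequence with itself: the states of \<Theta> and 2 \<Theta>
   cannot have equal means unless \<Theta> is bounded up to a linear term.\<close>
 have "EX \<eta>1:invariant_measures \<Lambda> f. EX \<eta>2:invariant_measures \<Lambda> f. mean_potential \<Theta> \<eta>1 ~= mean_potential \<Theta> \<eta>2"
 proof (rule tame_family[OF \<Theta> \<Theta>])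
  fix Pr' :: "real => real" and \<nu> :: "real => 'm measure"
  assume i: "!!t. \<nu> t : invariant_measures \<Lambda> f"
   and *: "!!t t'. t ~= t' ==> mean_potential \<Theta> (\<nu> t) = mean_potential \<Theta> (\<nu> t') ==> EX c B. ALL n>=1. ALL x:\<Lambda>. \<bar>\<Theta> n x - real n * c\<bar> <= B"
  have "mean_potential \<Theta> (\<nu> 0) ~= mean_potential \<Theta> (\<nu> 1)"
   using *[of 0 1] nc bounded_imp_cohomologous by fastforce
  thus ?thesis using i by blast
 qed
 then obtain \<eta>1 \<eta>2 where \<eta>: "\<eta>1 : invariant_measures \<Lambda> f" "\<eta>2 : invariant_measures \<Lambda> f" "mean_potential \<Theta> \<eta>1 ~= mean_potential \<Theta> \<eta>2"
  by blast
 \<comment> \<open>Below a third of the difference, the intervals of radius \<epsilon> around the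
   two means are disjoint.\<close>
 define e where "e = min 1 (\<bar>mean_potential \<Theta> \<eta>2 - mean_potential \<Theta> \<eta>1\<bar> / 3)"
 have e: "e > 0" using \<eta> by (simp add: e_def)
 have "\<not> cohomologous_to_const \<Lambda> f (g \<epsilon>)" if \<epsilon>: "0 < \<epsilon>" "\<epsilon> < e" for \<epsilon>
 proof
  assume "cohomologous_to_const \<Lambda> f (g \<epsilon>)"
  then obtain c where c: "!!\<eta>. \<eta> : invariant_measures \<Lambda> f ==> (\<integral>x. g \<epsilon> x \<partial>\<eta>) = c"
   using cohomologous_to_const_integral by metis
  have e1: "\<epsilon> : {0<..<1}" "\<epsilon> < \<bar>mean_potential \<Theta> \<eta>2 - mean_potential \<Theta> \<eta>1\<bar> / 3" using \<epsilon> by (auto simp: e_def)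
  have ad: "holder_on d \<alpha> \<Lambda> (g \<epsilon>)" "limsup (%n. ereal (1 / real n) * (SUP x\<in>\<Lambda>. ereal \<bar>\<Theta> n x - birkhoff_sum f (g \<epsilon>) n x\<bar>)) < ereal \<epsilon>"
   using adm e1(1) unfolding admissible_family_def by blast+
  have "\<bar>c - mean_potential \<Theta> \<eta>1\<bar> <= \<epsilon>" "\<bar>c - mean_potential \<Theta> \<eta>2\<bar> <= \<epsilon>"
   using admissible_mean_potential[OF \<Theta> holder_continuous[OF ad(1)] ad(2)] \<eta> c by force+
  hence "\<bar>mean_potential \<Theta> \<eta>2 - mean_potential \<Theta> \<eta>1\<bar> <= 2 * \<epsilon>" by (simp add: abs_le_iff)
  thus False using e1(2) \<epsilon>(1) by simp
 qed
 thus "\<forall>\<^sub>F \<epsilon> in at_right 0. \<not> cohomologous_to_const \<Lambda> f (g \<epsilon>)"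
  using e by (auto simp: eventually_at_right_field)
qed

text \<open>The manifold enters only through two facts about Hoelder functions: they are continuous,
  so that pressures of admissible functions are controlled, and they are dense, so that admissible
  families exist.\<close>

lemma legendre_structure:
 fixes d :: "'m => 'm => ennreal"
 assumes \<Phi>: "tame C \<Phi>" and \<Psi>: "tame C' \<Psi>"
  and holder_continuous: "!!g. holder_on d \<alpha> \<Lambda> g ==> continuous_on \<Lambda> g"
  and holder_dense: "!!g e. continuous_on \<Lambda> g ==> e > 0 ==> EX h. holder_on d \<alpha> \<Lambda> h & (ALL x:\<Lambda>. \<bar>g x - h x\<bar> < e)"
  and not_cohomologous: "\<not> seq_cohomologous_to_const d \<alpha> \<Lambda> f \<Psi>"
 defines "\<mu> \<equiv> equilibrium_state \<Lambda> f \<Phi>" and "E \<equiv> free_energy \<Lambda> f \<Phi> \<Psi>"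
  and "J \<equiv> rate_domain \<Lambda> f \<Phi> \<Psi>" and "I \<equiv> legendre d \<alpha> \<Lambda> f \<Phi> \<Psi>"
 shows "(ALL t. deriv E t : J & I (deriv E t) = t * deriv E t - E t) &
   (ALL s:J. 0 <= I s) & convex_on J I &
   (ALL a:J. ALL b:J. a < b & mean_potential \<Psi> \<mu> \<notin> {a<..<b} -->
    (INF s\<in>{a<..<b}. I s) = min (I a) (I b)) &
   (ALL s:J. ereal (I s) =
    (INF \<eta> \<in> {\<eta> : invariant_measures \<Lambda> f. mean_potential \<Psi> \<eta> = s}.
      top_pressure \<Lambda> f \<Phi> - metric_entropy f \<eta> - ereal (mean_potential \<Phi> \<eta>))) &
   (ALL s:J. I s = 0 \<longleftrightarrow> s = mean_potential \<Psi> \<mu>) &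
   (EX V. open V & mean_potential \<Psi> \<mu> : V & V \<subseteq> J & strictly_convex_on V I)"
proof -
 obtain Pr :: "real => real" and \<mu>t :: "real => 'm measure" where
  inv: "!!t. \<mu>t t : invariant_measures \<Lambda> f" and
  Pr: "!!t. top_pressure \<Lambda> f (seq_add_scaled \<Phi> t \<Psi>) = ereal (Pr t)" and
  eqs: "!!t. equilibrium_state \<Lambda> f (seq_add_scaled \<Phi> t \<Psi>) = \<mu>t t" and
  ent: "!!t. metric_entropy f (\<mu>t t) = ereal (Pr t - mean_potential \<Phi> (\<mu>t t) - t * mean_potential \<Psi> (\<mu>t t))" and
  ent_le: "!!t \<eta>. \<eta> : invariant_measures \<Lambda> f ==> metric_entropy f \<eta> <= ereal (Pr t - mean_potential \<Phi> \<eta> - t * mean_potential \<Psi> \<eta>)" and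
  sub: "!!t t'. Pr t + (t' - t) * mean_potential \<Psi> (\<mu>t t) <= Pr t'" and
  cont: "continuous_on UNIV (%t. mean_potential \<Psi> (\<mu>t t))" and
  inj: "!!t t'. t ~= t' ==> mean_potential \<Psi> (\<mu>t t) = mean_potential \<Psi> (\<mu>t t') ==>
   EX c B. ALL n>=1. ALL x:\<Lambda>. \<bar>\<Psi> n x - real n * c\<bar> <= B"
  by (rule tame_family[OF \<Phi> \<Psi>]) (rule that)
 define \<sigma> where "\<sigma> t = mean_potential \<Psi> (\<mu>t t)" for t
 have z: "seq_add_scaled \<Phi> 0 \<Psi> = \<Phi>" by (simp add: seq_add_scaled_def fun_eq_iff)
 have Pr0: "top_pressure \<Lambda> f \<Phi> = ereal (Pr 0)" using Pr[of 0] by (simp add: z)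
 have \<mu>0: "\<mu> = \<mu>t 0" using eqs[of 0] by (simp add: \<mu>_def z)
 have E: "E t = Pr t - Pr 0" for t by (simp add: E_def free_energy_def Pr Pr0)
 have not_bdd: "\<not> (EX c B. ALL n>=1. ALL x:\<Lambda>. \<bar>\<Psi> n x - real n * c\<bar> <= B)"
  using bounded_imp_cohomologous not_cohomologous by blast
 interpret smooth_convex E \<sigma>
 proof
  show "E t + (t' - t) * \<sigma> t <= E t'" for t t' using sub[of t t'] by (simp add: E \<sigma>_def)
  show "continuous_on UNIV \<sigma>" using cont by (simp add: \<sigma>_def)
  show "inj \<sigma>" unfolding inj_def \<sigma>_def using inj not_bdd by blast
  show "E 0 = 0" by (simp add: E)
 qed
 have J: "J = range \<sigma>" unfolding J_def rate_domain_def Let_def eqs using range_\<sigma> by (simp add: \<sigma>_def)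
 have legendre: "((%\<epsilon>. legendre_fun \<Lambda> f (\<phi> \<epsilon>) (g \<epsilon>) s) \<longlongrightarrow> ereal (leg s)) (at_right 0)"
  if adm: "admissible_family d \<alpha> \<Lambda> f \<Phi> \<phi>" "admissible_family d \<alpha> \<Lambda> f \<Psi> g" and s: "s : range \<sigma>" for \<phi> g s
  unfolding legendre_fun_def
 proof (rule legendre_limit[OF _ s])
  fix \<epsilon> t :: real assume \<epsilon>: "0 < \<epsilon>" "\<epsilon> < 1"
  have c\<phi>: "continuous_on \<Lambda> (\<phi> \<epsilon>)" and cg: "continuous_on \<Lambda> (g \<epsilon>)"
   using adm \<epsilon> by (auto simp: admissible_family_def intro: holder_continuous)
  have m\<phi>: "\<bar>(\<integral>x. \<phi> \<epsilon> x \<partial>\<eta>) - mean_potential \<Phi> \<eta>\<bar> <= \<epsilon>" and mg: "\<bar>(\<integral>x. g \<epsilon> x \<partial>\<eta>) - mean_potential \<Psi> \<eta>\<bar> <= \<epsilon>"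
   if "\<eta> : invariant_measures \<Lambda> f" for \<eta>
   using admissible_mean_potential[OF \<Phi> c\<phi> _ that] admissible_mean_potential[OF \<Psi> cg _ that] adm \<epsilon>
   by (auto simp: admissible_family_def)
  \<comment> \<open>Applied with u = t and with u = 0; the two errors add up to (2 + |t|)
    \<epsilon>, the form required by \<open>legendre_limit\<close>.\<close>
  have close: "\<bar>mean_potential (birkhoff_sum f (%x. \<phi> \<epsilon> x + u * g \<epsilon> x)) \<eta> - mean_potential (seq_add_scaled \<Phi> u \<Psi>) \<eta>\<bar> <= (1 + \<bar>u\<bar>) * \<epsilon>"
   if \<eta>: "\<eta> : invariant_measures \<Lambda> f" for u \<eta>
  proof -
   have cc: "continuous_on \<Lambda> (%x. \<phi> \<epsilon> x + u * g \<epsilon> x)" by (intro continuous_intros c\<phi> cg)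
   note ii = integrable_continuous[OF invariant_measuresD(1,2)[OF \<eta>]]
   have "mean_potential (birkhoff_sum f (%x. \<phi> \<epsilon> x + u * g \<epsilon> x)) \<eta> = (\<integral>x. \<phi> \<epsilon> x \<partial>\<eta>) + u * (\<integral>x. g \<epsilon> x \<partial>\<eta>)"
    using mean_potential_birkhoff_sum(3)[OF cc \<eta>] ii[OF c\<phi>] ii[OF cg] by simp
   moreover have "mean_potential (seq_add_scaled \<Phi> u \<Psi>) \<eta> = mean_potential \<Phi> \<eta> + u * mean_potential \<Psi> \<eta>"
    by (rule mean_potential_add_scaled[OF \<Phi> \<Psi> \<eta>])
   moreover have "\<bar>u * ((\<integral>x. g \<epsilon> x \<partial>\<eta>) - mean_potential \<Psi> \<eta>)\<bar> <= \<bar>u\<bar> * \<epsilon>"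
    unfolding abs_mult by (intro mult_left_mono mg \<eta>) auto
   ultimately show ?thesis using m\<phi>[OF \<eta>] by (simp add: algebra_simps)
  qed
  have hh: "EX h. metric_entropy f (\<mu>t 0) = ereal h" using ent by blast
  obtain P1 where P1: "top_pressure \<Lambda> f (birkhoff_sum f (%x. \<phi> \<epsilon> x + t * g \<epsilon> x)) = ereal P1" "\<bar>P1 - Pr t\<bar> <= (1 + \<bar>t\<bar>) * \<epsilon>"
   using top_pressure_close[OF Pr[of t] inv[of 0] _ close[of _ t]] hh by metis
  obtain P0 where P0: "top_pressure \<Lambda> f (birkhoff_sum f (%x. \<phi> \<epsilon> x + 0 * g \<epsilon> x)) = ereal P0" "\<bar>P0 - Pr 0\<bar> <= (1 + \<bar>0\<bar>) * \<epsilon>"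
   using top_pressure_close[OF Pr[of 0] inv[of 0] _ close[of _ 0]] hh by metis
  have "top_pressure \<Lambda> f (birkhoff_sum f (\<phi> \<epsilon>)) = ereal P0" using P0(1) by simp
  thus "\<bar>real_of_ereal (top_pressure \<Lambda> f (birkhoff_sum f (%x. \<phi> \<epsilon> x + t * g \<epsilon> x)) - top_pressure \<Lambda> f (birkhoff_sum f (\<phi> \<epsilon>))) - E t\<bar> <= (2 + \<bar>t\<bar>) * \<epsilon>"
   using P1 P0(2) by (simp add: E algebra_simps)
 qed
 \<comment> \<open>Without a single family every number would satisfy the description of the limit,
   and it would not define a value.\<close>
 obtain \<phi>0 where \<phi>0: "admissible_family d \<alpha> \<Lambda> f \<Phi> \<phi>0" using admissible_family_exists[OF \<Phi> holder_dense] by blast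
 obtain g0 where g0: "admissible_family d \<alpha> \<Lambda> f \<Psi> g0" using admissible_family_exists[OF \<Psi> holder_dense] by blast
 have I: "I s = leg s" if s: "s : range \<sigma>" for s
  unfolding I_def legendre_def
 proof (rule the_equality)
  show "ALL \<phi> g. considered_family d \<alpha> \<Lambda> f \<Phi> \<phi> & considered_family d \<alpha> \<Lambda> f \<Psi> g -->
    ((%\<epsilon>. legendre_fun \<Lambda> f (\<phi> \<epsilon>) (g \<epsilon>) s) \<longlongrightarrow> ereal (leg s)) (at_right 0)"
   using legendre[OF considered_familyD considered_familyD s] by blast
  fix L assume "ALL \<phi> g. considered_family d \<alpha> \<Lambda> f \<Phi> \<phi> & considered_family d \<alpha> \<Lambda> f \<Psi> g -->
    ((%\<epsilon>. legendre_fun \<Lambda> f (\<phi> \<epsilon>) (g \<epsilon>) s) \<longlongrightarrow> ereal L) (at_right 0)"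
  hence "((%\<epsilon>. legendre_fun \<Lambda> f (\<phi>0 \<epsilon>) (g0 \<epsilon>) s) \<longlongrightarrow> ereal L) (at_right 0)"
   using admissible_imp_considered[OF \<Phi> holder_continuous \<phi>0] admissible_imp_considered[OF \<Psi> holder_continuous g0] by blast
  from tendsto_unique[OF _ this legendre[OF \<phi>0 g0 s]] show "L = leg s" by simp
 qed
 have m\<mu>: "mean_potential \<Psi> \<mu> = \<sigma> 0" by (simp add: \<sigma>_def \<mu>0)
 have variational: "ereal (I s) = (INF \<eta> \<in> {\<eta> : invariant_measures \<Lambda> f. mean_potential \<Psi> \<eta> = s}.
    top_pressure \<Lambda> f \<Phi> - metric_entropy f \<eta> - ereal (mean_potential \<Phi> \<eta>))" if s: "s : range \<sigma>" for s
 proof -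
  obtain t where t: "s = \<sigma> t" using s by auto
  have Is: "I s = t * s - E t" using I[OF s] t by (simp add: leg_\<sigma>)
  show ?thesis
  proof (rule antisym)
   show "ereal (I s) <= (INF \<eta> \<in> {\<eta> : invariant_measures \<Lambda> f. mean_potential \<Psi> \<eta> = s}.
     top_pressure \<Lambda> f \<Phi> - metric_entropy f \<eta> - ereal (mean_potential \<Phi> \<eta>))"
   proof (rule INF_greatest)
    fix \<eta> assume "\<eta> : {\<eta> : invariant_measures \<Lambda> f. mean_potential \<Psi> \<eta> = s}"
    hence "metric_entropy f \<eta> <= ereal (Pr t - mean_potential \<Phi> \<eta> - t * s)" using ent_le[of \<eta> t] by simp
    thus "ereal (I s) <= top_pressure \<Lambda> f \<Phi> - metric_entropy f \<eta> - ereal (mean_potential \<Phi> \<eta>)"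
     by (cases "metric_entropy f \<eta>") (auto simp: Pr0 Is E)
   qed
   have "\<mu>t t : {\<eta> : invariant_measures \<Lambda> f. mean_potential \<Psi> \<eta> = s}" using inv t by (simp add: \<sigma>_def)
   \<comment> \<open>The equilibrium state whose mean is s attains the infimum.\<close>
   moreover have "top_pressure \<Lambda> f \<Phi> - metric_entropy f (\<mu>t t) - ereal (mean_potential \<Phi> (\<mu>t t)) = ereal (I s)"
    using ent[of t] by (simp add: Pr0 t[unfolded \<sigma>_def, symmetric] Is E)
   ultimately show "(INF \<eta> \<in> {\<eta> : invariant_measures \<Lambda> f. mean_potential \<Psi> \<eta> = s}.
     top_pressure \<Lambda> f \<Phi> - metric_entropy f \<eta> - ereal (mean_potential \<Phi> \<eta>)) <= ereal (I s)"
    by (intro INF_lower2[of "\<mu>t t"]) auto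
  qed
 qed
 have cI: "convex_on (range \<sigma>) I"
  unfolding convex_on_def
 proof (intro conjI convex_range_\<sigma> ballI allI impI)
  fix x y u v :: real
  assume a: "x : range \<sigma>" "y : range \<sigma>" "0 <= u" "0 <= v" "u + v = 1"
  have "u *\<^sub>R x + v *\<^sub>R y : range \<sigma>" by (rule convexD[OF convex_range_\<sigma> a])
  thus "I (u *\<^sub>R x + v *\<^sub>R y) <= u * I x + v * I y"
   using convex_leg[unfolded convex_on_def, THEN conjunct2, rule_format, OF a] a by (simp only: I)
 qed
 have sI: "strictly_convex_on (range \<sigma>) I"
  unfolding strictly_convex_on_def
 proof (intro conjI convex_range_\<sigma> ballI allI impI)
  fix x y u v :: real
  assume a: "x : range \<sigma>" "y : range \<sigma>" "u > 0" "v > 0" "x ~= y & u + v = 1"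
  have "u * x + v * y : range \<sigma>" using convexD[OF convex_range_\<sigma> a(1,2), of u v] a by simp
  thus "I (u * x + v * y) < u * I x + v * I y"
   using strictly_convex_leg[unfolded strictly_convex_on_def, THEN conjunct2, rule_format, OF a] a by (simp only: I)
 qed
 have infI: "(INF s\<in>{a<..<b}. I s) = min (I a) (I b)"
  if ab: "a : range \<sigma>" "b : range \<sigma>" "a < b" "\<sigma> 0 \<notin> {a<..<b}" for a b
 proof -
  have "s : range \<sigma>" if "s : {a<..<b}" for s
  proof -
   have "s : closed_segment a b" using that by (auto simp: closed_segment_eq_real_ivl)
   thus ?thesis using convex_range_\<sigma> ab unfolding convex_contains_segment by blast
  qed
  hence "(INF s\<in>{a<..<b}. I s) = (INF s\<in>{a<..<b}. leg s)" by (intro INF_cong refl) (rule I)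
  thus ?thesis using Inf_leg[OF ab] I ab by simp
 qed
 show ?thesis
  unfolding J m\<mu>
 proof (intro conjI allI ballI impI)
  show "deriv E t : range \<sigma>" for t by (simp add: deriv_E)
  show "I (deriv E t) = t * deriv E t - E t" for t by (simp add: deriv_E I leg_\<sigma>)
  show "0 <= I s" if "s : range \<sigma>" for s using I[OF that] leg_nonneg[OF that] by simp
  show "I s = 0 \<longleftrightarrow> s = \<sigma> 0" if "s : range \<sigma>" for s using I[OF that] leg_eq_0_iff[OF that] by simp
  show "EX V. open V & \<sigma> 0 : V & V \<subseteq> range \<sigma> & strictly_convex_on V I"
   using open_range_\<sigma> sI by (intro exI[of _ "range \<sigma>"] conjI) (simp_all only: rangeI order_refl)
  show "convex_on (range \<sigma>) I" by (rule cI)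
  show "(INF s\<in>{a<..<b}. I s) = min (I a) (I b)"
   if "a : range \<sigma>" "b : range \<sigma>" "a < b & \<sigma> 0 \<notin> {a<..<b}" for a b
   by (rule infI[OF that(1,2) conjunct1[OF that(3)] conjunct2[OF that(3)]])
  show "ereal (I s) = (INF \<eta> \<in> {\<eta> : invariant_measures \<Lambda> f. mean_potential \<Psi> \<eta> = s}.
    top_pressure \<Lambda> f \<Phi> - metric_entropy f \<eta> - ereal (mean_potential \<Phi> \<eta>))" if "s : range \<sigma>" for s
   by (rule variational[OF that])
 qed
qed

end

section \<open>Shadowing\<close>

text \<open>Expansion by 2 holds for the p-th iterate only, since the constants of the repeller and
  of the charts may hide it in a single step. Preimages, in contrast, are lifted one step at a
  time.\<close>

locale locally_expanding = compact_metrized \<Lambda> D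
 for \<Lambda> :: "'m::{t2_space, second_countable_topology} set" and D +
 fixes f :: "'m => 'm" and p :: nat and r0 :: real
 assumes continuous_f: "continuous_on \<Lambda> f" and f_image: "f ` \<Lambda> = \<Lambda>"
  and p_pos: "p >= 1" and r0_pos: "r0 > 0"
  and expands: "y : \<Lambda> ==> z : \<Lambda> ==> D y z <= r0 ==> 2 * D y z <= D ((f ^^ p) y) ((f ^^ p) z)"
  and open_map: "e > 0 ==> EX r>0. ALL x:\<Lambda>. ALL w:\<Lambda>. D w (f x) <= r --> (EX z:\<Lambda>. f z = w & D z x <= e)"
  and mixing: "topologically_mixing_on \<Lambda> f"
begin

lemma funpow_mem: "x : \<Lambda> ==> (f ^^ n) x : \<Lambda>"
 using f_image by (induction n) auto

text \<open>At the times 0, p, 2 p, ... the distance doubles while it stays below r0, so closeness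
  for l p steps forces an initial distance of at most r0 / 2^l.\<close>

lemma uniformly_expansive:
 assumes e: "e > 0"
 shows "EX L. ALL x:\<Lambda>. ALL y:\<Lambda>. (ALL j<=L. D ((f ^^ j) x) ((f ^^ j) y) <= r0) --> D x y <= e"
proof -
 obtain l where l: "r0 / e < 2 ^ l" using real_arch_pow[of 2 "r0 / e"] by auto
 show ?thesis
 proof (intro exI[of _ "l * p"] ballI impI)
  fix x y assume xy: "x : \<Lambda>" "y : \<Lambda>" and near: "ALL j<=l * p. D ((f ^^ j) x) ((f ^^ j) y) <= r0"
  have "2 ^ i * D x y <= D ((f ^^ (i * p)) x) ((f ^^ (i * p)) y)" if "i <= l" for i
   using that
  proof (induction i)
   case (Suc i)
   have "i * p <= l * p" using Suc by (intro mult_le_mono) auto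
   hence "2 * D ((f ^^ (i * p)) x) ((f ^^ (i * p)) y) <= D ((f ^^ p) ((f ^^ (i * p)) x)) ((f ^^ p) ((f ^^ (i * p)) y))"
    using near by (intro expands funpow_mem xy) auto
   thus ?case using Suc by (simp add: funpow_add)
  qed simp
  from this[of l] have "2 ^ l * D x y <= r0" using near by force
  moreover have "r0 < 2 ^ l * e" using l e by (simp add: field_simps)
  ultimately have "2 ^ l * D x y <= 2 ^ l * e" by linarith
  thus "D x y <= e" by simp
 qed
qed

text \<open>Preimages are lifted backwards along the orbit. Here the admissible error shrinks with
  k, which is harmless for the bounded k this is used with.\<close>

lemma shadowing_finite:
 assumes "e > 0"
 shows "EX r>0. ALL x:\<Lambda>. ALL w:\<Lambda>. D w ((f ^^ k) x) <= r -->
  (EX z:\<Lambda>. (f ^^ k) z = w & (ALL j<=k. D ((f ^^ j) z) ((f ^^ j) x) <= e))"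
 using assms
proof (induction k arbitrary: e)
 case 0 thus ?case by (intro exI[of _ e]) auto
next
 case (Suc k)
 obtain r1 where r1: "r1 > 0" "!!x w. x : \<Lambda> ==> w : \<Lambda> ==> D w (f x) <= r1 ==> EX z:\<Lambda>. f z = w & D z x <= e"
  using open_map[OF Suc.prems] by metis
 define e' where "e' = min e r1"
 have e': "e' > 0" using r1 Suc.prems by (simp add: e'_def)
 obtain r where r: "r > 0" "!!x w. x : \<Lambda> ==> w : \<Lambda> ==> D w ((f ^^ k) x) <= r ==>
  EX z:\<Lambda>. (f ^^ k) z = w & (ALL j<=k. D ((f ^^ j) z) ((f ^^ j) x) <= e')"
  using Suc.IH[OF e'] by metis
 show ?case
 proof (intro exI[of _ r] conjI ballI impI r(1))
  fix x w assume x: "x : \<Lambda>" and w: "w : \<Lambda>" and D: "D w ((f ^^ Suc k) x) <= r"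
  have fx: "f x : \<Lambda>" using x f_image by auto
  have "D w ((f ^^ k) (f x)) <= r" using D by (simp add: funpow_swap1)
  from r(2)[OF fx w this] obtain u where u: "u : \<Lambda>" "(f ^^ k) u = w" "ALL j<=k. D ((f ^^ j) u) ((f ^^ j) (f x)) <= e'" by blast
  have "D u (f x) <= r1" using u(3)[rule_format, of 0] by (simp add: e'_def)
  from r1(2)[OF x u(1) this] obtain z where z: "z : \<Lambda>" "f z = u" "D z x <= e" by blast
  have "D ((f ^^ j) z) ((f ^^ j) x) <= e" if j: "j <= Suc k" for j
  proof (cases j)
   case (Suc i)
   thus ?thesis using u(3)[rule_format, of i] j z(2) by (simp add: funpow_swap1 e'_def)
  qed (use z in simp)
  thus "EX z:\<Lambda>. (f ^^ Suc k) z = w & (ALL j<=Suc k. D ((f ^^ j) z) ((f ^^ j) x) <= e)"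
   using z u(2) by (intro bexI[of _ z]) (auto simp: funpow_swap1)
 qed
qed

text \<open>Radii independent of n come from treating blocks of p steps as units: lifting through a
  block halves the error, so the tolerance s reproduces itself from block to block.\<close>

lemma shadowing:
 assumes e: "e > 0"
 obtains r where "r > 0" "!!n x w. x : \<Lambda> ==> w : \<Lambda> ==> D w ((f ^^ n) x) <= r ==>
  EX z:\<Lambda>. (f ^^ n) z = w & (ALL j<=n. D ((f ^^ j) z) ((f ^^ j) x) <= e)"
proof -
 define e' where "e' = min e r0"
 have e': "e' > 0" "e' <= e" "e' <= r0" using e r0_pos by (auto simp: e'_def)
 obtain s0 where s0: "s0 > 0" "!!x w. x : \<Lambda> ==> w : \<Lambda> ==> D w ((f ^^ p) x) <= s0 ==>
   EX z:\<Lambda>. (f ^^ p) z = w & (ALL j<=p. D ((f ^^ j) z) ((f ^^ j) x) <= e')"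
  using shadowing_finite[OF e'(1), of p] by metis
 \<comment> \<open>An error s at the end of a block can be lifted because s <= s0; the lifted error
   is at most s / 2, and the induction continues.\<close>
 define s where "s = min s0 e"
 have s: "s > 0" "s <= s0" "s <= e" using s0 e by (auto simp: s_def)
 have long: "EX z:\<Lambda>. (f ^^ (l * p)) z = w & D z x <= s & (ALL j<=l * p. D ((f ^^ j) z) ((f ^^ j) x) <= e)"
  if "x : \<Lambda>" "w : \<Lambda>" "D w ((f ^^ (l * p)) x) <= s" for l x w
  using that
 proof (induction l arbitrary: x)
  case 0 thus ?case using s by (intro bexI[of _ w]) auto
 next
  case (Suc l)
  let ?x = "(f ^^ p) x"
  have "D w ((f ^^ (l * p)) ?x) <= s" using Suc.prems(3) by (simp add: add.commute[of p] funpow_add)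
  from Suc.IH[OF funpow_mem[OF Suc.prems(1)] Suc.prems(2) this] obtain u
   where u: "u : \<Lambda>" "(f ^^ (l * p)) u = w" "D u ?x <= s" "ALL j<=l * p. D ((f ^^ j) u) ((f ^^ j) ?x) <= e" by blast
  have "D u ?x <= s0" using u(3) s by simp
  from s0(2)[OF Suc.prems(1) u(1) this] obtain z
   where z: "z : \<Lambda>" "(f ^^ p) z = u" "ALL j<=p. D ((f ^^ j) z) ((f ^^ j) x) <= e'" by blast
  have "D z x <= r0" using z(3)[rule_format, of 0] e' by simp
  hence "2 * D z x <= D u ?x" using expands[OF z(1) Suc.prems(1)] z(2) by simp
  hence zx: "D z x <= s" using u(3) D_nonneg[of z x] by linarith
  have "D ((f ^^ j) z) ((f ^^ j) x) <= e" if j: "j <= Suc l * p" for j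
  proof (cases "j <= p")
   case True thus ?thesis using z(3) e' by (meson order_trans)
  next
   case False
   then obtain i where i: "j = i + p" by (metis add.commute le_Suc_ex nat_le_linear)
   thus ?thesis using u(4)[rule_format, of i] j z(2) by (simp add: funpow_add)
  qed
  moreover have "(f ^^ (Suc l * p)) z = w" using u(2) z(2) by (simp add: add.commute[of p] funpow_add)
  ultimately show ?case using z(1) zx by blast
 qed
 have "EX r>0. ALL x:\<Lambda>. ALL w:\<Lambda>. D w ((f ^^ t) x) <= r -->
   (EX z:\<Lambda>. (f ^^ t) z = w & (ALL j<=t. D ((f ^^ j) z) ((f ^^ j) x) <= s))" for t
  by (rule shadowing_finite[OF s(1)])
 then obtain rt where rt: "!!t. rt t > 0" "!!t x w. x : \<Lambda> ==> w : \<Lambda> ==> D w ((f ^^ t) x) <= rt t ==>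
   EX z:\<Lambda>. (f ^^ t) z = w & (ALL j<=t. D ((f ^^ j) z) ((f ^^ j) x) <= s)" by metis
 \<comment> \<open>The incomplete block at the end of the orbit is lifted first, and must leave an
   error of at most s for the complete blocks.\<close>
 define r where "r = Min (rt ` {..p})"
 have r: "r > 0" "!!t. t <= p ==> r <= rt t" unfolding r_def using rt(1) by (auto simp: Min_gr_iff)
 show ?thesis
 proof (rule that[OF r(1)])
  fix n x w assume x: "x : \<Lambda>" and w: "w : \<Lambda>" and D: "D w ((f ^^ n) x) <= r"
  define l t where "l = n div p" and "t = n mod p"
  have n: "n = t + l * p" "t <= p" using p_pos by (auto simp: l_def t_def less_imp_le)
  let ?x = "(f ^^ (l * p)) x"
  have "D w ((f ^^ t) ?x) <= rt t" using D r(2)[OF n(2)] by (simp add: n(1) funpow_add)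
  from rt(2)[OF funpow_mem[OF x] w this] obtain u
   where u: "u : \<Lambda>" "(f ^^ t) u = w" "ALL j<=t. D ((f ^^ j) u) ((f ^^ j) ?x) <= s" by blast
  have "D u ?x <= s" using u(3)[rule_format, of 0] by simp
  from long[OF x u(1) this] obtain z where z: "z : \<Lambda>" "(f ^^ (l * p)) z = u" "ALL j<=l * p. D ((f ^^ j) z) ((f ^^ j) x) <= e" by blast
  have "D ((f ^^ j) z) ((f ^^ j) x) <= e" if j: "j <= n" for j
  proof (cases "j <= l * p")
   case False
   then obtain i where i: "j = i + l * p" by (metis add.commute le_Suc_ex nat_le_linear)
   hence "D ((f ^^ i) u) ((f ^^ i) ?x) <= s" using u(3) j n(1) by auto
   thus ?thesis using z(2) s by (simp add: i funpow_add)
  qed (use z in blast)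
  moreover have "(f ^^ n) z = w" using z(2) u(2) by (simp add: n(1) funpow_add)
  ultimately show "EX z:\<Lambda>. (f ^^ n) z = w & (ALL j<=n. D ((f ^^ j) z) ((f ^^ j) x) <= e)" using z(1) by blast
 qed
qed

text \<open>Mixing between balls around finitely many net points gives one time M for all pairs. The
  resulting orbit only comes near y, and shadowing moves it to end exactly there.\<close>

lemma exactness:
 assumes e: "e > 0"
 obtains M where "!!m x y. m >= M ==> x : \<Lambda> ==> y : \<Lambda> ==> EX w:\<Lambda>. D w x <= e & (f ^^ m) w = y"
proof -
 obtain r where r: "r > 0" "!!n x w. x : \<Lambda> ==> w : \<Lambda> ==> D w ((f ^^ n) x) <= r ==>
  EX z:\<Lambda>. (f ^^ n) z = w & (ALL j<=n. D ((f ^^ j) z) ((f ^^ j) x) <= e / 2)"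
  using shadowing[of "e/2"] e by (metis half_gt_zero)
 \<comment> \<open>Two net errors must stay within r at the end, and within half of e at the start;
   the other half is spent on shadowing.\<close>
 define s where "s = min (r / 2) (e / 4)"
 have s: "s > 0" "2 * s <= r" "2 * s <= e / 2" using r e by (auto simp: s_def)
 obtain F where F: "finite F" "F \<subseteq> \<Lambda>" "!!y. y : \<Lambda> ==> EX x:F. D x y < s"
  using finite_D_cover[of "%_. s"] s(1) by metis
 have "EX N. ALL n>=N. EX u:\<Lambda>. D a u < s & D b ((f ^^ n) u) < s" if ab: "a : F" "b : F" for a b
 proof -
  have L: "a : \<Lambda>" "b : \<Lambda>" using ab F by auto
  obtain U where U: "open U" "!!y. y : \<Lambda> ==> y : U \<longleftrightarrow> D a y < s" using open_D_ball[OF L(1)] by metis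
  obtain V where V: "open V" "!!y. y : \<Lambda> ==> y : V \<longleftrightarrow> D b y < s" using open_D_ball[OF L(2)] by metis
  have "U \<inter> \<Lambda> ~= {}" "V \<inter> \<Lambda> ~= {}" using U(2)[OF L(1)] V(2)[OF L(2)] L s(1) by auto
  then obtain N where N: "ALL n>=N. (f ^^ n) ` (U \<inter> \<Lambda>) \<inter> (V \<inter> \<Lambda>) ~= {}"
   using mixing U(1) V(1) unfolding topologically_mixing_on_def by blast
  show ?thesis
  proof (intro exI[of _ N] allI impI)
   fix n assume "n >= N"
   then obtain u where "u : U" "u : \<Lambda>" "(f ^^ n) u : V" "(f ^^ n) u : \<Lambda>" using N by blast
   thus "EX u:\<Lambda>. D a u < s & D b ((f ^^ n) u) < s" using U(2) V(2) by blast
  qed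
 qed
 then obtain N where N: "!!a b n. a : F ==> b : F ==> n >= N a b ==> EX u:\<Lambda>. D a u < s & D b ((f ^^ n) u) < s" by metis
 define M where "M = Max (insert 0 ((%(a, b). N a b) ` (F \<times> F)))"
 have M: "N a b <= M" if "a : F" "b : F" for a b
 proof -
  have "N a b : (%(a, b). N a b) ` (F \<times> F)" using that by (intro image_eqI[of _ _ "(a, b)"]) auto
  thus ?thesis unfolding M_def using F(1) by (intro Max_ge) auto
 qed
 show ?thesis
 proof (rule that[of M])
  fix m x y assume m: "m >= M" and x: "x : \<Lambda>" and y: "y : \<Lambda>"
  obtain a b where ab: "a : F" "b : F" "D a x < s" "D b y < s" using F(3) x y by metis
  obtain u where u: "u : \<Lambda>" "D a u < s" "D b ((f ^^ m) u) < s" using N[OF ab(1,2)] M[OF ab(1,2)] m by (meson order_trans)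
  have ux: "D u x < 2 * s" using D_triangle[of u x a] D_commute[of u a] u ab by linarith
  have "D y ((f ^^ m) u) <= r" using D_triangle[of y "(f ^^ m) u" b] D_commute[of y b] u ab s by linarith
  from r(2)[OF u(1) y this] obtain z where z: "z : \<Lambda>" "(f ^^ m) z = y" "ALL j<=m. D ((f ^^ j) z) ((f ^^ j) u) <= e / 2" by blast
  have "D z u <= e / 2" using z(3)[rule_format, of 0] by simp
  hence "D z x <= e" using D_triangle[of z x u] ux s by linarith
  thus "EX w:\<Lambda>. D w x <= e & (f ^^ m) w = y" using z by blast
 qed
qed

text \<open>Jump from the end of the orbit of x to a nearby point that reaches y in N steps, and
  lift that jump back along the orbit of x. The lifted orbit ends exactly at y.\<close>

lemma expanding_mapI:
 assumes \<rho>: "\<rho> > 0" "64 * \<rho> <= r0"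
 obtains N where "expanding_map \<Lambda> D f \<rho> N"
proof -
 obtain r where r: "r > 0" "!!n x w. x : \<Lambda> ==> w : \<Lambda> ==> D w ((f ^^ n) x) <= r ==>
  EX z:\<Lambda>. (f ^^ n) z = w & (ALL j<=n. D ((f ^^ j) z) ((f ^^ j) x) <= \<rho>)"
  using shadowing[OF \<rho>(1)] by metis
 obtain M where M: "!!m x y. m >= M ==> x : \<Lambda> ==> y : \<Lambda> ==> EX w:\<Lambda>. D w x <= r & (f ^^ m) w = y"
  using exactness[OF r(1)] by metis
 define N where "N = max M 1"
 have "expanding_map \<Lambda> D f \<rho> N"
 proof
  show "continuous_on \<Lambda> f" "f ` \<Lambda> = \<Lambda>" "\<rho> > 0" "N >= 1" using continuous_f f_image \<rho> by (auto simp: N_def)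
  show "EX L. ALL x:\<Lambda>. ALL y:\<Lambda>. (ALL j<=L. D ((f ^^ j) x) ((f ^^ j) y) <= 64 * \<rho>) --> D x y <= e" if "e > 0" for e
   using uniformly_expansive[OF that] \<rho>(2) by (meson order_trans)
  fix x y n assume x: "x : \<Lambda>" and y: "y : \<Lambda>"
  have "N >= M" by (simp add: N_def)
  from M[OF this funpow_mem[OF x] y] obtain w where w: "w : \<Lambda>" "D w ((f ^^ n) x) <= r" "(f ^^ N) w = y" by blast
  from r(2)[OF x w(1,2)] obtain z where z: "z : \<Lambda>" "(f ^^ n) z = w" "ALL j<=n. D ((f ^^ j) z) ((f ^^ j) x) <= \<rho>" by blast
  show "EX z:\<Lambda>. (ALL j<=n. D ((f ^^ j) x) ((f ^^ j) z) <= \<rho>) & (f ^^ (n + N)) z = y"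
   using z w(3) D_commute by (intro bexI[of _ z]) (auto simp: add.commute[of n] funpow_add)
 qed
 thus ?thesis using that by blast
qed

end

section \<open>Strict differentiability\<close>

text \<open>Strict differentiability controls differences at two varying points, as needed for
  expansion and Lipschitz estimates. Unlike differentiability at p it does so without mentioning
  nearby derivatives, and it is stable under composition.\<close>

definition strict_deriv ::
  "('a::euclidean_space => 'b::euclidean_space) => ('a => 'b) => 'a => bool"
 where "strict_deriv F F' p \<longleftrightarrow> bounded_linear F' &
  (ALL e>0. EX r>0. ALL y:ball p r. ALL z:ball p r. norm (F y - F z - F' (y - z)) <= e * norm (y - z))"

lemma strict_derivE:
 assumes "strict_deriv F F' p" "e > 0"
 obtains r where "r > 0" "!!y z. y : ball p r ==> z : ball p r ==> norm (F y - F z - F' (y - z)) <= e * norm (y - z)"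
 using assms unfolding strict_deriv_def by meson

lemma strict_deriv_has_derivative:
 assumes "strict_deriv F F' p" shows "(F has_derivative F') (at p)"
 unfolding has_derivative_at_alt
proof (intro conjI allI impI)
 fix e :: real assume "e > 0"
 then obtain r where r: "r > 0"
  "!!y z. y : ball p r ==> z : ball p r ==> norm (F y - F z - F' (y - z)) <= e * norm (y - z)"
  using strict_derivE[OF assms] by metis
 show "EX d>0. ALL y. norm (y - p) < d --> norm (F y - F p - F' (y - p)) <= e * norm (y - p)"
  using r by (intro exI[of _ r]) (auto simp: dist_norm norm_minus_commute)
qed (use assms in \<open>simp add: strict_deriv_def\<close>)

lemma norm_linear_le_Basis:
 fixes L :: "'a::euclidean_space => 'b::euclidean_space"
 assumes L: "linear L" and e: "!!b. b : Basis ==> norm (L b) <= e"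
 shows "norm (L v) <= real DIM('a) * e * norm v"
proof -
 have "L v = L (\<Sum>b\<in>Basis. (v \<bullet> b) *\<^sub>R b)" by (simp add: euclidean_representation)
 also have "\<dots> = (\<Sum>b\<in>Basis. (v \<bullet> b) *\<^sub>R L b)" using L by (simp add: linear_sum linear_cmul)
 finally have "norm (L v) <= (\<Sum>b\<in>Basis. norm ((v \<bullet> b) *\<^sub>R L b))" by (simp only: norm_sum)
 also have "\<dots> <= (\<Sum>b\<in>(Basis::'a set). norm v * e)"
  using e by (intro sum_mono) (auto intro!: mult_mono Basis_le_norm)
 finally show ?thesis by (simp add: mult_ac)
qed

text \<open>Continuity is known for each directional derivative; finitely many basis directions
  bound the operator norm of L q - L p. The mean value inequality is then applied to F minus its
  linear part on a ball.\<close>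

lemma Ck_on_strict_deriv:
 fixes F :: "'a::euclidean_space => 'b::euclidean_space"
 assumes S: "open S" "p : S" and F: "Ck_on 1 F S"
 shows "strict_deriv F (frechet_derivative F (at p)) p"
proof -
 define L where "L q = frechet_derivative F (at q)" for q
 have D: "(F has_derivative L q) (at q)" if "q : S" for q
  using F S that unfolding L_def
  by (simp add: frechet_derivative_works[symmetric] differentiable_on_eq_differentiable_at)
 have lin: "linear (L q)" if "q : S" for q using D[OF that] by (rule has_derivative_linear)
 have cont: "continuous_on S (%q. L q v)" for v using F by (simp add: L_def)
 show ?thesis unfolding L_def[symmetric] strict_deriv_def
 proof (intro conjI allI impI)
  show "bounded_linear (L p)" using D[OF S(2)] by (rule has_derivative_bounded_linear)
  fix e :: real assume e: "e > 0"
  define e' where "e' = e / real DIM('a)"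
  have e': "e' > 0" using e by (simp add: e'_def)
  have "ALL b:Basis. \<forall>\<^sub>F q in nhds p. dist (L q b) (L p b) < e'"
  proof
   fix b :: 'a
   have "\<forall>\<^sub>F q in nhds p. q ~= p --> dist (L q b) (L p b) < e'"
    using cont[of b] S e' by (simp add: continuous_on_eq_continuous_at isCont_def tendsto_iff eventually_at_filter)
   thus "\<forall>\<^sub>F q in nhds p. dist (L q b) (L p b) < e'" by eventually_elim (use e' in auto)
  qed
  hence "\<forall>\<^sub>F q in nhds p. ALL b:Basis. dist (L q b) (L p b) < e'" by (intro eventually_ball_finite) auto
  moreover have "\<forall>\<^sub>F q in nhds p. q : S" using S by (rule eventually_nhds_in_open)
  ultimately have "\<forall>\<^sub>F q in nhds p. (ALL b:Basis. dist (L q b) (L p b) < e') & q : S" by (rule eventually_conj)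
  then obtain r where r: "r > 0" "!!q. dist q p < r ==> (ALL b:Basis. dist (L q b) (L p b) < e') & q : S"
   unfolding eventually_nhds_metric by auto
  have le: "onorm (%v. L q v - L p v) <= e" if "q : ball p r" for q
  proof (rule onorm_le)
   fix v
   have q: "dist q p < r" using that by (simp add: dist_commute)
   have "norm (L q v - L p v) <= real DIM('a) * e' * norm v"
    using r(2)[OF q] lin S by (intro norm_linear_le_Basis linear_compose_sub) (auto simp: dist_norm less_imp_le)
   thus "norm (L q v - L p v) <= e * norm v" by (simp add: e'_def)
  qed
  show "EX r>0. ALL y:ball p r. ALL z:ball p r. norm (F y - F z - L p (y - z)) <= e * norm (y - z)"
  proof (intro exI[of _ r] conjI ballI r(1))
   fix y z assume yz: "y : ball p r" "z : ball p r"
   have "norm ((F y - L p y) - (F z - L p z)) <= e * norm (y - z)"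
   proof (rule differentiable_bound[OF convex_ball _ le yz])
    fix q assume "q : ball p r"
    hence "q : S" using r by (auto simp: dist_commute)
    thus "((%y. F y - L p y) has_derivative (%v. L q v - L p v)) (at q within ball p r)"
     by (intro has_derivative_diff has_derivative_at_withinI[OF D] bounded_linear_imp_has_derivative
       has_derivative_bounded_linear[OF D[OF S(2)]])
   qed
   moreover have "F y - F z - L p (y - z) = (F y - L p y) - (F z - L p z)"
    using lin[OF S(2)] by (simp add: linear_diff)
   ultimately show "norm (F y - F z - L p (y - z)) <= e * norm (y - z)" by (simp only:)
  qed
 qed
qed

lemma strict_deriv_lipschitz:
 assumes F: "strict_deriv F F' p"
 obtains K r where "K > 0" "r > 0" "!!y z. y : ball p r ==> z : ball p r ==> norm (F y - F z) <= K * norm (y - z)"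
proof -
 have bl: "bounded_linear F'" using F by (simp add: strict_deriv_def)
 obtain B where B: "B > 0" "!!v. norm (F' v) <= norm v * B" using bounded_linear.pos_bounded[OF bl] by auto
 obtain r where r: "r > 0"
  "!!y z. y : ball p r ==> z : ball p r ==> norm (F y - F z - F' (y - z)) <= 1 * norm (y - z)"
  using strict_derivE[OF F, of 1] by auto
 show ?thesis
 proof (rule that[of "1 + B" r])
  fix y z assume "y : ball p r" "z : ball p r"
  hence "norm (F y - F z - F' (y - z)) <= norm (y - z)" using r by simp
  moreover have "norm (F y - F z) <= norm (F y - F z - F' (y - z)) + norm (F' (y - z))"
   using norm_triangle_ineq[of "F y - F z - F' (y - z)" "F' (y - z)"] by simp
  ultimately show "norm (F y - F z) <= (1 + B) * norm (y - z)" using B(2)[of "y - z"] by (simp add: algebra_simps)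
 qed (use B r in auto)
qed

lemma strict_deriv_expands:
 assumes F: "strict_deriv F F' p" and c: "c > 0" "!!v. c * norm v <= norm (F' v)"
 obtains r where "r > 0" "!!y z. y : ball p r ==> z : ball p r ==> c / 2 * norm (y - z) <= norm (F y - F z)"
proof -
 obtain r where r: "r > 0"
  "!!y z. y : ball p r ==> z : ball p r ==> norm (F y - F z - F' (y - z)) <= c / 2 * norm (y - z)"
  using strict_derivE[OF F, of "c / 2"] c(1) by auto
 show ?thesis
 proof (rule that[OF r(1)])
  fix y z assume "y : ball p r" "z : ball p r"
  hence "norm (F y - F z - F' (y - z)) <= c / 2 * norm (y - z)" using r by simp
  moreover have "norm (F' (y - z)) <= norm (F y - F z) + norm (F y - F z - F' (y - z))"
   using norm_triangle_ineq4[of "F y - F z" "F y - F z - F' (y - z)"] by simp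
  ultimately show "c / 2 * norm (y - z) <= norm (F y - F z)" using c(2)[of "y - z"] by (simp add: algebra_simps)
 qed
qed

lemma strict_deriv_compose:
 assumes F: "strict_deriv F F' p" and H: "strict_deriv H H' (F p)"
 shows "strict_deriv (H \<circ> F) (H' \<circ> F') p"
 unfolding strict_deriv_def
proof (intro conjI allI impI)
 have bl: "bounded_linear F'" "bounded_linear H'" using F H by (auto simp: strict_deriv_def)
 thus "bounded_linear (H' \<circ> F')" by (simp add: o_def bounded_linear_compose)
 fix e :: real assume e: "e > 0"
 obtain B where B: "B > 0" "!!v. norm (H' v) <= norm v * B" using bounded_linear.pos_bounded[OF bl(2)] by auto
 obtain K r1 where r1: "K > 0" "r1 > 0" "!!y z. y : ball p r1 ==> z : ball p r1 ==> norm (F y - F z) <= K * norm (y - z)"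
  by (rule strict_deriv_lipschitz[OF F]) (rule that)
 have e1: "e / (2 * B) > 0" "e / (2 * K) > 0" using e B r1 by auto
 obtain r2 where r2: "r2 > 0"
  "!!y z. y : ball p r2 ==> z : ball p r2 ==> norm (F y - F z - F' (y - z)) <= e / (2 * B) * norm (y - z)"
  by (rule strict_derivE[OF F e1(1)]) (rule that)
 obtain r3 where r3: "r3 > 0"
  "!!y z. y : ball (F p) r3 ==> z : ball (F p) r3 ==> norm (H y - H z - H' (y - z)) <= e / (2 * K) * norm (y - z)"
  by (rule strict_derivE[OF H e1(2)]) (rule that)
 define r where "r = min (min r1 r2) (r3 / K)"
 show "EX r>0. ALL y:ball p r. ALL z:ball p r. norm ((H \<circ> F) y - (H \<circ> F) z - (H' \<circ> F') (y - z)) <= e * norm (y - z)"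
 proof (intro exI[of _ r] conjI ballI)
  show "r > 0" using r1 r2 r3 by (simp add: r_def)
  fix y z assume yz: "y : ball p r" "z : ball p r"
  have im: "F q : ball (F p) r3" if q: "q : ball p r" for q
  proof -
   have "norm (F p - F q) <= K * norm (p - q)" using q r1 by (intro r1(3)) (auto simp: r_def)
   also have "\<dots> < K * (r3 / K)" using q r1 by (intro mult_strict_left_mono) (auto simp: r_def dist_norm)
   finally show ?thesis using r1 by (simp add: dist_norm)
  qed
  have K: "norm (F y - F z) <= K * norm (y - z)" using yz by (intro r1(3)) (auto simp: r_def)
  have "norm (H (F y) - H (F z) - H' (F y - F z)) <= e / (2 * K) * norm (F y - F z)"
   by (intro r3 im yz)
  also have "\<dots> <= e / (2 * K) * (K * norm (y - z))" using K e r1 by (intro mult_left_mono) auto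
  finally have 1: "norm (H (F y) - H (F z) - H' (F y - F z)) <= e / 2 * norm (y - z)" using r1 by simp
  have "norm (H' (F y - F z - F' (y - z))) <= norm (F y - F z - F' (y - z)) * B" by (rule B)
  also have "\<dots> <= e / (2 * B) * norm (y - z) * B" using yz B by (intro mult_right_mono r2) (auto simp: r_def)
  finally have 2: "norm (H' (F y - F z - F' (y - z))) <= e / 2 * norm (y - z)" using B by simp
  have "H (F y) - H (F z) - H' (F' (y - z)) = (H (F y) - H (F z) - H' (F y - F z)) + H' (F y - F z - F' (y - z))"
   using bl(2) by (simp add: linear_diff[OF bounded_linear.linear])
  hence "norm (H (F y) - H (F z) - H' (F' (y - z)))
   <= norm (H (F y) - H (F z) - H' (F y - F z)) + norm (H' (F y - F z - F' (y - z)))" by (simp only: norm_triangle_ineq)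
  thus "norm ((H \<circ> F) y - (H \<circ> F) z - (H' \<circ> F') (y - z)) <= e * norm (y - z)" using 1 2 by simp
 qed
qed

lemma strict_deriv_cong:
 assumes F: "strict_deriv F F' p" and S: "open S" "p : S" and eq: "!!q. q : S ==> H q = F q"
 shows "strict_deriv H F' p"
 unfolding strict_deriv_def
proof (intro conjI allI impI)
 fix e :: real assume e: "e > 0"
 obtain r1 where r1: "r1 > 0" "ball p r1 \<subseteq> S" using S open_contains_ball by blast
 obtain r2 where r2: "r2 > 0"
  "!!y z. y : ball p r2 ==> z : ball p r2 ==> norm (F y - F z - F' (y - z)) <= e * norm (y - z)"
  by (rule strict_derivE[OF F e]) (rule that)
 show "EX r>0. ALL y:ball p r. ALL z:ball p r. norm (H y - H z - F' (y - z)) <= e * norm (y - z)"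
 proof (intro exI[of _ "min r1 r2"] conjI ballI)
  fix y z assume yz: "y : ball p (min r1 r2)" "z : ball p (min r1 r2)"
  hence "y : S" "z : S" using r1 by auto
  thus "norm (H y - H z - F' (y - z)) <= e * norm (y - z)" using yz r2 eq by simp
 qed (use r1 r2 in simp)
qed (use F in \<open>simp add: strict_deriv_def\<close>)

text \<open>This inequality holds for arbitrary functions because \<open>nn_integral\<close> is a
  supremum over simple functions from below. It is used for the speed of a curve, whose definition
  involves an unspecified chart at each time, so that no measurability has to be shown.\<close>

lemma nn_integral_superadditive:
 "(\<integral>\<^sup>+x. f x \<partial>M) + (\<integral>\<^sup>+x. g x \<partial>M) <= (\<integral>\<^sup>+x. f x + g x \<partial>M)"
proof -
 define A where "A = {s. simple_function M s & s <= f}"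
 define B where "B = {s. simple_function M s & s <= g}"
 have ne: "A ~= {}" "B ~= {}" unfolding A_def B_def by (auto intro!: exI[of _ "%_. 0"] simp: le_fun_def)
 have main: "integral\<^sup>S M s + integral\<^sup>S M s' <= (\<integral>\<^sup>+x. f x + g x \<partial>M)" if "s : A" "s' : B" for s s'
 proof -
  have s: "simple_function M s" "simple_function M s'" using that by (auto simp: A_def B_def)
  hence "integral\<^sup>S M s + integral\<^sup>S M s' = (\<integral>\<^sup>+x. s x + s' x \<partial>M)"
   by (subst nn_integral_add) (auto simp: nn_integral_eq_simple_integral borel_measurable_simple_function)
  also have "\<dots> <= (\<integral>\<^sup>+x. f x + g x \<partial>M)"
   using that by (intro nn_integral_mono add_mono) (auto simp: A_def B_def le_fun_def)
  finally show ?thesis .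
 qed
 have "(\<integral>\<^sup>+x. f x \<partial>M) + (\<integral>\<^sup>+x. g x \<partial>M) = (SUP s\<in>A. integral\<^sup>S M s + (\<integral>\<^sup>+x. g x \<partial>M))"
  unfolding nn_integral_def[of M f] A_def[symmetric] by (rule ennreal_SUP_add_left[OF ne(1), symmetric])
 also have "\<dots> = (SUP s\<in>A. (SUP s'\<in>B. integral\<^sup>S M s' + integral\<^sup>S M s))"
  unfolding nn_integral_def[of M g] B_def[symmetric]
  by (intro SUP_cong refl) (subst add.commute, rule ennreal_SUP_add_left[OF ne(2), symmetric])
 also have "\<dots> <= (\<integral>\<^sup>+x. f x + g x \<partial>M)" using main by (intro SUP_least) (simp add: add.commute)
 finally show ?thesis .
qed

text \<open>An infinite integral leaves nothing to prove; otherwise the derivative, set to zero at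
  the finitely many bad times, is integrable, and the fundamental theorem of calculus
  applies.\<close>

lemma norm_diff_le_nn_integral:
 fixes \<gamma> :: "real => 'a::euclidean_space"
 assumes ab: "a <= b" and T: "finite T" and cont: "continuous_on {a..b} \<gamma>"
  and D: "!!t. t : {a..b} - T ==> (\<gamma> has_vector_derivative D t) (at t)" "continuous_on ({a..b} - T) D"
 shows "ennreal (norm (\<gamma> b - \<gamma> a)) <= (\<integral>\<^sup>+t\<in>{a..b} - T. ennreal (norm (D t)) \<partial>lborel)"
proof (cases "(\<integral>\<^sup>+t\<in>{a..b} - T. ennreal (norm (D t)) \<partial>lborel) = \<infinity>")
 case False
 define w where "w t = indicator ({a..b} - T) t *\<^sub>R D t" for t
 have "{a..b} - T : sets borel" using T by (intro sets.Diff) (auto simp: finite_imp_closed)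
 hence w: "w : borel_measurable borel" unfolding w_def using D(2) by (rule borel_measurable_continuous_on_indicator)
 have nw: "(\<integral>\<^sup>+t. ennreal (norm (w t)) \<partial>lborel) = (\<integral>\<^sup>+t\<in>{a..b} - T. ennreal (norm (D t)) \<partial>lborel)"
  by (intro nn_integral_cong) (auto simp: w_def indicator_def)
 hence int: "integrable lborel w" using w False by (intro integrableI_bounded) (auto simp: top.not_eq_extremum)
 have "(w has_integral (\<gamma> b - \<gamma> a)) {a..b}"
 proof (rule fundamental_theorem_of_calculus_strong[OF T ab _ cont])
  fix t assume "t : {a..b} - T"
  thus "(\<gamma> has_vector_derivative w t) (at t)" using D(1)[of t] by (simp add: w_def)
 qed
 moreover have "(w has_integral integral\<^sup>L lborel w) UNIV" by (rule has_integral_integral_lborel[OF int])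
 hence "(w has_integral integral\<^sup>L lborel w) {a..b}"
 proof -
  have "(%t. if t : {a..b} then w t else 0) = w" by (auto simp: w_def indicator_def)
  moreover assume "(w has_integral integral\<^sup>L lborel w) UNIV"
  ultimately show ?thesis by (subst has_integral_restrict_UNIV[symmetric]) simp
 qed
 ultimately have "\<gamma> b - \<gamma> a = integral\<^sup>L lborel w" by (rule has_integral_unique)
 thus ?thesis using integral_norm_bound_ennreal[OF int] nw by simp
qed simp

section \<open>The Riemannian distance in charts\<close>

lemma bilinear_expand:
 fixes h :: "'a::euclidean_space => 'a => real"
 assumes "bilinear h"
 shows "h v v = (\<Sum>(i,j)\<in>Basis \<times> Basis. (v \<bullet> i) * (v \<bullet> j) * h i j)"
proof -
 have "h v v = h (\<Sum>i\<in>Basis. (v \<bullet> i) *\<^sub>R i) (\<Sum>j\<in>Basis. (v \<bullet> j) *\<^sub>R j)" by (simp add: euclidean_representation)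
 also have "\<dots> = (\<Sum>(i,j)\<in>Basis \<times> Basis. h ((v \<bullet> i) *\<^sub>R i) ((v \<bullet> j) *\<^sub>R j))" by (rule bilinear_sum[OF assms])
 finally show ?thesis by (simp add: bilinear_lmul[OF assms] bilinear_rmul[OF assms] mult_ac)
qed

text \<open>A constant factor is moved through the supremum defining the integral, again for a
  function whose measurability is not at hand.\<close>

lemma nn_integral_scale_le:
 assumes k: "k > 0"
 shows "ennreal (1 / k) * (\<integral>\<^sup>+x. ennreal k * g x \<partial>M) <= (\<integral>\<^sup>+x. g x \<partial>M)"
proof -
 have cancel: "ennreal (1 / k) * (ennreal k * u) = u" for u
  using k by (simp add: mult.assoc[symmetric] ennreal_mult'[symmetric])
 have "ennreal (1 / k) * integral\<^sup>S M s <= (\<integral>\<^sup>+x. g x \<partial>M)"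
  if s: "simple_function M s" "s <= (%x. ennreal k * g x)" for s
 proof -
  have "ennreal (1 / k) * integral\<^sup>S M s = (\<integral>\<^sup>+x. ennreal (1 / k) * s x \<partial>M)"
   using s by (subst nn_integral_cmult) (auto simp: nn_integral_eq_simple_integral borel_measurable_simple_function)
  also have "\<dots> <= (\<integral>\<^sup>+x. g x \<partial>M)"
  proof (rule nn_integral_mono)
   fix x
   have "ennreal (1 / k) * s x <= ennreal (1 / k) * (ennreal k * g x)"
    using s(2) by (intro mult_left_mono) (auto simp: le_fun_def)
   thus "ennreal (1 / k) * s x <= g x" by (simp only: cancel)
  qed
  finally show ?thesis .
 qed
 thus ?thesis unfolding nn_integral_def[of M "%x. ennreal k * g x"]
  by (subst SUP_mult_left_ennreal) (intro SUP_least, auto)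
qed

locale riemannian =
 fixes \<A> :: "('m::{t2_space, second_countable_topology}, 'e::euclidean_space) chart set"
  and G :: "('m, 'e) metric_field"
 assumes manifold: "riemannian_manifold \<A> G"
begin

abbreviation cdist :: "'m => 'm => ennreal" where "cdist \<equiv> riemannian_dist \<A> G"

lemma atlas: "smooth_atlas \<A>" using manifold by (simp add: riemannian_manifold_def)

lemma chartE: obtains c where "c : \<A>" "x : chart_dom c"
proof -
 have "x : (\<Union>c\<in>\<A>. chart_dom c)" using atlas by (simp add: smooth_atlas_def)
 thus ?thesis using that by blast
qed

context fixes c assumes c: "c : \<A>"
begin

lemma
 shows open_chart_dom: "open (chart_dom c)"
  and open_chart_range: "open (chart_map c ` chart_dom c)"
  and chart_homeomorphism: "homeomorphism (chart_dom c) (chart_map c ` chart_dom c) (chart_map c) (chart_inv c)"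
 using atlas c by (auto simp: smooth_atlas_def)

lemma chart_inv_map [simp]: "x : chart_dom c ==> chart_inv c (chart_map c x) = x"
 and chart_map_inv [simp]: "q : chart_map c ` chart_dom c ==> chart_map c (chart_inv c q) = q"
 and chart_inv_mem: "q : chart_map c ` chart_dom c ==> chart_inv c q : chart_dom c"
 and continuous_chart_map: "continuous_on (chart_dom c) (chart_map c)"
 and continuous_chart_inv: "continuous_on (chart_map c ` chart_dom c) (chart_inv c)"
 using chart_homeomorphism unfolding homeomorphism_def by auto

lemma open_chart_preimage: "open W ==> open (chart_dom c \<inter> chart_map c -` W)"
 by (rule continuous_open_preimage[OF continuous_chart_map open_chart_dom])

lemma open_chart_image:
 assumes W: "open W" "W \<subseteq> chart_dom c" shows "open (chart_map c ` W)"
proof -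
 have "chart_map c ` W = chart_map c ` chart_dom c \<inter> chart_inv c -` W"
  using W chart_inv_map by (force simp: image_iff)
 thus ?thesis using continuous_open_preimage[OF continuous_chart_inv open_chart_range W(1)] by simp
qed

end

text \<open>It suffices to ask for some strict derivative: strict differentiability makes it the
  Frechet derivative that defines \<open>tangent_map\<close>. The class contains the identity and is
  closed under composition, hence under iteration.\<close>

definition strictly_smooth :: "('m => 'm) => bool" where
 "strictly_smooth g \<longleftrightarrow> continuous_on UNIV g &
  (ALL c:\<A>. ALL c':\<A>. ALL x:chart_dom c. g x : chart_dom c' --> (EX L. strict_deriv (local_rep c c' g) L (chart_map c x)))"

lemma strictly_smooth_tangent_map:
 assumes "strictly_smooth g" "c : \<A>" "c' : \<A>" "x : chart_dom c" "g x : chart_dom c'"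
 shows "strict_deriv (local_rep c c' g) (tangent_map c c' g x) (chart_map c x)"
proof -
 obtain L where L: "strict_deriv (local_rep c c' g) L (chart_map c x)"
  using assms unfolding strictly_smooth_def by blast
 thus ?thesis
  using frechet_derivative_at[OF strict_deriv_has_derivative[OF L]] by (simp add: tangent_map_def)
qed

lemma strictly_smooth_id: "strictly_smooth id"
 unfolding strictly_smooth_def
proof (intro conjI ballI impI)
 fix c c' x assume c: "c : \<A>" "c' : \<A>" "x : chart_dom c" "id x : chart_dom c'"
 have "smooth_on (local_rep c c' id) (chart_map c ` (chart_dom c \<inter> chart_dom c'))"
  using atlas c by (simp add: smooth_atlas_def)
 hence "Ck_on 1 (local_rep c c' id) (chart_map c ` (chart_dom c \<inter> chart_dom c'))" unfolding smooth_on_def by blast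
 moreover have "open (chart_map c ` (chart_dom c \<inter> chart_dom c'))"
  using c by (intro open_chart_image open_Int open_chart_dom) auto
 moreover have "chart_map c x : chart_map c ` (chart_dom c \<inter> chart_dom c')" using c by simp
 ultimately show "EX L. strict_deriv (local_rep c c' id) L (chart_map c x)" by (blast intro: Ck_on_strict_deriv)
qed (simp add: continuous_on_id)

lemma C1_map_strictly_smooth:
 assumes f: "C1_map \<A> f" shows "strictly_smooth f"
 unfolding strictly_smooth_def
proof (intro conjI ballI impI)
 show cont: "continuous_on UNIV f" using f by (simp add: C1_map_def)
 fix c c' x assume c: "c : \<A>" "c' : \<A>" "x : chart_dom c" "f x : chart_dom c'"
 have "Ck_on 1 (local_rep c c' f) (chart_map c ` (chart_dom c \<inter> f -` chart_dom c'))"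
  using f c unfolding C1_map_def by blast
 moreover have "open (chart_map c ` (chart_dom c \<inter> f -` chart_dom c'))"
  using c cont by (intro open_chart_image open_Int open_chart_dom open_vimage) auto
 moreover have "chart_map c x : chart_map c ` (chart_dom c \<inter> f -` chart_dom c')" using c by simp
 ultimately show "EX L. strict_deriv (local_rep c c' f) L (chart_map c x)" by (blast intro: Ck_on_strict_deriv)
qed

lemma strictly_smooth_compose:
 assumes g: "strictly_smooth g" and h: "strictly_smooth h" shows "strictly_smooth (h \<circ> g)"
 unfolding strictly_smooth_def
proof (intro conjI ballI impI)
 have cont: "continuous_on UNIV g" "continuous_on UNIV h" using g h by (auto simp: strictly_smooth_def)
 thus "continuous_on UNIV (h \<circ> g)" by (metis continuous_on_compose continuous_on_subset subset_UNIV)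
 fix c c'' x assume c: "c : \<A>" "c'' : \<A>" "x : chart_dom c" "(h \<circ> g) x : chart_dom c''"
 obtain c' where c': "c' : \<A>" "g x : chart_dom c'" by (rule chartE)
 have "strict_deriv (local_rep c c' g) (tangent_map c c' g x) (chart_map c x)"
  by (rule strictly_smooth_tangent_map[OF g]) (use c c' in auto)
 moreover have "strict_deriv (local_rep c' c'' h) (tangent_map c' c'' h (g x)) (local_rep c c' g (chart_map c x))"
  using strictly_smooth_tangent_map[OF h c'(1) c(2) c'(2)] c by (simp add: local_rep_def)
 ultimately have "strict_deriv (local_rep c' c'' h \<circ> local_rep c c' g)
   (tangent_map c' c'' h (g x) \<circ> tangent_map c c' g x) (chart_map c x)" by (rule strict_deriv_compose)
 hence "strict_deriv (local_rep c c'' (h \<circ> g)) (tangent_map c' c'' h (g x) \<circ> tangent_map c c' g x) (chart_map c x)"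
 proof (rule strict_deriv_cong)
  show "open (chart_map c ` (chart_dom c \<inter> g -` chart_dom c'))"
   using c c' cont by (intro open_chart_image open_Int open_chart_dom open_vimage) auto
  show "chart_map c x : chart_map c ` (chart_dom c \<inter> g -` chart_dom c')" using c c' by auto
  fix q assume "q : chart_map c ` (chart_dom c \<inter> g -` chart_dom c')"
  thus "local_rep c c'' (h \<circ> g) q = (local_rep c' c'' h \<circ> local_rep c c' g) q"
   using c c' by (auto simp: local_rep_def)
 qed
 thus "EX L. strict_deriv (local_rep c c'' (h \<circ> g)) L (chart_map c x)" by blast
qed

lemma strictly_smooth_funpow: "strictly_smooth g ==> strictly_smooth (g ^^ n)"
 by (induction n) (simp_all add: strictly_smooth_compose strictly_smooth_id flip: id_def)

text \<open>By homogeneity it is enough to bound the quadratic form on unit vectors, and the product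
  of a closed coordinate ball with the unit sphere is compact. Continuity on the product follows
  from that of finitely many coefficients.\<close>

lemma metric_bounds:
 assumes c: "c : \<A>" and x: "x : chart_dom c"
 obtains k r where "k > 0" "r > 0" "cball (chart_map c x) r \<subseteq> chart_map c ` chart_dom c"
  "!!q v. q : cball (chart_map c x) r ==> tangent_norm G c (chart_inv c q) v <= k * norm v"
  "!!q v. q : cball (chart_map c x) r ==> norm v <= k * tangent_norm G c (chart_inv c q) v"
proof -
 define p where "p = chart_map c x"
 have "p : chart_map c ` chart_dom c" using x by (simp add: p_def)
 then obtain r where r: "r > 0" "cball p r \<subseteq> chart_map c ` chart_dom c"
  using open_chart_range[OF c] open_contains_cball by blast
 define g where "g q v = G c (chart_inv c q) v v" for q v
 have mem: "chart_inv c q : chart_dom c" if "q : cball p r" for q using that r chart_inv_mem[OF c] by blast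
 have bil: "bilinear (G c (chart_inv c q))" if "q : cball p r" for q
  using manifold c mem[OF that] unfolding riemannian_manifold_def by blast
 have pos: "g q v > 0" if "q : cball p r" "v ~= 0" for q v
  using manifold c mem[OF that(1)] that(2) unfolding riemannian_manifold_def g_def by blast
 have cont: "continuous_on (cball p r) (%q. G c (chart_inv c q) u v)" for u v
 proof -
  have "smooth_on (%p. G c (chart_inv c p) u v) (chart_map c ` chart_dom c)"
   using manifold c unfolding riemannian_manifold_def by blast
  hence "Ck_on 0 (%p. G c (chart_inv c p) u v) (chart_map c ` chart_dom c)" unfolding smooth_on_def by blast
  thus ?thesis using r continuous_on_subset by auto
 qed
 define X where "X = cball p r \<times> sphere (0::'e) 1"
 have "continuous_on X (%(q,v). \<Sum>(i,j)\<in>Basis \<times> Basis. (v \<bullet> i) * (v \<bullet> j) * G c (chart_inv c q) i j)"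
  unfolding X_def split_beta
  by (intro continuous_intros continuous_on_compose2[OF cont]) auto
 hence contX: "continuous_on X (%z. g (fst z) (snd z))"
  by (rule continuous_on_eq) (auto simp: X_def g_def bilinear_expand[OF bil])
 have compX: "compact X" unfolding X_def by (intro compact_Times) auto
 have "(p, SOME i. i : Basis) : X" using r by (simp add: X_def SOME_Basis)
 hence neX: "X ~= {}" by blast
 obtain z1 where z1: "z1 : X" "!!z. z : X ==> g (fst z1) (snd z1) <= g (fst z) (snd z)"
  using continuous_attains_inf[OF compX neX contX] by auto
 obtain z2 where z2: "z2 : X" "!!z. z : X ==> g (fst z) (snd z) <= g (fst z2) (snd z2)"
  using continuous_attains_sup[OF compX neX contX] by auto
 define m M where "m = g (fst z1) (snd z1)" and "M = g (fst z2) (snd z2)"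
 have m: "m > 0" unfolding m_def using z1(1) by (intro pos) (auto simp: X_def)
 have M: "m <= M" unfolding m_def M_def using z1 z2 by auto
 have scale: "g q (a *\<^sub>R v) = a\<^sup>2 * g q v" if "q : cball p r" for q a v
  using bil[OF that] by (simp add: g_def bilinear_lmul bilinear_rmul power2_eq_square)
 have bound: "m * (norm v)\<^sup>2 <= g q v & g q v <= M * (norm v)\<^sup>2" if q: "q : cball p r" for q v
 proof (cases "v = 0")
  case True thus ?thesis using scale[OF q, of 0 v] by simp
 next
  case False
  define u where "u = (1 / norm v) *\<^sub>R v"
  have "(q, u) : X" using q False by (simp add: X_def u_def)
  hence "m <= g q u" "g q u <= M" using z1(2)[of "(q,u)"] z2(2)[of "(q,u)"] by (simp_all add: m_def M_def)
  moreover have "g q v = (norm v)\<^sup>2 * g q u" using scale[OF q, of "norm v" u] False by (simp add: u_def)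
  ultimately show ?thesis by (auto intro!: mult_right_mono simp: mult.commute)
 qed
 define k where "k = max (sqrt M) (1 / sqrt m)"
 have k: "k > 0" using m M by (simp add: k_def less_max_iff_disj)
 show ?thesis
 proof (rule that[OF k r(1)])
  show "cball (chart_map c x) r \<subseteq> chart_map c ` chart_dom c" using r by (simp add: p_def)
  fix q v assume "q : cball (chart_map c x) r"
  hence b: "m * (norm v)\<^sup>2 <= g q v" "g q v <= M * (norm v)\<^sup>2" using bound p_def by auto
  have "tangent_norm G c (chart_inv c q) v <= sqrt (M * (norm v)\<^sup>2)"
   using b unfolding tangent_norm_def g_def by (intro real_sqrt_le_mono) auto
  also have "\<dots> = sqrt M * norm v" by (simp add: real_sqrt_mult)
  also have "\<dots> <= k * norm v" by (intro mult_right_mono) (auto simp: k_def)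
  finally show "tangent_norm G c (chart_inv c q) v <= k * norm v" .
  have "sqrt (m * (norm v)\<^sup>2) <= tangent_norm G c (chart_inv c q) v"
   using b unfolding tangent_norm_def g_def by (intro real_sqrt_le_mono) auto
  hence le: "sqrt m * norm v <= tangent_norm G c (chart_inv c q) v" by (simp add: real_sqrt_mult)
  hence "norm v <= 1 / sqrt m * tangent_norm G c (chart_inv c q) v" using m by (simp add: field_simps)
  also have "0 <= tangent_norm G c (chart_inv c q) v" using le m by (meson order_trans mult_nonneg_nonneg norm_ge_zero real_sqrt_ge_zero less_imp_le)
  hence "1 / sqrt m * tangent_norm G c (chart_inv c q) v <= k * tangent_norm G c (chart_inv c q) v"
   by (intro mult_right_mono) (auto simp: k_def)
  finally show "norm v <= k * tangent_norm G c (chart_inv c q) v" .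
 qed
qed

text \<open>Replaces the unspecified chart in \<open>curve_speed\<close> by any chart around the
  point; the metric is invariant under the derivative of the transition map.\<close>

lemma curve_speed_chart:
 assumes c: "c : \<A>" "\<gamma> t : chart_dom c" and O: "open T" "t : T" "continuous_on T \<gamma>"
  and w: "((chart_map c \<circ> \<gamma>) has_vector_derivative w) (at t)"
 shows "curve_speed \<A> G \<gamma> t = tangent_norm G c (\<gamma> t) w"
proof -
 define c' where "c' = (SOME c. c : \<A> & \<gamma> t : chart_dom c)"
 have "c' : \<A> & \<gamma> t : chart_dom c'" unfolding c'_def by (rule someI[of _ c]) (use c in auto)
 hence c': "c' : \<A>" "\<gamma> t : chart_dom c'" by auto
 define L where "L = tangent_map c c' id (\<gamma> t)"
 have "(local_rep c c' id has_derivative L) (at (chart_map c (\<gamma> t)))" unfolding L_def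
  by (rule strict_deriv_has_derivative[OF strictly_smooth_tangent_map[OF strictly_smooth_id]]) (use c c' in auto)
 hence "((local_rep c c' id \<circ> (chart_map c \<circ> \<gamma>)) has_derivative (L \<circ> (%s. s *\<^sub>R w))) (at t)"
  using w by (intro diff_chain_at) (auto simp: has_vector_derivative_def)
 moreover have "open (T \<inter> \<gamma> -` (chart_dom c \<inter> chart_dom c'))"
  using c c' O by (intro continuous_open_preimage open_Int open_chart_dom)
 ultimately have "((chart_map c' \<circ> \<gamma>) has_derivative (L \<circ> (%s. s *\<^sub>R w))) (at t)"
  by (rule has_derivative_transform_within_open) (use c c' O in \<open>auto simp: local_rep_def\<close>)
 moreover have "linear L"
  using \<open>(local_rep c c' id has_derivative L) _\<close> by (rule has_derivative_linear)
 ultimately have "((chart_map c' \<circ> \<gamma>) has_vector_derivative L w) (at t)"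
  by (simp add: has_vector_derivative_def o_def linear_cmul)
 hence "vector_derivative (chart_map c' \<circ> \<gamma>) (at t) = L w" by (rule vector_derivative_at)
 moreover have "G c (\<gamma> t) w w = G c' (\<gamma> t) (L w) (L w)"
  using manifold c c' unfolding riemannian_manifold_def L_def by blast
 ultimately show ?thesis by (simp add: curve_speed_def c'_def[symmetric] Let_def tangent_norm_def)
qed

text \<open>The coordinate segment between two points of a small coordinate ball is an admissible
  curve, of length at most k times the Euclidean one.\<close>

lemma cdist_le_chart:
 assumes c: "c : \<A>" and x0: "x0 : chart_dom c"
 obtains k N where "k > 0" "open N" "x0 : N" "N \<subseteq> chart_dom c"
  "!!x y. x : N ==> y : N ==> cdist x y <= ennreal (k * norm (chart_map c x - chart_map c y))"
proof -
 define p where "p = chart_map c x0"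
 obtain k r where k: "k > 0" and r: "r > 0" "cball p r \<subseteq> chart_map c ` chart_dom c"
  and le: "!!q v. q : cball p r ==> tangent_norm G c (chart_inv c q) v <= k * norm v"
 proof -
  fix thesis assume *: "!!k r. k > 0 ==> r > 0 ==> cball p r \<subseteq> chart_map c ` chart_dom c ==>
   (!!q v. q : cball p r ==> tangent_norm G c (chart_inv c q) v <= k * norm v) ==> thesis"
  show thesis by (rule metric_bounds[OF c x0, folded p_def]) (rule *)
 qed
 define N where "N = chart_dom c \<inter> chart_map c -` ball p r"
 have main: "cdist x y <= ennreal (k * norm (chart_map c x - chart_map c y))" if x: "x : N" and y: "y : N" for x y
 proof -
  define a b where "a = chart_map c x" and "b = chart_map c y"
  define l where "l t = a + t *\<^sub>R (b - a)" for t :: real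
  define \<gamma> where "\<gamma> t = chart_inv c (l t)" for t
  \<comment> \<open>An open set of times containing the closed unit interval, so that two-sided
    derivatives exist at both ends.\<close>
  define T where "T = l -` ball p r"
  have ab: "a : ball p r" "b : ball p r" using x y by (auto simp: N_def a_def b_def)
  have l_cont: "continuous_on S l" for S unfolding l_def by (intro continuous_intros)
  have l_deriv: "(l has_vector_derivative (b - a)) (at t)" for t
   unfolding l_def by (auto intro!: derivative_eq_intros)
  have openT: "open T" unfolding T_def using l_cont by (intro open_vimage) auto
  have "l t : ball p r" if "t : {0..1}" for t
  proof -
   have "l t = (1 - t) *\<^sub>R a + t *\<^sub>R b" by (simp add: l_def algebra_simps)
   thus ?thesis using convexD_alt[OF convex_ball ab, of t] that by simp
  qed
  hence T: "{0..1} \<subseteq> T" by (auto simp: T_def)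
  have range: "l t : chart_map c ` chart_dom c" if "t : T" for t using that r by (auto simp: T_def)
  have \<gamma>_cont: "continuous_on T \<gamma>" unfolding \<gamma>_def
   by (rule continuous_on_compose2[OF continuous_chart_inv[OF c] l_cont]) (use range in auto)
  have \<gamma>_mem: "\<gamma> t : chart_dom c" if "t : T" for t unfolding \<gamma>_def by (intro chart_inv_mem c range that)
  have "piecewise_C1_curve \<A> \<gamma>" unfolding piecewise_C1_curve_def
  proof (intro conjI ballI allI impI)
   show "continuous_on {0..1} \<gamma>" using \<gamma>_cont T by (rule continuous_on_subset)
   fix c' and u v :: real assume c': "c' : \<A>" and uv: "0 <= u & u < v & v <= 1 & \<gamma> ` {u..v} \<subseteq> chart_dom c'"
   define F where "F = local_rep c c' id"
   define W where "W = chart_map c ` (chart_dom c \<inter> chart_dom c')"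
   have W: "open W" unfolding W_def using c c' by (intro open_chart_image open_Int open_chart_dom) auto
   have "smooth_on F W" using atlas c c' by (simp add: smooth_atlas_def W_def F_def)
   hence F: "F differentiable_on W" "!!v. continuous_on W (%p. frechet_derivative F (at p) v)"
    unfolding smooth_on_def by (auto dest: spec[of _ 1])
   have lW: "l t : W" if "t : {u..v}" for t
   proof -
    have "t : T" using that uv T by auto
    hence "l t = chart_map c (\<gamma> t)" unfolding \<gamma>_def using range c by simp
    moreover have "\<gamma> t : chart_dom c'" using that uv by blast
    ultimately show ?thesis using \<gamma>_mem[OF \<open>t : T\<close>] by (simp add: W_def)
   qed
   have eq: "chart_map c' \<circ> \<gamma> = F \<circ> l" by (auto simp: F_def \<gamma>_def local_rep_def)
   have "(F \<circ> l) C1_differentiable_on {u..v}" unfolding C1_differentiable_on_def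
   proof (intro exI[of _ "%t. frechet_derivative F (at (l t)) (b - a)"] conjI ballI)
    fix t assume t: "t : {u..v}"
    have FD: "(F has_derivative frechet_derivative F (at (l t))) (at (l t))"
     using F(1) lW[OF t] W by (simp add: differentiable_on_eq_differentiable_at frechet_derivative_works[symmetric])
    hence "linear (frechet_derivative F (at (l t)))" by (rule has_derivative_linear)
    with diff_chain_at[OF l_deriv[of t, unfolded has_vector_derivative_def] FD]
    show "(F \<circ> l has_vector_derivative frechet_derivative F (at (l t)) (b - a)) (at t)"
     by (simp add: has_vector_derivative_def o_def linear_cmul)
   next
    show "continuous_on {u..v} (%t. frechet_derivative F (at (l t)) (b - a))"
     by (rule continuous_on_compose2[OF F(2) l_cont]) (use lW in auto)
   qed
   thus "(chart_map c' \<circ> \<gamma>) piecewise_C1_differentiable_on {u..v}" unfolding eq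
    by (rule C1_differentiable_imp_piecewise)
  qed
  moreover have "\<gamma> 0 = x" "\<gamma> 1 = y" using x y c by (auto simp: \<gamma>_def l_def a_def b_def N_def)
  ultimately have "cdist x y <= (\<integral>\<^sup>+t\<in>{0..1}. ennreal (curve_speed \<A> G \<gamma> t) \<partial>lborel)"
   unfolding riemannian_dist_def by (intro INF_lower) auto
  also have "\<dots> <= (\<integral>\<^sup>+t. ennreal (k * norm (b - a)) * indicator {0..1::real} t \<partial>lborel)"
  proof (rule nn_integral_mono)
   fix t :: real
   show "ennreal (curve_speed \<A> G \<gamma> t) * indicator {0..1} t <= ennreal (k * norm (b - a)) * indicator {0..1} t"
   proof (cases "t : {0..1}")
    case True
    hence t: "t : T" using T by auto
    have "((chart_map c \<circ> \<gamma>) has_vector_derivative (b - a)) (at t)"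
     by (rule has_vector_derivative_transform_within_open[OF l_deriv openT t]) (use range c in \<open>auto simp: \<gamma>_def\<close>)
    hence "curve_speed \<A> G \<gamma> t = tangent_norm G c (\<gamma> t) (b - a)"
     by (rule curve_speed_chart[OF c \<gamma>_mem[OF t] openT t \<gamma>_cont])
    also have "\<dots> <= k * norm (b - a)" using t unfolding \<gamma>_def by (intro le) (auto simp: T_def)
    finally show ?thesis by (simp add: ennreal_leI mult_right_mono)
   qed simp
  qed
  also have "\<dots> = ennreal (k * norm (b - a))" by (subst nn_integral_cmult_indicator) auto
  finally show ?thesis by (simp add: a_def b_def norm_minus_commute)
 qed
 have N: "open N" "x0 : N" "N \<subseteq> chart_dom c"
  using r x0 open_chart_preimage[OF c, of "ball p r"] by (auto simp: N_def p_def)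
 show ?thesis by (rule that[OF k N main])
qed

text \<open>A connecting curve may leave the chart and return. Locally it either stays in the chart,
  where its length dominates the coordinate distance, or stays where h vanishes. The local estimates
  are glued along a subdivision of the time interval.\<close>

lemma chart_function_lipschitz:
 fixes \<beta> :: "'e => 'b::real_normed_vector"
 assumes c: "c : \<A>" and k: "k > 0" and r: "r > 0" "cball p r \<subseteq> chart_map c ` chart_dom c"
  and le: "!!q v. q : cball p r ==> norm v <= k * tangent_norm G c (chart_inv c q) v"
  and K: "K > 0" and \<beta>: "!!y z. norm (\<beta> y - \<beta> z) <= K * norm (y - z)" "!!q. q \<notin> cball p (r/2) ==> \<beta> q = 0"
  and h: "h = (%x. if x : chart_dom c then \<beta> (chart_map c x) else 0)"
  and fin: "cdist x y < \<infinity>"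
 shows "norm (h x - h y) <= K * k * enn2real (cdist x y)"
proof -
 define w where "w = 1 / (K * k)"
 have w: "w > 0" using K k by (simp add: w_def)
 define O1 where "O1 = chart_dom c \<inter> chart_map c -` ball p r"
 define O2 where "O2 = - chart_inv c ` cball p (r/2)"
 have O1: "open O1" unfolding O1_def using open_chart_preimage[OF c] by simp
 have sub: "cball p (r/2) \<subseteq> chart_map c ` chart_dom c" using subset_cball[of "r/2" r p] r by auto
 have "compact (chart_inv c ` cball p (r/2))"
  by (intro compact_continuous_image continuous_on_subset[OF continuous_chart_inv[OF c] sub] compact_cball)
 hence O2: "open O2" unfolding O2_def by (intro open_Compl compact_imp_closed)
 have O2_0: "h z = 0" if "z : O2" for z
 proof (cases "z : chart_dom c")
  case True
  have "chart_map c z \<notin> cball p (r/2)"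
   using that chart_inv_map[OF c True] by (auto simp: O2_def image_iff simp del: mem_cball)
  thus ?thesis using \<beta>(2) by (simp add: h)
 qed (simp add: h)
 have O12: "z : O1" if z: "z \<notin> O2" for z
 proof -
  obtain q where q: "q : cball p (r/2)" "z = chart_inv c q" using z by (auto simp: O2_def)
  have "q : chart_map c ` chart_dom c" using q sub by auto
  thus ?thesis using q r chart_inv_mem[OF c] c by (auto simp: O1_def)
 qed
 have curve: "ennreal (w * norm (h y - h x)) <= (\<integral>\<^sup>+t\<in>{0..1}. ennreal (curve_speed \<A> G \<gamma> t) \<partial>lborel)"
  if \<gamma>: "piecewise_C1_curve \<A> \<gamma>" "\<gamma> 0 = x" "\<gamma> 1 = y" for \<gamma>
 proof -
  have cont: "continuous_on {0..1} \<gamma>" using \<gamma> by (simp add: piecewise_C1_curve_def)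
  define s where "s t = ennreal (curve_speed \<A> G \<gamma> t)" for t
  \<comment> \<open>Half-open intervals make the integrals over adjacent pieces add up without
    overlap.\<close>
  define P where "P a b \<longleftrightarrow> (0 <= a & a <= b & b <= 1 -->
   ennreal (w * norm (h (\<gamma> b) - h (\<gamma> a))) <= (\<integral>\<^sup>+t\<in>{a..<b}. s t \<partial>lborel))" for a b
  have "P 0 1"
  proof (rule Bolzano)
   show "(0::real) <= 1" by simp
  next
   fix a b c' assume P: "P a b" "P b c'" and ab: "a <= b" "b <= c'"
   show "P a c'" unfolding P_def
   proof
    assume ac: "0 <= a & a <= c' & c' <= 1"
    have "norm (h (\<gamma> c') - h (\<gamma> a)) <= norm (h (\<gamma> b) - h (\<gamma> a)) + norm (h (\<gamma> c') - h (\<gamma> b))"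
     using norm_triangle_ineq[of "h (\<gamma> b) - h (\<gamma> a)" "h (\<gamma> c') - h (\<gamma> b)"] by simp
    hence "ennreal (w * norm (h (\<gamma> c') - h (\<gamma> a)))
     <= ennreal (w * norm (h (\<gamma> b) - h (\<gamma> a)) + w * norm (h (\<gamma> c') - h (\<gamma> b)))"
     using w by (intro ennreal_leI) (simp flip: distrib_left)
    also have "\<dots> = ennreal (w * norm (h (\<gamma> b) - h (\<gamma> a))) + ennreal (w * norm (h (\<gamma> c') - h (\<gamma> b)))"
     using w by (intro ennreal_plus) auto
    also have "\<dots> <= (\<integral>\<^sup>+t\<in>{a..<b}. s t \<partial>lborel) + (\<integral>\<^sup>+t\<in>{b..<c'}. s t \<partial>lborel)"
     using P ac ab unfolding P_def by (intro add_mono) auto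
    also have "\<dots> <= (\<integral>\<^sup>+t. s t * indicator {a..<b} t + s t * indicator {b..<c'} t \<partial>lborel)"
     by (rule nn_integral_superadditive)
    also have "\<dots> = (\<integral>\<^sup>+t\<in>{a..<c'}. s t \<partial>lborel)"
     using ab by (intro nn_integral_cong) (auto simp: indicator_def)
    finally show "ennreal (w * norm (h (\<gamma> c') - h (\<gamma> a))) <= (\<integral>\<^sup>+t\<in>{a..<c'}. s t \<partial>lborel)" .
   qed
  next
   fix t :: real assume t: "0 <= t" "t <= 1"
   have near: "EX d>0. ALL u:{0..1}. \<bar>u - t\<bar> < d --> \<gamma> u : V" if V: "open V" "\<gamma> t : V" for V
   proof -
    have "t : {0..1}" using t by simp
    then obtain A where A: "open A" "t : A" "!!u. u : {0..1} ==> u : A ==> \<gamma> u : V"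
     using cont V unfolding continuous_on_topological by metis
    obtain d where "d > 0" "!!u. dist u t < d ==> u : A" using A(1,2) unfolding open_dist by blast
    thus ?thesis using A(3) by (intro exI[of _ d]) (auto simp: dist_real_def)
   qed
   show "EX d>0. ALL a b. a <= t & t <= b & b - a < d --> P a b"
   proof (cases "\<gamma> t : O2")
    case True
    then obtain d where d: "d > 0" "!!u. u : {0..1} ==> \<bar>u - t\<bar> < d ==> \<gamma> u : O2" using near[OF O2] by auto
    have "P a b" if "a <= t" "t <= b" "b - a < d" for a b
     unfolding P_def using that d(2)[of a] d(2)[of b] O2_0 by auto
    thus ?thesis using d(1) by blast
   next
    case False
    then obtain d where d: "d > 0" "!!u. u : {0..1} ==> \<bar>u - t\<bar> < d ==> \<gamma> u : O1" using near[OF O1] O12 by auto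
    have "P a b" if ab: "a <= t" "t <= b" "b - a < d" for a b
     unfolding P_def
    proof
     assume ab': "0 <= a & a <= b & b <= 1"
     have in1: "\<gamma> u : O1" if "u : {a..b}" for u using that ab ab' by (intro d(2)) auto
     hence in_dom: "\<gamma> u : chart_dom c" "chart_map c (\<gamma> u) : ball p r" if "u : {a..b}" for u
      using that by (auto simp: O1_def)
     show "ennreal (w * norm (h (\<gamma> b) - h (\<gamma> a))) <= (\<integral>\<^sup>+t\<in>{a..<b}. s t \<partial>lborel)"
     proof (cases "a = b")
      case False
      hence "a < b" using ab' by simp
      hence "(chart_map c \<circ> \<gamma>) piecewise_C1_differentiable_on {a..b}"
       using \<gamma>(1) ab' c in_dom(1) unfolding piecewise_C1_curve_def by blast
      then obtain S D where S: "finite S" and contc: "continuous_on {a..b} (chart_map c \<circ> \<gamma>)"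
       and D: "!!t. t : {a..b} - S ==> ((chart_map c \<circ> \<gamma>) has_vector_derivative D t) (at t)"
        "continuous_on ({a..b} - S) D"
       unfolding piecewise_C1_differentiable_on_def C1_differentiable_on_def by blast
      define T where "T = insert a (insert b S)"
      have speed: "norm (D t) <= k * curve_speed \<A> G \<gamma> t" if t: "t : {a..b} - T" for t
      proof -
       have "curve_speed \<A> G \<gamma> t = tangent_norm G c (\<gamma> t) (D t)"
       proof (rule curve_speed_chart[OF c])
        show "\<gamma> t : chart_dom c" using t by (intro in_dom) auto
        show "open {a<..<b}" "t : {a<..<b}" using t by (auto simp: T_def)
        show "continuous_on {a<..<b} \<gamma>" using ab' by (intro continuous_on_subset[OF cont]) auto
        show "((chart_map c \<circ> \<gamma>) has_vector_derivative D t) (at t)" using t by (intro D) (auto simp: T_def)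
       qed
       moreover have "norm (D t) <= k * tangent_norm G c (chart_inv c (chart_map c (\<gamma> t))) (D t)"
        using t in_dom(2)[of t] by (intro le) auto
       moreover have "\<gamma> t : chart_dom c" using t by (intro in_dom) auto
       ultimately show ?thesis using c by simp
      qed
      have "norm (h (\<gamma> b) - h (\<gamma> a)) <= K * norm (chart_map c (\<gamma> b) - chart_map c (\<gamma> a))"
       using in_dom(1)[of a] in_dom(1)[of b] ab' \<beta>(1) by (simp add: h)
      hence "w * norm (h (\<gamma> b) - h (\<gamma> a)) <= w * (K * norm (chart_map c (\<gamma> b) - chart_map c (\<gamma> a)))"
       using w by (intro mult_left_mono) auto
      also have "\<dots> = 1 / k * norm (chart_map c (\<gamma> b) - chart_map c (\<gamma> a))" using K by (simp add: w_def)
      finally have "ennreal (w * norm (h (\<gamma> b) - h (\<gamma> a)))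
       <= ennreal (1 / k) * ennreal (norm (chart_map c (\<gamma> b) - chart_map c (\<gamma> a)))"
       using k by (simp add: ennreal_leI ennreal_mult'[symmetric])
      also have "\<dots> <= ennreal (1 / k) * (\<integral>\<^sup>+t\<in>{a..b} - T. ennreal (norm (D t)) \<partial>lborel)"
       using norm_diff_le_nn_integral[of a b T "chart_map c \<circ> \<gamma>" D] ab' S contc D
       by (intro mult_left_mono) (auto simp: T_def intro: continuous_on_subset)
      also have "\<dots> <= ennreal (1 / k) * (\<integral>\<^sup>+t\<in>{a..b} - T. (ennreal k * s t) \<partial>lborel)"
      proof (intro mult_left_mono nn_integral_mono)
       fix t :: real
       show "ennreal (norm (D t)) * indicator ({a..b} - T) t <= ennreal k * s t * indicator ({a..b} - T) t"
        using speed[of t] k by (cases "t : {a..b} - T") (auto simp: s_def ennreal_leI ennreal_mult'[symmetric])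
      qed simp
      also have "\<dots> <= ennreal (1 / k) * (\<integral>\<^sup>+t. ennreal k * (s t * indicator {a..<b} t) \<partial>lborel)"
       by (intro mult_left_mono nn_integral_mono) (auto simp: indicator_def T_def)
      also have "\<dots> <= (\<integral>\<^sup>+t\<in>{a..<b}. s t \<partial>lborel)"
       by (rule nn_integral_scale_le[OF k])
      finally show ?thesis .
     qed simp
    qed
    thus ?thesis using d(1) by blast
   qed
  qed
  hence "ennreal (w * norm (h y - h x)) <= (\<integral>\<^sup>+t\<in>{0..<1}. s t \<partial>lborel)" using \<gamma> by (simp add: P_def)
  also have "\<dots> <= (\<integral>\<^sup>+t\<in>{0..1}. s t \<partial>lborel)" by (intro nn_integral_mono) (auto simp: indicator_def)
  finally show ?thesis by (simp add: s_def)
 qed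
 have "ennreal (w * norm (h y - h x)) <= cdist x y"
  unfolding riemannian_dist_def by (intro INF_greatest curve) auto
 hence "enn2real (ennreal (w * norm (h y - h x))) <= enn2real (cdist x y)" using fin by (intro enn2real_mono) auto
 hence "w * norm (h y - h x) <= enn2real (cdist x y)" using w by simp
 hence "norm (h y - h x) <= K * k * enn2real (cdist x y)" using K k by (simp add: w_def field_simps)
 thus ?thesis by (simp add: norm_minus_commute)
qed

end

section \<open>An adapted metric\<close>

text \<open>The cutoff is 1 up to distance r / 4 and 0 from r / 2 on. Recording it next to the
  cut-off coordinates ensures that a point of the plateau shares its value with no other point,
  inside or outside the chart.\<close>

definition bump :: "'e::euclidean_space => real => 'e => real \<times> 'e" where
 "bump p r q = (let u = clamp01 (2 - 4 * norm (q - p) / r) in (u, u *\<^sub>R (q - p)))"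

lemma bump_eq_0:
 assumes "r > 0" "q \<notin> cball p (r/2)" shows "bump p r q = 0"
proof -
 have "2 - 4 * norm (q - p) / r <= 0" using assms by (simp add: dist_norm norm_minus_commute[of p] field_simps)
 thus ?thesis by (simp add: bump_def clamp01_le0 zero_prod_def)
qed

lemma bump_near:
 assumes "r > 0" "norm (q - p) <= r / 4" shows "bump p r q = (1, q - p)"
proof -
 have "1 <= 2 - 4 * norm (q - p) / r" using assms by (simp add: field_simps)
 thus ?thesis by (simp add: bump_def clamp01_ge1)
qed

text \<open>The cutoff has slope 4 / r. In the product, 1 comes from the coordinates and 2 from the
  slope times r / 2, a bound for the coordinates of whichever point is in the support; by symmetry
  one such point is enough.\<close>

lemma bump_lipschitz:
 assumes r: "r > 0"
 shows "norm (bump p r y - bump p r z) <= (4 / r + (1 + 2)) * norm (y - z)"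
proof -
 define u where "u q = clamp01 (2 - 4 * norm (q - p) / r)" for q
 have u: "\<bar>u y - u z\<bar> <= 4 / r * norm (y - z)" for y z
 proof -
  have "\<bar>u y - u z\<bar> <= \<bar>4 * norm (y - p) / r - 4 * norm (z - p) / r\<bar>"
   unfolding u_def clamp01_def by linarith
  also have "4 * norm (y - p) / r - 4 * norm (z - p) / r = 4 / r * (norm (y - p) - norm (z - p))"
   by (simp add: right_diff_distrib)
  also have "\<bar>\<dots>\<bar> = 4 / r * \<bar>norm (y - p) - norm (z - p)\<bar>" unfolding abs_mult using r by simp
  also have "\<dots> <= 4 / r * norm ((y - p) - (z - p))" using r by (intro mult_left_mono norm_triangle_ineq3) auto
  finally show ?thesis by simp
 qed
 have ux: "norm (u y *\<^sub>R (y - p) - u z *\<^sub>R (z - p)) <= (1 + 2) * norm (y - z)" if y: "norm (y - p) <= r / 2" for y z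
 proof -
  have "u y *\<^sub>R (y - p) - u z *\<^sub>R (z - p) = u z *\<^sub>R (y - z) + (u y - u z) *\<^sub>R (y - p)" by (simp add: algebra_simps)
  hence "norm (u y *\<^sub>R (y - p) - u z *\<^sub>R (z - p)) <= \<bar>u z\<bar> * norm (y - z) + \<bar>u y - u z\<bar> * norm (y - p)"
   using norm_triangle_ineq[of "u z *\<^sub>R (y - z)" "(u y - u z) *\<^sub>R (y - p)"] by simp
  also have "\<dots> <= 1 * norm (y - z) + (4 / r * norm (y - z)) * (r / 2)"
   using u[of y z] y r clamp01_bounds[of "2 - 4 * norm (z - p) / r"]
   by (intro add_mono mult_mono) (auto simp: u_def)
  finally show ?thesis using r by simp
 qed
 have "norm (u y *\<^sub>R (y - p) - u z *\<^sub>R (z - p)) <= (1 + 2) * norm (y - z)"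
 proof (cases "norm (y - p) <= r / 2 \<or> norm (z - p) <= r / 2")
  case True thus ?thesis using ux[of y z] ux[of z y] by (auto simp: norm_minus_commute)
 next
  case False
  hence "u y = 0" "u z = 0" using r by (auto simp: u_def clamp01_le0 field_simps)
  thus ?thesis by simp
 qed
 moreover have "norm (bump p r y - bump p r z) <= norm (u y - u z) + norm (u y *\<^sub>R (y - p) - u z *\<^sub>R (z - p))"
  unfolding bump_def Let_def u_def[symmetric] diff_Pair by (rule norm_Pair_le)
 ultimately show ?thesis using u[of y z] by (simp only: real_norm_def distrib_right)
qed

context riemannian
begin

definition chart_bump :: "('m, 'e) chart \<times> 'e \<times> real => 'm => real \<times> 'e" where
 "chart_bump b x = (case b of (c, p, r) => if x : chart_dom c then bump p r (chart_map c x) else 0)"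

definition bump_triple :: "('m, 'e) chart \<times> 'e \<times> real => bool" where
 "bump_triple b \<longleftrightarrow> (case b of (c, p, r) => c : \<A> & r > 0 & cball p r \<subseteq> chart_map c ` chart_dom c &
  (EX k>0. ALL q:cball p r. ALL v. norm v <= k * tangent_norm G c (chart_inv c q) v))"

definition bump_core :: "('m, 'e) chart \<times> 'e \<times> real => 'm set" where
 "bump_core b = (case b of (c, p, r) => chart_dom c \<inter> chart_map c -` ball p (r/4))"

lemma open_bump_core: "bump_triple b ==> open (bump_core b)"
 by (cases b) (simp add: bump_triple_def bump_core_def open_chart_preimage)

lemma bump_tripleE:
 assumes "bump_triple b"
 obtains c p r k where "b = (c, p, r)" "c : \<A>" "r > 0" "cball p r \<subseteq> chart_map c ` chart_dom c" "k > 0"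
  "!!q v. q : cball p r ==> norm v <= k * tangent_norm G c (chart_inv c q) v"
proof -
 obtain c p r where b: "b = (c, p, r)" by (rule prod_cases3)
 have *: "c : \<A>" "r > 0" "cball p r \<subseteq> chart_map c ` chart_dom c"
   "EX k>0. ALL q:cball p r. ALL v. norm v <= k * tangent_norm G c (chart_inv c q) v"
  using assms by (simp_all add: bump_triple_def b)
 from *(4) obtain k where "k > 0" "ALL q:cball p r. ALL v. norm v <= k * tangent_norm G c (chart_inv c q) v" by blast
 thus ?thesis using that[OF b *(1-3), of k] by blast
qed

lemma bump_triple_exists: obtains b where "bump_triple b" "x : bump_core b"
proof -
 obtain c where c: "c : \<A>" "x : chart_dom c" by (rule chartE)
 show ?thesis
 proof (rule metric_bounds[OF c])
  fix k r assume "k > 0" "r > 0" "cball (chart_map c x) r \<subseteq> chart_map c ` chart_dom c"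
   "!!q v. q : cball (chart_map c x) r ==> norm v <= k * tangent_norm G c (chart_inv c q) v"
  thus thesis using c by (intro that[of "(c, chart_map c x, r)"]) (auto simp: bump_triple_def bump_core_def)
 qed
qed

lemma chart_bump_lipschitz:
 assumes b: "bump_triple b"
 obtains K where "K > 0" "!!x y. cdist x y < \<infinity> ==> norm (chart_bump b x - chart_bump b y) <= K * enn2real (cdist x y)"
proof -
 obtain c p r k where b': "b = (c, p, r)" "c : \<A>" "r > 0" "cball p r \<subseteq> chart_map c ` chart_dom c" "k > 0"
  "!!q v. q : cball p r ==> norm v <= k * tangent_norm G c (chart_inv c q) v"
  by (rule bump_tripleE[OF b]) (rule that)
 have K: "4 / r + (1 + 2) > 0" using b'(3) by (simp add: add_pos_pos)
 show ?thesis
 proof (rule that[of "(4 / r + (1 + 2)) * k"])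
  show "(4 / r + (1 + 2)) * k > 0" using K b'(5) by simp
  have h: "chart_bump b = (%x. if x : chart_dom c then bump p r (chart_map c x) else 0)"
   by (rule ext) (simp add: chart_bump_def b'(1))
  fix x y assume "cdist x y < \<infinity>"
  thus "norm (chart_bump b x - chart_bump b y) <= (4 / r + (1 + 2)) * k * enn2real (cdist x y)"
   using chart_function_lipschitz[OF b'(2,5,3,4,6) K bump_lipschitz[OF b'(3)] bump_eq_0[OF b'(3)] h] by simp
 qed
qed

text \<open>Around points of the chart of b this is a Lipschitz bound for the transition map. Around
  all other points the function vanishes, because its support is compact within its chart.\<close>

lemma chart_bump_local:
 assumes b: "bump_triple b" and c': "c' : \<A>" "x : chart_dom c'"
 obtains K N where "K > 0" "open N" "x : N" "N \<subseteq> chart_dom c'"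
  "!!y z. y : N ==> z : N ==> norm (chart_bump b y - chart_bump b z) <= K * norm (chart_map c' y - chart_map c' z)"
proof -
 obtain c p r k where b': "b = (c, p, r)" "c : \<A>" "r > 0" "cball p r \<subseteq> chart_map c ` chart_dom c" "k > 0"
  "!!q v. q : cball p r ==> norm v <= k * tangent_norm G c (chart_inv c q) v"
  by (rule bump_tripleE[OF b]) (rule that)
 show ?thesis
 proof (cases "x : chart_dom c")
  case True
  have "strict_deriv (local_rep c' c id) (tangent_map c' c id x) (chart_map c' x)"
   by (rule strictly_smooth_tangent_map[OF strictly_smooth_id]) (use c' b' True in auto)
  then obtain K s where K: "K > 0" "s > 0" "!!y z. y : ball (chart_map c' x) s ==> z : ball (chart_map c' x) s ==>
    norm (local_rep c' c id y - local_rep c' c id z) <= K * norm (y - z)"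
   by (rule strict_deriv_lipschitz) (rule that)
  define N where "N = (chart_dom c' \<inter> chart_map c' -` ball (chart_map c' x) s) \<inter> chart_dom c"
  have N: "open N" "x : N" "N \<subseteq> chart_dom c'" unfolding N_def
   using c' b' K True by (auto intro!: open_Int open_chart_preimage open_chart_dom)
  have K': "4 / r + (1 + 2) > 0" using b'(3) by (simp add: add_pos_pos)
  show ?thesis
  proof (rule that[of "(4 / r + (1 + 2)) * K", OF _ N])
   show "(4 / r + (1 + 2)) * K > 0" using K' K by simp
   fix y z assume yz: "y : N" "z : N"
   have "norm (chart_bump b y - chart_bump b z) <= (4 / r + (1 + 2)) * norm (chart_map c y - chart_map c z)"
    using yz bump_lipschitz[OF b'(3)] by (simp add: chart_bump_def b'(1) N_def)
   also have "norm (chart_map c y - chart_map c z) <= K * norm (chart_map c' y - chart_map c' z)"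
    using K(3)[of "chart_map c' y" "chart_map c' z"] yz c' by (simp add: N_def local_rep_def)
   finally show "norm (chart_bump b y - chart_bump b z) <= (4 / r + (1 + 2)) * K * norm (chart_map c' y - chart_map c' z)"
    using K' by (simp add: mult.assoc mult_left_mono)
  qed
 next
  case False
  have sub: "cball p (r/2) \<subseteq> chart_map c ` chart_dom c" using subset_cball[of "r/2" r p] b' by auto
  have "compact (chart_inv c ` cball p (r/2))"
   by (intro compact_continuous_image continuous_on_subset[OF continuous_chart_inv[OF b'(2)] sub] compact_cball)
  hence o: "open (- chart_inv c ` cball p (r/2))" by (intro open_Compl compact_imp_closed)
  define N where "N = chart_dom c' \<inter> - chart_inv c ` cball p (r/2)"
  have "x \<notin> chart_inv c ` cball p (r/2)" using False sub chart_inv_mem[OF b'(2)] by auto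
  hence N: "open N" "x : N" "N \<subseteq> chart_dom c'"
   unfolding N_def using open_Int[OF open_chart_dom[OF c'(1)] o] c'(2) by auto
  have 0: "chart_bump b y = 0" if "y : N" for y
  proof (cases "y : chart_dom c")
   case True
   hence "chart_map c y \<notin> cball p (r/2)"
    using that chart_inv_map[OF b'(2) True] by (auto simp: N_def image_iff simp del: mem_cball)
   hence "bump p r (chart_map c y) = 0" by (rule bump_eq_0[OF b'(3)])
   thus ?thesis by (simp add: chart_bump_def b'(1))
  qed (simp add: chart_bump_def b'(1))
  show ?thesis by (rule that[of 1, OF _ N]) (simp_all add: 0)
 qed
qed

lemma continuous_chart_bump:
 assumes b: "bump_triple b" shows "continuous_on UNIV (chart_bump b)"
 unfolding continuous_on_eq_continuous_at[OF open_UNIV]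
proof
 fix x
 obtain c' where c': "c' : \<A>" "x : chart_dom c'" by (rule chartE)
 obtain K N where K: "K > 0" "open N" "x : N" "N \<subseteq> chart_dom c'"
  "!!y z. y : N ==> z : N ==> norm (chart_bump b y - chart_bump b z) <= K * norm (chart_map c' y - chart_map c' z)"
  by (rule chart_bump_local[OF b c']) (rule that)
 have "isCont (chart_map c') x"
  using continuous_on_eq_continuous_at[OF open_chart_dom[OF c'(1)]] continuous_chart_map[OF c'(1)] c' by blast
 hence "((%y. K * norm (chart_map c' y - chart_map c' x)) \<longlongrightarrow> K * norm (chart_map c' x - chart_map c' x)) (at x)"
  unfolding isCont_def by (intro tendsto_intros)
 hence "((%y. chart_bump b y - chart_bump b x) \<longlongrightarrow> 0) (at x)"
 proof -
  assume lim: "((%y. K * norm (chart_map c' y - chart_map c' x)) \<longlongrightarrow> K * norm (chart_map c' x - chart_map c' x)) (at x)"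
  have "\<forall>\<^sub>F y in at x. y : N" using K by (intro eventually_at_in_open') auto
  hence "\<forall>\<^sub>F y in at x. norm (chart_bump b y - chart_bump b x) <= K * norm (chart_map c' y - chart_map c' x)"
   by eventually_elim (rule K(5), use K in auto)
  thus ?thesis by (rule Lim_null_comparison) (use lim in simp)
 qed
 thus "isCont (chart_bump b) x" unfolding isCont_def by (simp add: LIM_zero_iff)
qed

lemma transition_lipschitz:
 assumes c: "c : \<A>" "c' : \<A>" "x : chart_dom c" "x : chart_dom c'"
 obtains K N where "K > 0" "open N" "x : N" "N \<subseteq> chart_dom c" "N \<subseteq> chart_dom c'"
  "!!y z. y : N ==> z : N ==> norm (chart_map c' y - chart_map c' z) <= K * norm (chart_map c y - chart_map c z)"
proof -
 have "strict_deriv (local_rep c c' id) (tangent_map c c' id x) (chart_map c x)"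
  by (rule strictly_smooth_tangent_map[OF strictly_smooth_id]) (use c in auto)
 then obtain K s where K: "K > 0" "s > 0" "!!y z. y : ball (chart_map c x) s ==> z : ball (chart_map c x) s ==>
   norm (local_rep c c' id y - local_rep c c' id z) <= K * norm (y - z)"
  by (rule strict_deriv_lipschitz) (rule that)
 define N where "N = (chart_dom c \<inter> chart_map c -` ball (chart_map c x) s) \<inter> chart_dom c'"
 have N: "open N" "x : N" "N \<subseteq> chart_dom c" "N \<subseteq> chart_dom c'" unfolding N_def
  using c K by (auto intro!: open_Int open_chart_preimage open_chart_dom)
 show ?thesis
 proof (rule that[OF K(1) N])
  fix y z assume yz: "y : N" "z : N"
  thus "norm (chart_map c' y - chart_map c' z) <= K * norm (chart_map c y - chart_map c z)"
   using K(3)[of "chart_map c y" "chart_map c z"] c by (simp add: N_def local_rep_def)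
 qed
qed

end

locale bump_cover = riemannian \<A> G
 for \<A> :: "('m::{t2_space, second_countable_topology}, 'e::euclidean_space) chart set" and G +
 fixes \<Lambda> :: "'m set" and B :: "(('m, 'e) chart \<times> 'e \<times> real) set"
 assumes compact_\<Lambda>: "compact \<Lambda>" and ne_\<Lambda>: "\<Lambda> ~= {}"
  and finite_B: "finite B" and B: "b : B ==> bump_triple b" and cover: "\<Lambda> \<subseteq> (\<Union>b\<in>B. bump_core b)"
begin

text \<open>The sum metric pulled back by the map whose components are the bumps. It is continuous
  on the whole manifold and finite between different components, and it separates points of
  \<Lambda> because the cores cover \<Lambda>.\<close>

definition D :: "'m => 'm => real" where "D x y = (\<Sum>b\<in>B. norm (chart_bump b x - chart_bump b y))"

lemma continuous_bump_D: "continuous_on S (D x)"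
proof -
 have "continuous_on S (chart_bump b)" if "b : B" for b
  using continuous_chart_bump[OF B[OF that]] by (rule continuous_on_subset) simp
 thus ?thesis unfolding D_def[abs_def]
  by (intro continuous_on_sum continuous_on_norm continuous_on_diff continuous_on_const)
qed

lemma norm_le_D: "b : B ==> norm (chart_bump b x - chart_bump b y) <= D x y"
 unfolding D_def by (rule member_le_sum) (simp_all add: finite_B)

sublocale compact_metrized \<Lambda> D
proof
 fix x y z
 show "D x y = D y x" unfolding D_def by (simp add: norm_minus_commute)
 show "D x z <= D x y + D y z" unfolding D_def sum.distrib[symmetric]
  by (intro sum_mono) (metis norm_triangle_ineq diff_add_cancel add_diff_eq)
 show "x = y" if xy: "x : \<Lambda>" "y : \<Lambda>" "D x y = 0"
 proof -
  obtain b where b: "b : B" "x : bump_core b" using xy cover by auto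
  have "norm (chart_bump b x - chart_bump b y) <= 0" using norm_le_D[OF b(1), of x y] xy by simp
  hence eq: "chart_bump b x = chart_bump b y" by simp
  obtain c p r k where b': "b = (c, p, r)" "c : \<A>" "r > 0" "cball p r \<subseteq> chart_map c ` chart_dom c" "k > 0"
   "!!q v. q : cball p r ==> norm v <= k * tangent_norm G c (chart_inv c q) v"
   by (rule bump_tripleE[OF B[OF b(1)]]) (rule that)
  have x: "x : chart_dom c" "norm (chart_map c x - p) <= r / 4"
   using b(2) by (auto simp: bump_core_def b'(1) dist_norm norm_minus_commute)
  hence "chart_bump b x = (1, chart_map c x - p)" using bump_near[OF b'(3) x(2)] by (simp add: chart_bump_def b'(1))
  hence bx: "chart_bump b y = (1, chart_map c x - p)" using eq by simp
  hence y: "y : chart_dom c" by (auto simp: chart_bump_def b'(1) zero_prod_def split: if_splits)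
  with bx have "chart_map c y = chart_map c x" by (auto simp: chart_bump_def b'(1) bump_def Let_def)
  thus "x = y" using chart_inv_map[OF b'(2)] x y by metis
 qed
 show "continuous_on \<Lambda> (D x)" by (rule continuous_bump_D)
qed (simp_all add: D_def compact_\<Lambda> ne_\<Lambda> sum_nonneg)

lemma D_le_chart:
 assumes c: "c : \<A>" "x : chart_dom c"
 obtains K N where "K > 0" "open N" "x : N" "N \<subseteq> chart_dom c"
  "!!y z. y : N ==> z : N ==> D y z <= K * norm (chart_map c y - chart_map c z)"
proof -
 have "ALL b:B. EX K N. K > 0 & open N & x : N & N \<subseteq> chart_dom c &
  (ALL y:N. ALL z:N. norm (chart_bump b y - chart_bump b z) <= K * norm (chart_map c y - chart_map c z))"
 proof
  fix b assume "b : B"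
  show "EX K N. K > 0 & open N & x : N & N \<subseteq> chart_dom c &
   (ALL y:N. ALL z:N. norm (chart_bump b y - chart_bump b z) <= K * norm (chart_map c y - chart_map c z))"
   by (rule chart_bump_local[OF B[OF \<open>b : B\<close>] c]) blast
 qed
 then obtain K N where KN: "!!b. b : B ==> K b > 0 & open (N b) & x : N b & N b \<subseteq> chart_dom c &
  (ALL y:N b. ALL z:N b. norm (chart_bump b y - chart_bump b z) <= K b * norm (chart_map c y - chart_map c z))"
  by metis
 define K' where "K' = 1 + (\<Sum>b\<in>B. K b)"
 define N' where "N' = chart_dom c \<inter> (\<Inter>b\<in>B. N b)"
 show ?thesis
 proof (rule that[of K' N'])
  show "K' > 0" unfolding K'_def using KN by (intro add_pos_nonneg sum_nonneg) (auto simp: less_imp_le)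
  show "open N'" unfolding N'_def using KN finite_B c open_chart_dom by (intro open_Int open_INT) auto
  show "x : N'" "N' \<subseteq> chart_dom c" using KN c by (auto simp: N'_def)
  fix y z assume yz: "y : N'" "z : N'"
  have "D y z <= (\<Sum>b\<in>B. K b * norm (chart_map c y - chart_map c z))"
   unfolding D_def using KN yz by (intro sum_mono) (auto simp: N'_def)
  also have "\<dots> = (\<Sum>b\<in>B. K b) * norm (chart_map c y - chart_map c z)" by (simp add: sum_distrib_right)
  also have "\<dots> <= K' * norm (chart_map c y - chart_map c z)" by (intro mult_right_mono) (auto simp: K'_def)
  finally show "D y z <= K' * norm (chart_map c y - chart_map c z)" .
 qed
qed

lemma chart_le_D:
 assumes x: "x : \<Lambda>" and c: "c : \<A>" "x : chart_dom c"
 obtains K N where "K > 0" "open N" "x : N" "N \<subseteq> chart_dom c"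
  "!!y z. y : N ==> z : N ==> norm (chart_map c y - chart_map c z) <= K * D y z"
proof -
 obtain b where b: "b : B" "x : bump_core b" using x cover by auto
 obtain c' p r k where b': "b = (c', p, r)" "c' : \<A>" "r > 0" "cball p r \<subseteq> chart_map c' ` chart_dom c'" "k > 0"
  "!!q v. q : cball p r ==> norm v <= k * tangent_norm G c' (chart_inv c' q) v"
  by (rule bump_tripleE[OF B[OF b(1)]]) (rule that)
 have xc': "x : chart_dom c'" using b by (simp add: bump_core_def b'(1))
 obtain K N where K: "K > 0" "open N" "x : N" "N \<subseteq> chart_dom c'" "N \<subseteq> chart_dom c"
  "!!y z. y : N ==> z : N ==> norm (chart_map c y - chart_map c z) <= K * norm (chart_map c' y - chart_map c' z)"
  by (rule transition_lipschitz[OF b'(2) c(1) xc' c(2)]) (rule that)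
 show ?thesis
 proof (rule that[of K "N \<inter> bump_core b"])
  show "open (N \<inter> bump_core b)" using K open_bump_core[OF B[OF b(1)]] by auto
  fix y z assume yz: "y : N \<inter> bump_core b" "z : N \<inter> bump_core b"
  have "chart_bump b w = (1, chart_map c' w - p)" if "w : bump_core b" for w
   using that bump_near[OF b'(3), of "chart_map c' w" p]
   by (auto simp: chart_bump_def bump_core_def b'(1) dist_norm norm_minus_commute)
  hence "norm (chart_map c' y - chart_map c' z) = norm (chart_bump b y - chart_bump b z)" using yz by (simp add: norm_Pair)
  also have "\<dots> <= D y z" by (rule norm_le_D[OF b(1)])
  finally have "K * norm (chart_map c' y - chart_map c' z) <= K * D y z" using K by simp
  thus "norm (chart_map c y - chart_map c z) <= K * D y z" using K(6)[of y z] yz by simp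
 qed (use K b in auto)
qed

text \<open>One constant for both comparisons, of D with coordinates and of tangent vectors with
  theirs, so that compactness yields one K for all of \<Lambda>.\<close>

definition chart_comparable :: "real => ('m, 'e) chart => 'm set => bool" where
 "chart_comparable K c N \<longleftrightarrow> c : \<A> & open N & N \<subseteq> chart_dom c &
  (ALL y:N. ALL z:N. D y z <= K * norm (chart_map c y - chart_map c z) & norm (chart_map c y - chart_map c z) <= K * D y z) &
  (ALL y:N. ALL v. tangent_norm G c y v <= K * norm v & norm v <= K * tangent_norm G c y v)"

lemma tangent_norm_nonneg:
 assumes "c : \<A>" "x : chart_dom c" shows "tangent_norm G c x v >= 0"
proof (rule metric_bounds[OF assms])
 fix k r assume k: "k > 0" "r > 0"
  "!!q v. q : cball (chart_map c x) r ==> norm v <= k * tangent_norm G c (chart_inv c q) v"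
 have "norm v <= k * tangent_norm G c x v" using k(3)[of "chart_map c x" v] k(2) chart_inv_map[OF assms] by simp
 hence "0 <= k * tangent_norm G c x v" using norm_ge_zero[of v] by linarith
 thus ?thesis using k(1) by (simp add: zero_le_mult_iff)
qed

lemma chart_comparable_mono:
 assumes N: "chart_comparable K c N" and K: "K <= K'" shows "chart_comparable K' c N"
 unfolding chart_comparable_def
proof (intro conjI ballI allI)
 show "c : \<A>" "open N" "N \<subseteq> chart_dom c" using N by (auto simp: chart_comparable_def)
 have mono: "a <= K' * u" if "a <= K * u" "u >= 0" for a u using that K by (meson mult_right_mono order_trans)
 fix y z assume yz: "y : N" "z : N"
 show "D y z <= K' * norm (chart_map c y - chart_map c z)" "norm (chart_map c y - chart_map c z) <= K' * D y z"
  using N yz unfolding chart_comparable_def by (auto intro!: mono)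
next
 have mono: "a <= K' * u" if "a <= K * u" "u >= 0" for a u using that K by (meson mult_right_mono order_trans)
 fix y v assume y: "y : N"
 show "tangent_norm G c y v <= K' * norm v" using N y unfolding chart_comparable_def by (auto intro!: mono)
 have "c : \<A>" "y : chart_dom c" using N y by (auto simp: chart_comparable_def)
 thus "norm v <= K' * tangent_norm G c y v"
  using N y unfolding chart_comparable_def by (intro mono tangent_norm_nonneg) auto
qed

lemma chart_comparable_exists:
 assumes x: "x : \<Lambda>" shows "EX K c N. chart_comparable K c N & x : N"
proof -
 obtain c where c: "c : \<A>" "x : chart_dom c" by (rule chartE)
 obtain K1 N1 where 1: "K1 > 0" "open N1" "x : N1" "N1 \<subseteq> chart_dom c"
  "!!y z. y : N1 ==> z : N1 ==> D y z <= K1 * norm (chart_map c y - chart_map c z)"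
  by (rule D_le_chart[OF c]) (rule that)
 obtain K2 N2 where 2: "K2 > 0" "open N2" "x : N2" "N2 \<subseteq> chart_dom c"
  "!!y z. y : N2 ==> z : N2 ==> norm (chart_map c y - chart_map c z) <= K2 * D y z"
  by (rule chart_le_D[OF x c]) (rule that)
 obtain k r where k: "k > 0" "r > 0" "cball (chart_map c x) r \<subseteq> chart_map c ` chart_dom c"
  "!!q v. q : cball (chart_map c x) r ==> tangent_norm G c (chart_inv c q) v <= k * norm v"
  "!!q v. q : cball (chart_map c x) r ==> norm v <= k * tangent_norm G c (chart_inv c q) v"
  by (rule metric_bounds[OF c]) (rule that)
 define N where "N = N1 \<inter> N2 \<inter> (chart_dom c \<inter> chart_map c -` ball (chart_map c x) r)"
 define K where "K = max (max K1 K2) k"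
 have mono: "a <= K * u" if "a <= K0 * u" "u >= 0" "K0 <= K" for a u K0
  using that by (meson mult_right_mono order_trans)
 have "chart_comparable K c N" unfolding chart_comparable_def
 proof (intro conjI ballI allI)
  show "open N" using 1 2 open_chart_preimage[OF c(1)] by (simp add: N_def open_Int)
  fix y z assume "y : N" "z : N"
  hence yz: "y : N1" "z : N1" "y : N2" "z : N2" by (auto simp: N_def)
  show "D y z <= K * norm (chart_map c y - chart_map c z)" by (rule mono[OF 1(5)[OF yz(1,2)]]) (auto simp: K_def)
  show "norm (chart_map c y - chart_map c z) <= K * D y z" by (rule mono[OF 2(5)[OF yz(3,4)]]) (auto simp: K_def)
 next
  fix y v assume "y : N"
  hence y: "y : chart_dom c" "chart_map c y : cball (chart_map c x) r" by (auto simp: N_def)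
  show "tangent_norm G c y v <= K * norm v"
   using k(4)[OF y(2), of v] chart_inv_map[OF c(1) y(1)] by (intro mono[of _ k]) (auto simp: K_def)
  show "norm v <= K * tangent_norm G c y v"
   using k(5)[OF y(2), of v] chart_inv_map[OF c(1) y(1)] tangent_norm_nonneg[OF c(1) y(1)]
   by (intro mono[of _ k]) (auto simp: K_def)
 qed (use c in \<open>auto simp: N_def\<close>)
 moreover have "x : N" using 1 2 c k by (simp add: N_def)
 ultimately show ?thesis by blast
qed

lemma chart_comparable_uniform:
 obtains K where "K > 0" "!!x. x : \<Lambda> ==> EX c N. chart_comparable K c N & x : N"
proof -
 have "EX K c N. x : \<Lambda> --> chart_comparable K c N & x : N" for x using chart_comparable_exists by blast
 then obtain K c N where KN: "!!x. x : \<Lambda> ==> chart_comparable (K x) (c x) (N x) & x : N x" by metis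
 have "\<Lambda> \<subseteq> (\<Union>x\<in>\<Lambda>. N x)" using KN by blast
 moreover have "open (N x)" if "x : \<Lambda>" for x using KN[OF that] by (simp add: chart_comparable_def)
 ultimately obtain F where F: "F \<subseteq> \<Lambda>" "finite F" "\<Lambda> \<subseteq> (\<Union>x\<in>F. N x)"
  using compactE_image[OF compact_\<Lambda>, of \<Lambda> N] by metis
 define K' where "K' = Max (insert 1 (K ` F))"
 have K': "1 <= K'" "!!x. x : F ==> K x <= K'" unfolding K'_def using F by (auto intro!: Max_ge)
 show ?thesis
 proof (rule that[of K'])
  fix x assume "x : \<Lambda>"
  then obtain y where y: "y : F" "x : N y" using F(3) by blast
  have "chart_comparable (K y) (c y) (N y)" using KN[of y] F(1) y(1) by blast
  hence "chart_comparable K' (c y) (N y)" by (rule chart_comparable_mono) (rule K'(2)[OF y(1)])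
  thus "EX c N. chart_comparable K' c N & x : N" using y(2) by (intro exI conjI)
 qed (use K' in simp)
qed

end

section \<open>Repellers\<close>

locale repeller = bump_cover \<A> G \<Lambda> B
 for \<A> :: "('m::{t2_space, second_countable_topology}, 'e::euclidean_space) chart set" and G \<Lambda> B +
 fixes f :: "'m => 'm"
 assumes C1: "C1_map \<A> f" and repeller: "isolated_repeller \<A> G f \<Lambda>"
begin

lemma continuous_funpow: "continuous_on UNIV (f ^^ n)" and smooth_funpow: "strictly_smooth (f ^^ n)"
proof -
 show "strictly_smooth (f ^^ n)" by (rule strictly_smooth_funpow[OF C1_map_strictly_smooth[OF C1]])
 thus "continuous_on UNIV (f ^^ n)" by (simp add: strictly_smooth_def)
qed

lemma f_image: "f ` \<Lambda> = \<Lambda>" using repeller by (simp add: isolated_repeller_def)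

lemma funpow_mem: "x : \<Lambda> ==> (f ^^ n) x : \<Lambda>"
 using f_image by (induction n) auto

lemma tangent_map_expands:
 obtains C L where "C > 0" "L > 1" "!!x n c c' v. x : \<Lambda> ==> n >= 1 ==> c : \<A> ==> c' : \<A> ==> x : chart_dom c ==>
  (f ^^ n) x : chart_dom c' ==>
  C * L ^ n * tangent_norm G c x v <= tangent_norm G c' ((f ^^ n) x) (tangent_map c c' (f ^^ n) x v)"
proof -
 have "EX C>0. EX L>1. ALL x:\<Lambda>. ALL n>=1. ALL c:\<A>. ALL c':\<A>.
    x : chart_dom c & (f ^^ n) x : chart_dom c' -->
    (ALL v. tangent_norm G c' ((f ^^ n) x) (tangent_map c c' (f ^^ n) x v) >= C * L ^ n * tangent_norm G c x v)"
  using repeller unfolding isolated_repeller_def by (elim conjE)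
 then obtain C L where C: "C > 0" and L: "L > 1" and *: "ALL x:\<Lambda>. ALL n>=1. ALL c:\<A>. ALL c':\<A>.
    x : chart_dom c & (f ^^ n) x : chart_dom c' -->
    (ALL v. tangent_norm G c' ((f ^^ n) x) (tangent_map c c' (f ^^ n) x v) >= C * L ^ n * tangent_norm G c x v)"
  by (elim exE conjE) (rule that)
 show ?thesis by (rule that[OF C L]) (simp add: *)
qed

text \<open>The infinitesimal expansion of a high iterate outweighs the distortion between D,
  coordinates and the Riemannian norm; strict differentiability turns it into expansion of small
  distances.\<close>

lemma expands_eventually:
 obtains p r0 where "p >= 1" "r0 > 0"
  "!!y z. y : \<Lambda> ==> z : \<Lambda> ==> D y z <= r0 ==> 2 * D y z <= D ((f ^^ p) y) ((f ^^ p) z)"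
proof -
 obtain C L where C: "C > 0" "L > 1" and exp: "!!x n c c' v. x : \<Lambda> ==> n >= 1 ==> c : \<A> ==> c' : \<A> ==>
  x : chart_dom c ==> (f ^^ n) x : chart_dom c' ==>
  C * L ^ n * tangent_norm G c x v <= tangent_norm G c' ((f ^^ n) x) (tangent_map c c' (f ^^ n) x v)"
  by (rule tangent_map_expands) (rule that)
 obtain K where K: "K > 0" "!!x. x : \<Lambda> ==> EX c N. chart_comparable K c N & x : N"
  by (rule chart_comparable_uniform) (rule that)
 \<comment> \<open>K enters twice for vectors and twice for distances; one factor 2 is lost in the
   passage from derivative to differences and one is the desired doubling.\<close>
 obtain m where m: "4 * K ^ 4 / C < L ^ m" using real_arch_pow[OF C(2)] by blast
 define n where "n = Suc m"
 have "C * L ^ m <= C * L ^ n" unfolding n_def using C by (intro mult_left_mono power_increasing) auto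
 moreover have "4 * K ^ 4 < C * L ^ m" using m C(1) by (simp add: field_simps)
 ultimately have n: "4 * K ^ 4 <= C * L ^ n" "n >= 1" by (auto simp: n_def)
 define a where "a = C * L ^ n / K ^ 2"
 have a: "a > 0" using C K by (simp add: a_def)
 show ?thesis
 proof (rule lebesgue_number[of "%y z. 2 * D y z <= D ((f ^^ n) y) ((f ^^ n) z)"])
  fix x assume x: "x : \<Lambda>"
  obtain c N where N: "chart_comparable K c N" "x : N" using K(2)[OF x] by blast
  obtain c' N' where N': "chart_comparable K c' N'" "(f ^^ n) x : N'" using K(2)[OF funpow_mem[OF x]] by blast
  have c: "c : \<A>" "open N" "N \<subseteq> chart_dom c"
    "!!y z. y : N ==> z : N ==> D y z <= K * norm (chart_map c y - chart_map c z)"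
    "!!y v. y : N ==> norm v <= K * tangent_norm G c y v"
   using N(1) unfolding chart_comparable_def by blast+
  have c': "c' : \<A>" "open N'" "N' \<subseteq> chart_dom c'"
    "!!y z. y : N' ==> z : N' ==> norm (chart_map c' y - chart_map c' z) <= K * D y z"
    "!!y v. y : N' ==> tangent_norm G c' y v <= K * norm v"
   using N'(1) unfolding chart_comparable_def by blast+
  have xc: "x : chart_dom c" "(f ^^ n) x : chart_dom c'" using N N' c c' by auto
  define T where "T = tangent_map c c' (f ^^ n) x"
  have T: "strict_deriv (local_rep c c' (f ^^ n)) T (chart_map c x)"
   unfolding T_def by (rule strictly_smooth_tangent_map[OF smooth_funpow c(1) c'(1) xc])
  have le: "a * norm v <= norm (T v)" for v
  proof -
   have "C * L ^ n * norm v <= C * L ^ n * (K * tangent_norm G c x v)"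
    using c(5)[OF N(2)] C by (intro mult_left_mono) auto
   also have "\<dots> = K * (C * L ^ n * tangent_norm G c x v)" by simp
   also have "\<dots> <= K * tangent_norm G c' ((f ^^ n) x) (T v)"
    unfolding T_def using K by (intro mult_left_mono exp x n(2) c(1) c'(1) xc) auto
   also have "\<dots> <= K * (K * norm (T v))" using c'(5)[OF N'(2)] K by (intro mult_left_mono) auto
   finally show ?thesis using K by (simp add: a_def field_simps power2_eq_square)
  qed
  obtain r where r: "r > 0" "!!y z. y : ball (chart_map c x) r ==> z : ball (chart_map c x) r ==>
    a / 2 * norm (y - z) <= norm (local_rep c c' (f ^^ n) y - local_rep c c' (f ^^ n) z)"
   by (rule strict_deriv_expands[OF T a le]) (rule that)
  define U where "U = N \<inter> (chart_dom c \<inter> chart_map c -` ball (chart_map c x) r) \<inter> (f ^^ n) -` N'"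
  show "EX U. open U & x : U & (ALL y:U \<inter> \<Lambda>. ALL z:U \<inter> \<Lambda>. 2 * D y z <= D ((f ^^ n) y) ((f ^^ n) z))"
  proof (intro exI[of _ U] conjI ballI)
   show "open U" unfolding U_def
    by (intro open_Int open_vimage[OF c'(2) continuous_funpow] c(2) open_chart_preimage[OF c(1) open_ball])
   show "x : U" using N N' xc r by (simp add: U_def)
   fix y z assume "y : U \<inter> \<Lambda>" "z : U \<inter> \<Lambda>"
   hence y: "y : N" "y : chart_dom c" "chart_map c y : ball (chart_map c x) r" "(f ^^ n) y : N'"
    and z: "z : N" "z : chart_dom c" "chart_map c z : ball (chart_map c x) r" "(f ^^ n) z : N'"
    by (auto simp: U_def)
   have "a / 2 * norm (chart_map c y - chart_map c z)
     <= norm (chart_map c' ((f ^^ n) y) - chart_map c' ((f ^^ n) z))"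
    using r(2)[OF y(3) z(3)] chart_inv_map[OF c(1)] y z by (simp add: local_rep_def)
   also have "\<dots> <= K * D ((f ^^ n) y) ((f ^^ n) z)" by (rule c'(4)[OF y(4) z(4)])
   finally have "norm (chart_map c y - chart_map c z) <= 2 * K / a * D ((f ^^ n) y) ((f ^^ n) z)"
    using a by (simp add: field_simps)
   hence "K * norm (chart_map c y - chart_map c z) <= K * (2 * K / a * D ((f ^^ n) y) ((f ^^ n) z))"
    using K by (intro mult_left_mono) auto
   hence "D y z <= K * (2 * K / a * D ((f ^^ n) y) ((f ^^ n) z))" using c(4)[OF y(1) z(1)] by linarith
   also have "\<dots> = (2 * K ^ 4 / (C * L ^ n)) * D ((f ^^ n) y) ((f ^^ n) z)"
    using K by (simp add: a_def power2_eq_square power4_eq_xxxx)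
   also have "\<dots> <= (1 / 2) * D ((f ^^ n) y) ((f ^^ n) z)"
    using n(1) C by (intro mult_right_mono) (auto simp: field_simps)
   finally show "2 * D y z <= D ((f ^^ n) y) ((f ^^ n) z)" by simp
  qed
 next
  fix r assume "r > 0" "!!y z. y : \<Lambda> ==> z : \<Lambda> ==> D y z <= r ==> 2 * D y z <= D ((f ^^ n) y) ((f ^^ n) z)"
  thus thesis by (rule that[OF n(2)])
 qed
qed

text \<open>Expansion makes the derivative injective, and equality of dimensions makes it
  invertible. With differentiability at the single point and continuity nearby, the image contains a
  neighbourhood.\<close>

lemma f_open_at:
 assumes x: "x : \<Lambda>" and N: "open N" "x : N"
 obtains W where "open W" "f x : W" "W \<subseteq> f ` N"
proof -
 obtain C L where C: "C > 0" "L > 1" and exp: "!!x n c c' v. x : \<Lambda> ==> n >= 1 ==> c : \<A> ==> c' : \<A> ==>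
  x : chart_dom c ==> (f ^^ n) x : chart_dom c' ==>
  C * L ^ n * tangent_norm G c x v <= tangent_norm G c' ((f ^^ n) x) (tangent_map c c' (f ^^ n) x v)"
  by (rule tangent_map_expands) (rule that)
 obtain c where c: "c : \<A>" "x : chart_dom c" by (rule chartE)
 obtain c' where c': "c' : \<A>" "f x : chart_dom c'" by (rule chartE)
 have contf: "continuous_on UNIV f" using continuous_funpow[of 1] by simp
 define F where "F = local_rep c c' f"
 define T where "T = tangent_map c c' f x"
 have "strict_deriv F T (chart_map c x)"
  unfolding F_def T_def by (rule strictly_smooth_tangent_map[OF C1_map_strictly_smooth[OF C1] c(1) c'(1) c(2) c'(2)])
 hence FT: "(F has_derivative T) (at (chart_map c x))" by (rule strict_deriv_has_derivative)
 hence lin: "linear T" by (rule has_derivative_linear)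
 have "v = 0" if v: "T v = 0" for v
 proof (rule ccontr)
  assume "v ~= 0"
  hence "G c x v v > 0" using manifold c unfolding riemannian_manifold_def by blast
  hence pos: "tangent_norm G c x v > 0" by (simp add: tangent_norm_def)
  have "bilinear (G c' (f x))" using manifold c' unfolding riemannian_manifold_def by blast
  hence "tangent_norm G c' (f x) (T v) = 0" using v by (simp add: tangent_norm_def bilinear_lzero)
  hence "C * L * tangent_norm G c x v <= 0"
   using exp[OF x order_refl c(1) c'(1) c(2), of v] c'(2) by (simp add: T_def)
  moreover have "0 < C * L * tangent_norm G c x v" using pos C by (intro mult_pos_pos) auto
  ultimately show False by linarith
 qed
 hence "inj T" using linear_injective_0[OF lin] by blast
 then obtain T' where T': "linear T'" "!!v. T (T' v) = v" using linear_injective_isomorphism[OF lin] by blast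
 define S where "S = chart_map c ` (chart_dom c \<inter> (N \<inter> f -` chart_dom c'))"
 have S: "open S" unfolding S_def
  using c c' N contf by (intro open_chart_image open_Int open_chart_dom open_vimage) auto
 have S_mem: "q : chart_map c ` chart_dom c" "chart_inv c q : N" "f (chart_inv c q) : chart_dom c'" if "q : S" for q
  using that c(1) by (auto simp: S_def)
 have xS: "chart_map c x : S" using c N c' by (simp add: S_def)
 have contF: "continuous_on S F"
  unfolding F_def local_rep_def
  by (intro continuous_on_compose continuous_on_subset[OF continuous_chart_inv[OF c(1)]]
    continuous_on_subset[OF contf] continuous_on_subset[OF continuous_chart_map[OF c'(1)]])
   (use S_mem in auto)
 have int: "F (chart_map c x) : interior (F ` S)"
 proof (rule sussmann_open_mapping[OF S contF xS FT])
  show "bounded_linear T'" using T'(1) by (simp add: linear_conv_bounded_linear)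
  show "T \<circ> T' = id" using T'(2) by auto
  show "chart_map c x : interior S" using xS S by (simp add: interior_open)
 qed simp
 show ?thesis
 proof (rule that[of "chart_dom c' \<inter> chart_map c' -` interior (F ` S)"])
  show "open (chart_dom c' \<inter> chart_map c' -` interior (F ` S))" by (rule open_chart_preimage[OF c'(1)]) simp
  show "f x : chart_dom c' \<inter> chart_map c' -` interior (F ` S)" using int c c' by (simp add: F_def local_rep_def)
  show "chart_dom c' \<inter> chart_map c' -` interior (F ` S) \<subseteq> f ` N"
  proof
   fix w assume w: "w : chart_dom c' \<inter> chart_map c' -` interior (F ` S)"
   hence "chart_map c' w : F ` S" using interior_subset by auto
   then obtain q where q: "q : S" "chart_map c' w = chart_map c' (f (chart_inv c q))"
    by (auto simp: F_def local_rep_def)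
   hence "w = f (chart_inv c q)" using chart_inv_map[OF c'(1)] w S_mem(3)[OF q(1)] by (metis IntD1)
   thus "w : f ` N" using S_mem(2)[OF q(1)] by blast
  qed
 qed
qed

text \<open>Local openness produces preimages in the manifold; isolation puts them into \<Lambda>
  when their images are in \<Lambda>. A finite cover makes the radius uniform.\<close>

lemma open_map_uniform:
 assumes e: "e > 0"
 shows "EX r>0. ALL x:\<Lambda>. ALL w:\<Lambda>. D w (f x) <= r --> (EX z:\<Lambda>. f z = w & D z x <= e)"
proof -
 obtain U where U: "open U" "\<Lambda> \<subseteq> U" "\<Lambda> = (\<Inter>n. (f ^^ n) -` U)"
  using repeller unfolding isolated_repeller_def by (elim conjE exE) (rule that)
 \<comment> \<open>The whole orbit of z lies in U: its first point by assumption and all later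
   points since f z is in \<Lambda>.\<close>
 have preimage: "z : \<Lambda>" if "z : U" "f z : \<Lambda>" for z
 proof -
  have "(f ^^ n) z : U" for n
  proof (cases n)
   case (Suc m) thus ?thesis using funpow_mem[OF that(2), of m] U(2) by (auto simp: funpow_swap1)
  qed (use that in simp)
  thus ?thesis by (subst U(3)) (simp only: INT_iff vimage_eq simp_thms UNIV_I ball_UNIV)
 qed
 have "EX s>0. ALL x:\<Lambda>. D x0 x < s --> (ALL w:\<Lambda>. D w (f x) < s --> (EX z:\<Lambda>. f z = w & D z x <= e))" if x0: "x0 : \<Lambda>" for x0
 proof -
  define N where "N = U \<inter> {z. D x0 z < e / 2}"
  have open_lt: "open {z. D y z < r}" for y r
   by (rule open_Collect_less[OF continuous_bump_D continuous_on_const])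
  have "open N" unfolding N_def by (rule open_Int[OF U(1) open_lt])
  moreover have "x0 : N" using x0 U(2) e by (simp add: N_def subset_iff)
  ultimately obtain W where W: "open W" "f x0 : W" "W \<subseteq> f ` N" using f_open_at[OF x0] by metis
  have fx0: "f x0 : \<Lambda>" using funpow_mem[OF x0, of 1] by simp
  obtain s where s: "s > 0" "!!y. y : \<Lambda> ==> D (f x0) y < s ==> y : W"
   by (rule D_openE[OF fx0 W(1,2)]) (rule that)
  have "continuous_on UNIV f" using continuous_funpow[of 1] by simp
  with open_lt have "open (f -` {z. D (f x0) z < s / 2})" by (rule open_vimage)
  moreover have "x0 : f -` {z. D (f x0) z < s / 2}" using s by simp
  ultimately obtain s' where s': "s' > 0" "!!y. y : \<Lambda> ==> D x0 y < s' ==> y : f -` {z. D (f x0) z < s / 2}"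
   by (rule D_openE[OF x0]) (rule that)
  define t where "t = min (min (s / 2) s') (e / 2)"
  show ?thesis
  proof (intro exI[of _ t] conjI ballI impI)
   show "t > 0" using s s' e by (simp add: t_def)
   fix x w assume x: "x : \<Lambda>" "D x0 x < t" and w: "w : \<Lambda>" "D w (f x) < t"
   have "D (f x0) (f x) < s / 2" using s'(2)[OF x(1)] x(2) by (simp add: t_def)
   moreover have "D (f x0) w <= D (f x0) (f x) + D w (f x)" using D_triangle[of "f x0" w "f x"] by (simp add: D_commute)
   ultimately have "w : W" using w by (intro s(2)) (auto simp: t_def)
   then obtain z where z: "z : N" "f z = w" using W by blast
   hence "z : \<Lambda>" using preimage w by (auto simp: N_def)
   moreover have "D z x <= e" using D_triangle[of z x x0] z x by (simp add: N_def t_def D_commute)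
   ultimately show "EX z:\<Lambda>. f z = w & D z x <= e" using z by blast
  qed
 qed
 then obtain s where s: "!!x0. x0 : \<Lambda> ==> s x0 > 0"
  "!!x0 x w. x0 : \<Lambda> ==> x : \<Lambda> ==> D x0 x < s x0 ==> w : \<Lambda> ==> D w (f x) < s x0 ==> EX z:\<Lambda>. f z = w & D z x <= e"
  by metis
 obtain F where F: "finite F" "F \<subseteq> \<Lambda>" "!!y. y : \<Lambda> ==> EX x:F. D x y < s x"
  by (rule finite_D_cover[OF s(1)]) (assumption, rule that)
 have Fne: "F ~= {}" using F(3) nonempty by blast
 define r where "r = Min (s ` F)"
 have r: "r > 0" "!!x. x : F ==> r <= s x" unfolding r_def using F Fne s(1) by (auto simp: Min_gr_iff)
 show ?thesis
 proof (intro exI[of _ "r / 2"] conjI ballI impI)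
  fix x w assume x: "x : \<Lambda>" and w: "w : \<Lambda>" "D w (f x) <= r / 2"
  obtain x0 where x0: "x0 : F" "D x0 x < s x0" using F(3)[OF x] by blast
  have "D w (f x) < s x0" using r(1) r(2)[OF x0(1)] w(2) by linarith
  thus "EX z:\<Lambda>. f z = w & D z x <= e" using s(2)[of x0 x w] x0 x w(1) F(2) by blast
 qed (use r in simp)
qed

lemma cdist_small:
 assumes e: "e > 0"
 obtains r where "r > 0" "!!y z. y : \<Lambda> ==> z : \<Lambda> ==> D y z <= r ==> cdist y z <= ennreal e"
proof (rule lebesgue_number[of "%y z. cdist y z <= ennreal e"])
 fix x assume x: "x : \<Lambda>"
 obtain c where c: "c : \<A>" "x : chart_dom c" by (rule chartE)
 obtain k N where N: "k > 0" "open N" "x : N" "N \<subseteq> chart_dom c"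
  "!!x y. x : N ==> y : N ==> cdist x y <= ennreal (k * norm (chart_map c x - chart_map c y))"
  by (rule cdist_le_chart[OF c]) (rule that)
 define U where "U = N \<inter> (chart_dom c \<inter> chart_map c -` ball (chart_map c x) (e / (2 * k)))"
 show "EX U. open U & x : U & (ALL y:U \<inter> \<Lambda>. ALL z:U \<inter> \<Lambda>. cdist y z <= ennreal e)"
 proof (intro exI[of _ U] conjI ballI)
  show "open U" unfolding U_def by (rule open_Int[OF N(2) open_chart_preimage[OF c(1) open_ball]])
  show "x : U" using N c e by (simp add: U_def)
  fix y z assume yz: "y : U \<inter> \<Lambda>" "z : U \<inter> \<Lambda>"
  have "norm (chart_map c y - chart_map c z) <= dist (chart_map c x) (chart_map c y) + dist (chart_map c x) (chart_map c z)"
   using dist_triangle3[of "chart_map c y" "chart_map c z" "chart_map c x"] by (simp add: dist_norm)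
  also have "\<dots> <= e / (2 * k) + e / (2 * k)" using yz by (intro add_mono) (auto simp: U_def)
  also have "\<dots> = e / k" using N(1) by (simp add: field_simps)
  finally have "k * norm (chart_map c y - chart_map c z) <= e" using N(1) by (simp add: field_simps)
  thus "cdist y z <= ennreal e" using N(5)[of y z] yz ennreal_leI order_trans by (simp add: U_def) blast
 qed
qed (rule that)

section \<open>Hoelder and Lipschitz functions for the Riemannian distance\<close>

lemma holder_continuous:
 assumes \<alpha>: "\<alpha> > 0" and g: "holder_on cdist \<alpha> \<Lambda> g"
 shows "continuous_on \<Lambda> g"
proof -
 obtain C where C: "C >= 0" "!!x y. x : \<Lambda> ==> y : \<Lambda> ==> cdist x y < \<infinity> ==> \<bar>g x - g y\<bar> <= C * enn2real (cdist x y) powr \<alpha>"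
  using g unfolding holder_on_def by blast
 have near: "EX r>0. ALL y:\<Lambda>. D x y < r --> \<bar>g x - g y\<bar> < e" if x: "x : \<Lambda>" and e: "e > 0" for x e
 proof -
  \<comment> \<open>Adding 1 covers C = 0 and makes the final inequality strict.\<close>
  define \<delta> where "\<delta> = (e / (C + 1)) powr (1 / \<alpha>)"
  have \<delta>: "\<delta> > 0" "\<delta> powr \<alpha> = e / (C + 1)" using e C(1) \<alpha> by (auto simp: \<delta>_def powr_powr)
  obtain r where r: "r > 0" "!!y z. y : \<Lambda> ==> z : \<Lambda> ==> D y z <= r ==> cdist y z <= ennreal \<delta>"
   by (rule cdist_small[OF \<delta>(1)]) (rule that)
  have "\<bar>g x - g y\<bar> < e" if y: "y : \<Lambda>" "D x y < r" for y
  proof -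
   have d: "cdist x y <= ennreal \<delta>" using r(2)[OF x y(1)] y(2) by simp
   hence "enn2real (cdist x y) <= \<delta>" using \<delta>(1) by (intro enn2real_leI) auto
   hence "enn2real (cdist x y) powr \<alpha> <= \<delta> powr \<alpha>" using \<alpha> by (intro powr_mono2) auto
   hence "C * enn2real (cdist x y) powr \<alpha> <= C * (e / (C + 1))" unfolding \<delta>(2)[symmetric] using C(1) by (intro mult_left_mono)
   moreover have "cdist x y < \<infinity>" using d by (rule order_le_less_trans) simp
   moreover have "C * (e / (C + 1)) < e" using e C(1) by (simp add: field_simps)
   ultimately show ?thesis using C(2)[OF x y(1)] by linarith
  qed
  thus ?thesis using r(1) by blast
 qed
 show ?thesis unfolding continuous_on_topological
 proof (intro ballI allI impI)
  fix x V assume x: "x : \<Lambda>" and V: "open V" "g x : V"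
  obtain e where e: "e > 0" "!!y. dist y (g x) < e ==> y : V" using V unfolding open_dist by blast
  obtain r where r: "r > 0" "!!y. y : \<Lambda> ==> D x y < r ==> \<bar>g x - g y\<bar> < e" using near[OF x e(1)] by blast
  obtain U where U: "open U" "!!y. y : \<Lambda> ==> y : U \<longleftrightarrow> D x y < r" by (rule open_D_ball[OF x]) (rule that)
  show "EX A. open A & x : A & (ALL y:\<Lambda>. y : A --> g y : V)"
   using U r x e(2) by (intro exI[of _ U]) (auto simp: dist_real_def abs_minus_commute)
 qed
qed

text \<open>Lipschitz rather than Hoelder functions, because they form the algebra for
  Stone-Weierstrass most directly. The bound concerns pairs at finite distance only, as in
  \<open>holder_on\<close>.\<close>

definition lipschitz_functions :: "('m => real) set" where
 "lipschitz_functions = {g. continuous_on \<Lambda> g &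
  (EX K>=0. ALL x:\<Lambda>. ALL y:\<Lambda>. cdist x y < \<infinity> --> \<bar>g x - g y\<bar> <= K * enn2real (cdist x y))}"

sublocale lip: function_ring_on lipschitz_functions \<Lambda>
proof
 show "compact \<Lambda>" by (rule compact_\<Lambda>)
 show "continuous_on \<Lambda> g" if "g : lipschitz_functions" for g using that by (simp add: lipschitz_functions_def)
 show "(%_. c) : lipschitz_functions" for c by (auto simp: lipschitz_functions_def)
 fix g h assume "g : lipschitz_functions" "h : lipschitz_functions"
 then obtain K L where cont: "continuous_on \<Lambda> g" "continuous_on \<Lambda> h" and "K >= 0" "L >= 0"
  and K: "!!x y. x : \<Lambda> ==> y : \<Lambda> ==> cdist x y < \<infinity> ==> \<bar>g x - g y\<bar> <= K * enn2real (cdist x y)"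
  and L: "!!x y. x : \<Lambda> ==> y : \<Lambda> ==> cdist x y < \<infinity> ==> \<bar>h x - h y\<bar> <= L * enn2real (cdist x y)"
  unfolding lipschitz_functions_def by blast
 show "(%x. g x + h x) : lipschitz_functions" unfolding lipschitz_functions_def
 proof (intro CollectI conjI exI[of _ "K + L"] ballI impI continuous_on_add cont)
  fix x y assume "x : \<Lambda>" "y : \<Lambda>" "cdist x y < \<infinity>"
  thus "\<bar>g x + h x - (g y + h y)\<bar> <= (K + L) * enn2real (cdist x y)"
   using K[of x y] L[of x y] by (simp add: distrib_right)
 qed (use \<open>K >= 0\<close> \<open>L >= 0\<close> in simp)
 obtain a where a: "a >= 0" "!!x. x : \<Lambda> ==> \<bar>g x\<bar> <= a" using continuous_boundedE[OF cont(1)] by blast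
 obtain b where b: "b >= 0" "!!x. x : \<Lambda> ==> \<bar>h x\<bar> <= b" using continuous_boundedE[OF cont(2)] by blast
 show "(%x. g x * h x) : lipschitz_functions" unfolding lipschitz_functions_def
 proof (intro CollectI conjI exI[of _ "a * L + b * K"] ballI impI continuous_on_mult cont)
  fix x y assume xy: "x : \<Lambda>" "y : \<Lambda>" "cdist x y < \<infinity>"
  have "g x * h x - g y * h y = g x * (h x - h y) + h y * (g x - g y)" by (simp add: algebra_simps)
  hence "\<bar>g x * h x - g y * h y\<bar> <= \<bar>g x\<bar> * \<bar>h x - h y\<bar> + \<bar>h y\<bar> * \<bar>g x - g y\<bar>"
   using abs_triangle_ineq[of "g x * (h x - h y)" "h y * (g x - g y)"] by (simp add: abs_mult)
  also have "\<dots> <= a * (L * enn2real (cdist x y)) + b * (K * enn2real (cdist x y))"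
   using xy a b K L by (intro add_mono mult_mono) auto
  finally show "\<bar>g x * h x - g y * h y\<bar> <= (a * L + b * K) * enn2real (cdist x y)" by (simp add: algebra_simps)
 qed (use a b \<open>K >= 0\<close> \<open>L >= 0\<close> in simp)
next
 fix x y assume xy: "x : \<Lambda>" "y : \<Lambda>" "x ~= y"
 hence ne: "D x y ~= 0" using D_eq_0 by blast
 \<comment> \<open>Separation comes from the bumps, so points in different components need no
   separate treatment.\<close>
 have "EX b:B. chart_bump b x ~= chart_bump b y"
 proof (rule ccontr)
  assume "\<not> ?thesis"
  hence "D x y = 0" by (simp add: D_def)
  thus False using ne by contradiction
 qed
 then obtain b where b: "b : B" "chart_bump b x ~= chart_bump b y" by blast
 then obtain i where i: "i : Basis" "chart_bump b x \<bullet> i ~= chart_bump b y \<bullet> i"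
  unfolding euclidean_eq_iff[of "chart_bump b x"] by blast
 define g where "g z = chart_bump b z \<bullet> i" for z
 obtain K where K: "K > 0" "!!x y. cdist x y < \<infinity> ==> norm (chart_bump b x - chart_bump b y) <= K * enn2real (cdist x y)"
  by (rule chart_bump_lipschitz[OF B[OF b(1)]]) (rule that)
 have "g : lipschitz_functions" unfolding lipschitz_functions_def
 proof (intro CollectI conjI exI[of _ K] ballI impI)
  show "continuous_on \<Lambda> g" unfolding g_def
   by (intro continuous_on_inner continuous_on_const continuous_on_subset[OF continuous_chart_bump[OF B[OF b(1)]]]) simp
  fix y z assume "cdist y z < \<infinity>"
  moreover have "\<bar>g y - g z\<bar> <= norm (chart_bump b y - chart_bump b z)"
   unfolding g_def inner_diff_left[symmetric] by (rule Basis_le_norm[OF i(1)])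
  ultimately show "\<bar>g y - g z\<bar> <= K * enn2real (cdist y z)" using K(2)[of y z] by linarith
 qed (use K in simp)
 thus "EX f:lipschitz_functions. f x ~= f y" using i(2) by (intro bexI[of _ g]) (simp_all add: g_def)
qed

lemma holder_dense:
 assumes \<alpha>: "\<alpha> > 0" "\<alpha> < 1" and g: "continuous_on \<Lambda> g" and e: "e > 0"
 shows "EX h. holder_on cdist \<alpha> \<Lambda> h & (ALL x:\<Lambda>. \<bar>g x - h x\<bar> < e)"
proof -
 obtain h where h: "h : lipschitz_functions" "!!x. x : \<Lambda> ==> \<bar>g x - h x\<bar> < e"
  using lip.Stone_Weierstrass_basic[OF g e] by blast
 obtain K where cont: "continuous_on \<Lambda> h" and K: "K >= 0"
   "!!x y. x : \<Lambda> ==> y : \<Lambda> ==> cdist x y < \<infinity> ==> \<bar>h x - h y\<bar> <= K * enn2real (cdist x y)"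
  using h(1) unfolding lipschitz_functions_def by blast
 obtain b where b: "b >= 0" "!!x. x : \<Lambda> ==> \<bar>h x\<bar> <= b" using continuous_boundedE[OF cont] by blast
 have "holder_on cdist \<alpha> \<Lambda> h" unfolding holder_on_def
 proof (intro exI[of _ "K + 2 * b"] conjI ballI impI)
  show "0 <= K + 2 * b" using K b by simp
  fix x y assume xy: "x : \<Lambda>" "y : \<Lambda>" "cdist x y < \<infinity>"
  define t where "t = enn2real (cdist x y)"
  have t: "t >= 0" by (simp add: t_def)
  show "\<bar>h x - h y\<bar> <= (K + 2 * b) * enn2real (cdist x y) powr \<alpha>"
  \<comment> \<open>At distances up to 1 the Lipschitz bound is stronger than the Hoelder bound;
    beyond 1 the bound 2 b on the oscillation suffices.\<close>
  proof (cases "t <= 1")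
   case True
   have "t <= t powr \<alpha>" using powr_mono'[of \<alpha> 1 t] t True \<alpha> by simp
   hence "K * t <= (K + 2 * b) * t powr \<alpha>" using K(1) b(1) t by (intro mult_mono) auto
   thus ?thesis using K(2)[OF xy] by (simp add: t_def)
  next
   case False
   have "1 <= t powr \<alpha>" using False \<alpha> by (intro ge_one_powr_ge_zero) auto
   hence "2 * b * 1 <= (K + 2 * b) * t powr \<alpha>" using K(1) b(1) by (intro mult_mono) auto
   thus ?thesis using b(2)[OF xy(1)] b(2)[OF xy(2)] by (simp add: t_def)
  qed
 qed
 thus ?thesis using h(2) by blast
qed

end

section \<open>Assembly: from the repeller to the Legendre transform\<close>

theorem theorem1:
  fixes \<A> :: "('m::{t2_space, second_countable_topology}, 'e::euclidean_space) chart set"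
    and G :: "('m, 'e) metric_field"
    and f :: "'m \<Rightarrow> 'm" and \<Lambda> :: "'m set"
    and \<Phi> \<Psi> :: "nat \<Rightarrow> 'm \<Rightarrow> real"
    and \<alpha> :: real
    and d :: "'m \<Rightarrow> 'm \<Rightarrow> ennreal" and \<mu> :: "'m measure"
    and E I :: "real \<Rightarrow> real" and J :: "real set"
  assumes "riemannian_manifold \<A> G"
    and "C1_map \<A> f"
    and "isolated_repeller \<A> G f \<Lambda>"
    and "topologically_mixing_on \<Lambda> f"
    and "\<alpha> \<in> {0<..<1}"
    and "d = riemannian_dist \<A> G"
    and "continuous_potentials \<Lambda> \<Phi>" "almost_additive \<Lambda> f \<Phi>" "bounded_distortion d \<Lambda> f \<Phi>"
    and "continuous_potentials \<Lambda> \<Psi>" "almost_additive \<Lambda> f \<Psi>" "bounded_distortion d \<Lambda> f \<Psi>"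
    and "\<not> seq_cohomologous_to_const d \<alpha> \<Lambda> f \<Psi>"
    and "\<mu> = equilibrium_state \<Lambda> f \<Phi>"
    and "E = free_energy \<Lambda> f \<Phi> \<Psi>"
    and "J = rate_domain \<Lambda> f \<Phi> \<Psi>"
    and "I = legendre d \<alpha> \<Lambda> f \<Phi> \<Psi>"
  shows
    \<comment> \<open>(i)\<close>
    "(\<forall>t. deriv E t \<in> J \<and> I (deriv E t) = t * deriv E t - E t) \<and>
    \<comment> \<open>(ii)\<close>
     (\<forall>s\<in>J. 0 \<le> I s) \<and> convex_on J I \<and>
     (\<forall>a\<in>J. \<forall>b\<in>J. a < b \<and> mean_potential \<Psi> \<mu> \<notin> {a<..<b} \<longrightarrow>
        (INF s\<in>{a<..<b}. I s) = min (I a) (I b)) \<and>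
    \<comment> \<open>(iii)\<close>
     (\<forall>s\<in>J. ereal (I s) =
        (INF \<eta> \<in> {\<eta> \<in> invariant_measures \<Lambda> f. mean_potential \<Psi> \<eta> = s}.
           top_pressure \<Lambda> f \<Phi> - metric_entropy f \<eta> - ereal (mean_potential \<Phi> \<eta>))) \<and>
    \<comment> \<open>(iv)\<close>
     (\<forall>s\<in>J. I s = 0 \<longleftrightarrow> s = mean_potential \<Psi> \<mu>) \<and>
     (\<exists>V. open V \<and> mean_potential \<Psi> \<mu> \<in> V \<and> V \<subseteq> J \<and> strictly_convex_on V I)"
proof -
 \<comment> \<open>Finitely many bump cores cover \<Lambda>; they define D and place f in the
   abstract setting.\<close>
 interpret riemannian \<A> G by unfold_locales (rule assms(1))
 have comp: "compact \<Lambda>" "\<Lambda> ~= {}" using assms(3) by (simp_all add: isolated_repeller_def)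
 have "EX b. bump_triple b & x : bump_core b" for x by (rule bump_triple_exists[of x]) blast
 then obtain bt where bt: "!!x. bump_triple (bt x)" "!!x. x : bump_core (bt x)" by metis
 obtain F where F: "F \<subseteq> \<Lambda>" "finite F" "\<Lambda> \<subseteq> (\<Union>x\<in>F. bump_core (bt x))"
 proof (rule compactE_image[OF comp(1), of \<Lambda> "%x. bump_core (bt x)"])
  show "open (bump_core (bt x))" for x by (rule open_bump_core[OF bt(1)])
  show "\<Lambda> \<subseteq> (\<Union>x\<in>\<Lambda>. bump_core (bt x))" using bt(2) by blast
 qed (rule that)
 interpret repeller \<A> G \<Lambda> "bt ` F" f
  by unfold_locales (use assms comp F bt in auto)
 obtain p r0 where p: "p >= 1" "r0 > 0"
  "!!y z. y : \<Lambda> ==> z : \<Lambda> ==> D y z <= r0 ==> 2 * D y z <= D ((f ^^ p) y) ((f ^^ p) z)"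
  by (rule expands_eventually) (rule that)
 have contf: "continuous_on \<Lambda> f" using continuous_funpow[of 1] continuous_on_subset[of UNIV f \<Lambda>] by simp
 interpret le: locally_expanding \<Lambda> D f p r0
  by unfold_locales (rule contf f_image p(1) p(2) p(3) open_map_uniform assms(4); assumption)+
 have distort: "EX A \<delta>. \<delta> > 0 & (ALL n>=1. ALL x:\<Lambda>. ALL y:dyn_ball d \<Lambda> f x n \<delta>. ALL z:dyn_ball d \<Lambda> f x n \<delta>. \<bar>\<Theta> n y - \<Theta> n z\<bar> <= A)"
  if bd: "bounded_distortion d \<Lambda> f \<Theta>" for \<Theta>
 proof -
  obtain A \<delta> where A: "\<delta> > 0" "(SUP n\<in>{1..}. distortion d \<Lambda> f \<Theta> n \<delta>) <= ereal A"
   using bd unfolding bounded_distortion_def by blast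
  have "\<bar>\<Theta> n y - \<Theta> n z\<bar> <= A"
   if n: "n >= 1" and x: "x : \<Lambda>" and yz: "y : dyn_ball d \<Lambda> f x n \<delta>" "z : dyn_ball d \<Lambda> f x n \<delta>" for n x y z
  proof -
   have "ereal \<bar>\<Theta> n y - \<Theta> n z\<bar> <= distortion d \<Lambda> f \<Theta> n \<delta>"
    unfolding distortion_def using x yz by (intro Sup_upper) blast
   also have "\<dots> <= (SUP n\<in>{1..}. distortion d \<Lambda> f \<Theta> n \<delta>)" using n by (intro SUP_upper) simp
   finally show ?thesis using A(2) by (metis ereal_less_eq(3) order_trans)
  qed
  thus ?thesis using A(1) by blast
 qed
 obtain A1 \<delta>1 where A1: "\<delta>1 > 0" "ALL n>=1. ALL x:\<Lambda>. ALL y:dyn_ball d \<Lambda> f x n \<delta>1. ALL z:dyn_ball d \<Lambda> f x n \<delta>1. \<bar>\<Phi> n y - \<Phi> n z\<bar> <= A1"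
  using distort[OF assms(9)] by blast
 obtain A2 \<delta>2 where A2: "\<delta>2 > 0" "ALL n>=1. ALL x:\<Lambda>. ALL y:dyn_ball d \<Lambda> f x n \<delta>2. ALL z:dyn_ball d \<Lambda> f x n \<delta>2. \<bar>\<Psi> n y - \<Psi> n z\<bar> <= A2"
  using distort[OF assms(12)] by blast
 define \<delta> where "\<delta> = min \<delta>1 \<delta>2"
 have \<delta>: "\<delta> > 0" "\<delta> <= \<delta>1" "\<delta> <= \<delta>2" using A1 A2 by (auto simp: \<delta>_def)
 obtain r1 where r1: "r1 > 0" "!!y z. y : \<Lambda> ==> z : \<Lambda> ==> D y z <= r1 ==> cdist y z <= ennreal \<delta>"
  by (rule cdist_small[OF \<delta>(1)]) (rule that)
 \<comment> \<open>The scale 64 \<rho> lies both within the expansivity radius r0 and within r1, so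
   Bowen balls of that radius are contained in the dynamical balls of the distortion
   hypotheses.\<close>
 define \<rho> where "\<rho> = min r0 r1 / 64"
 have \<rho>: "\<rho> > 0" "64 * \<rho> <= r0" "64 * \<rho> <= r1" using p r1 by (auto simp: \<rho>_def)
 obtain N where "expanding_map \<Lambda> D f \<rho> N" by (rule le.expanding_mapI[OF \<rho>(1,2)]) (rule that)
 then interpret ex: expanding_map \<Lambda> D f \<rho> N .
 have tame: "EX C. ex.tame C \<Theta>"
  if \<Theta>: "continuous_potentials \<Lambda> \<Theta>" "almost_additive \<Lambda> f \<Theta>" and \<delta>': "\<delta> <= \<delta>'"
   and A: "ALL n>=1. ALL x:\<Lambda>. ALL y:dyn_ball d \<Lambda> f x n \<delta>'. ALL z:dyn_ball d \<Lambda> f x n \<delta>'. \<bar>\<Theta> n y - \<Theta> n z\<bar> <= A"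
  for \<Theta> \<delta>' A
 proof -
  obtain C where C: "C > 0" "ALL m>=1. ALL n>=1. ALL x:\<Lambda>.
    \<Theta> m x + \<Theta> n ((f ^^ m) x) - C <= \<Theta> (m + n) x & \<Theta> (m + n) x <= \<Theta> m x + \<Theta> n ((f ^^ m) x) + C"
   using \<Theta>(2) unfolding almost_additive_def by blast
  have cont: "continuous_on \<Lambda> (\<Theta> n)" if "n >= 1" for n using \<Theta>(1) that by (simp add: continuous_potentials_def)
  obtain b where b: "b >= 0" "!!x. x : \<Lambda> ==> \<bar>\<Theta> N x\<bar> <= b" using continuous_boundedE[OF cont[OF ex.N_pos]] by blast
  \<comment> \<open>Additivity defect, distortion and the size of \<Theta> at the gap length N,
    merged into the single constant of \<open>tame\<close>.\<close>
  define C' where "C' = max (max C A) b"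
  have "ex.tame C' \<Theta>" unfolding ex.tame_def
  proof (intro conjI allI impI ballI cont)
   show "0 <= C'" using b by (simp add: C'_def)
   show "\<bar>\<Theta> N x\<bar> <= C'" if "x : \<Lambda>" for x using b(2)[OF that] by (simp add: C'_def)
   fix m n :: nat and x assume mn: "1 <= m" "1 <= n" and x: "x : \<Lambda>"
   have "\<Theta> m x + \<Theta> n ((f ^^ m) x) - C <= \<Theta> (m + n) x" "\<Theta> (m + n) x <= \<Theta> m x + \<Theta> n ((f ^^ m) x) + C"
    using C(2) mn x by blast+
   thus "\<bar>\<Theta> (m + n) x - \<Theta> m x - \<Theta> n ((f ^^ m) x)\<bar> <= C'" unfolding C'_def by linarith
  next
   fix n :: nat and x y assume n: "1 <= n" and x: "x : \<Lambda>" and y: "y : ex.bowen n x (64 * \<rho>)"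
   have close: "d v w <= ennreal \<delta>'" if "v : \<Lambda>" "w : \<Lambda>" "D v w <= 64 * \<rho>" for v w
   proof -
    have "d v w <= ennreal \<delta>" using r1(2)[OF that(1,2)] that(3) \<rho>(3) assms(6) by simp
    thus ?thesis using \<delta>' ennreal_leI order_trans by blast
   qed
   have y': "y : \<Lambda>" "!!j. j <= n ==> D ((f ^^ j) y) ((f ^^ j) x) <= 64 * \<rho>"
    using y D_commute by (auto simp: ex.bowen_def)
   have "x : dyn_ball d \<Lambda> f x n \<delta>'" "y : dyn_ball d \<Lambda> f x n \<delta>'"
    using close x y' \<rho>(1) funpow_mem by (auto simp: dyn_ball_def)
   hence "\<bar>\<Theta> n x - \<Theta> n y\<bar> <= A" using A n x by blast
   thus "\<bar>\<Theta> n x - \<Theta> n y\<bar> <= C'" by (simp add: C'_def)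
  qed
  thus ?thesis ..
 qed
 obtain C1 where C1: "ex.tame C1 \<Phi>" using tame[OF assms(7,8) \<delta>(2) A1(2)] by blast
 obtain C2 where C2: "ex.tame C2 \<Psi>" using tame[OF assms(10,11) \<delta>(3) A2(2)] by blast
 have \<alpha>: "\<alpha> > 0" "\<alpha> < 1" using assms(5) by auto
 show ?thesis unfolding assms(14-17)
  by (rule ex.legendre_structure[OF C1 C2 _ _ assms(13)])
   (unfold assms(6), rule holder_continuous[OF \<alpha>(1)], assumption, rule holder_dense[OF \<alpha>], assumption+)
qed

end
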